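(* Let $d\geq 1$, and let $\mu,\nu$ be real numbers such that either ($\nu\in\mathbb{R}$ and $0<\mu\leq 1$) or ($\nu<-1$ and $\mu=0$). Let $(c_n)_{n\geq 0}$ be a sequence of scalars for which there exists $C>0$ such that $$\sum_{k=2^j}^{2^{j+1}}\max_{n\in I(k)}|c_n|^2\leq C\,2^{(-\gamma(d)-\mu)j}\,j^{2\nu}\qquad\text{for all } j\geq 1.$$ Let $(X_n)_{n\geq 0}$ be an i.i.d. family of real random variables, not almost surely constant, such that for some $\sigma>0$ one has $\mathbb{E}[e^{rX_1}]\leq e^{\frac12\sigma^2r^2}$ for all $r\in\mathbb{R}$, and let $u^\omega=\sum_{n\geq 0}c_nX_n(\omega)\varphi_n$. Then, almost surely in $\omega$, as $h\to 0^+$, $$m_{u^\omega}(h)=\mathcal{O}\big(h^\mu|\ln h|^\theta\big),$$ where - $\theta=\frac12+\nu$ if $0<\mu<1$; - $\theta=1+\nu$ if $\mu=0$; - if $\mu=1$: $\theta=1+\nu$ when $\nu\geq-\frac12$, and $\theta=\frac12$ when $-1\leq\nu\leq-\frac12$. If $\mu=1$ and $\nu<-1$, then for almost every $\omega$ the function $u^\omega$ is differentiable.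
   Context: $H=-\Delta+|x|^2$ is the harmonic oscillator on $L^2(\mathbb{R}^d)$; its eigenvalues, counted with multiplicity, are $d=\lambda_0<\lambda_1\leq\lambda_2\leq\cdots$ (as a set, the spectrum is $d+2\mathbb{N}$). $(\varphi_n)_{n\geq 0}$ is any fixed orthonormal basis of $L^2(\mathbb{R}^d)$ with $H\varphi_n=\lambda_n\varphi_n$. For $k\geq 1$, $I(k)=\{n\in\mathbb{N}:2k\leq\lambda_n<2(k+1)\}$ (a maximum over an empty $I(k)$ is $0$). $\gamma(1)=-\frac16$ and $\gamma(d)=\frac d2-1$ for $d\geq 2$. The modulus of continuity of $u:\mathbb{R}^d\to\mathbb{C}$ is $m_u(h)=\sup\{|u(x)-u(y)|: x,y\in\mathbb{R}^d,\ |x-y|\leq h\}$, $h>0$. The series $u^\omega$ is a priori defined, almost surely, as a tempered distribution (there is $s\in\mathbb{R}$ with $\sum_n\lambda_n^s|c_nX_n|^2<+\infty$ a.s.); the conclusion is understood to include that it is a function. *)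

theory Defs
  imports "HOL-Probability.Probability"
begin

section \<open>Schwartz functions and the harmonic oscillator\<close>

definition partial_deriv ::
  "'d::finite \<Rightarrow> (real ^ 'd \<Rightarrow> complex) \<Rightarrow> real ^ 'd \<Rightarrow> complex" where
  "partial_deriv i f x = frechet_derivative f (at x) (axis i 1)"

primrec iterated_partial_deriv ::
  "'d::finite list \<Rightarrow> (real ^ 'd \<Rightarrow> complex) \<Rightarrow> real ^ 'd \<Rightarrow> complex" where
  "iterated_partial_deriv [] f = f"
| "iterated_partial_deriv (i # is) f = partial_deriv i (iterated_partial_deriv is f)"

text \<open>Differentiability of all iterated partial derivatives is required separately, because
  \<^const>\<open>frechet_derivative\<close> is total; it makes the function smooth.\<close>

definition schwartz :: "(real ^ 'd::finite \<Rightarrow> complex) \<Rightarrow> bool" where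
  "schwartz f \<longleftrightarrow>
     (\<forall>is. (\<forall>x. iterated_partial_deriv is f differentiable (at x)) \<and>
           (\<forall>k::nat. bounded (range (\<lambda>x. norm x ^ k *\<^sub>R iterated_partial_deriv is f x))))"

definition laplacian :: "(real ^ 'd::finite \<Rightarrow> complex) \<Rightarrow> real ^ 'd \<Rightarrow> complex" where
  "laplacian f x = (\<Sum>i\<in>UNIV. partial_deriv i (partial_deriv i f) x)"

definition square_integrable :: "(real ^ 'd::finite \<Rightarrow> complex) \<Rightarrow> bool" where
  "square_integrable f \<longleftrightarrow>
     f \<in> borel_measurable lborel \<and> integrable lborel (\<lambda>x. (cmod (f x))\<^sup>2)"

text \<open>\<open>harmonic_oscillator f g\<close> says that \<open>f\<close> is in the domain of the operator
  \<open>H = - \<Delta> + |x|\<^sup>2\<close> on \<open>L\<^sup>2\<close> and that \<open>H f = g\<close>. Here \<open>H\<close> acts in the sense of tempered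
  distributions and its domain is the set of all \<open>f\<close> in \<open>L\<^sup>2\<close> with \<open>H f\<close> in \<open>L\<^sup>2\<close>; this is the
  self-adjoint realisation of \<open>H\<close>, which is unique since \<open>H\<close> is essentially self-adjoint on
  Schwartz functions.\<close>

definition harmonic_oscillator ::
  "(real ^ 'd::finite \<Rightarrow> complex) \<Rightarrow> (real ^ 'd \<Rightarrow> complex) \<Rightarrow> bool" where
  "harmonic_oscillator f g \<longleftrightarrow>
     square_integrable f \<and> square_integrable g \<and>
     (\<forall>\<psi>. schwartz \<psi> \<longrightarrow>
        (LINT x|lborel. f x * (- laplacian \<psi> x + of_real ((norm x)\<^sup>2) * \<psi> x))
          = (LINT x|lborel. g x * \<psi> x))"

definition orthonormal_basis_L2 :: "(nat \<Rightarrow> real ^ 'd::finite \<Rightarrow> complex) \<Rightarrow> bool" where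
  "orthonormal_basis_L2 \<phi> \<longleftrightarrow>
     (\<forall>n. square_integrable (\<phi> n)) \<and>
     (\<forall>m n. (LINT x|lborel. \<phi> m x * cnj (\<phi> n x)) = (if m = n then 1 else 0)) \<and>
     (\<forall>f. square_integrable f \<longrightarrow>
        (\<forall>\<epsilon>>0. \<exists>N (a :: nat \<Rightarrow> complex).
           (LINT x|lborel. (cmod (f x - (\<Sum>n<N. a n * \<phi> n x)))\<^sup>2) < \<epsilon>))"

text \<open>Since \<open>\<phi>\<close> is an orthonormal basis, a nondecreasing \<open>\<Lambda>\<close> with \<open>H \<phi>\<^sub>n = \<Lambda>\<^sub>n \<phi>\<^sub>n\<close> is
  necessarily the sequence of all eigenvalues of \<open>H\<close> counted with multiplicity, so that
  \<open>\<Lambda>\<^sub>0 = d < \<Lambda>\<^sub>1\<close> need not be imposed.\<close>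

definition oscillator_eigenbasis ::
  "(nat \<Rightarrow> real) \<Rightarrow> (nat \<Rightarrow> real ^ 'd::finite \<Rightarrow> complex) \<Rightarrow> bool" where
  "oscillator_eigenbasis \<Lambda> \<phi> \<longleftrightarrow>
     mono \<Lambda> \<and> orthonormal_basis_L2 \<phi> \<and>
     (\<forall>n. harmonic_oscillator (\<phi> n) (\<lambda>x. of_real (\<Lambda> n) * \<phi> n x))"

section \<open>Assumptions on the coefficients\<close>

definition eigen_block :: "(nat \<Rightarrow> real) \<Rightarrow> nat \<Rightarrow> nat set" where
  "eigen_block \<Lambda> k = {n. 2 * real k \<le> \<Lambda> n \<and> \<Lambda> n < 2 * (real k + 1)}"

definition block_max :: "(nat \<Rightarrow> real) \<Rightarrow> (nat \<Rightarrow> complex) \<Rightarrow> nat \<Rightarrow> real" where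
  "block_max \<Lambda> c k =
     (if eigen_block \<Lambda> k = {} then 0 else Max ((\<lambda>n. (cmod (c n))\<^sup>2) ` eigen_block \<Lambda> k))"

definition gamma_exp :: "nat \<Rightarrow> real" where
  "gamma_exp d = (if d = 1 then - 1 / 6 else real d / 2 - 1)"

text \<open>Not meaningful for \<open>\<mu> = 1\<close>, \<open>\<nu> < - 1\<close>.\<close>

definition theta_exp :: "real \<Rightarrow> real \<Rightarrow> real" where
  "theta_exp \<mu> \<nu> =
     (if \<mu> = 0 then 1 + \<nu>
      else if \<mu> < 1 then 1 / 2 + \<nu>
      else if \<nu> \<ge> - 1 / 2 then 1 + \<nu> else 1 / 2)"

section \<open>Random variables\<close>

definition iid :: "'w measure \<Rightarrow> (nat \<Rightarrow> 'w \<Rightarrow> real) \<Rightarrow> bool" where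
  "iid M X \<longleftrightarrow>
     prob_space.indep_vars M (\<lambda>_. borel) X UNIV \<and>
     (\<forall>m n. distr M borel (X m) = distr M borel (X n))"

text \<open>Integrability is explicit because the Bochner integral of a non-integrable function is 0.\<close>

definition subgaussian :: "'w measure \<Rightarrow> ('w \<Rightarrow> real) \<Rightarrow> bool" where
  "subgaussian M Y \<longleftrightarrow>
     (\<exists>\<sigma>>0. \<forall>r. integrable M (\<lambda>\<omega>. exp (r * Y \<omega>)) \<and>
              (LINT \<omega>|M. exp (r * Y \<omega>)) \<le> exp (1 / 2 * \<sigma>\<^sup>2 * r\<^sup>2))"

section \<open>The sum of the series and its modulus of continuity\<close>

text \<open>The series \<open>\<Sum>n. a\<^sub>n \<phi>\<^sub>n\<close> converges in the space of tempered distributions, and its sum is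
  the function \<open>u\<close>.\<close>

definition sums_in_tempered ::
  "(nat \<Rightarrow> complex) \<Rightarrow> (nat \<Rightarrow> real ^ 'd::finite \<Rightarrow> complex) \<Rightarrow> (real ^ 'd \<Rightarrow> complex) \<Rightarrow> bool" where
  "sums_in_tempered a \<phi> u \<longleftrightarrow>
     (\<forall>\<psi>. schwartz \<psi> \<longrightarrow>
        integrable lborel (\<lambda>x. u x * \<psi> x) \<and>
        (\<lambda>n. a n * (LINT x|lborel. \<phi> n x * \<psi> x)) sums (LINT x|lborel. u x * \<psi> x))"

text \<open>Valued in \<^typ>\<open>ennreal\<close>, as the supremum may be infinite for an arbitrary \<open>u\<close>.\<close>

definition modulus_of_continuity :: "(real ^ 'd::finite \<Rightarrow> complex) \<Rightarrow> real \<Rightarrow> ennreal" where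
  "modulus_of_continuity u h =
     (SUP (x, y) \<in> {(x, y). norm (x - y) \<le> h}. ennreal (cmod (u x - u y)))"

text \<open>\<open>m = O(g)\<close> as \<open>h \<rightarrow> 0\<^sup>+\<close>, for an \<^typ>\<open>ennreal\<close>-valued \<open>m\<close>, which the Landau symbols of the
  library do not cover.\<close>

definition ennreal_bigo_at_0 :: "(real \<Rightarrow> ennreal) \<Rightarrow> (real \<Rightarrow> real) \<Rightarrow> bool" where
  "ennreal_bigo_at_0 m g \<longleftrightarrow> (\<exists>K>0. \<forall>\<^sub>F h in at_right 0. m h \<le> ennreal (K * \<bar>g h\<bar>))"

end

theory Submission
  imports Defs "HOL-Real_Asymp.Real_Asymp"
begin

text \<open>Every eigenfunction is almost everywhere a finite combination of products of Hermite functions of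
  its level, and by Bessel's inequality the orthonormal family \<open>(\<phi>\<^sub>n)\<close> restricted to the eigenspace
  \<open>\<Lambda> = 2 m + d\<close> satisfies \<open>\<Sum> |\<phi>\<^sub>n(x)|\<^sup>2 \<le> C (m + 1)\<^bsup>\<gamma>(d)\<^esup>\<close> as soon as the products of Hermite
  functions do. For these the bound comes from two energies of the equation
  \<open>h'' = (x\<^sup>2 - 2 n - 1) h\<close> in dimension one (\<open>h\<^sup>2 = O(n\<^bsup>-1/6\<^esup>)\<close> at the turning point) and by summing
  over the multi-indices in higher dimension; derivatives and multiplication by \<open>x\<^sub>i\<close> act as
  ladder operators and cost a factor \<open>m + 1\<close> in the bound.

  Group the blocks into dyadic ranges \<open>2\<^sup>J \<le> k < 2\<^bsup>J'\<^esup>\<close>. A sub-Gaussian tail bound on a grid of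
  polynomial size together with the Borel-Cantelli lemma shows that almost surely the partial sums of
  the series over such a range are bounded by \<open>sqrt J'\<close> times their standard deviation, uniformly in
  \<open>x\<close>, and similarly for the gradient. Given \<open>h = 2\<^bsup>-y\<^esup>\<close>, the increments of \<open>u\<close> are estimated by \<open>h\<close>
  times the gradient of the low frequencies plus twice the supremum of the high frequencies. For
  \<open>0 < \<mu> < 1\<close> the dyadic blocks are summed one by one; for \<open>\<mu> = 0\<close> and \<open>\<mu> = 1\<close>, where this
  would lose a power of the logarithm, they are grouped into the ranges \<open>2\<^sup>i \<le> J < 2\<^bsup>i+1\<^esup>\<close>, on each of
  which the supremum is estimated at once.\<close>

section \<open>Hermite functions\<close>

text \<open>The given basis is arbitrary inside each eigenspace and consists of classes modulo null
  sets. What is invariant under a unitary change of basis, and what the variance of the random sum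
  sees, is the sum of squares over a level; hence every deterministic input is a bound for such a
  sum. Smooth representatives \<open>g n\<close> carry all pointwise statements. The factor
  \<open>sqrt J'\<close> is the price of a union bound over 2^O(J') events. Paid once for a whole
  range it costs the root of the total variance times \<open>J'\<close>; paid block by block it
  costs a sum of roots. For \<open>\<mu> = 0\<close> (values) and \<open>\<mu> = 1\<close>
  (gradients) the block variances carry no exponential factor, so over 2^i <= j < 2^(i+1) the first
  gives 2^(i (1 + \<nu>)) and the second 2^(i (3/2 + \<nu>)): this is the origin of the exponent
  \<open>1 + \<nu>\<close>. For \<open>0 < \<mu> < 1\<close> the sums are geometric, and the
  dominant block has the logarithmic exponent \<open>1/2 + \<nu>\<close>. Partial sums in the order
  of \<open>n\<close> cut through eigenspaces, so the random events also range over all truncations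
  \<open>n < N\<close>.\<close>

fun hermite_fun :: "nat \<Rightarrow> real \<Rightarrow> real" where
  "hermite_fun 0 x = pi powr (- 1 / 4) * exp (- x\<^sup>2 / 2)"
| "hermite_fun (Suc 0) x = sqrt 2 * x * hermite_fun 0 x"
| "hermite_fun (Suc (Suc n)) x =
     sqrt (2 / real (n + 2)) * x * hermite_fun (Suc n) x
     - sqrt (real (n + 1) / real (n + 2)) * hermite_fun n x"

text \<open>\<open>hermite_fun n\<close> is the L2-normalised Hermite function, so multiplication by
  \<open>sqrt 2 * x\<close> is creation plus annihilation with square root coefficients. At
  \<open>n = 0\<close> the index \<open>n - 1\<close> is truncated to 0, which is harmless because
  its coefficient \<open>sqrt 0\<close> vanishes; this convention recurs in every ladder
  formula.\<close>

lemma hermite_fun_rec: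
  "sqrt 2 * x * hermite_fun n x
     = sqrt (real n + 1) * hermite_fun (Suc n) x + sqrt (real n) * hermite_fun (n - 1) x"
proof (cases n)
  case (Suc k)
  have "sqrt (real (k + 2)) * hermite_fun (Suc (Suc k)) x
      = sqrt 2 * x * hermite_fun (Suc k) x - sqrt (real k + 1) * hermite_fun k x"
    by (simp add: real_sqrt_divide algebra_simps add.commute)
  then show ?thesis using Suc by (simp add: algebra_simps)
qed simp

text \<open>The derivative is introduced algebraically, from the same two ladder terms that make up
  multiplication by \<open>x\<close>; \<open>hermite_fun_has_deriv\<close> justifies the
  name.\<close>

definition hermite_deriv :: "nat \<Rightarrow> real \<Rightarrow> real" where
  "hermite_deriv n x = (sqrt (real n) * hermite_fun (n - 1) x
     - sqrt (real n + 1) * hermite_fun (Suc n) x) / sqrt 2"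

text \<open>The recurrence eliminates the upper neighbour; this is the annihilation operator d/dx +
  x. The companion \<open>hermite_deriv_upper\<close> eliminates the lower neighbour. Having both
  forms lets derivatives of adjacent indices be written in the same two functions.\<close>

lemma hermite_deriv_lower:
  "hermite_deriv n x = sqrt 2 * sqrt (real n) * hermite_fun (n - 1) x - x * hermite_fun n x"
proof -
  have "sqrt 2 * hermite_deriv n x
      = 2 * sqrt (real n) * hermite_fun (n - 1) x - sqrt 2 * x * hermite_fun n x"
    unfolding hermite_fun_rec by (simp add: hermite_deriv_def)
  also have "\<dots> = sqrt 2 * (sqrt 2 * sqrt (real n) * hermite_fun (n - 1) x - x * hermite_fun n x)"
    by (simp add: algebra_simps)
  finally show ?thesis by simp
qed

lemma hermite_deriv_upper:
  "hermite_deriv n x = x * hermite_fun n x - sqrt 2 * sqrt (real n + 1) * hermite_fun (Suc n) x"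
proof -
  have "sqrt 2 * hermite_deriv n x
      = sqrt 2 * x * hermite_fun n x - 2 * sqrt (real n + 1) * hermite_fun (Suc n) x"
    unfolding hermite_fun_rec by (simp add: hermite_deriv_def)
  also have "\<dots> = sqrt 2 * (x * hermite_fun n x - sqrt 2 * sqrt (real n + 1) * hermite_fun (Suc n) x)"
    by (simp add: algebra_simps)
  finally show ?thesis by simp
qed

text \<open>Differentiate the recurrence. With the lowering form at \<open>Suc m\<close> and the
  raising form at \<open>m\<close>, everything is expressed through \<open>hermite_fun m\<close> and
  \<open>hermite_fun (Suc m)\<close>, and \<open>s^2 = t^2 + 1\<close> closes the induction.\<close>

lemma hermite_fun_has_deriv:
  "(hermite_fun n has_real_derivative hermite_deriv n x) (at x)"
proof (induction n rule: less_induct)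
  case (less n)
  consider "n = 0" | "n = 1" | m where "n = Suc (Suc m)"
    by (metis One_nat_def not0_implies_Suc)
  then show ?case
  proof cases
    case 1
    have "(\<lambda>x. pi powr (- 1 / 4) * exp (- x\<^sup>2 / 2)) = hermite_fun 0" by auto
    moreover have "((\<lambda>x. pi powr (- 1 / 4) * exp (- x\<^sup>2 / 2)) has_real_derivative
        - x * hermite_fun 0 x) (at x)"
      by (auto intro!: derivative_eq_intros)
    ultimately show ?thesis using 1 by (simp add: hermite_deriv_lower)
  next
    case 2
    have e: "(\<lambda>x. sqrt 2 * x * hermite_fun 0 x) = hermite_fun 1" by auto
    have "(hermite_fun 0 has_real_derivative hermite_deriv 0 x) (at x)"
      using less 2 by (simp del: hermite_fun.simps)
    then have "((\<lambda>x. sqrt 2 * x * hermite_fun 0 x) has_real_derivative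
        sqrt 2 * hermite_fun 0 x + sqrt 2 * x * hermite_deriv 0 x) (at x)"
      by (auto intro!: derivative_eq_intros simp del: hermite_fun.simps)
    moreover have "sqrt 2 * hermite_fun 0 x + sqrt 2 * x * hermite_deriv 0 x = hermite_deriv 1 x"
      by (simp add: hermite_deriv_lower algebra_simps del: hermite_fun.simps(1))
    ultimately show ?thesis unfolding 2 e by metis
  next
    case 3
    define s where "s = sqrt (real m + 2)"
    define t where "t = sqrt (real m + 1)"
    have s: "s > 0" "s\<^sup>2 = real m + 2" and t: "t > 0" "t\<^sup>2 = real m + 1"
      by (simp_all add: s_def t_def)
    have e: "hermite_fun (Suc (Suc m)) = (\<lambda>x. (sqrt 2 * x * hermite_fun (Suc m) x - t * hermite_fun m x) / s)"
      by (rule ext) (simp add: s_def t_def real_sqrt_divide diff_divide_distrib add.commute)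
    have "((\<lambda>x. (sqrt 2 * x * hermite_fun (Suc m) x - t * hermite_fun m x) / s) has_real_derivative
       (sqrt 2 * hermite_fun (Suc m) x + sqrt 2 * x * hermite_deriv (Suc m) x
         - t * hermite_deriv m x) / s) (at x)"
      using less[of "Suc m"] less[of m] 3
      by (intro DERIV_cdivide) (auto intro!: derivative_eq_intros simp del: hermite_fun.simps)
    moreover have "(sqrt 2 * hermite_fun (Suc m) x + sqrt 2 * x * hermite_deriv (Suc m) x
         - t * hermite_deriv m x) = s * hermite_deriv (Suc (Suc m)) x"
    proof -
      have d1: "hermite_deriv (Suc m) x = sqrt 2 * t * hermite_fun m x - x * hermite_fun (Suc m) x"
        by (simp add: hermite_deriv_lower t_def add.commute)
      have d0: "hermite_deriv m x = x * hermite_fun m x - sqrt 2 * t * hermite_fun (Suc m) x"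
        by (simp add: hermite_deriv_upper t_def add.commute)
      have d2: "hermite_deriv (Suc (Suc m)) x = sqrt 2 * s * hermite_fun (Suc m) x
          - x * hermite_fun (Suc (Suc m)) x"
        by (simp add: hermite_deriv_lower s_def add.commute)
      have r: "s * hermite_fun (Suc (Suc m)) x = sqrt 2 * x * hermite_fun (Suc m) x - t * hermite_fun m x"
        unfolding e using s by simp
      have "s * hermite_deriv (Suc (Suc m)) x = sqrt 2 * s\<^sup>2 * hermite_fun (Suc m) x
          - x * (sqrt 2 * x * hermite_fun (Suc m) x - t * hermite_fun m x)"
        unfolding d2 r[symmetric] by (simp add: algebra_simps power2_eq_square)
      also have "\<dots> = sqrt 2 * (t\<^sup>2 + 1) * hermite_fun (Suc m) x
          - x * (sqrt 2 * x * hermite_fun (Suc m) x - t * hermite_fun m x)"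
        using s t by (simp add: algebra_simps)
      also have "\<dots> = sqrt 2 * hermite_fun (Suc m) x + sqrt 2 * x * hermite_deriv (Suc m) x
         - t * hermite_deriv m x"
        unfolding d1 d0
        using real_sqrt_mult_self[of 2] by (simp add: algebra_simps power2_eq_square)
      finally show ?thesis by simp
    qed
    ultimately have "((\<lambda>x. (sqrt 2 * x * hermite_fun (Suc m) x - t * hermite_fun m x) / s) has_real_derivative
       hermite_deriv (Suc (Suc m)) x) (at x)" using s by simp
    then show ?thesis unfolding 3 e[symmetric] .
  qed
qed

text \<open>Differentiating the lowering form and inserting the raising form for the lower neighbour
  turns the two first-order relations into the oscillator equation, on which all energy arguments
  rest.\<close>

lemma hermite_deriv_has_deriv:
  "(hermite_deriv n has_real_derivative (x\<^sup>2 - (2 * real n + 1)) * hermite_fun n x) (at x)"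
proof -
  have e: "hermite_deriv n = (\<lambda>x. sqrt 2 * sqrt (real n) * hermite_fun (n - 1) x - x * hermite_fun n x)"
    by (rule ext) (rule hermite_deriv_lower)
  have "(hermite_deriv n has_real_derivative (sqrt 2 * sqrt (real n) * hermite_deriv (n - 1) x
      - (hermite_fun n x + x * hermite_deriv n x))) (at x)"
    unfolding e by (auto intro!: derivative_eq_intros hermite_fun_has_deriv) (simp add: e)
  moreover have "sqrt 2 * sqrt (real n) * hermite_deriv (n - 1) x
      - (hermite_fun n x + x * hermite_deriv n x) = (x\<^sup>2 - (2 * real n + 1)) * hermite_fun n x"
  proof (cases n)
    case 0 then show ?thesis
      by (simp add: hermite_deriv_lower[of 0] algebra_simps power2_eq_square)
  next
    case (Suc m)
    define t where "t = sqrt (real n)"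
    have t: "t * t = real n" by (simp add: t_def)
    have d0: "hermite_deriv (n - 1) x = x * hermite_fun (n - 1) x - sqrt 2 * t * hermite_fun n x"
      using Suc by (simp add: hermite_deriv_upper t_def add.commute)
    have d1: "hermite_deriv n x = sqrt 2 * t * hermite_fun (n - 1) x - x * hermite_fun n x"
      by (simp add: hermite_deriv_lower t_def)
    have "sqrt 2 * t * (x * hermite_fun (n - 1) x - sqrt 2 * t * hermite_fun n x)
        - (hermite_fun n x + x * (sqrt 2 * t * hermite_fun (n - 1) x - x * hermite_fun n x))
      = (x * x - (sqrt 2 * sqrt 2 * (t * t) + 1)) * hermite_fun n x"
      by (simp add: algebra_simps del: real_sqrt_mult_self)
    then show ?thesis unfolding d0 d1 t by (simp add: t_def power2_eq_square)
  qed
  ultimately show ?thesis by simp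
qed

lemma hermite_fun_minus: "hermite_fun n (- x) = (- 1) ^ n * hermite_fun n x"
  by (induction n x rule: hermite_fun.induct) (auto simp: algebra_simps)

lemma hermite_fun_minus_sq: "(hermite_fun n (- x))\<^sup>2 = (hermite_fun n x)\<^sup>2"
  by (simp add: hermite_fun_minus power_mult_distrib flip: power_mult)

lemma hermite_fun_abs_sq: "(hermite_fun n \<bar>x\<bar>)\<^sup>2 = (hermite_fun n x)\<^sup>2"
  by (cases "x \<ge> 0") (auto simp: hermite_fun_minus_sq)

lemma continuous_on_hermite_fun [continuous_intros]:
  "continuous_on S f \<Longrightarrow> continuous_on S (\<lambda>x. hermite_fun n (f x))"
proof -
  have "continuous_on UNIV (hermite_fun n)"
    by (meson DERIV_continuous_on hermite_fun_has_deriv has_field_derivative_at_within)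
  then show "continuous_on S f \<Longrightarrow> continuous_on S (\<lambda>x. hermite_fun n (f x))"
    by (rule continuous_on_compose2) auto
qed

lemma continuous_on_hermite_deriv [continuous_intros]:
  "continuous_on S f \<Longrightarrow> continuous_on S (\<lambda>x. hermite_deriv n (f x))"
  unfolding hermite_deriv_def by (intro continuous_intros) auto

lemma borel_measurable_hermite_fun [measurable]: "hermite_fun n \<in> borel_measurable borel"
  by (intro borel_measurable_continuous_onI continuous_intros)

section \<open>Gaussian decay of the Hermite functions\<close>

lemma power_div_fact_le_exp:
  fixes x :: real
  assumes "x \<ge> 0"
  shows "x ^ k / fact k \<le> exp x"
proof -
  have "(\<Sum>i\<in>{k}. x ^ i /\<^sub>R fact i) \<le> (\<Sum>i. x ^ i /\<^sub>R fact i)"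
    using assms by (intro sum_le_suminf summable_exp_generic) auto
  then show ?thesis by (simp add: exp_def divide_inverse mult.commute)
qed

lemma abs_le_one_plus_sq: "\<bar>y\<bar> \<le> 1 + y\<^sup>2" for y :: real
proof (cases "\<bar>y\<bar> \<le> 1")
  case True
  then show ?thesis by (smt (verit) zero_le_power2)
next
  case False
  then have "\<bar>y\<bar> * 1 \<le> \<bar>y\<bar> * \<bar>y\<bar>" by (intro mult_left_mono) auto
  then show ?thesis by (simp add: power2_eq_square)
qed

text \<open>One term of the exponential series at \<open>x^2 / 4\<close> controls
  \<open>(x^k)^2\<close>; the detour \<open>|y| <= 1 + y^2\<close> trades the absolute value for
  that even power.\<close>

lemma abs_power_le_exp_sq: "\<bar>x\<bar> ^ k \<le> (1 + 4 ^ k * fact k) * exp (x\<^sup>2 / 4)" for x :: real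
proof -
  have "(x\<^sup>2 / 4) ^ k / fact k \<le> exp (x\<^sup>2 / 4)"
    by (rule power_div_fact_le_exp) simp
  then have a: "(x ^ k)\<^sup>2 \<le> 4 ^ k * fact k * exp (x\<^sup>2 / 4)"
    by (simp add: field_simps power_divide flip: power_mult)
  have "\<bar>x\<bar> ^ k \<le> 1 + (x ^ k)\<^sup>2"
    using abs_le_one_plus_sq[of "x ^ k"] by (simp add: power_abs)
  also have "\<dots> \<le> exp (x\<^sup>2 / 4) + 4 ^ k * fact k * exp (x\<^sup>2 / 4)"
    using a by (intro add_mono) auto
  finally show ?thesis by (simp add: algebra_simps)
qed

text \<open>The rate \<open>1/4\<close> instead of the true \<open>1/2\<close> leaves room to absorb
  powers of \<open>x\<close>. The power \<open>k\<close> must be arbitrary in the induction because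
  each use of the recurrence spends one more factor \<open>x\<close>.\<close>

lemma hermite_fun_decay:
  "\<exists>C\<ge>0. \<forall>x. \<bar>x\<bar> ^ k * \<bar>hermite_fun n x\<bar> \<le> C * exp (- x\<^sup>2 / 4)"
proof (induction n arbitrary: k rule: less_induct)
  case (less n)
  consider "n = 0" | "n = 1" | m where "n = Suc (Suc m)"
    by (metis One_nat_def not0_implies_Suc)
  then show ?case
  proof cases
    case 1
    have "\<bar>x\<bar> ^ k * \<bar>hermite_fun 0 x\<bar> \<le> (1 + 4 ^ k * fact k) * exp (- x\<^sup>2 / 4)" for x :: real
    proof -
      note b = abs_power_le_exp_sq[of x k]
      have c: "\<bar>hermite_fun 0 x\<bar> \<le> exp (- x\<^sup>2 / 2)"
      proof -
        have "pi powr (- 1 / 4) \<le> pi powr 0" using pi_gt3 by (intro powr_mono) auto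
        then show ?thesis using pi_gt3 by (simp add: abs_mult mult_left_le_one_le)
      qed
      have "\<bar>x\<bar> ^ k * \<bar>hermite_fun 0 x\<bar> \<le> (1 + 4 ^ k * fact k) * exp (x\<^sup>2 / 4) * exp (- x\<^sup>2 / 2)"
        by (intro mult_mono b c) auto
      also have "\<dots> = (1 + 4 ^ k * fact k) * exp (- x\<^sup>2 / 4)"
        by (simp add: mult.assoc flip: exp_add)
      finally show ?thesis .
    qed
    then show ?thesis unfolding 1 by (intro exI[of _ "1 + 4 ^ k * fact k"]) auto
  next
    case 2
    obtain C where C: "C \<ge> 0" "\<And>x. \<bar>x\<bar> ^ Suc k * \<bar>hermite_fun 0 x\<bar> \<le> C * exp (- x\<^sup>2 / 4)"
      using less[of 0 "Suc k"] 2 by auto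
    have "\<bar>x\<bar> ^ k * \<bar>hermite_fun 1 x\<bar> \<le> (sqrt 2 * C) * exp (- x\<^sup>2 / 4)" for x
      using mult_left_mono[OF C(2)[of x], of "sqrt 2"]
      by (simp add: abs_mult mult_ac del: hermite_fun.simps(1))
    then show ?thesis unfolding 2 using C by (intro exI[of _ "sqrt 2 * C"]) auto
  next
    case 3
    obtain C where C: "C \<ge> 0" "\<And>x. \<bar>x\<bar> ^ Suc k * \<bar>hermite_fun (Suc m) x\<bar> \<le> C * exp (- x\<^sup>2 / 4)"
      using less[of "Suc m" "Suc k"] 3 by auto
    obtain D where D: "D \<ge> 0" "\<And>x. \<bar>x\<bar> ^ k * \<bar>hermite_fun m x\<bar> \<le> D * exp (- x\<^sup>2 / 4)"
      using less[of m k] 3 by auto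
    define a where "a = sqrt (2 / real (m + 2))"
    define b where "b = sqrt (real (m + 1) / real (m + 2))"
    have ab: "a \<ge> 0" "b \<ge> 0" by (simp_all add: a_def b_def)
    have "\<bar>x\<bar> ^ k * \<bar>hermite_fun n x\<bar> \<le> (a * C + b * D) * exp (- x\<^sup>2 / 4)" for x
    proof -
      have "\<bar>hermite_fun n x\<bar> \<le> \<bar>a * x * hermite_fun (Suc m) x\<bar> + \<bar>b * hermite_fun m x\<bar>"
        unfolding 3 by (simp only: hermite_fun.simps(3) a_def b_def abs_triangle_ineq4)
      then have "\<bar>x\<bar> ^ k * \<bar>hermite_fun n x\<bar>
          \<le> \<bar>x\<bar> ^ k * (\<bar>a * x * hermite_fun (Suc m) x\<bar> + \<bar>b * hermite_fun m x\<bar>)"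
        by (intro mult_left_mono) auto
      also have "\<dots> = a * (\<bar>x\<bar> ^ Suc k * \<bar>hermite_fun (Suc m) x\<bar>) + b * (\<bar>x\<bar> ^ k * \<bar>hermite_fun m x\<bar>)"
        using ab by (simp add: abs_mult algebra_simps)
      also have "\<dots> \<le> a * (C * exp (- x\<^sup>2 / 4)) + b * (D * exp (- x\<^sup>2 / 4))"
        using ab by (intro add_mono mult_left_mono C D)
      finally show ?thesis by (simp add: algebra_simps)
    qed
    then show ?thesis using ab C D by (intro exI[of _ "a * C + b * D"]) auto
  qed
qed

lemma hermite_fun_gaussian_bound: "\<exists>C\<ge>0. \<forall>x. \<bar>hermite_fun n x\<bar> \<le> C * exp (- x\<^sup>2 / 4)"
  using hermite_fun_decay[of 0 n] by simp

section \<open>Orthonormality in one variable\<close>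

lemma integrable_exp_minus_sq:
  assumes "a > 0"
  shows "integrable lborel (\<lambda>x::real. exp (- (a * x\<^sup>2)))"
proof -
  define s where "s = sqrt (1 / (2 * a))"
  have s: "s > 0" "s\<^sup>2 = 1 / (2 * a)" using assms by (simp_all add: s_def)
  have "integrable lborel (\<lambda>x. sqrt (2 * pi * s\<^sup>2) * normal_density 0 s x)"
    using s by (intro integrable_mult_right integrable_normal_density)
  also have "(\<lambda>x. sqrt (2 * pi * s\<^sup>2) * normal_density 0 s x) = (\<lambda>x. exp (- (a * x\<^sup>2)))"
    using s assms by (auto simp: normal_density_def fun_eq_iff)
  finally show ?thesis .
qed

lemma integrable_hermite_fun_mult:
  "integrable lborel (\<lambda>x. hermite_fun m x * hermite_fun n x)"
proof -
  obtain C where C: "C \<ge> 0" "\<And>x. \<bar>hermite_fun m x\<bar> \<le> C * exp (- x\<^sup>2 / 4)"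
    using hermite_fun_gaussian_bound by blast
  obtain D where D: "D \<ge> 0" "\<And>x. \<bar>hermite_fun n x\<bar> \<le> D * exp (- x\<^sup>2 / 4)"
    using hermite_fun_gaussian_bound by blast
  have "integrable lborel (\<lambda>x. C * D * exp (- (1 / 2 * x\<^sup>2)))"
    by (intro integrable_mult_right integrable_exp_minus_sq) auto
  then show ?thesis
  proof (rule Bochner_Integration.integrable_bound)
    show "AE x in lborel. norm (hermite_fun m x * hermite_fun n x) \<le> norm (C * D * exp (- (1 / 2 * x\<^sup>2)))"
    proof (rule AE_I2)
      fix x :: real
      have "\<bar>hermite_fun m x\<bar> * \<bar>hermite_fun n x\<bar> \<le> (C * exp (- x\<^sup>2 / 4)) * (D * exp (- x\<^sup>2 / 4))"
        using C D by (intro mult_mono) auto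
      also have "\<dots> = C * D * (exp (- x\<^sup>2 / 4) * exp (- x\<^sup>2 / 4))" by simp
      also have "exp (- x\<^sup>2 / 4) * exp (- x\<^sup>2 / 4) = exp (- (1 / 2 * x\<^sup>2))"
        by (simp flip: exp_add)
      finally show "norm (hermite_fun m x * hermite_fun n x) \<le> norm (C * D * exp (- (1 / 2 * x\<^sup>2)))"
        using C D by (simp add: abs_mult)
    qed
  qed measurable
qed

text \<open>The general filter lets the same statement remove the boundary terms at both ends of the
  line in the integration by parts below. Comparison with \<open>exp (- |x|)\<close>, via
  \<open>(|x| - 1)^2 >= 0\<close>, reduces it to the limit of the exponential.\<close>

lemma hermite_fun_mult_tendsto_0:
  assumes "filterlim id at_infinity F"
  shows "((\<lambda>x. hermite_fun m x * hermite_fun n x) \<longlongrightarrow> 0) F"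
proof -
  obtain C where C: "C \<ge> 0" "\<And>x. \<bar>hermite_fun m x\<bar> \<le> C * exp (- x\<^sup>2 / 4)"
    using hermite_fun_gaussian_bound by blast
  obtain D where D: "D \<ge> 0" "\<And>x. \<bar>hermite_fun n x\<bar> \<le> D * exp (- x\<^sup>2 / 4)"
    using hermite_fun_gaussian_bound by blast
  have b: "\<bar>hermite_fun m x * hermite_fun n x\<bar> \<le> C * D * exp (- \<bar>x\<bar>) * exp 1" for x
  proof -
    have "\<bar>hermite_fun m x\<bar> * \<bar>hermite_fun n x\<bar> \<le> (C * exp (- x\<^sup>2 / 4)) * (D * exp (- x\<^sup>2 / 4))"
      using C D by (intro mult_mono) auto
    also have "\<dots> = C * D * (exp (- x\<^sup>2 / 4) * exp (- x\<^sup>2 / 4))" by simp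
    also have "exp (- x\<^sup>2 / 4) * exp (- x\<^sup>2 / 4) = exp (- x\<^sup>2 / 2)"
      by (simp flip: exp_add)
    also have "C * D * exp (- x\<^sup>2 / 2) \<le> C * D * exp (- \<bar>x\<bar> + 1)"
    proof -
      have "0 \<le> (\<bar>x\<bar> - 1)\<^sup>2" by simp
      then show ?thesis using C D by (intro mult_left_mono) (simp_all add: power2_diff)
    qed
    finally show ?thesis by (simp add: abs_mult mult.assoc flip: exp_add)
  qed
  have "((\<lambda>x::real. C * D * exp (- \<bar>x\<bar>) * exp 1) \<longlongrightarrow> C * D * 0 * exp 1) F"
  proof (intro tendsto_intros)
    have "filterlim (\<lambda>x::real. \<bar>x\<bar>) at_top F"
      using filterlim_compose[OF filterlim_norm_at_top assms] by simp
    then show "((\<lambda>x::real. exp (- \<bar>x\<bar>)) \<longlongrightarrow> 0) F"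
      by (intro filterlim_compose[OF exp_at_bot] filterlim_compose[OF filterlim_uminus_at_bot_at_top])
  qed
  then have "((\<lambda>x::real. C * D * exp (- \<bar>x\<bar>) * exp 1) \<longlongrightarrow> 0) F" by simp
  then show ?thesis
    by (rule Lim_null_comparison[rotated]) (auto simp: b)
qed

lemma hermite_fun_ibp:
  "(LBINT x. hermite_deriv m x * hermite_fun n x) = - (LBINT x. hermite_fun m x * hermite_deriv n x)"
proof -
  have i1: "integrable lborel (\<lambda>x. hermite_deriv m x * hermite_fun n x)" for m n
    unfolding hermite_deriv_def left_diff_distrib diff_divide_distrib
    by (simp add: mult.assoc) (intro integrable_hermite_fun_mult Bochner_Integration.integrable_diff integrable_divide integrable_mult_right)
  have i2: "integrable lborel (\<lambda>x. hermite_fun m x * hermite_deriv n x)"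
    using i1[of n m] by (simp add: mult.commute)
  have "(LBINT x=-\<infinity>..\<infinity>. hermite_deriv m x * hermite_fun n x + hermite_fun m x * hermite_deriv n x) = 0 - 0"
  proof (rule interval_integral_FTC_integrable[where F = "\<lambda>x. hermite_fun m x * hermite_fun n x"])
    show "((\<lambda>x. hermite_fun m x * hermite_fun n x) has_vector_derivative
        hermite_deriv m x * hermite_fun n x + hermite_fun m x * hermite_deriv n x) (at x)" for x
      unfolding has_real_derivative_iff_has_vector_derivative[symmetric]
      by (auto intro!: derivative_eq_intros hermite_fun_has_deriv)
    show "isCont (\<lambda>x. hermite_deriv m x * hermite_fun n x + hermite_fun m x * hermite_deriv n x) x" for x
      by (intro continuous_on_interior[of UNIV] continuous_intros) auto
    show "set_integrable lborel (einterval (-\<infinity>) \<infinity>)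
        (\<lambda>x. hermite_deriv m x * hermite_fun n x + hermite_fun m x * hermite_deriv n x)"
      using i1[of m n] i2 by (simp add: set_integrable_def)
    have "filterlim (id :: real \<Rightarrow> real) at_infinity at_top" "filterlim (id :: real \<Rightarrow> real) at_infinity at_bot"
      by (auto simp: id_def filterlim_at_top_imp_at_infinity filterlim_at_bot_imp_at_infinity filterlim_ident)
    then show "(((\<lambda>x. hermite_fun m x * hermite_fun n x) \<circ> real_of_ereal) \<longlongrightarrow> 0) (at_left \<infinity>)"
      "(((\<lambda>x. hermite_fun m x * hermite_fun n x) \<circ> real_of_ereal) \<longlongrightarrow> 0) (at_right (-\<infinity>))"
      by (simp_all add: ereal_tendsto_simps hermite_fun_mult_tendsto_0)
  qed auto
  then have "(LBINT x. hermite_deriv m x * hermite_fun n x + hermite_fun m x * hermite_deriv n x) = 0"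
    by (simp add: interval_lebesgue_integral_def set_lebesgue_integral_def einterval_def)
  then show ?thesis using i1[of m n] i2 by simp
qed

text \<open>Integration by parts makes creation the adjoint of annihilation: insert the raising form
  on one side and the lowering form on the other, and the integrals of
  \<open>x * (?h n x * ?h m x)\<close> cancel.\<close>

lemma hermite_fun_shift:
  "sqrt (real n + 1) * (LBINT x. hermite_fun (Suc n) x * hermite_fun m x)
     = sqrt (real m) * (LBINT x. hermite_fun n x * hermite_fun (m - 1) x)"
proof -
  let ?h = hermite_fun
  note [simp] = integrable_hermite_fun_mult
  have xi: "integrable lborel (\<lambda>x. x * (?h n x * ?h m x))"
  proof -
    have "integrable lborel (\<lambda>x. (sqrt (real n + 1) * (?h (Suc n) x * ?h m x) + sqrt (real n) * (?h (n - 1) x * ?h m x)) / sqrt 2)"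
      by simp
    also have "(\<lambda>x. (sqrt (real n + 1) * (?h (Suc n) x * ?h m x) + sqrt (real n) * (?h (n - 1) x * ?h m x)) / sqrt 2)
        = (\<lambda>x. (sqrt (real n + 1) * ?h (Suc n) x + sqrt (real n) * ?h (n - 1) x) * ?h m x / sqrt 2)"
      by (simp add: algebra_simps)
    also have "\<dots> = (\<lambda>x. x * (?h n x * ?h m x))"
      unfolding hermite_fun_rec[symmetric] by simp
    finally show ?thesis .
  qed
  have "(LBINT x. hermite_deriv n x * ?h m x) = (LBINT x. x * (?h n x * ?h m x) - sqrt 2 * sqrt (real n + 1) * (?h (Suc n) x * ?h m x))"
    unfolding hermite_deriv_upper by (simp add: algebra_simps)
  also have "\<dots> = (LBINT x. x * (?h n x * ?h m x)) - sqrt 2 * sqrt (real n + 1) * (LBINT x. ?h (Suc n) x * ?h m x)"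
    using xi by simp
  finally have 1: "(LBINT x. hermite_deriv n x * ?h m x) = \<dots>" .
  have "(LBINT x. ?h n x * hermite_deriv m x) = (LBINT x. sqrt 2 * sqrt (real m) * (?h n x * ?h (m - 1) x) - x * (?h n x * ?h m x))"
    unfolding hermite_deriv_lower by (simp add: algebra_simps)
  also have "\<dots> = sqrt 2 * sqrt (real m) * (LBINT x. ?h n x * ?h (m - 1) x) - (LBINT x. x * (?h n x * ?h m x))"
    using xi by simp
  finally have 2: "(LBINT x. ?h n x * hermite_deriv m x) = \<dots>" .
  have "sqrt 2 * (sqrt (real n + 1) * (LBINT x. ?h (Suc n) x * ?h m x))
      = sqrt 2 * (sqrt (real m) * (LBINT x. ?h n x * ?h (m - 1) x))"
    using hermite_fun_ibp[of n m] unfolding 1 2 by simp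
  then show ?thesis by simp
qed

text \<open>\<open>hermite_fun_shift\<close> lowers both indices at once, which reduces every pair
  to first index 0. There the shift with \<open>m = 0\<close> kills all positive second indices, and
  the square of the ground state is the normal density of standard deviation
  \<open>1 / sqrt 2\<close>.\<close>

lemma hermite_fun_orthonormal:
  "(LBINT x. hermite_fun m x * hermite_fun n x) = (if m = n then 1 else 0)"
proof (induction m arbitrary: n)
  case 0
  show ?case
  proof (cases n)
    case 0
    have "(LBINT x. hermite_fun 0 x * hermite_fun 0 x) = (LBINT x. normal_density 0 (1 / sqrt 2) x)"
    proof (rule Bochner_Integration.integral_cong[OF refl])
      fix x :: real
      have "pi powr (- 1 / 4) * pi powr (- 1 / 4) = 1 / sqrt pi"
        by (simp flip: powr_add) (simp add: powr_minus_divide powr_half_sqrt)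
      then have "pi powr (- 1 / 4) * exp (- x\<^sup>2 / 2) * (pi powr (- 1 / 4) * exp (- x\<^sup>2 / 2))
          = 1 / sqrt pi * (exp (- x\<^sup>2 / 2) * exp (- x\<^sup>2 / 2))"
        by (simp only: mult.assoc mult.left_commute[of "exp _"] flip: mult.assoc[of "pi powr _" "pi powr _"])
      also have "exp (- x\<^sup>2 / 2) * exp (- x\<^sup>2 / 2) = exp (- x\<^sup>2)" by (simp flip: exp_add)
      finally show "hermite_fun 0 x * hermite_fun 0 x = normal_density 0 (1 / sqrt 2) x"
        by (simp add: normal_density_def power_divide)
    qed
    also have "\<dots> = 1" by simp
    finally show ?thesis using 0 by simp
  next
    case (Suc k)
    have "sqrt (real k + 1) * (LBINT x. hermite_fun (Suc k) x * hermite_fun 0 x) = 0"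
      using hermite_fun_shift[of k 0] by (simp del: hermite_fun.simps)
    moreover have "sqrt (real k + 1) \<noteq> 0" by simp
    ultimately show ?thesis using Suc by (simp add: mult.commute del: hermite_fun.simps)
  qed
next
  case (Suc m)
  have "sqrt (real m + 1) * (LBINT x. hermite_fun (Suc m) x * hermite_fun n x)
     = sqrt (real n) * (if m = n - 1 then 1 else 0)"
    using hermite_fun_shift[of m n] Suc[of "n - 1"] by simp
  then show ?case by (cases n) (auto simp: add.commute split: if_splits)
qed

declare hermite_fun.simps [simp del]

section \<open>Pointwise bounds for Hermite functions\<close>

text \<open>At 0 the recurrence loses its middle term, so the square is multiplied by
  \<open>(m + 1) / (m + 2)\<close> in each step of two; the decay follows from
  \<open>(m + 3) * (m + 1) <= (m + 2)^2\<close>.\<close>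

lemma hermite_fun_0_bound: "sqrt (real n + 1) * (hermite_fun n 0)\<^sup>2 \<le> 1"
proof (induction n rule: less_induct)
  case (less n)
  consider "n = 0" | "n = 1" | m where "n = Suc (Suc m)"
    by (metis One_nat_def not0_implies_Suc)
  then show ?case
  proof cases
    case 1
    have "pi powr (- 1 / 4) \<le> pi powr 0" using pi_gt3 by (intro powr_mono) auto
    then show ?thesis using 1 pi_gt3 by (simp add: hermite_fun.simps power_le_one)
  next
    case 2 then show ?thesis by (simp add: hermite_fun.simps)
  next
    case 3
    have "sqrt (real m + 3) * sqrt (real m + 1) \<le> real m + 2"
    proof (rule power2_le_imp_le)
      show "(sqrt (real m + 3) * sqrt (real m + 1))\<^sup>2 \<le> (real m + 2)\<^sup>2"
        by (simp add: power_mult_distrib) (simp add: power2_eq_square algebra_simps)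
    qed simp
    then have "(sqrt (real m + 3) * sqrt (real m + 1)) * sqrt (real m + 1) \<le> (real m + 2) * sqrt (real m + 1)"
      by (intro mult_right_mono) auto
    then have "sqrt (real m + 3) * (real m + 1) \<le> (real m + 2) * sqrt (real m + 1)"
      by (simp add: mult.assoc)
    then have a: "sqrt (real m + 3) * ((real m + 1) / (real m + 2)) \<le> sqrt (real m + 1)"
      by (simp add: divide_le_eq mult.commute)
    have "(hermite_fun n 0)\<^sup>2 = (real m + 1) / (real m + 2) * (hermite_fun m 0)\<^sup>2"
      unfolding 3 by (simp add: hermite_fun.simps power_mult_distrib add.commute)
    then have "sqrt (real n + 1) * (hermite_fun n 0)\<^sup>2
        = (sqrt (real m + 3) * ((real m + 1) / (real m + 2))) * (hermite_fun m 0)\<^sup>2"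
      using 3 by (simp add: add.commute)
    also have "\<dots> \<le> sqrt (real m + 1) * (hermite_fun m 0)\<^sup>2"
      by (intro mult_right_mono a) auto
    also have "\<dots> \<le> 1" using less[of m] 3 by simp
    finally show ?thesis .
  qed
qed

text \<open>The conserved energy of the harmonic oscillator equation frozen at the point \<open>x\<close>.\<close>

definition hermite_energy :: "nat \<Rightarrow> real \<Rightarrow> real" where
  "hermite_energy n x = (2 * real n + 1 - x\<^sup>2) * (hermite_fun n x)\<^sup>2 + (hermite_deriv n x)\<^sup>2"

text \<open>Initial value for the energy estimates. The derivative at 0 is \<open>sqrt (2 n)\<close>
  times the preceding Hermite function at 0, so both terms come from
  \<open>hermite_fun_0_bound\<close>, each with constant 2.\<close>

lemma hermite_energy_0: "hermite_energy n 0 \<le> 4 * sqrt (2 * real n + 1)"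
proof -
  let ?s = "sqrt (2 * real n + 1)"
  have "?s * (hermite_fun n 0)\<^sup>2 \<le> sqrt 2 * (sqrt (real n + 1) * (hermite_fun n 0)\<^sup>2)"
    unfolding mult.assoc[symmetric] real_sqrt_mult[symmetric] by (intro mult_right_mono) auto
  also have "\<dots> \<le> sqrt 2 * 1" by (intro mult_left_mono hermite_fun_0_bound) auto
  also have "\<dots> \<le> 2" using sqrt2_less_2 by simp
  finally have "?s * (?s * (hermite_fun n 0)\<^sup>2) \<le> ?s * 2" by (intro mult_left_mono) auto
  then have 1: "(2 * real n + 1) * (hermite_fun n 0)\<^sup>2 \<le> 2 * ?s"
    by (simp flip: mult.assoc)
  have 2: "(hermite_deriv n 0)\<^sup>2 \<le> 2 * ?s"
  proof (cases n)
    case 0 then show ?thesis by (simp add: hermite_deriv_lower)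
  next
    case (Suc m)
    have "(hermite_deriv n 0)\<^sup>2 = 2 * (real m + 1) * (hermite_fun m 0)\<^sup>2"
      using Suc by (simp add: hermite_deriv_lower power_mult_distrib)
    also have "\<dots> = 2 * (sqrt (real m + 1) * sqrt (real m + 1)) * (hermite_fun m 0)\<^sup>2"
      by (subst real_sqrt_mult_self) simp
    also have "\<dots> = 2 * sqrt (real m + 1) * (sqrt (real m + 1) * (hermite_fun m 0)\<^sup>2)"
      by (simp only: mult.assoc)
    also have "\<dots> \<le> 2 * sqrt (real m + 1) * 1" by (intro mult_left_mono hermite_fun_0_bound) auto
    also have "\<dots> \<le> 2 * ?s" using Suc by simp
    finally show ?thesis .
  qed
  show ?thesis using 1 2 by (simp add: hermite_energy_def)
qed

text \<open>By the oscillator equation the terms in \<open>h * h'\<close> cancel, and only the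
  derivative of the coefficient \<open>- x^2\<close> survives.\<close>

lemma hermite_energy_has_deriv:
  "(hermite_energy n has_real_derivative - 2 * x * (hermite_fun n x)\<^sup>2) (at x)"
  unfolding hermite_energy_def
  by (auto intro!: derivative_eq_intros hermite_fun_has_deriv hermite_deriv_has_deriv
      simp: algebra_simps power2_eq_square)

lemma hermite_energy_antimono:
  assumes "0 \<le> x" "x \<le> y"
  shows "hermite_energy n y \<le> hermite_energy n x"
  using assms(2)
proof (rule DERIV_nonpos_imp_nonincreasing)
  fix z assume "x \<le> z" "z \<le> y"
  then show "\<exists>d. (hermite_energy n has_real_derivative d) (at z) \<and> d \<le> 0"
    using assms hermite_energy_has_deriv[of n z] by (intro exI[of _ "- 2 * z * (hermite_fun n z)\<^sup>2"]) auto
qed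

text \<open>The WKB energy \<open>s h\<^sup>2 + h'\<^sup>2 / s\<close>, \<open>s = sqrt (2 n + 1 - x\<^sup>2)\<close>, becomes almost constant
  after the correction by \<open>x h h' / s\<^sup>3\<close>: the logarithmic derivative of the corrected energy is
  at most that of \<open>exp (x / s\<^sup>3)\<close>, and \<open>x / s\<^sup>3 \<le> 1\<close> outside the turning zone.\<close>

lemma hermite_energy_allowed:
  assumes x: "0 \<le> x" and turn: "2 * real n + 1 \<le> (2 * real n + 1 - x\<^sup>2) ^ 3" "x\<^sup>2 < 2 * real n + 1"
  shows "hermite_energy n x \<le> 24 * sqrt (2 * real n + 1 - x\<^sup>2)"
proof -
  let ?h = "hermite_fun n" and ?d = "hermite_deriv n"
  define l where "l = 2 * real n + 1"
  define s where "s = (\<lambda>y. sqrt (l - y\<^sup>2))"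
  define Z where "Z = (\<lambda>y. s y * (?h y)\<^sup>2 + (?d y)\<^sup>2 / s y - y * ?h y * ?d y / s y ^ 3)"
  define p where "p = (\<lambda>y. y / s y ^ 3)"
  have l1: "l \<ge> 1" by (simp add: l_def)
  have s_pos: "s y > 0" and s_sq: "(s y)\<^sup>2 = l - y\<^sup>2" and p_le: "p y \<le> 1" and y2: "y\<^sup>2 < l"
    if y: "0 \<le> y" "y \<le> x" for y
  proof -
    have yx: "y\<^sup>2 \<le> x\<^sup>2" using y by (intro power_mono) auto
    then show y2: "y\<^sup>2 < l" using turn by (simp add: l_def)
    show sp: "s y > 0" unfolding s_def using y2 by simp
    show sq: "(s y)\<^sup>2 = l - y\<^sup>2" unfolding s_def using y2 by simp
    \<comment> \<open>The hypothesis \<open>turn\<close> says \<open>s^3 >= sqrt l\<close> at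
      \<open>x\<close>, hence at all smaller \<open>y\<close>, while \<open>y < sqrt l\<close>. This
      gives \<open>p y <= 1\<close>, and it fixes the width of the turning zone.\<close>
    have c1: "l \<le> (l - x\<^sup>2) ^ 3" using turn(1) by (simp only: l_def)
    have c2: "(l - x\<^sup>2) ^ 3 \<le> (l - y\<^sup>2) ^ 3"
      using yx turn(2) unfolding l_def by (intro power_mono) linarith+
    have c3: "((s y)\<^sup>2) ^ 3 = (s y ^ 3)\<^sup>2" by (simp only: power_mult[symmetric] mult.commute)
    have "y\<^sup>2 \<le> (s y ^ 3)\<^sup>2" using y2 c1 c2 c3 unfolding sq by linarith
    moreover have "0 \<le> s y ^ 3" using sp by simp
    ultimately have "y \<le> s y ^ 3" by (rule power2_le_imp_le)
    then show "p y \<le> 1" using sp by (simp add: p_def divide_le_eq)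
  qed
  have s_deriv: "(s has_real_derivative - y / s y) (at y)" if y: "0 \<le> y" "y \<le> x" for y
  proof -
    have "((\<lambda>y. sqrt (l - y\<^sup>2)) has_real_derivative - y / sqrt (l - y\<^sup>2)) (at y)"
      using y2[OF y] by (auto intro!: derivative_eq_intros simp: field_simps)
    then show ?thesis unfolding s_def .
  qed
  define g where "g = (\<lambda>y. 1 / s y ^ 3 + 3 * y\<^sup>2 / s y ^ 5)"
  have p_deriv: "(p has_real_derivative g y) (at y)" if y: "0 \<le> y" "y \<le> x" for y
  proof -
    have "((\<lambda>y. y / s y ^ 3) has_real_derivative g y) (at y)"
      using s_pos[OF y] by (auto intro!: derivative_eq_intros s_deriv[OF y] simp: g_def)
        (simp add: field_simps eval_nat_numeral)
    then show ?thesis unfolding p_def .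
  qed
  \<comment> \<open>The correction is chosen so that its derivative cancels the terms
    \<open>- y / s * h^2\<close> and \<open>y / s^3 * h'^2\<close> left by the uncorrected energy.
    What remains is the derivative \<open>g\<close> of \<open>p\<close> times the product
    \<open>h * h'\<close>.\<close>
  have Z_deriv: "(Z has_real_derivative - g y * ?h y * ?d y) (at y)" if y: "0 \<le> y" "y \<le> x" for y
  proof -
    have "((\<lambda>y. s y * (?h y)\<^sup>2 + (?d y)\<^sup>2 / s y - p y * (?h y * ?d y)) has_real_derivative
       (- y / s y) * (?h y)\<^sup>2 + s y * (2 * ?h y * ?d y)
       + (2 * ?d y * (- (s y)\<^sup>2 * ?h y) * s y - (?d y)\<^sup>2 * (- y / s y)) / (s y * s y)
       - (g y * (?h y * ?d y) + p y * (?d y * ?d y + ?h y * (- (s y)\<^sup>2 * ?h y)))) (at y)"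
      using s_pos[OF y] unfolding s_sq[OF y]
      by (auto intro!: derivative_eq_intros s_deriv[OF y] p_deriv[OF y] hermite_fun_has_deriv
          hermite_deriv_has_deriv simp: l_def algebra_simps)
    moreover have "(- y / s y) * (?h y)\<^sup>2 + s y * (2 * ?h y * ?d y)
       + (2 * ?d y * (- (s y)\<^sup>2 * ?h y) * s y - (?d y)\<^sup>2 * (- y / s y)) / (s y * s y)
       - (g y * (?h y * ?d y) + p y * (?d y * ?d y + ?h y * (- (s y)\<^sup>2 * ?h y)))
      = - g y * ?h y * ?d y"
      using s_pos[OF y] unfolding p_def by (simp add: field_simps eval_nat_numeral)
    moreover have "Z = (\<lambda>y. s y * (?h y)\<^sup>2 + (?d y)\<^sup>2 / s y - p y * (?h y * ?d y))"
      by (simp add: Z_def p_def mult.assoc)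
    ultimately show ?thesis by (simp only:)
  qed
  have Zp: "Z y = s y * (?h y)\<^sup>2 + (?d y)\<^sup>2 / s y - p y * (?h y * ?d y)" for y
    by (simp add: Z_def p_def mult.assoc)
  have AM: "2 * \<bar>?h y * ?d y\<bar> \<le> s y * (?h y)\<^sup>2 + (?d y)\<^sup>2 / s y" if y: "0 \<le> y" "y \<le> x" for y
  proof -
    have "0 \<le> (s y * \<bar>?h y\<bar> - \<bar>?d y\<bar>)\<^sup>2" by simp
    then have "2 * s y * (\<bar>?h y\<bar> * \<bar>?d y\<bar>) \<le> (s y)\<^sup>2 * (?h y)\<^sup>2 + (?d y)\<^sup>2"
      by (simp add: power2_diff power_mult_distrib)
    then have "2 * s y * (\<bar>?h y\<bar> * \<bar>?d y\<bar>) / s y \<le> ((s y)\<^sup>2 * (?h y)\<^sup>2 + (?d y)\<^sup>2) / s y"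
      using s_pos[OF y] by (intro divide_right_mono) auto
    then show ?thesis using s_pos[OF y] by (simp add: abs_mult add_divide_distrib power2_eq_square)
  qed
  \<comment> \<open>With \<open>p <= 1\<close> the correction costs at most half of the main terms,
    by the inequality \<open>AM\<close>. The second bound is what makes \<open>Z * exp (- p)\<close>
    nonincreasing.\<close>
  have Zl: "(s y * (?h y)\<^sup>2 + (?d y)\<^sup>2 / s y) / 2 \<le> Z y" "\<bar>?h y * ?d y\<bar> \<le> Z y"
    if y: "0 \<le> y" "y \<le> x" for y
  proof -
    have "p y * (?h y * ?d y) \<le> \<bar>p y\<bar> * \<bar>?h y * ?d y\<bar>" by (simp flip: abs_mult)
    also have "\<dots> \<le> 1 * \<bar>?h y * ?d y\<bar>"
      using p_le[OF y] s_pos[OF y] y by (intro mult_right_mono) (auto simp: p_def)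
    finally have "p y * (?h y * ?d y) \<le> \<bar>?h y * ?d y\<bar>" by simp
    moreover have "S / 2 \<le> S - P \<and> H \<le> S - P" if "P \<le> H" "2 * H \<le> S" for S P H :: real
      using that by auto
    ultimately show "(s y * (?h y)\<^sup>2 + (?d y)\<^sup>2 / s y) / 2 \<le> Z y" "\<bar>?h y * ?d y\<bar> \<le> Z y"
      unfolding Zp using AM[OF y] by blast+
  qed
  have "Z x * exp (- p x) \<le> Z 0 * exp (- p 0)"
    using x
  proof (rule DERIV_nonpos_imp_nonincreasing)
    fix y assume y: "0 \<le> y" "y \<le> x"
    have "((\<lambda>y. Z y * exp (- p y)) has_real_derivative
        (- g y * ?h y * ?d y - g y * Z y) * exp (- p y)) (at y)"
      by (auto intro!: derivative_eq_intros Z_deriv[OF y] p_deriv[OF y] simp: algebra_simps)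
    moreover have "(- g y * ?h y * ?d y - g y * Z y) * exp (- p y) \<le> 0"
    proof -
      have "g y \<ge> 0" using s_pos[OF y] by (auto simp: g_def)
      then have "g y * (- (?h y * ?d y)) \<le> g y * Z y"
        using Zl(2)[OF y] by (intro mult_left_mono) auto
      then show ?thesis by (intro mult_nonpos_nonneg) (auto simp: mult.assoc)
    qed
    ultimately show "\<exists>d. ((\<lambda>y. Z y * exp (- p y)) has_real_derivative d) (at y) \<and> d \<le> 0"
      by blast
  qed
  \<comment> \<open>Both \<open>p\<close> and the correction vanish at 0, so \<open>Z 0\<close> is
    the energy at 0 over \<open>sqrt l\<close>. The final factor 24 is \<open>2 * 4 * 3\<close>,
    with \<open>exp 1 <= 3\<close>.\<close>
  also have "Z 0 * exp (- p 0) \<le> 4"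
  proof -
    have "Z 0 = hermite_energy n 0 / sqrt l"
    proof -
      have "sqrt l * A + B / sqrt l = (l * A + B) / sqrt l" for A B
        using l1 real_sqrt_mult_self[of l] by (simp add: field_simps)
      then show ?thesis by (simp add: Z_def s_def hermite_energy_def flip: l_def)
    qed
    also have "\<dots> \<le> 4" using hermite_energy_0[of n] l1 by (simp add: divide_le_eq l_def)
    finally show ?thesis by (simp add: p_def)
  qed
  finally have "Z x * exp (- p x) \<le> 4" .
  then have "Z x \<le> 4 * exp (p x)" by (simp add: exp_minus field_simps)
  also have "\<dots> \<le> 4 * exp 1" using p_le[of x] x by simp
  also have "\<dots> \<le> 12" using exp_le by simp
  finally have "Z x \<le> 12" .
  then have "s x * (?h x)\<^sup>2 + (?d x)\<^sup>2 / s x \<le> 24" using Zl(1)[of x] x by simp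
  then have "s x * (s x * (?h x)\<^sup>2 + (?d x)\<^sup>2 / s x) \<le> s x * 24"
    using s_pos[of x] x by (intro mult_left_mono) auto
  moreover have "s x * (s x * (?h x)\<^sup>2 + (?d x)\<^sup>2 / s x) = hermite_energy n x"
  proof -
    have "s x * (s x * A + B / s x) = (s x)\<^sup>2 * A + B" for A B
      using s_pos[of x] x by (simp add: field_simps power2_eq_square)
    then show ?thesis using s_sq[of x] x by (simp add: hermite_energy_def l_def)
  qed
  ultimately show ?thesis by (simp add: s_def l_def mult.commute)
qed

section \<open>The turning zone and the forbidden region\<close>

lemma hermite_fun_tendsto_0: "(hermite_fun n \<longlongrightarrow> 0) at_top"
proof -
  have "((\<lambda>x. hermite_fun n x * hermite_fun n x) \<longlongrightarrow> 0) at_top"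
    by (intro hermite_fun_mult_tendsto_0) (auto simp: id_def filterlim_at_top_imp_at_infinity filterlim_ident)
  then have "((\<lambda>x. sqrt (hermite_fun n x * hermite_fun n x)) \<longlongrightarrow> sqrt 0) at_top"
    by (intro tendsto_intros)
  then show ?thesis by (simp add: tendsto_rabs_zero_iff)
qed

lemma hermite_deriv_tendsto_0: "(hermite_deriv n \<longlongrightarrow> 0) at_top"
proof -
  have "((\<lambda>x. (sqrt (real n) * hermite_fun (n - 1) x - sqrt (real n + 1) * hermite_fun (Suc n) x) / sqrt 2)
      \<longlongrightarrow> (sqrt (real n) * 0 - sqrt (real n + 1) * 0) / sqrt 2) at_top"
    by (intro tendsto_intros hermite_fun_tendsto_0) auto
  then show ?thesis by (simp add: hermite_deriv_def[abs_def])
qed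

text \<open>The energy decreases on the half line and tends to 0 at infinity. Beyond the turning
  point, where its first term is nonpositive, this bounds \<open>h\<close> by
  \<open>h'\<close>.\<close>

lemma hermite_energy_nonneg:
  assumes "0 \<le> x" shows "0 \<le> hermite_energy n x"
proof -
  have xh: "x * hermite_fun n x
      = (sqrt (real n + 1) * hermite_fun (Suc n) x + sqrt (real n) * hermite_fun (n - 1) x) / sqrt 2" for x
    using hermite_fun_rec[of x n] by (simp add: field_simps)
  have "((\<lambda>x. (sqrt (real n + 1) * hermite_fun (Suc n) x + sqrt (real n) * hermite_fun (n - 1) x) / sqrt 2)
      \<longlongrightarrow> (sqrt (real n + 1) * 0 + sqrt (real n) * 0) / sqrt 2) at_top"
    by (intro tendsto_intros hermite_fun_tendsto_0) auto
  then have "((\<lambda>x. x * hermite_fun n x) \<longlongrightarrow> 0) at_top" by (simp add: xh)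
  then have "((\<lambda>x. (2 * real n + 1) * (hermite_fun n x)\<^sup>2 - (x * hermite_fun n x)\<^sup>2 + (hermite_deriv n x)\<^sup>2)
     \<longlongrightarrow> (2 * real n + 1) * 0\<^sup>2 - 0\<^sup>2 + 0\<^sup>2) at_top"
    by (intro tendsto_intros hermite_fun_tendsto_0 hermite_deriv_tendsto_0)
  then have "(hermite_energy n \<longlongrightarrow> 0) at_top"
    by (simp add: hermite_energy_def[abs_def] algebra_simps power_mult_distrib)
  then show ?thesis
    by (rule tendsto_upperbound) (auto simp: eventually_at_top_linorder intro!: exI[of _ x] hermite_energy_antimono assms)
qed

text \<open>In the forbidden region \<open>h * h'\<close> has nonnegative derivative and tends to 0
  at infinity, so it increases to 0. Hence \<open>h^2\<close> and \<open>h'^2\<close> both decrease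
  there.\<close>

lemma hermite_fun_mult_deriv_nonpos:
  assumes "2 * real n + 1 \<le> x\<^sup>2" "0 \<le> x"
  shows "hermite_fun n x * hermite_deriv n x \<le> 0"
proof -
  have "((\<lambda>x. hermite_fun n x * hermite_deriv n x) \<longlongrightarrow> 0 * 0) at_top"
    by (intro tendsto_intros hermite_fun_tendsto_0 hermite_deriv_tendsto_0)
  then have "((\<lambda>x. hermite_fun n x * hermite_deriv n x) \<longlongrightarrow> 0) at_top" by simp
  moreover have "hermite_fun n x * hermite_deriv n x \<le> hermite_fun n y * hermite_deriv n y" if "x \<le> y" for y
    using that
  proof (rule DERIV_nonneg_imp_nondecreasing)
    fix z assume z: "x \<le> z" "z \<le> y"
    have "x\<^sup>2 \<le> z\<^sup>2" using z assms by (intro power_mono) auto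
    then have "0 \<le> (z\<^sup>2 - (2 * real n + 1)) * (hermite_fun n z)\<^sup>2 + (hermite_deriv n z)\<^sup>2"
      using assms by (intro add_nonneg_nonneg mult_nonneg_nonneg) auto
    moreover have "((\<lambda>z. hermite_fun n z * hermite_deriv n z) has_real_derivative
       (z\<^sup>2 - (2 * real n + 1)) * (hermite_fun n z)\<^sup>2 + (hermite_deriv n z)\<^sup>2) (at z)"
      by (auto intro!: derivative_eq_intros hermite_fun_has_deriv hermite_deriv_has_deriv
          simp: power2_eq_square)
    ultimately show "\<exists>d. ((\<lambda>z. hermite_fun n z * hermite_deriv n z) has_real_derivative d) (at z) \<and> 0 \<le> d"
      by blast
  qed
  ultimately show ?thesis
    by (intro tendsto_lowerbound[of "\<lambda>x. hermite_fun n x * hermite_deriv n x" 0 at_top])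
      (auto simp: eventually_at_top_linorder)
qed

text \<open>With \<open>t = l^(1/6)\<close> the turning point is \<open>sqrt l = t^3\<close>, and
  the turning zone from \<open>X\<close> to \<open>t^3\<close> has width at most
  \<open>1 / t\<close>. Before it the energy gives \<open>h^2 <= 24 / t\<close>; inside it
  \<open>|h'| <= sqrt (24 t)\<close>, so \<open>h\<close> moves by at most
  \<open>sqrt (24 / t)\<close>; behind it \<open>h^2\<close> decreases. The constant is
  \<open>96 = 2 * 24 + 2 * 24\<close>.\<close>

lemma
  fixes n :: nat and x :: real
  assumes x: "0 \<le> x"
  defines "l \<equiv> 2 * real n + 1"
  shows hermite_fun_bound_nonneg: "(hermite_fun n x)\<^sup>2 \<le> 96 / l powr (1 / 6)"
    and hermite_fun_bound_forbidden_nonneg: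
      "l \<le> x\<^sup>2 \<Longrightarrow> (x\<^sup>2 - l) * (hermite_fun n x)\<^sup>2 \<le> 24 * l powr (1 / 6)"
proof -
  let ?h = "hermite_fun n" and ?d = "hermite_deriv n"
  define t where "t = l powr (1 / 6)"
  have l1: "l \<ge> 1" by (simp add: l_def)
  have t1: "t \<ge> 1" using l1 by (simp add: t_def ge_one_powr_ge_zero)
  have "t ^ 6 = l powr (1 / 6 * 6)" using l1 by (simp add: t_def powr_power)
  then have t6: "t ^ 6 = l" using l1 by simp
  have t26: "t\<^sup>2 \<le> t ^ 6" using t1 by (intro power_increasing) auto
  \<comment> \<open>\<open>l - X^2 = t^2\<close> is the smallest gap for which
    \<open>hermite_energy_allowed\<close> applies, because \<open>(t^2)^3 = l\<close>.\<close>
  define X where "X = sqrt (l - t\<^sup>2)"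
  have X: "0 \<le> X" "X\<^sup>2 = l - t\<^sup>2" using t26 t6 by (auto simp: X_def)
  have allowed: "hermite_energy n y \<le> 24 * sqrt (l - y\<^sup>2)" if y: "0 \<le> y" "y \<le> X" for y
  proof -
    have "y\<^sup>2 \<le> X\<^sup>2" using y by (intro power_mono) auto
    then have q: "t\<^sup>2 \<le> l - y\<^sup>2" using X by simp
    then have "(t\<^sup>2) ^ 3 \<le> (l - y\<^sup>2) ^ 3" by (intro power_mono) auto
    then have "l \<le> (l - y\<^sup>2) ^ 3" using t6 by (simp flip: power_mult)
    moreover have "y\<^sup>2 < l" using q t1 by (smt (verit) zero_less_power)
    ultimately show ?thesis using hermite_energy_allowed[of y n] y by (simp add: l_def)
  qed
  have allowed_h: "(?h y)\<^sup>2 \<le> 24 / t" if y: "0 \<le> y" "y \<le> X" for y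
  proof -
    define s where "s = sqrt (l - y\<^sup>2)"
    have "y\<^sup>2 \<le> X\<^sup>2" using y by (intro power_mono) auto
    then have "t\<^sup>2 \<le> l - y\<^sup>2" using X by simp
    then have q: "t\<^sup>2 \<le> l - y\<^sup>2" "0 \<le> l - y\<^sup>2" using zero_le_power2[of t] by linarith+
    then have s: "t \<le> s" "s\<^sup>2 = l - y\<^sup>2"
      unfolding s_def by (auto intro: real_le_rsqrt)
    have "s\<^sup>2 * (?h y)\<^sup>2 \<le> 24 * s"
      using allowed[OF y] unfolding s(2) by (simp add: hermite_energy_def l_def s_def)
        (smt (verit) zero_le_power2)
    then have "s * (?h y)\<^sup>2 \<le> 24" using s t1 by (simp add: power2_eq_square)
    moreover have "t * (?h y)\<^sup>2 \<le> s * (?h y)\<^sup>2" using s by (intro mult_right_mono) auto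
    ultimately show ?thesis using t1 by (simp add: field_simps)
  qed
  have EX: "hermite_energy n X \<le> 24 * t"
    using allowed[of X] X t1 by simp
  have t3: "(t ^ 3)\<^sup>2 = l" using t6 by (simp flip: power_mult)
  have X_t3: "X \<le> t ^ 3" "t ^ 3 - X \<le> 1 / t"
  proof -
    have "X\<^sup>2 \<le> (t ^ 3)\<^sup>2" unfolding X(2) t3 by simp
    then show le: "X \<le> t ^ 3" by (rule power2_le_imp_le) (use t1 in simp)
    have "(t ^ 3 - X) * t ^ 3 \<le> (t ^ 3 - X) * (t ^ 3 + X)"
      using le X by (intro mult_left_mono) auto
    also have "\<dots> = (t ^ 3)\<^sup>2 - X\<^sup>2" by (simp add: algebra_simps power2_eq_square)
    also have "\<dots> = t\<^sup>2" unfolding X(2) t3 by simp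
    finally have "(t ^ 3 - X) * t * t\<^sup>2 \<le> 1 * t\<^sup>2" by (simp add: power2_eq_square power3_eq_cube mult.assoc)
    then have "(t ^ 3 - X) * t \<le> 1" using t1 by (subst (asm) mult_le_cancel_right) auto
    then show "t ^ 3 - X \<le> 1 / t" using t1 by (simp add: le_divide_eq)
  qed
  have d_zone: "(?d y)\<^sup>2 \<le> 24 * t" if y: "X \<le> y" "y \<le> t ^ 3" for y
  proof -
    have "y\<^sup>2 \<le> (t ^ 3)\<^sup>2" using y X by (intro power_mono) auto
    then have "(?d y)\<^sup>2 \<le> hermite_energy n y" unfolding t3 by (simp add: hermite_energy_def l_def)
    also have "\<dots> \<le> hermite_energy n X" using X y by (intro hermite_energy_antimono) auto
    also note EX
    finally show ?thesis .
  qed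
  have zone_h: "(?h y)\<^sup>2 \<le> 96 / t" if y: "X \<le> y" "y \<le> t ^ 3" for y
  proof (cases "y = X")
    case True
    then show ?thesis using allowed_h[of X] X t1 by (smt (verit) divide_right_mono)
  next
    case False
    then have "X < y" using y by simp
    then obtain z where z: "X < z" "z < y" "?h y - ?h X = (y - X) * ?d z"
      using MVT2[of X y ?h ?d] hermite_fun_has_deriv by blast
    have "?h y = ?h X + (y - X) * ?d z" using z(3) by linarith
    then have "(?h y)\<^sup>2 = (?h X + (y - X) * ?d z)\<^sup>2" by simp
    also have "\<dots> \<le> 2 * (?h X)\<^sup>2 + 2 * ((y - X) * ?d z)\<^sup>2"
      using sum_squares_ge_zero[of 0 "?h X - (y - X) * ?d z"]
      by (simp add: power2_eq_square algebra_simps)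
    also have "\<dots> \<le> 2 * (24 / t) + 2 * ((1 / t)\<^sup>2 * (24 * t))"
    proof (intro add_mono mult_left_mono)
      show "(?h X)\<^sup>2 \<le> 24 / t" using allowed_h X by simp
      have "(y - X)\<^sup>2 \<le> (1 / t)\<^sup>2" using y X_t3 by (intro power_mono) auto
      then show "((y - X) * ?d z)\<^sup>2 \<le> (1 / t)\<^sup>2 * (24 * t)"
        unfolding power_mult_distrib using d_zone[of z] z y by (intro mult_mono) auto
    qed auto
    also have "\<dots> = 96 / t" using t1 by (simp add: power2_eq_square field_simps)
    finally show ?thesis .
  qed
  have mono_beyond: "(?h y)\<^sup>2 \<le> (?h (t ^ 3))\<^sup>2" "(?d y)\<^sup>2 \<le> (?d (t ^ 3))\<^sup>2" if y: "t ^ 3 \<le> y" for y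
  proof -
    have *: "l \<le> z\<^sup>2" "0 \<le> z" "?h z * ?d z \<le> 0" if "t ^ 3 \<le> z" for z
    proof -
      have "0 \<le> t ^ 3" using t1 by simp
      then show z0: "0 \<le> z" using that by (rule order_trans)
      have "(t ^ 3)\<^sup>2 \<le> z\<^sup>2" using that \<open>0 \<le> t ^ 3\<close> by (intro power_mono)
      then show lz: "l \<le> z\<^sup>2" unfolding t3 .
      show "?h z * ?d z \<le> 0" using hermite_fun_mult_deriv_nonpos[of n z] lz z0 by (simp add: l_def)
    qed
    show "(?h y)\<^sup>2 \<le> (?h (t ^ 3))\<^sup>2" using y
    proof (rule DERIV_nonpos_imp_nonincreasing)
      fix z assume z: "t ^ 3 \<le> z" "z \<le> y"
      have "((\<lambda>z. (?h z)\<^sup>2) has_real_derivative 2 * (?h z * ?d z)) (at z)"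
        by (auto intro!: derivative_eq_intros hermite_fun_has_deriv)
      then show "\<exists>d. ((\<lambda>z. (?h z)\<^sup>2) has_real_derivative d) (at z) \<and> d \<le> 0"
        using *(3)[OF z(1)] by (intro exI[of _ "2 * (?h z * ?d z)"]) (auto simp: mult.commute)
    qed
    show "(?d y)\<^sup>2 \<le> (?d (t ^ 3))\<^sup>2" using y
    proof (rule DERIV_nonpos_imp_nonincreasing)
      fix z assume z: "t ^ 3 \<le> z" "z \<le> y"
      have "((\<lambda>z. (?d z)\<^sup>2) has_real_derivative 2 * (z\<^sup>2 - l) * (?h z * ?d z)) (at z)"
        by (auto intro!: derivative_eq_intros hermite_deriv_has_deriv simp: l_def)
      moreover have "2 * (z\<^sup>2 - l) * (?h z * ?d z) \<le> 0"
        by (rule mult_nonneg_nonpos) (use *[OF z(1)] in simp_all)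
      ultimately show "\<exists>d. ((\<lambda>z. (?d z)\<^sup>2) has_real_derivative d) (at z) \<and> d \<le> 0"
        by blast
    qed
  qed
  have "(?h x)\<^sup>2 \<le> 96 / t"
  proof -
    consider "x \<le> X" | "X \<le> x" "x \<le> t ^ 3" | "t ^ 3 \<le> x" by linarith
    then show ?thesis
    proof cases
      case 1
      have "24 / t \<le> 96 / t" using t1 by (intro divide_right_mono) auto
      then show ?thesis using allowed_h[OF x 1] by linarith
    next
      case 2 then show ?thesis by (rule zone_h)
    next
      case 3 then show ?thesis using mono_beyond(1)[OF 3] zone_h[of "t ^ 3"] X_t3 by linarith
    qed
  qed
  then show "(?h x)\<^sup>2 \<le> 96 / l powr (1 / 6)" by (simp add: t_def)
  show "(x\<^sup>2 - l) * (?h x)\<^sup>2 \<le> 24 * l powr (1 / 6)" if "l \<le> x\<^sup>2"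
  proof -
    have "(t ^ 3)\<^sup>2 \<le> x\<^sup>2" using that unfolding t3 .
    then have "t ^ 3 \<le> x" by (rule power2_le_imp_le) (rule x)
    have "(x\<^sup>2 - l) * (?h x)\<^sup>2 \<le> (?d x)\<^sup>2"
      using hermite_energy_nonneg[OF x, of n] by (simp add: hermite_energy_def l_def algebra_simps)
    also have "\<dots> \<le> (?d (t ^ 3))\<^sup>2" by (rule mono_beyond) fact
    also have "\<dots> \<le> 24 * t" by (rule d_zone) (use X_t3 in auto)
    finally show ?thesis by (simp add: t_def)
  qed
qed

lemma hermite_fun_bound: "(hermite_fun n x)\<^sup>2 \<le> 96 / (2 * real n + 1) powr (1 / 6)"
  using hermite_fun_bound_nonneg[of "\<bar>x\<bar>" n] by (simp add: hermite_fun_abs_sq)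

lemma hermite_fun_bound_forbidden:
  assumes "2 * real n + 1 \<le> x\<^sup>2"
  shows "(x\<^sup>2 - (2 * real n + 1)) * (hermite_fun n x)\<^sup>2 \<le> 24 * (2 * real n + 1) powr (1 / 6)"
  using hermite_fun_bound_forbidden_nonneg[of "\<bar>x\<bar>" n] assms by (simp add: hermite_fun_abs_sq)

text \<open>One bound for all regimes of \<open>q = 2 n + 1 - x^2\<close>: for
  \<open>|q| <= t^2\<close> the uniform bound gives it, for \<open>q > t^2\<close> the energy does,
  and for \<open>q < - t^2\<close> the forbidden bound \<open>24 t / |q|\<close> is even stronger
  since \<open>t <= sqrt |q|\<close>. The absolute value lets the later sums treat both sides of the
  turning point alike.\<close>

lemma hermite_fun_bound_sqrt:
  "(hermite_fun n x)\<^sup>2 \<le> 200 / sqrt (1 + \<bar>2 * real n + 1 - x\<^sup>2\<bar>)"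
proof -
  define l where "l = 2 * real n + 1"
  define t where "t = l powr (1 / 6)"
  define q where "q = l - x\<^sup>2"
  define w where "w = sqrt (1 + \<bar>q\<bar>)"
  have l1: "l \<ge> 1" by (simp add: l_def)
  have t1: "t \<ge> 1" using l1 by (simp add: t_def ge_one_powr_ge_zero)
  have "t ^ 6 = l powr (1 / 6 * 6)" using l1 by (simp add: t_def powr_power)
  then have t6: "t ^ 6 = l" using l1 by simp
  have w: "w \<ge> 1" "w\<^sup>2 = 1 + \<bar>q\<bar>" by (simp_all add: w_def)
  have "(hermite_fun n x)\<^sup>2 * w \<le> 200"
  proof -
    consider "\<bar>q\<bar> \<le> t\<^sup>2" | "q > t\<^sup>2" | "- q > t\<^sup>2" by linarith
    then show ?thesis
    proof cases
      case 1
      have "1 \<le> t\<^sup>2" using t1 by (simp add: one_le_power)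
      then have "w\<^sup>2 \<le> (2 * t)\<^sup>2" using w 1 by (simp add: power_mult_distrib)
      then have wt: "w \<le> 2 * t" by (rule power2_le_imp_le) (use t1 in simp)
      have "(hermite_fun n x)\<^sup>2 * w \<le> 96 / t * (2 * t)"
        using hermite_fun_bound[of n x] wt t1 w by (intro mult_mono) (auto simp: t_def l_def)
      then show ?thesis using t1 by simp
    next
      case 2
      have t2q: "(t\<^sup>2) ^ 3 \<le> q ^ 3" using 2 by (intro power_mono) auto
      have q1: "1 \<le> q" using 2 t1 by (smt (verit) one_le_power)
      have "\<bar>x\<bar>\<^sup>2 = x\<^sup>2" by simp
      then have "hermite_energy n \<bar>x\<bar> \<le> 24 * sqrt q"
        using hermite_energy_allowed[of "\<bar>x\<bar>" n] t2q q1 t6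
        by (simp add: q_def l_def flip: power_mult)
      then have "q * (hermite_fun n x)\<^sup>2 \<le> 24 * sqrt q"
        by (simp add: hermite_energy_def q_def l_def hermite_fun_abs_sq) (smt (verit) zero_le_power2)
      then have "sqrt q * (sqrt q * (hermite_fun n x)\<^sup>2) \<le> sqrt q * 24"
        using q1 by (simp flip: mult.assoc add: mult.commute)
      then have a: "sqrt q * (hermite_fun n x)\<^sup>2 \<le> 24" using q1 by simp
      have "w\<^sup>2 \<le> (2 * sqrt q)\<^sup>2" using w q1 by (simp add: power_mult_distrib)
      then have "w \<le> 2 * sqrt q" by (rule power2_le_imp_le) (use q1 in simp)
      then have "(hermite_fun n x)\<^sup>2 * w \<le> (hermite_fun n x)\<^sup>2 * (2 * sqrt q)"
        by (intro mult_left_mono) auto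
      then show ?thesis using a by (simp add: mult_ac)
    next
      case 3
      define s where "s = sqrt (- q)"
      have st: "t \<le> s" unfolding s_def using 3 by (intro real_le_rsqrt) auto
      have q0: "0 \<le> - q" using 3 zero_le_power2[of t] by linarith
      have s: "s\<^sup>2 = - q" "1 \<le> s" using st t1 real_sqrt_pow2[OF q0] unfolding s_def by linarith+
      have "s\<^sup>2 * (hermite_fun n x)\<^sup>2 \<le> 24 * t"
        unfolding s(1) using hermite_fun_bound_forbidden[of n x] q0 by (simp add: q_def l_def t_def)
      also have "\<dots> \<le> 24 * s" using st by simp
      finally have "s * (s * (hermite_fun n x)\<^sup>2) \<le> s * 24" by (simp add: power2_eq_square mult_ac)
      then have a: "s * (hermite_fun n x)\<^sup>2 \<le> 24" using s by simp
      have "1 \<le> s\<^sup>2" by (rule one_le_power[OF s(2)])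
      then have "w\<^sup>2 \<le> (2 * s)\<^sup>2" using w s by (simp add: power_mult_distrib)
      then have "w \<le> 2 * s" by (rule power2_le_imp_le) (use s in simp)
      then have "(hermite_fun n x)\<^sup>2 * w \<le> (hermite_fun n x)\<^sup>2 * (2 * s)"
        by (intro mult_left_mono) auto
      then show ?thesis using a by (simp add: mult_ac)
    qed
  qed
  then have "(hermite_fun n x)\<^sup>2 \<le> 200 / w" using w(1) by (simp add: le_divide_eq)
  then show ?thesis by (simp add: w_def q_def l_def)
qed

text \<open>In the forbidden region the decay in \<open>|q|\<close> is needed to avoid a logarithm in dimension 2.\<close>

lemma hermite_fun_bound_decay:
  assumes "2 * real n + 1 < x\<^sup>2"
  defines "v \<equiv> \<bar>x\<bar> powr (1 / 3)"
  shows "(hermite_fun n x)\<^sup>2 \<le> 300 * v / (v\<^sup>2 + (x\<^sup>2 - (2 * real n + 1)))"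
proof -
  define l where "l = 2 * real n + 1"
  define t where "t = l powr (1 / 6)"
  define q where "q = x\<^sup>2 - l"
  have l1: "l \<ge> 1" by (simp add: l_def)
  have t1: "t \<ge> 1" using l1 by (simp add: t_def ge_one_powr_ge_zero)
  have q0: "q > 0" using assms by (simp add: q_def l_def)
  have x2: "1 < x\<^sup>2" using assms l1 by (simp add: l_def)
  have x1: "1 < \<bar>x\<bar>" using x2 by (simp add: abs_square_less_1 flip: not_le abs_square_le_1)
  have v6: "v = (x\<^sup>2) powr (1 / 6)"
  proof -
    have "x\<^sup>2 = \<bar>x\<bar> powr 2" using x1 by simp
    then have "(x\<^sup>2) powr (1 / 6) = \<bar>x\<bar> powr (2 * (1 / 6))" by (simp only: powr_powr)
    then show ?thesis by (simp add: v_def)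
  qed
  have v1: "v \<ge> 1" using x1 by (simp add: v_def ge_one_powr_ge_zero)
  have tv: "t \<le> v" unfolding v6 t_def using q0 l1 by (intro powr_mono2) (auto simp: q_def)
  have 1: "q * (hermite_fun n x)\<^sup>2 \<le> 24 * v"
    using hermite_fun_bound_forbidden[of n x] q0 tv by (simp add: q_def l_def t_def)
  have 2: "v\<^sup>2 * (hermite_fun n x)\<^sup>2 \<le> 192 * v"
  \<comment> \<open>The threshold 64 is \<open>2^6\<close>: below it \<open>v <= 2 * t\<close> and
    the uniform bound suffices; above it \<open>q\<close> is at least half of
    \<open>x^2 = v^6 >= v^2\<close>.\<close>
  proof (cases "x\<^sup>2 \<le> 64 * l")
    case True
    have "v \<le> (64 * l) powr (1 / 6)" unfolding v6 using True by (intro powr_mono2) auto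
    also have "\<dots> = 2 * t"
    proof -
      have "(64::real) powr (1 / 6) = (2 powr 6) powr (1 / 6)" by simp
      also have "\<dots> = 2" by (subst powr_powr) simp
      finally show ?thesis using l1 by (simp add: powr_mult t_def)
    qed
    finally have "v * (hermite_fun n x)\<^sup>2 \<le> 2 * t * (96 / t)"
      using hermite_fun_bound[of n x] v1 t1 by (intro mult_mono) (auto simp: t_def l_def)
    then have "v * (hermite_fun n x)\<^sup>2 \<le> 192" using t1 by simp
    then have "v * (v * (hermite_fun n x)\<^sup>2) \<le> v * 192" using v1 by (intro mult_left_mono) auto
    then show ?thesis by (simp add: power2_eq_square mult_ac)
  next
    case False
    have "v ^ 6 = (x\<^sup>2) powr (1 / 6 * 6)" unfolding v6 using x2 by (subst powr_power) auto
    then have "v ^ 6 = x\<^sup>2" using x2 by simp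
    moreover have "v\<^sup>2 \<le> v ^ 6" using v1 by (intro power_increasing) auto
    ultimately have "v\<^sup>2 \<le> 2 * q" using False l1 by (simp add: q_def)
    then have "v\<^sup>2 * (hermite_fun n x)\<^sup>2 \<le> 2 * q * (hermite_fun n x)\<^sup>2" by (intro mult_right_mono) auto
    then show ?thesis using 1 v1 by simp
  qed
  have "(hermite_fun n x)\<^sup>2 * (v\<^sup>2 + q) \<le> 300 * v" using 1 2 v1 by (simp add: algebra_simps)
  moreover have "v\<^sup>2 + q > 0" using q0 by (simp add: add_nonneg_pos)
  ultimately show ?thesis by (simp add: le_divide_eq q_def l_def)
qed

section \<open>The spectral function\<close>

text \<open>Telescoping: \<open>1 / b <= b - a\<close> because \<open>(b - a) * (b + a) = 2\<close>
  and \<open>a <= b\<close>.\<close>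

lemma sum_inverse_sqrt: "(\<Sum>j\<le>N. 1 / sqrt (1 + 2 * real j)) \<le> sqrt (2 * real N + 1)"
proof (induction N)
  case (Suc N)
  define a where "a = sqrt (2 * real N + 1)"
  define b where "b = sqrt (2 * real N + 3)"
  have ab: "0 < a" "a \<le> b" "a\<^sup>2 = 2 * real N + 1" "b\<^sup>2 = 2 * real N + 3"
    by (simp_all add: a_def b_def)
  have "(b - a) * (b + a) = 2" using ab by (simp add: algebra_simps power2_eq_square)
  moreover have "(b - a) * (b + a) \<le> (b - a) * (2 * b)" using ab by (intro mult_left_mono) auto
  ultimately have "1 \<le> (b - a) * b" by simp
  then have "1 / b \<le> b - a" using ab by (simp add: divide_le_eq)
  then show ?case using Suc by (simp add: a_def b_def add_ac)
qed simp

text \<open>The offset \<open>B\<close> will depend on the point \<open>x\<close>, and the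
  right-hand side does not: this is what makes the later bounds uniform. Counted from the first
  admissible index \<open>a0\<close>, the arguments \<open>2 a - B\<close> lie beyond the even
  integers 0, 2, 4 and so on.\<close>

lemma sum_antimono_shift:
  fixes g :: "real \<Rightarrow> real"
  assumes g: "\<And>s t. 0 \<le> s \<Longrightarrow> s \<le> t \<Longrightarrow> g t \<le> g s" "\<And>s. 0 \<le> s \<Longrightarrow> 0 \<le> g s"
  shows "(\<Sum>a\<in>{a. a \<le> m \<and> B \<le> 2 * real a}. g (2 * real a - B)) \<le> (\<Sum>j\<le>m. g (2 * real j))"
proof -
  define a0 where "a0 = nat \<lceil>B / 2\<rceil>"
  let ?S = "{a. a \<le> m \<and> B \<le> 2 * real a}"
  have a0: "B \<le> 2 * real a0" unfolding a0_def by linarith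
  have le: "a0 \<le> a" if "a \<in> ?S" for a using that unfolding a0_def by (auto simp: nat_le_iff ceiling_le_iff)
  have "(\<Sum>a\<in>?S. g (2 * real a - B)) \<le> (\<Sum>a\<in>?S. g (2 * real (a - a0)))"
    using le a0 by (intro sum_mono g) (auto simp: of_nat_diff)
  also have "\<dots> = (\<Sum>j\<in>(\<lambda>a. a - a0) ` ?S. g (2 * real j))"
    using le by (subst sum.reindex) (auto simp: inj_on_def, metis le diff_add_inverse2 le_add_diff_inverse2 mem_Collect_eq)
  also have "\<dots> \<le> (\<Sum>j\<le>m. g (2 * real j))"
    by (intro sum_mono2 g) auto
  finally show ?thesis .
qed

lemma sum_antimono_shift_rev:
  fixes g :: "real \<Rightarrow> real"
  assumes g: "\<And>s t. 0 \<le> s \<Longrightarrow> s \<le> t \<Longrightarrow> g t \<le> g s" "\<And>s. 0 \<le> s \<Longrightarrow> 0 \<le> g s"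
  shows "(\<Sum>a\<in>{a. a \<le> m \<and> B \<le> 2 * real (m - a)}. g (2 * real (m - a) - B)) \<le> (\<Sum>j\<le>m. g (2 * real j))"
proof -
  have "(\<Sum>a\<in>{a. a \<le> m \<and> B \<le> 2 * real (m - a)}. g (2 * real (m - a) - B))
      = (\<Sum>a\<in>{a. a \<le> m \<and> B \<le> 2 * real a}. g (2 * real a - B))"
    by (rule sum.reindex_bij_witness[of _ "\<lambda>a. m - a" "\<lambda>a. m - a"]) auto
  also have "\<dots> \<le> (\<Sum>j\<le>m. g (2 * real j))" by (rule sum_antimono_shift[OF g])
  finally show ?thesis .
qed

lemma sum_inverse_sqrt_truncated:
  assumes "0 \<le> T"
  shows "(\<Sum>j\<le>m. if 2 * real j \<le> T then 1 / sqrt (1 + 2 * real j) else 0) \<le> sqrt (1 + T)"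
proof -
  define K where "K = nat \<lfloor>T / 2\<rfloor>"
  have K: "2 * real K \<le> T" using assms unfolding K_def by linarith
  have "(\<Sum>j\<le>m. if 2 * real j \<le> T then 1 / sqrt (1 + 2 * real j) else 0)
      = (\<Sum>j\<in>{j. j \<le> m \<and> 2 * real j \<le> T}. 1 / sqrt (1 + 2 * real j))"
    by (intro sum.mono_neutral_cong_right) auto
  also have "\<dots> \<le> (\<Sum>j\<le>K. 1 / sqrt (1 + 2 * real j))"
    by (intro sum_mono2) (auto simp: K_def le_nat_iff le_floor_iff)
  also have "\<dots> \<le> sqrt (2 * real K + 1)" by (rule sum_inverse_sqrt)
  also have "\<dots> \<le> sqrt (1 + T)" using K by simp
  finally show ?thesis .
qed

text \<open>A discrete Beta(1/2, 1/2) integral, whose value does not depend on the length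
  \<open>T\<close> of the interval. With \<open>u + v = T\<close> the larger of the two is at least
  \<open>T / 2\<close> and contributes the factor \<open>c\<close>; the smaller one is summed and
  gives \<open>sqrt (1 + T)\<close>.\<close>

lemma beta_sum_bound:
  "(\<Sum>a\<in>{a. a \<le> m \<and> p \<le> 2 * real a \<and> r \<le> 2 * real (m - a)}.
      1 / (sqrt (1 + (2 * real a - p)) * sqrt (1 + (2 * real (m - a) - r)))) \<le> 4"
proof -
  let ?S = "{a. a \<le> m \<and> p \<le> 2 * real a \<and> r \<le> 2 * real (m - a)}"
  let ?f = "\<lambda>a. 1 / (sqrt (1 + (2 * real a - p)) * sqrt (1 + (2 * real (m - a) - r)))"
  define T where "T = 2 * real m - p - r"
  define g where "g = (\<lambda>t. if t \<le> T then 1 / sqrt (1 + t) else 0)"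
  show ?thesis
  proof (cases "0 \<le> T")
    case False
    have e: "?S = {}" using False by (auto simp: T_def of_nat_diff)
    show ?thesis unfolding e by simp
  next
    case True
    define c where "c = 1 / sqrt (1 + T / 2)"
    have c: "0 < c" using True by (simp add: c_def)
    have g: "\<And>s t. 0 \<le> s \<Longrightarrow> s \<le> t \<Longrightarrow> g t \<le> g s" "\<And>s. 0 \<le> s \<Longrightarrow> 0 \<le> g s"
      by (auto simp: g_def frac_le)
    have gsum: "(\<Sum>j\<le>m. g (2 * real j)) \<le> sqrt (1 + T)"
      unfolding g_def by (rule sum_inverse_sqrt_truncated[OF True])
    have pw: "?f a \<le> c * g (2 * real a - p) + c * g (2 * real (m - a) - r)" if a: "a \<in> ?S" for a
    proof -
      define u where "u = 2 * real a - p"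
      define v where "v = 2 * real (m - a) - r"
      have uv: "u + v = T" "0 \<le> u" "0 \<le> v" using a by (auto simp: u_def v_def T_def of_nat_diff)
      have g0: "0 \<le> c * g u" "0 \<le> c * g v" using c g(2) uv by auto
      have *: "1 / (sqrt (1 + u) * sqrt (1 + v)) \<le> 1 / sqrt (1 + u) * c"
        if "u \<le> v" "u + v = T" "0 \<le> u" for u v
      proof -
        have "1 / sqrt (1 + v) \<le> c" unfolding c_def using that True by (intro divide_left_mono) auto
        then have "1 / sqrt (1 + u) * (1 / sqrt (1 + v)) \<le> 1 / sqrt (1 + u) * c"
          using that by (intro mult_left_mono) auto
        then show ?thesis by simp
      qed
      have "1 / (sqrt (1 + u) * sqrt (1 + v)) \<le> c * g u + c * g v"
      proof (cases "u \<le> v")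
        case True
        then show ?thesis using *[of u v] uv g0 by (simp add: g_def)
      next
        case False
        then show ?thesis using *[of v u] uv g0 by (simp add: g_def mult.commute add.commute)
      qed
      then show ?thesis by (simp add: u_def v_def)
    qed
    have "(\<Sum>a\<in>?S. ?f a) \<le> (\<Sum>a\<in>?S. c * g (2 * real a - p) + c * g (2 * real (m - a) - r))"
      by (intro sum_mono pw)
    also have "\<dots> = c * (\<Sum>a\<in>?S. g (2 * real a - p)) + c * (\<Sum>a\<in>?S. g (2 * real (m - a) - r))"
      by (simp add: sum.distrib sum_distrib_left)
    also have "\<dots> \<le> c * sqrt (1 + T) + c * sqrt (1 + T)"
    proof (intro add_mono mult_left_mono)
      have "(\<Sum>a\<in>?S. g (2 * real a - p)) \<le> (\<Sum>a\<in>{a. a \<le> m \<and> p \<le> 2 * real a}. g (2 * real a - p))"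
        by (intro sum_mono2 g) auto
      also have "\<dots> \<le> (\<Sum>j\<le>m. g (2 * real j))" by (rule sum_antimono_shift[OF g])
      finally show "(\<Sum>a\<in>?S. g (2 * real a - p)) \<le> sqrt (1 + T)" using gsum by simp
      have "(\<Sum>a\<in>?S. g (2 * real (m - a) - r))
          \<le> (\<Sum>a\<in>{a. a \<le> m \<and> r \<le> 2 * real (m - a)}. g (2 * real (m - a) - r))"
        by (intro sum_mono2 g) auto
      also have "\<dots> \<le> (\<Sum>j\<le>m. g (2 * real j))" by (rule sum_antimono_shift_rev[OF g])
      finally show "(\<Sum>a\<in>?S. g (2 * real (m - a) - r)) \<le> sqrt (1 + T)" using gsum by simp
    qed (use c in auto)
    also have "\<dots> \<le> 4"
    proof -
      have "(1 + T) / (1 + T / 2) \<le> 2" using True by (simp add: divide_le_eq)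
      then have "sqrt ((1 + T) / (1 + T / 2)) \<le> sqrt 2" by simp
      then have "c * sqrt (1 + T) \<le> sqrt 2" by (simp add: c_def real_sqrt_divide)
      then show ?thesis using sqrt2_less_2 by linarith
    qed
    finally show ?thesis .
  qed
qed

text \<open>The summand is dominated by the derivative of \<open>2 arctan (sqrt s / v)\<close>.\<close>

lemma arctan_sum_bound:
  fixes v :: real
  assumes v: "1 \<le> v"
  shows "(\<Sum>j\<le>m. v / ((v\<^sup>2 + 2 * real j) * sqrt (1 + 2 * real j))) \<le> 4"
proof -
  define g where "g = (\<lambda>s. v / ((v\<^sup>2 + s) * sqrt (1 + s)))"
  define F where "F = (\<lambda>s. arctan (sqrt s / v))"
  have v2: "v \<le> v\<^sup>2" "0 < v\<^sup>2" using v by (auto simp: power2_eq_square)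
  have g1: "g s \<le> 1" if "0 \<le> s" for s
  proof -
    have "v * 1 \<le> (v\<^sup>2 + s) * sqrt (1 + s)" using that v v2 by (intro mult_mono) auto
    then show ?thesis using that v2 by (simp add: g_def divide_le_eq_1 add_pos_nonneg)
  qed
  have g_anti: "g t \<le> g s" if "0 \<le> s" "s \<le> t" for s t
    unfolding g_def using that v v2
    by (intro divide_left_mono mult_mono mult_pos_pos) (auto simp: add_pos_nonneg)
  \<comment> \<open>The mean value theorem on an interval of length 2, the spacing of the arguments,
    cancels the 2 in \<open>2 * sqrt z\<close>. Near 0 the terms are bounded by 1 instead:
    \<open>j = 0\<close> and \<open>j = 1\<close> give the summand 2 in
    \<open>2 + pi / 2\<close>.\<close>
  have step: "g (s + 2) \<le> F (s + 2) - F s" if s: "2 \<le> s" for s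
  proof -
    have d: "(F has_real_derivative v / ((v\<^sup>2 + z) * (2 * sqrt z))) (at z)" if "0 < z" for z
    proof -
      have "(F has_real_derivative inverse (1 + (sqrt z / v)\<^sup>2) * (inverse (sqrt z) / 2 / v)) (at z)"
        unfolding F_def using that v by (auto intro!: derivative_eq_intros simp: field_simps)
      moreover have "inverse (1 + (sqrt z / v)\<^sup>2) * (inverse (sqrt z) / 2 / v)
          = v / ((v\<^sup>2 + z) * (2 * sqrt z))"
      proof -
        have "1 + (sqrt z / v)\<^sup>2 = (v\<^sup>2 + z) / v\<^sup>2" using that v by (simp add: power_divide field_simps)
        moreover have "inverse (A / v\<^sup>2) * (inverse w / 2 / v) = v / (A * (2 * w))"
          if "A \<noteq> 0" "w \<noteq> 0" for A w
          using v that by (simp add: field_simps power2_eq_square)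
        moreover have "v\<^sup>2 + z \<noteq> 0" using add_pos_pos[OF v2(2) that] by simp
        moreover have "sqrt z \<noteq> 0" using that by simp
        ultimately show ?thesis by simp
      qed
      ultimately show ?thesis by simp
    qed
    obtain z where z: "s < z" "z < s + 2" "F (s + 2) - F s = (s + 2 - s) * (v / ((v\<^sup>2 + z) * (2 * sqrt z)))"
      using MVT2[of s "s + 2" F "\<lambda>z. v / ((v\<^sup>2 + z) * (2 * sqrt z))"] d s by force
    have "g (s + 2) \<le> g z" using z s by (intro g_anti) auto
    also have "\<dots> \<le> v / ((v\<^sup>2 + z) * sqrt z)"
      unfolding g_def using z s v v2
      by (intro divide_left_mono mult_mono mult_pos_pos) (auto simp: add_pos_nonneg)
    also have "\<dots> = F (s + 2) - F s" unfolding z(3) by simp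
    finally show ?thesis .
  qed
  have "(\<Sum>j\<le>m. g (2 * real j)) \<le> 2 + F (2 * real m)"
  proof (induction m)
    case 0
    then show ?case using g1[of 0] by (simp add: F_def)
  next
    case (Suc k)
    show ?case
    proof (cases k)
      case 0
      then show ?thesis using g1[of 0] g1[of 2] v by (simp add: F_def add_increasing2)
    next
      case (Suc l)
      then show ?thesis using Suc.IH step[of "2 * real k"] by (simp add: algebra_simps)
    qed
  qed
  also have "F (2 * real m) \<le> pi / 2" unfolding F_def using arctan_ubound[of "sqrt (2 * real m) / v"] by simp
  also have "2 + pi / 2 \<le> 4" using pi_less_4 by simp
  finally show ?thesis by (simp add: g_def)
qed

text \<open>\<open>?A\<close> and \<open>?B\<close> collect the indices for which \<open>x\<close>
  is in the allowed and in the forbidden region. Reflecting \<open>a\<close> to \<open>m - a\<close>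
  gives the second sum the shape of the first, and each is at most a constant times the sum of
  \<open>1 / sqrt (1 + 2 j)\<close>.\<close>

lemma sum_hermite_fun_sq: "(\<Sum>a\<le>m. (hermite_fun a x)\<^sup>2) \<le> 800 * sqrt (real m + 1)"
proof -
  define g where "g = (\<lambda>t::real. 1 / sqrt (1 + t))"
  have g: "\<And>s t. 0 \<le> s \<Longrightarrow> s \<le> t \<Longrightarrow> g t \<le> g s" "\<And>s. 0 \<le> s \<Longrightarrow> 0 \<le> g s"
    by (auto simp: g_def frac_le)
  let ?A = "{a. a \<le> m \<and> x\<^sup>2 - 1 \<le> 2 * real a}"
  let ?B = "{a. a \<le> m \<and> 2 * real m + 1 - x\<^sup>2 \<le> 2 * real (m - a)}"
  have "(\<Sum>a\<le>m. (hermite_fun a x)\<^sup>2) \<le> (\<Sum>a\<in>?A \<union> ?B. 200 * g \<bar>2 * real a + 1 - x\<^sup>2\<bar>)"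
  proof (rule order_trans[OF sum_mono])
    show "(hermite_fun a x)\<^sup>2 \<le> 200 * g \<bar>2 * real a + 1 - x\<^sup>2\<bar>" for a
      using hermite_fun_bound_sqrt[of a x] by (simp add: g_def)
    show "(\<Sum>a\<le>m. 200 * g \<bar>2 * real a + 1 - x\<^sup>2\<bar>) \<le> (\<Sum>a\<in>?A \<union> ?B. 200 * g \<bar>2 * real a + 1 - x\<^sup>2\<bar>)"
      by (intro sum_mono2) (auto simp: of_nat_diff g)
  qed
  also have "\<dots> \<le> (\<Sum>a\<in>?A. 200 * g \<bar>2 * real a + 1 - x\<^sup>2\<bar>) + (\<Sum>a\<in>?B. 200 * g \<bar>2 * real a + 1 - x\<^sup>2\<bar>)"
    by (subst sum_Un) (auto intro!: sum_nonneg g)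
  also have "(\<Sum>a\<in>?A. 200 * g \<bar>2 * real a + 1 - x\<^sup>2\<bar>) = 200 * (\<Sum>a\<in>?A. g (2 * real a - (x\<^sup>2 - 1)))"
    unfolding sum_distrib_left by (intro sum.cong) (auto intro!: arg_cong[of _ _ g])
  also have "(\<Sum>a\<in>?B. 200 * g \<bar>2 * real a + 1 - x\<^sup>2\<bar>)
      = 200 * (\<Sum>a\<in>?B. g (2 * real (m - a) - (2 * real m + 1 - x\<^sup>2)))"
    unfolding sum_distrib_left by (intro sum.cong) (auto simp: of_nat_diff intro!: arg_cong[of _ _ g])
  also have "200 * (\<Sum>a\<in>?A. g (2 * real a - (x\<^sup>2 - 1)))
        + 200 * (\<Sum>a\<in>?B. g (2 * real (m - a) - (2 * real m + 1 - x\<^sup>2)))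
      \<le> 200 * (\<Sum>j\<le>m. g (2 * real j)) + 200 * (\<Sum>j\<le>m. g (2 * real j))"
    by (intro add_mono mult_left_mono sum_antimono_shift sum_antimono_shift_rev g) auto
  also have "\<dots> \<le> 400 * sqrt (2 * real m + 1)"
    using sum_inverse_sqrt[of m] by (simp add: g_def)
  also have "sqrt (2 * real m + 1) \<le> sqrt (4 * (real m + 1))" by simp
  also have "\<dots> = sqrt 4 * sqrt (real m + 1)" by (rule real_sqrt_mult)
  finally show ?thesis by simp
qed

text \<open>Here \<open>x\<close> is forbidden and \<open>y\<close> allowed, and as \<open>a\<close>
  decreases both distances to the turning points grow together. Two inverse square roots would only
  give a harmonic sum; the decay bound in \<open>x\<close> replaces it by the arctangent
  sum.\<close>

lemma hermite_conv_mixed: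
  "(\<Sum>a\<in>{a. a \<le> m \<and> 2 * real a + 1 < x\<^sup>2 \<and> y\<^sup>2 \<le> 2 * real (m - a) + 1}.
      (hermite_fun a x)\<^sup>2 * (hermite_fun (m - a) y)\<^sup>2) \<le> 240000"
proof (cases "1 < x\<^sup>2")
  case False
  then have e: "{a. a \<le> m \<and> 2 * real a + 1 < x\<^sup>2 \<and> y\<^sup>2 \<le> 2 * real (m - a) + 1} = {}" by auto
  show ?thesis unfolding e by simp
next
  case True
  define v where "v = \<bar>x\<bar> powr (1 / 3)"
  have "1 < \<bar>x\<bar>" using True by (simp flip: abs_square_le_1 not_le)
  then have v1: "1 \<le> v" by (simp add: v_def ge_one_powr_ge_zero)
  have v2: "0 < v\<^sup>2" using v1 by simp
  define g where "g = (\<lambda>s. v / ((v\<^sup>2 + s) * sqrt (1 + s)))"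
  have g: "g t \<le> g s" if "0 \<le> s" "s \<le> t" for s t
    unfolding g_def using that v1 v2
    by (intro divide_left_mono mult_mono mult_pos_pos) (auto simp: add_pos_nonneg)
  have g0: "0 \<le> g s" if "0 \<le> s" for s
    using that v1 by (simp add: g_def)
  \<comment> \<open>The larger of the two thresholds, so that the single variable \<open>s\<close>
    bounds both distances \<open>t\<close> and \<open>q\<close> from below.\<close>
  define B where "B = max (2 * real m + 1 - x\<^sup>2) (y\<^sup>2 - 1)"
  let ?S = "{a. a \<le> m \<and> 2 * real a + 1 < x\<^sup>2 \<and> y\<^sup>2 \<le> 2 * real (m - a) + 1}"
  have "(\<Sum>a\<in>?S. (hermite_fun a x)\<^sup>2 * (hermite_fun (m - a) y)\<^sup>2)
      \<le> (\<Sum>a\<in>?S. 60000 * g (2 * real (m - a) - B))"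
  proof (intro sum_mono)
    fix a assume a: "a \<in> ?S"
    define s where "s = 2 * real (m - a) - B"
    define t where "t = x\<^sup>2 - (2 * real a + 1)"
    define q where "q = 2 * real (m - a) + 1 - y\<^sup>2"
    have s: "0 \<le> s" "s \<le> t" "s \<le> q" using a by (auto simp: s_def t_def q_def B_def of_nat_diff)
    have "(hermite_fun a x)\<^sup>2 * (hermite_fun (m - a) y)\<^sup>2 \<le> (300 * v / (v\<^sup>2 + t)) * (200 / sqrt (1 + q))"
    proof (intro mult_mono)
      show "(hermite_fun a x)\<^sup>2 \<le> 300 * v / (v\<^sup>2 + t)"
        using hermite_fun_bound_decay[of a x] a by (simp add: v_def t_def)
      show "(hermite_fun (m - a) y)\<^sup>2 \<le> 200 / sqrt (1 + q)"
        using hermite_fun_bound_sqrt[of "m - a" y] s by (simp add: q_def)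
      show "0 \<le> 300 * v / (v\<^sup>2 + t)" using v1 s by (intro divide_nonneg_nonneg add_nonneg_nonneg) auto
    qed auto
    also have "\<dots> \<le> (300 * v / (v\<^sup>2 + s)) * (200 / sqrt (1 + s))"
      using s v1 v2 by (intro mult_mono divide_left_mono mult_pos_pos) (auto simp: add_pos_nonneg)
    also have "\<dots> = 60000 * g s" by (simp add: g_def)
    finally show "(hermite_fun a x)\<^sup>2 * (hermite_fun (m - a) y)\<^sup>2 \<le> 60000 * g (2 * real (m - a) - B)"
      by (simp add: s_def)
  qed
  also have "\<dots> \<le> (\<Sum>a\<in>{a. a \<le> m \<and> B \<le> 2 * real (m - a)}. 60000 * g (2 * real (m - a) - B))"
    by (intro sum_mono2) (auto simp: B_def of_nat_diff intro!: g0)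
  also have "\<dots> = 60000 * (\<Sum>a\<in>{a. a \<le> m \<and> B \<le> 2 * real (m - a)}. g (2 * real (m - a) - B))"
    by (simp add: sum_distrib_left)
  also have "\<dots> \<le> 60000 * (\<Sum>j\<le>m. g (2 * real j))"
    by (intro mult_left_mono sum_antimono_shift_rev g g0) auto
  also have "\<dots> \<le> 60000 * 4"
    using arctan_sum_bound[OF v1, of m] by (simp add: g_def)
  finally show ?thesis by simp
qed

text \<open>When both points are allowed, or both forbidden, the two distances have a constant sum
  and fall under the Beta sum; in the forbidden case \<open>a\<close> and \<open>m - a\<close>
  exchange roles. The two mixed cases are mirror images. The constant is
  \<open>2 * 160000 + 2 * 240000\<close>.\<close>

lemma hermite_conv_bound:
  "(\<Sum>a\<le>m. (hermite_fun a x)\<^sup>2 * (hermite_fun (m - a) y)\<^sup>2) \<le> 800000"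
proof -
  let ?f = "\<lambda>a. (hermite_fun a x)\<^sup>2 * (hermite_fun (m - a) y)\<^sup>2"
  let ?AA = "{a. a \<le> m \<and> x\<^sup>2 - 1 \<le> 2 * real a \<and> y\<^sup>2 - 1 \<le> 2 * real (m - a)}"
  let ?FF = "{a. a \<le> m \<and> 2 * real m + 1 - y\<^sup>2 \<le> 2 * real a \<and> 2 * real m + 1 - x\<^sup>2 \<le> 2 * real (m - a)}"
  let ?FA = "{a. a \<le> m \<and> 2 * real a + 1 < x\<^sup>2 \<and> y\<^sup>2 \<le> 2 * real (m - a) + 1}"
  let ?AF = "{a. a \<le> m \<and> x\<^sup>2 \<le> 2 * real a + 1 \<and> 2 * real (m - a) + 1 < y\<^sup>2}"
  have f_le: "?f a \<le> 40000 * (1 / (sqrt (1 + \<bar>2 * real a + 1 - x\<^sup>2\<bar>) * sqrt (1 + \<bar>2 * real (m - a) + 1 - y\<^sup>2\<bar>)))" for a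
  proof -
    have "?f a \<le> (200 / sqrt (1 + \<bar>2 * real a + 1 - x\<^sup>2\<bar>)) * (200 / sqrt (1 + \<bar>2 * real (m - a) + 1 - y\<^sup>2\<bar>))"
      by (intro mult_mono hermite_fun_bound_sqrt) auto
    then show ?thesis by simp
  qed
  have AA: "sum ?f ?AA \<le> 160000"
  proof -
    have "sum ?f ?AA \<le> (\<Sum>a\<in>?AA. 40000 * (1 / (sqrt (1 + (2 * real a - (x\<^sup>2 - 1))) * sqrt (1 + (2 * real (m - a) - (y\<^sup>2 - 1))))))"
    proof (intro sum_mono)
      fix a assume "a \<in> ?AA"
      then have "\<bar>2 * real a + 1 - x\<^sup>2\<bar> = 2 * real a - (x\<^sup>2 - 1)" "\<bar>2 * real (m - a) + 1 - y\<^sup>2\<bar> = 2 * real (m - a) - (y\<^sup>2 - 1)"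
        by auto
      then show "?f a \<le> 40000 * (1 / (sqrt (1 + (2 * real a - (x\<^sup>2 - 1))) * sqrt (1 + (2 * real (m - a) - (y\<^sup>2 - 1)))))"
        using f_le[of a] by (simp only:)
    qed
    also have "\<dots> \<le> 40000 * 4"
      unfolding sum_distrib_left[symmetric] by (intro mult_left_mono beta_sum_bound) auto
    finally show ?thesis by simp
  qed
  have FF: "sum ?f ?FF \<le> 160000"
  proof -
    have "sum ?f ?FF \<le> (\<Sum>a\<in>?FF. 40000 * (1 / (sqrt (1 + (2 * real a - (2 * real m + 1 - y\<^sup>2))) * sqrt (1 + (2 * real (m - a) - (2 * real m + 1 - x\<^sup>2))))))"
    proof (intro sum_mono)
      fix a assume "a \<in> ?FF"
      then have "\<bar>2 * real a + 1 - x\<^sup>2\<bar> = 2 * real (m - a) - (2 * real m + 1 - x\<^sup>2)"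
        "\<bar>2 * real (m - a) + 1 - y\<^sup>2\<bar> = 2 * real a - (2 * real m + 1 - y\<^sup>2)"
        by (auto simp: of_nat_diff)
      then show "?f a \<le> 40000 * (1 / (sqrt (1 + (2 * real a - (2 * real m + 1 - y\<^sup>2))) * sqrt (1 + (2 * real (m - a) - (2 * real m + 1 - x\<^sup>2)))))"
        using f_le[of a] by (simp only: mult.commute)
    qed
    also have "\<dots> \<le> 40000 * 4"
      unfolding sum_distrib_left[symmetric] by (intro mult_left_mono beta_sum_bound) auto
    finally show ?thesis by simp
  qed
  have AF: "sum ?f ?AF \<le> 240000"
  proof -
    have "sum ?f ?AF = (\<Sum>a\<in>{a. a \<le> m \<and> 2 * real a + 1 < y\<^sup>2 \<and> x\<^sup>2 \<le> 2 * real (m - a) + 1}.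
      (hermite_fun a y)\<^sup>2 * (hermite_fun (m - a) x)\<^sup>2)"
      by (rule sum.reindex_bij_witness[of _ "\<lambda>a. m - a" "\<lambda>a. m - a"]) auto
    then show ?thesis using hermite_conv_mixed by simp
  qed
  have "sum ?f {..m} \<le> sum ?f ((?AA \<union> ?FF) \<union> (?FA \<union> ?AF))"
    by (intro sum_mono2) (auto simp: of_nat_diff)
  also have "\<dots> \<le> (sum ?f ?AA + sum ?f ?FF) + (sum ?f ?FA + sum ?f ?AF)"
  proof -
    have un: "sum ?f (A \<union> B) \<le> sum ?f A + sum ?f B" if "finite A" "finite B" for A B
      using that by (subst sum_Un) (auto intro!: sum_nonneg)
    show ?thesis by (intro order_trans[OF un] add_mono un) auto
  qed
  also have "\<dots> \<le> 800000" using AA FF AF hermite_conv_mixed[where m = m and x = x and y = y] by linarith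
  finally show ?thesis .
qed

text \<open>Multi-indices are functions on the whole type that vanish outside \<open>I\<close>, so
  that index sets for different \<open>I\<close> share one type and the dimension can be raised by
  induction on \<open>I\<close>.\<close>

definition multi_idx :: "'i set \<Rightarrow> nat \<Rightarrow> ('i \<Rightarrow> nat) set" where
  "multi_idx I m = {\<alpha>. (\<forall>i. i \<notin> I \<longrightarrow> \<alpha> i = 0) \<and> sum \<alpha> I = m}"

lemma finite_multi_idx [simp]:
  assumes "finite I" shows "finite (multi_idx I m)"
proof (rule finite_subset)
  show "multi_idx I m \<subseteq> {\<alpha>. \<forall>i. (i \<in> I \<longrightarrow> \<alpha> i \<in> {..m}) \<and> (i \<notin> I \<longrightarrow> \<alpha> i = 0)}"
    using assms by (auto simp: multi_idx_def intro: member_le_sum)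
  show "finite {\<alpha>. \<forall>i. (i \<in> I \<longrightarrow> \<alpha> i \<in> {..m}) \<and> (i \<notin> I \<longrightarrow> \<alpha> i = 0)}"
    using assms by (intro finite_set_of_finite_funs) auto
qed

lemma multi_idx_empty: "multi_idx {} m = (if m = 0 then {\<lambda>_. 0} else {})"
  by (auto simp: multi_idx_def)

lemma sum_multi_idx_insert:
  assumes "finite I" "i \<notin> I"
  shows "(\<Sum>\<alpha>\<in>multi_idx (insert i I) m. F \<alpha>) = (\<Sum>a\<le>m. \<Sum>\<beta>\<in>multi_idx I (m - a). F (\<beta>(i := a)))"
proof -
  have s: "sum (\<beta>(i := a)) I = sum \<beta> I" for \<beta> :: "'a \<Rightarrow> nat" and a
    using assms by (intro sum.cong) auto
  note s' = s[unfolded fun_upd_def]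
  have "(\<Sum>a\<le>m. \<Sum>\<beta>\<in>multi_idx I (m - a). F (\<beta>(i := a)))
      = (\<Sum>(a, \<beta>)\<in>(SIGMA a:{..m}. multi_idx I (m - a)). F (\<beta>(i := a)))"
    using assms by (intro sum.Sigma) auto
  also have "\<dots> = (\<Sum>\<alpha>\<in>multi_idx (insert i I) m. F \<alpha>)"
    using assms
    by (intro sum.reindex_bij_witness[of _ "\<lambda>\<alpha>. (\<alpha> i, \<alpha>(i := 0))" "\<lambda>(a, \<beta>). \<beta>(i := a)"])
      (auto simp: multi_idx_def s s' fun_eq_iff)
  finally show ?thesis by simp
qed

lemma gamma_exp_Suc: "2 \<le> k \<Longrightarrow> gamma_exp (Suc k) = gamma_exp k + 1 / 2"
  by (simp add: gamma_exp_def field_simps)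

lemma gamma_exp_nonneg: "2 \<le> k \<Longrightarrow> 0 \<le> gamma_exp k"
  by (simp add: gamma_exp_def)

lemma spectral_function_insert:
  assumes "finite I" "i \<notin> I"
  shows "(\<Sum>\<alpha>\<in>multi_idx (insert i I) m. \<Prod>j\<in>insert i I. (hermite_fun (\<alpha> j) (x j))\<^sup>2)
    = (\<Sum>a\<le>m. (hermite_fun a (x i))\<^sup>2 * (\<Sum>\<beta>\<in>multi_idx I (m - a). \<Prod>j\<in>I. (hermite_fun (\<beta> j) (x j))\<^sup>2))"
proof -
  have "(\<Prod>j\<in>I. (hermite_fun ((\<beta>(i := a)) j) (x j))\<^sup>2) = (\<Prod>j\<in>I. (hermite_fun (\<beta> j) (x j))\<^sup>2)" for \<beta> a
    using assms by (intro prod.cong) auto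
  then show ?thesis
    using assms by (simp add: sum_multi_idx_insert sum_distrib_left del: fun_upd_apply) simp
qed

lemma spectral_function_singleton:
  "(\<Sum>\<alpha>\<in>multi_idx {i} m. \<Prod>j\<in>{i}. (hermite_fun (\<alpha> j) (x j))\<^sup>2) = (hermite_fun m (x i))\<^sup>2"
proof -
  have "(\<Sum>\<alpha>\<in>multi_idx {i} m. \<Prod>j\<in>{i}. (hermite_fun (\<alpha> j) (x j))\<^sup>2)
     = (\<Sum>a\<le>m. (hermite_fun a (x i))\<^sup>2 * real (card (multi_idx ({} :: 'a set) (m - a))))"
    using spectral_function_insert[where I = "{}" and i = i and m = m and x = x] by simp
  also have "\<dots> = (\<Sum>a\<le>m. if a = m then (hermite_fun m (x i))\<^sup>2 else 0)"
    by (intro sum.cong) (auto simp: multi_idx_empty)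
  finally show ?thesis by simp
qed

text \<open>Dimension one is the turning point bound. From one to two the convolution itself must be
  estimated: pulling out a supremum would lose a power of \<open>m\<close>. From dimension two on
  the exponent is nonnegative, so the inner factor is bounded by its value at level
  \<open>m\<close>, and each new variable contributes the square root of
  \<open>sum_hermite_fun_sq\<close>.\<close>

lemma spectral_function_bound:
  assumes "finite I" "I \<noteq> {}"
  shows "\<exists>C>0. \<forall>m x. (\<Sum>\<alpha>\<in>multi_idx I m. \<Prod>i\<in>I. (hermite_fun (\<alpha> i) (x i))\<^sup>2)
      \<le> C * (real m + 1) powr gamma_exp (card I)"
  using assms
proof (induction I rule: finite_ne_induct)
  case (singleton i)
  have "(\<Sum>\<alpha>\<in>multi_idx {i} m. \<Prod>j\<in>{i}. (hermite_fun (\<alpha> j) (x j))\<^sup>2)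
      \<le> 96 * (real m + 1) powr gamma_exp (card {i})" for m x
  proof -
    have "(hermite_fun m (x i))\<^sup>2 \<le> 96 / (2 * real m + 1) powr (1 / 6)" by (rule hermite_fun_bound)
    also have "\<dots> \<le> 96 / (real m + 1) powr (1 / 6)"
      by (intro divide_left_mono powr_mono2) auto
    also have "\<dots> = 96 * (real m + 1) powr gamma_exp 1"
      by (simp add: gamma_exp_def powr_minus_divide)
    finally show ?thesis unfolding spectral_function_singleton by simp
  qed
  then show ?case by (intro exI[of _ 96]) auto
next
  case (insert i I)
  then obtain C where C: "C > 0" "\<And>m x. (\<Sum>\<alpha>\<in>multi_idx I m. \<Prod>i\<in>I. (hermite_fun (\<alpha> i) (x i))\<^sup>2)
      \<le> C * (real m + 1) powr gamma_exp (card I)" by blast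
  show ?case
  proof (cases "card I = 1")
    case True
    then obtain j where j: "I = {j}" by (auto simp: card_1_singleton_iff)
    have "(\<Sum>\<alpha>\<in>multi_idx (insert i I) m. \<Prod>j\<in>insert i I. (hermite_fun (\<alpha> j) (x j))\<^sup>2)
       \<le> 800000 * (real m + 1) powr gamma_exp (card (insert i I))" for m x
      unfolding spectral_function_insert[OF insert(1,3)]
      unfolding j spectral_function_singleton
      using hermite_conv_bound[where m = m and x = "x i" and y = "x j"] insert j by (simp add: gamma_exp_def)
    then show ?thesis by (intro exI[of _ 800000]) auto
  next
    case False
    moreover have "card I \<noteq> 0" using insert by simp
    ultimately have k: "2 \<le> card I" by linarith
    let ?g = "gamma_exp (card I)"
    have "(\<Sum>\<alpha>\<in>multi_idx (insert i I) m. \<Prod>j\<in>insert i I. (hermite_fun (\<alpha> j) (x j))\<^sup>2)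
       \<le> C * 800 * (real m + 1) powr gamma_exp (card (insert i I))" for m x
    proof -
      have "(\<Sum>\<alpha>\<in>multi_idx (insert i I) m. \<Prod>j\<in>insert i I. (hermite_fun (\<alpha> j) (x j))\<^sup>2)
        \<le> (\<Sum>a\<le>m. (hermite_fun a (x i))\<^sup>2 * (C * (real m + 1) powr ?g))"
        unfolding spectral_function_insert[OF insert(1,3)]
      proof (intro sum_mono mult_left_mono)
        fix a
        have "(\<Sum>\<beta>\<in>multi_idx I (m - a). \<Prod>j\<in>I. (hermite_fun (\<beta> j) (x j))\<^sup>2)
            \<le> C * (real (m - a) + 1) powr ?g" by (rule C)
        also have "\<dots> \<le> C * (real m + 1) powr ?g"
          using C gamma_exp_nonneg[OF k] by (intro mult_left_mono powr_mono2) auto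
        finally show "(\<Sum>\<beta>\<in>multi_idx I (m - a). \<Prod>j\<in>I. (hermite_fun (\<beta> j) (x j))\<^sup>2)
            \<le> C * (real m + 1) powr ?g" .
      qed auto
      also have "\<dots> = (\<Sum>a\<le>m. (hermite_fun a (x i))\<^sup>2) * (C * (real m + 1) powr ?g)"
        by (simp add: sum_distrib_right)
      also have "\<dots> \<le> (800 * sqrt (real m + 1)) * (C * (real m + 1) powr ?g)"
        using C by (intro mult_right_mono sum_hermite_fun_sq) auto
      also have "\<dots> = C * 800 * ((real m + 1) powr ?g * (real m + 1) powr (1 / 2))"
        by (simp add: powr_half_sqrt)
      also have "\<dots> = C * 800 * (real m + 1) powr (gamma_exp (card (insert i I)))"
        using insert gamma_exp_Suc[OF k] by (simp add: powr_add)
      finally show ?thesis .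
    qed
    then show ?thesis using C by (intro exI[of _ "C * 800"]) auto
  qed
qed

section \<open>Hermite functions in several variables\<close>

definition hermite_nd :: "('d::finite \<Rightarrow> nat) \<Rightarrow> real ^ 'd \<Rightarrow> real" where
  "hermite_nd \<alpha> x = (\<Prod>i\<in>UNIV. hermite_fun (\<alpha> i) (x $ i))"

text \<open>\<open>ladder True i\<close> and \<open>ladder False i\<close> express \<open>x\<^sub>i\<close> and \<open>\<partial>\<^sub>i\<close> on the Hermite functions.\<close>

definition ladder :: "bool \<Rightarrow> 'd \<Rightarrow> (('d \<Rightarrow> nat) \<Rightarrow> 'a::real_vector) \<Rightarrow> ('d \<Rightarrow> nat) \<Rightarrow> 'a" where
  "ladder b i P \<alpha> = (sqrt (real (\<alpha> i)) / sqrt 2) *\<^sub>R P (\<alpha>(i := \<alpha> i - 1))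
     + ((if b then 1 else - 1) * sqrt (real (\<alpha> i) + 1) / sqrt 2) *\<^sub>R P (\<alpha>(i := Suc (\<alpha> i)))"

lemma hermite_nd_upd:
  "hermite_nd (\<alpha>(i := a)) x = hermite_fun a (x $ i) * (\<Prod>j\<in>UNIV - {i}. hermite_fun (\<alpha> j) (x $ j))"
  unfolding hermite_nd_def by (subst prod.remove[of _ i]) (auto intro!: prod.cong)

lemma hermite_nd_split:
  "hermite_nd \<alpha> x = hermite_fun (\<alpha> i) (x $ i) * (\<Prod>j\<in>UNIV - {i}. hermite_fun (\<alpha> j) (x $ j))"
  using hermite_nd_upd[of \<alpha> i "\<alpha> i" x] by simp

lemma ladder_True_hermite_nd:
  "ladder True i (\<lambda>\<alpha>. hermite_nd \<alpha> x) \<alpha> = x $ i * hermite_nd \<alpha> x"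
proof -
  have "x $ i * hermite_fun (\<alpha> i) (x $ i) = (sqrt (real (\<alpha> i) + 1) * hermite_fun (Suc (\<alpha> i)) (x $ i)
     + sqrt (real (\<alpha> i)) * hermite_fun (\<alpha> i - 1) (x $ i)) / sqrt 2"
    using hermite_fun_rec[of "x $ i" "\<alpha> i"] by (simp add: field_simps)
  then show ?thesis
    unfolding ladder_def hermite_nd_upd hermite_nd_split[of \<alpha> x i] mult.assoc[symmetric]
    by (simp only:) (simp add: field_simps)
qed

lemma ladder_False_hermite_nd:
  "ladder False i (\<lambda>\<alpha>. hermite_nd \<alpha> x) \<alpha>
     = hermite_deriv (\<alpha> i) (x $ i) * (\<Prod>j\<in>UNIV - {i}. hermite_fun (\<alpha> j) (x $ j))"
  unfolding ladder_def hermite_nd_upd hermite_deriv_def by (simp add: field_simps)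

lemma hermite_nd_has_derivative:
  "(hermite_nd \<alpha> has_derivative (\<lambda>v. \<Sum>i\<in>UNIV. v $ i *\<^sub>R ladder False i (\<lambda>\<beta>. hermite_nd \<beta> x) \<alpha>)) (at x)"
proof -
  have "((\<lambda>x. \<Prod>i\<in>UNIV. hermite_fun (\<alpha> i) (x $ i)) has_derivative
      (\<lambda>v. \<Sum>i\<in>UNIV. (v $ i * hermite_deriv (\<alpha> i) (x $ i)) * (\<Prod>j\<in>UNIV - {i}. hermite_fun (\<alpha> j) (x $ j)))) (at x)"
  proof (rule has_derivative_prod)
    fix i
    have "((\<lambda>x. x $ i) has_derivative (\<lambda>v. v $ i)) (at x)"
      by (rule bounded_linear.has_derivative[OF bounded_linear_vec_nth has_derivative_ident])
    from has_derivative_compose[OF this hermite_fun_has_deriv[unfolded has_field_derivative_def]]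
    have "((\<lambda>x. hermite_fun (\<alpha> i) (x $ i)) has_derivative (\<lambda>v. hermite_deriv (\<alpha> i) (x $ i) * v $ i)) (at x)"
      by simp
    then show "((\<lambda>x. hermite_fun (\<alpha> i) (x $ i)) has_derivative (\<lambda>v. v $ i * hermite_deriv (\<alpha> i) (x $ i))) (at x)"
      by (simp add: mult.commute)
  qed
  moreover have e: "hermite_nd \<alpha> = (\<lambda>x. \<Prod>i\<in>UNIV. hermite_fun (\<alpha> i) (x $ i))"
    by (rule ext) (rule hermite_nd_def)
  ultimately show ?thesis unfolding ladder_False_hermite_nd e by (simp add: mult.assoc)
qed

lemma ladder_linear:
  assumes "bounded_linear f"
  shows "ladder b i (\<lambda>\<alpha>. f (P \<alpha>)) \<alpha> = f (ladder b i P \<alpha>)"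
  using assms by (simp add: ladder_def bounded_linear.linear linear_add linear_scale)

text \<open>\<open>ladder\<close> acts on the index only, so it commutes with differentiation in
  \<open>x\<close>; second derivatives become iterated ladders.\<close>

lemma ladder_has_derivative:
  assumes "\<And>\<beta>. (P \<beta> has_derivative (\<lambda>v. \<Sum>j\<in>UNIV. v $ j *\<^sub>R Q j \<beta>)) (at x)"
  shows "((\<lambda>x. ladder b i (\<lambda>\<beta>. P \<beta> x) \<alpha>) has_derivative
      (\<lambda>v. \<Sum>j\<in>UNIV. v $ j *\<^sub>R ladder b i (Q j) \<alpha>)) (at x)"
  unfolding ladder_def
  by (rule has_derivative_eq_rhs, (rule derivative_intros assms)+)
    (simp add: scaleR_sum_right sum.distrib[symmetric] scaleR_add_right mult.commute)

lemma partial_deriv_eq: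
  assumes "(f has_derivative (\<lambda>v. \<Sum>i\<in>UNIV. v $ i *\<^sub>R D i)) (at x)"
  shows "partial_deriv i f x = D i"
proof -
  have "frechet_derivative f (at x) = (\<lambda>v. \<Sum>i\<in>UNIV. v $ i *\<^sub>R D i)"
    using frechet_derivative_at[OF assms] by simp
  then show ?thesis
    by (simp add: partial_deriv_def axis_def if_distrib[of "\<lambda>c. c *\<^sub>R _"] cong: if_cong)
qed

text \<open>The shifts of the index by two cancel between the two squares and the mixed terms
  double, leaving a diagonal operator: the one-dimensional eigenvalue equation in coordinate
  \<open>i\<close>.\<close>

lemma ladder_squares:
  "ladder True i (ladder True i P) \<alpha> - ladder False i (ladder False i P) \<alpha>
     = (2 * real (\<alpha> i) + 1) *\<^sub>R P \<alpha>"
proof (cases "\<alpha> i")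
  case 0
  then show ?thesis by (simp add: ladder_def algebra_simps fun_upd_idem flip: scaleR_add_left)
next
  case (Suc k)
  then show ?thesis
    by (simp add: ladder_def algebra_simps fun_upd_idem flip: scaleR_add_left)
qed

text \<open>This space is closed under partial derivatives and consists of Schwartz functions, so
  its members may be used as test functions in the weak eigenvalue equation. It also contains the
  smooth representatives of all eigenfunctions.\<close>

inductive_set hermite_span :: "(real ^ 'd::finite \<Rightarrow> complex) set" where
  hermite: "(\<lambda>x. of_real (hermite_nd \<alpha> x)) \<in> hermite_span"
| zero: "(\<lambda>x. 0) \<in> hermite_span"
| add: "f \<in> hermite_span \<Longrightarrow> g \<in> hermite_span \<Longrightarrow> (\<lambda>x. f x + g x) \<in> hermite_span"
| scale: "f \<in> hermite_span \<Longrightarrow> (\<lambda>x. c * f x) \<in> hermite_span"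

lemma hermite_span_scaleR: "f \<in> hermite_span \<Longrightarrow> (\<lambda>x. c *\<^sub>R f x) \<in> hermite_span"
  unfolding scaleR_conv_of_real by (rule hermite_span.scale)

lemma hermite_span_sum:
  "(\<And>n. n \<in> A \<Longrightarrow> f n \<in> hermite_span) \<Longrightarrow> (\<lambda>x. \<Sum>n\<in>A. f n x) \<in> hermite_span"
  by (induction A rule: infinite_finite_induct) (auto intro: hermite_span.intros)

lemma hermite_span_ladder:
  assumes "\<And>\<beta>. (\<lambda>x. P \<beta> x) \<in> hermite_span"
  shows "(\<lambda>x. ladder b i (\<lambda>\<beta>. P \<beta> x) \<alpha>) \<in> hermite_span"
  unfolding ladder_def by (intro hermite_span.add hermite_span_scaleR assms)

lemma hermite_nd_complex_has_derivative:
  "((\<lambda>x. complex_of_real (hermite_nd \<alpha> x)) has_derivative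
     (\<lambda>v. \<Sum>i\<in>UNIV. v $ i *\<^sub>R ladder False i (\<lambda>\<beta>. complex_of_real (hermite_nd \<beta> x)) \<alpha>)) (at x)"
proof -
  have "((\<lambda>x. complex_of_real (hermite_nd \<alpha> x)) has_derivative
     (\<lambda>v. complex_of_real (\<Sum>i\<in>UNIV. v $ i *\<^sub>R ladder False i (\<lambda>\<beta>. hermite_nd \<beta> x) \<alpha>))) (at x)"
    by (intro bounded_linear.has_derivative[OF bounded_linear_of_real] hermite_nd_has_derivative)
  moreover have "complex_of_real (\<Sum>i\<in>UNIV. v $ i *\<^sub>R ladder False i (\<lambda>\<beta>. hermite_nd \<beta> x) \<alpha>)
      = (\<Sum>i\<in>UNIV. v $ i *\<^sub>R ladder False i (\<lambda>\<beta>. complex_of_real (hermite_nd \<beta> x)) \<alpha>)" for v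
    by (subst ladder_linear[OF bounded_linear_of_real]) (simp add: scaleR_conv_of_real)
  ultimately show ?thesis by simp
qed

lemma partial_deriv_hermite_nd:
  "partial_deriv i (\<lambda>x. complex_of_real (hermite_nd \<alpha> x)) x
     = ladder False i (\<lambda>\<beta>. complex_of_real (hermite_nd \<beta> x)) \<alpha>"
  by (rule partial_deriv_eq[OF hermite_nd_complex_has_derivative])

text \<open>The induction produces some family \<open>f'\<close> of partial derivatives in the span.
  Only afterwards is it identified with \<open>partial_deriv\<close>, which is total and carries no
  information before differentiability is known.\<close>

lemma hermite_span_deriv:
  assumes "f \<in> hermite_span"
  shows "(f has_derivative (\<lambda>v. \<Sum>i\<in>UNIV. v $ i *\<^sub>R partial_deriv i f x)) (at x)"
    and "(\<lambda>x. partial_deriv i f x) \<in> hermite_span"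
proof -
  have "\<exists>f'. (\<forall>i. f' i \<in> hermite_span) \<and> (\<forall>x. (f has_derivative (\<lambda>v. \<Sum>i\<in>UNIV. v $ i *\<^sub>R f' i x)) (at x))"
    using assms
  proof (induction f rule: hermite_span.induct)
    case (hermite \<alpha>)
    show ?case
      by (intro exI[of _ "\<lambda>i x. ladder False i (\<lambda>\<beta>. complex_of_real (hermite_nd \<beta> x)) \<alpha>"] conjI allI
          hermite_nd_complex_has_derivative hermite_span_ladder hermite_span.hermite)
  next
    case zero
    show ?case by (intro exI[of _ "\<lambda>i x. 0"]) (auto intro: hermite_span.zero)
  next
    case (add f g)
    from add.IH(1) obtain f' where f': "\<And>i. f' i \<in> hermite_span"
      "\<And>x. (f has_derivative (\<lambda>v. \<Sum>i\<in>UNIV. v $ i *\<^sub>R f' i x)) (at x)" by blast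
    from add.IH(2) obtain g' where g': "\<And>i. g' i \<in> hermite_span"
      "\<And>x. (g has_derivative (\<lambda>v. \<Sum>i\<in>UNIV. v $ i *\<^sub>R g' i x)) (at x)" by blast
    show ?case
      using has_derivative_add[OF f'(2) g'(2)] f'(1) g'(1)
      by (intro exI[of _ "\<lambda>i x. f' i x + g' i x"])
        (auto intro: hermite_span.add simp: scaleR_add_right sum.distrib)
  next
    case (scale f c)
    from scale.IH obtain f' where *: "\<And>i. f' i \<in> hermite_span"
      "\<And>x. (f has_derivative (\<lambda>v. \<Sum>i\<in>UNIV. v $ i *\<^sub>R f' i x)) (at x)" by blast
    show ?case
      using has_derivative_mult_right[OF *(2), where x = c] *(1)
      by (intro exI[of _ "\<lambda>i x. c * f' i x"])
        (auto intro: hermite_span.scale simp: sum_distrib_left)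
  qed
  then obtain f' where *: "\<And>i. f' i \<in> hermite_span"
      "\<And>x. (f has_derivative (\<lambda>v. \<Sum>i\<in>UNIV. v $ i *\<^sub>R f' i x)) (at x)" by blast
  have p: "partial_deriv i f x = f' i x" for i x by (rule partial_deriv_eq) (rule *)
  show "(f has_derivative (\<lambda>v. \<Sum>i\<in>UNIV. v $ i *\<^sub>R partial_deriv i f x)) (at x)"
    unfolding p by (rule *)
  show "(\<lambda>x. partial_deriv i f x) \<in> hermite_span" unfolding p by (rule *)
qed

section \<open>Gaussian bounds and the Schwartz property in several variables\<close>

lemma norm_vec_sq: "(norm x)\<^sup>2 = (\<Sum>i\<in>UNIV. (x $ i)\<^sup>2)" for x :: "real ^ 'd::finite"
  by (simp add: norm_vec_def L2_set_def sum_nonneg)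

lemma hermite_nd_gaussian_bound:
  "\<exists>C\<ge>0. \<forall>x. \<bar>hermite_nd \<alpha> x\<bar> \<le> C * exp (- (norm x)\<^sup>2 / 4)"
proof -
  have "\<forall>i. \<exists>C\<ge>0. \<forall>x. \<bar>hermite_fun (\<alpha> i) x\<bar> \<le> C * exp (- x\<^sup>2 / 4)"
    using hermite_fun_gaussian_bound by blast
  then obtain C where C: "\<And>i. C i \<ge> 0" "\<And>i x. \<bar>hermite_fun (\<alpha> i) x\<bar> \<le> C i * exp (- x\<^sup>2 / 4)"
    by metis
  have "\<bar>hermite_nd \<alpha> x\<bar> \<le> (\<Prod>i\<in>UNIV. C i) * exp (- (norm x)\<^sup>2 / 4)" for x
  proof -
    have "\<bar>hermite_nd \<alpha> x\<bar> \<le> (\<Prod>i\<in>UNIV. C i * exp (- (x $ i)\<^sup>2 / 4))"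
      unfolding hermite_nd_def abs_prod by (intro prod_mono conjI C abs_ge_zero)
    also have "\<dots> = (\<Prod>i\<in>UNIV. C i) * exp (- (norm x)\<^sup>2 / 4)"
      by (simp add: prod.distrib norm_vec_sq sum_negf sum_divide_distrib flip: exp_sum)
    finally show ?thesis .
  qed
  then show ?thesis using C by (intro exI[of _ "\<Prod>i\<in>UNIV. C i"]) (auto intro: prod_nonneg)
qed

lemma hermite_span_gaussian_bound:
  "f \<in> hermite_span \<Longrightarrow> \<exists>C\<ge>0. \<forall>x. cmod (f x) \<le> C * exp (- (norm x)\<^sup>2 / 4)"
proof (induction f rule: hermite_span.induct)
  case (hermite \<alpha>)
  then show ?case using hermite_nd_gaussian_bound[of \<alpha>] by simp
next
  case zero
  show ?case by (intro exI[of _ 0]) auto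
next
  case (add f g)
  then obtain C D where *: "C \<ge> 0" "D \<ge> 0" "\<And>x. cmod (f x) \<le> C * exp (- (norm x)\<^sup>2 / 4)"
    "\<And>x. cmod (g x) \<le> D * exp (- (norm x)\<^sup>2 / 4)" by metis
  have "cmod (f x + g x) \<le> (C + D) * exp (- (norm x)\<^sup>2 / 4)" for x
    using norm_triangle_ineq[of "f x" "g x"] *(3,4)[of x] by (simp add: distrib_right)
  then show ?case using * by (intro exI[of _ "C + D"]) auto
next
  case (scale f c)
  then obtain C where *: "C \<ge> 0" "\<And>x. cmod (f x) \<le> C * exp (- (norm x)\<^sup>2 / 4)" by metis
  have "cmod (c * f x) \<le> (cmod c * C) * exp (- (norm x)\<^sup>2 / 4)" for x
    using mult_left_mono[OF *(2)[of x], of "cmod c"] by (simp add: norm_mult mult.assoc)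
  then show ?case using * by (intro exI[of _ "cmod c * C"]) auto
qed

lemma hermite_span_power_bound:
  assumes "f \<in> hermite_span"
  shows "\<exists>C\<ge>0. \<forall>x. norm x ^ k * cmod (f x) \<le> C"
proof -
  obtain C where C: "C \<ge> 0" "\<And>x. cmod (f x) \<le> C * exp (- (norm x)\<^sup>2 / 4)"
    using hermite_span_gaussian_bound[OF assms] by blast
  have "norm x ^ k * cmod (f x) \<le> (1 + 4 ^ k * fact k) * C" for x
  proof -
    have "norm x ^ k * cmod (f x) \<le> ((1 + 4 ^ k * fact k) * exp ((norm x)\<^sup>2 / 4)) * (C * exp (- (norm x)\<^sup>2 / 4))"
      using abs_power_le_exp_sq[of "norm x" k] C by (intro mult_mono) auto
    also have "\<dots> = (1 + 4 ^ k * fact k) * C * (exp ((norm x)\<^sup>2 / 4) * exp (- (norm x)\<^sup>2 / 4))" by simp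
    also have "exp ((norm x)\<^sup>2 / 4) * exp (- (norm x)\<^sup>2 / 4) = 1" by (simp flip: exp_add)
    finally show ?thesis by simp
  qed
  then show ?thesis using C by (intro exI[of _ "(1 + 4 ^ k * fact k) * C"]) auto
qed

lemma hermite_span_continuous: "f \<in> hermite_span \<Longrightarrow> continuous_on UNIV f"
  by (rule continuous_at_imp_continuous_on) (simp add: has_derivative_continuous[OF hermite_span_deriv(1)])

lemma hermite_span_schwartz:
  assumes "f \<in> hermite_span"
  shows "schwartz f"
proof -
  have *: "iterated_partial_deriv is f \<in> hermite_span" for "is"
  proof (induction "is")
    case Nil then show ?case using assms by simp
  next
    case (Cons i "is")
    then show ?case using hermite_span_deriv(2)[OF Cons, of i] by simp
  qed
  show ?thesis unfolding schwartz_def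
  proof (intro allI conjI)
    fix "is" x k
    show "iterated_partial_deriv is f differentiable (at x)"
      by (rule differentiableI[OF hermite_span_deriv(1)[OF *]])
    obtain C where "\<And>x. norm x ^ k * cmod (iterated_partial_deriv is f x) \<le> C"
      using hermite_span_power_bound[OF *] by blast
    then show "bounded (range (\<lambda>x. norm x ^ k *\<^sub>R iterated_partial_deriv is f x))"
      unfolding bounded_iff by (intro exI[of _ C]) auto
  qed
qed

text \<open>Both multiplication by the square of a coordinate and the second derivative are squares
  of ladders, so the equation is the sum of \<open>ladder_squares\<close> over the
  coordinates.\<close>

lemma harmonic_oscillator_hermite_nd:
  fixes \<alpha> :: "'d::finite \<Rightarrow> nat"
  shows "- laplacian (\<lambda>x. complex_of_real (hermite_nd \<alpha> x)) x
      + of_real ((norm x)\<^sup>2) * complex_of_real (hermite_nd \<alpha> x)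
    = of_real (2 * real (sum \<alpha> UNIV) + real CARD('d)) * complex_of_real (hermite_nd \<alpha> x)"
proof -
  let ?H = "\<lambda>\<beta> x. complex_of_real (hermite_nd \<beta> x)"
  have 1: "partial_deriv i (partial_deriv i (?H \<alpha>)) x
      = ladder False i (ladder False i (\<lambda>\<beta>. ?H \<beta> x)) \<alpha>" for i
  proof -
    have "partial_deriv i (?H \<alpha>) = (\<lambda>x. ladder False i (\<lambda>\<beta>. ?H \<beta> x) \<alpha>)"
      by (rule ext) (rule partial_deriv_hermite_nd)
    moreover have "partial_deriv i (\<lambda>x. ladder False i (\<lambda>\<beta>. ?H \<beta> x) \<alpha>) x
        = ladder False i (\<lambda>\<beta>. ladder False i (\<lambda>\<gamma>. ?H \<gamma> x) \<beta>) \<alpha>"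
      by (rule partial_deriv_eq[OF ladder_has_derivative[OF hermite_nd_complex_has_derivative]])
    ultimately show ?thesis by simp
  qed
  have X: "ladder True i (\<lambda>\<beta>. ?H \<beta> x) = (\<lambda>\<beta>. of_real (x $ i) * ?H \<beta> x)" for i
    by (rule ext) (simp add: ladder_linear[OF bounded_linear_of_real] ladder_True_hermite_nd)
  have 2: "ladder True i (ladder True i (\<lambda>\<beta>. ?H \<beta> x)) \<alpha> = of_real ((x $ i)\<^sup>2) * ?H \<alpha> x" for i
  proof -
    have "ladder True i (\<lambda>\<beta>. of_real (x $ i) * ?H \<beta> x) \<alpha> = of_real (x $ i) * ladder True i (\<lambda>\<beta>. ?H \<beta> x) \<alpha>"
      by (rule ladder_linear) (rule bounded_linear_mult_right)
    then show ?thesis unfolding X by (simp add: power2_eq_square)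
  qed
  have "- laplacian (?H \<alpha>) x + of_real ((norm x)\<^sup>2) * ?H \<alpha> x
      = (\<Sum>i\<in>UNIV. of_real ((x $ i)\<^sup>2) * ?H \<alpha> x - partial_deriv i (partial_deriv i (?H \<alpha>)) x)"
    by (simp add: laplacian_def norm_vec_sq sum_subtractf sum_distrib_right)
  also have "\<dots> = (\<Sum>i\<in>UNIV. (2 * real (\<alpha> i) + 1) *\<^sub>R ?H \<alpha> x)"
    unfolding 1 2[symmetric] ladder_squares ..
  also have "\<dots> = of_real (2 * real (sum \<alpha> UNIV) + real CARD('d)) * ?H \<alpha> x"
    by (simp add: scaleR_conv_of_real algebra_simps sum.distrib sum_distrib_left sum_distrib_right)
  finally show ?thesis .
qed

text \<open>The exponents met later, such as \<open>gamma_exp\<close> in dimension one or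
  \<open>2 * \<nu>\<close>, may have either sign; two-sided comparability together with
  \<open>|p|\<close> covers both.\<close>

lemma powr_comparable:
  fixes s t p L :: real
  assumes "0 < s" "0 < t" "s \<le> L * t" "t \<le> L * s"
  shows "s powr p \<le> L powr \<bar>p\<bar> * t powr p"
proof -
  have "0 < L * t" using assms(1,3) by (rule less_le_trans)
  then have L: "0 < L" using assms(2) by (simp add: zero_less_mult_iff)
  have "(s / t) powr p \<le> L powr \<bar>p\<bar>"
  proof (cases "0 \<le> p")
    case True
    then show ?thesis using assms by (auto intro!: powr_mono2 simp: divide_le_eq)
  next
    case False
    have "(s / t) powr p = (t / s) powr (- p)" using assms by (simp add: powr_divide powr_minus field_simps)
    also have "\<dots> \<le> L powr (- p)" using assms False by (intro powr_mono2) (auto simp: divide_le_eq)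
    finally show ?thesis using False by simp
  qed
  then show ?thesis using assms by (simp add: powr_divide divide_le_eq)
qed

text \<open>Each of the two shifts is injective where its coefficient is nonzero and sends level
  \<open>m\<close> to a neighbouring level; the squared coefficients are at most
  \<open>m + 1\<close>. Neighbouring levels are compared by \<open>powr_comparable\<close> with
  ratio 2, which also covers negative \<open>p\<close>.\<close>

lemma ladder_sum_bound:
  fixes P :: "('d::finite \<Rightarrow> nat) \<Rightarrow> real"
  assumes C: "0 \<le> C" and P: "\<And>m. (\<Sum>\<alpha>\<in>multi_idx UNIV m. (P \<alpha>)\<^sup>2) \<le> C * (real m + 1) powr p"
  shows "(\<Sum>\<alpha>\<in>multi_idx UNIV m. (ladder b i P \<alpha>)\<^sup>2) \<le> (2 * 2 powr \<bar>p\<bar> * C) * (real m + 1) powr (p + 1)"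
proof -
  let ?K = "2 powr \<bar>p\<bar>"
  let ?R = "?K * C * (real m + 1) powr (p + 1)"
  have R0: "0 \<le> ?R" using C by simp
  have le: "(ladder b i P \<alpha>)\<^sup>2 \<le> real (\<alpha> i) * (P (\<alpha>(i := \<alpha> i - 1)))\<^sup>2
      + (real (\<alpha> i) + 1) * (P (\<alpha>(i := Suc (\<alpha> i))))\<^sup>2" for \<alpha>
  proof -
    define u where "u = sqrt (real (\<alpha> i)) * P (\<alpha>(i := \<alpha> i - 1))"
    define w where "w = (if b then 1 else - 1) * (sqrt (real (\<alpha> i) + 1) * P (\<alpha>(i := Suc (\<alpha> i))))"
    have "ladder b i P \<alpha> = (u + w) / sqrt 2"
      by (simp add: ladder_def u_def w_def add_divide_distrib)
    then have "(ladder b i P \<alpha>)\<^sup>2 = (u + w)\<^sup>2 / 2" by (simp add: power_divide)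
    also have "\<dots> \<le> u\<^sup>2 + w\<^sup>2"
      using zero_le_power2[of "u - w"] by (simp add: power2_eq_square algebra_simps)
    also have "w\<^sup>2 = (sqrt (real (\<alpha> i) + 1) * P (\<alpha>(i := Suc (\<alpha> i))))\<^sup>2" by (simp add: w_def)
    finally show ?thesis by (simp add: u_def power_mult_distrib)
  qed
  have idx: "real (\<alpha> i) \<le> real m" if "\<alpha> \<in> multi_idx UNIV m" for \<alpha>
    using that member_le_sum[of i UNIV \<alpha>] by (simp add: multi_idx_def)
  have sum_dec: "sum (\<alpha>(i := \<alpha> i - 1)) UNIV = sum \<alpha> UNIV - 1" if "0 < \<alpha> i" for \<alpha> :: "'d \<Rightarrow> nat"
    using that by (simp add: sum.remove[of UNIV i])
  have sum_inc: "sum (\<alpha>(i := Suc (\<alpha> i))) UNIV = Suc (sum \<alpha> UNIV)" for \<alpha> :: "'d \<Rightarrow> nat"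
    by (simp add: sum.remove[of UNIV i])
  have "(\<Sum>\<alpha>\<in>multi_idx UNIV m. real (\<alpha> i) * (P (\<alpha>(i := \<alpha> i - 1)))\<^sup>2) \<le> ?R"
  proof (cases m)
    case 0
    then have "(\<Sum>\<alpha>\<in>multi_idx UNIV m. real (\<alpha> i) * (P (\<alpha>(i := \<alpha> i - 1)))\<^sup>2) = 0"
      using idx by (intro sum.neutral) auto
    then show ?thesis using R0 by simp
  next
    case (Suc k)
    let ?A = "{\<alpha> \<in> multi_idx UNIV m. \<alpha> i \<noteq> 0}"
    have "(\<Sum>\<alpha>\<in>multi_idx UNIV m. real (\<alpha> i) * (P (\<alpha>(i := \<alpha> i - 1)))\<^sup>2)
        = (\<Sum>\<alpha>\<in>?A. real (\<alpha> i) * (P (\<alpha>(i := \<alpha> i - 1)))\<^sup>2)"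
      by (intro sum.mono_neutral_right) auto
    also have "\<dots> \<le> (\<Sum>\<alpha>\<in>?A. real m * (P (\<alpha>(i := \<alpha> i - 1)))\<^sup>2)"
      using idx by (intro sum_mono mult_right_mono) auto
    also have "\<dots> = (\<Sum>\<beta>\<in>(\<lambda>\<alpha>. \<alpha>(i := \<alpha> i - 1)) ` ?A. real m * (P \<beta>)\<^sup>2)"
    proof (subst sum.reindex)
      show "inj_on (\<lambda>\<alpha>. \<alpha>(i := \<alpha> i - 1)) ?A"
      proof (rule inj_onI)
        fix \<alpha> \<beta> assume *: "\<alpha> \<in> ?A" "\<beta> \<in> ?A" "\<alpha>(i := \<alpha> i - 1) = \<beta>(i := \<beta> i - 1)"
        have eq: "(\<alpha>(i := \<alpha> i - 1)) j = (\<beta>(i := \<beta> i - 1)) j" for j by (simp only: *(3))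
        have "\<alpha> j = \<beta> j" for j using eq[of j] *(1,2) by (cases "j = i") auto
        then show "\<alpha> = \<beta>" by (rule ext)
      qed
    qed simp
    also have "\<dots> \<le> (\<Sum>\<beta>\<in>multi_idx UNIV k. real m * (P \<beta>)\<^sup>2)"
    proof (intro sum_mono2)
      show "(\<lambda>\<alpha>. \<alpha>(i := \<alpha> i - 1)) ` ?A \<subseteq> multi_idx UNIV k"
        using Suc by (auto simp: multi_idx_def sum_dec[simplified One_nat_def] simp del: fun_upd_apply)
    qed auto
    also have "\<dots> = real m * (\<Sum>\<beta>\<in>multi_idx UNIV k. (P \<beta>)\<^sup>2)" by (simp add: sum_distrib_left)
    also have "\<dots> \<le> (real m + 1) * (C * (?K * (real m + 1) powr p))"
    proof (intro mult_mono order_trans[OF P[of k]] mult_left_mono C)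
      show "(real k + 1) powr p \<le> ?K * (real m + 1) powr p"
        using Suc by (intro powr_comparable) auto
    qed (use C in \<open>auto intro: sum_nonneg\<close>)
    also have "\<dots> = ?R" by (simp add: powr_add mult_ac)
    finally show ?thesis .
  qed
  moreover have "(\<Sum>\<alpha>\<in>multi_idx UNIV m. (real (\<alpha> i) + 1) * (P (\<alpha>(i := Suc (\<alpha> i))))\<^sup>2) \<le> ?R"
  proof -
    have "(\<Sum>\<alpha>\<in>multi_idx UNIV m. (real (\<alpha> i) + 1) * (P (\<alpha>(i := Suc (\<alpha> i))))\<^sup>2)
       \<le> (\<Sum>\<alpha>\<in>multi_idx UNIV m. (real m + 1) * (P (\<alpha>(i := Suc (\<alpha> i))))\<^sup>2)"
      using idx by (intro sum_mono mult_right_mono) auto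
    also have "\<dots> = (\<Sum>\<beta>\<in>(\<lambda>\<alpha>. \<alpha>(i := Suc (\<alpha> i))) ` multi_idx UNIV m. (real m + 1) * (P \<beta>)\<^sup>2)"
    proof (subst sum.reindex)
      show "inj_on (\<lambda>\<alpha>. \<alpha>(i := Suc (\<alpha> i))) (multi_idx UNIV m)"
      proof (rule inj_onI)
        fix \<alpha> \<beta> :: "'d \<Rightarrow> nat" assume *: "\<alpha>(i := Suc (\<alpha> i)) = \<beta>(i := Suc (\<beta> i))"
        have eq: "(\<alpha>(i := Suc (\<alpha> i))) j = (\<beta>(i := Suc (\<beta> i))) j" for j by (simp only: *)
        have "\<alpha> j = \<beta> j" for j using eq[of j] by (cases "j = i") auto
        then show "\<alpha> = \<beta>" by (rule ext)
      qed
    qed simp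
    also have "\<dots> \<le> (\<Sum>\<beta>\<in>multi_idx UNIV (Suc m). (real m + 1) * (P \<beta>)\<^sup>2)"
    proof (intro sum_mono2)
      show "(\<lambda>\<alpha>. \<alpha>(i := Suc (\<alpha> i))) ` multi_idx UNIV m \<subseteq> multi_idx UNIV (Suc m)"
        by (auto simp: multi_idx_def sum_inc simp del: fun_upd_apply)
    qed auto
    also have "\<dots> = (real m + 1) * (\<Sum>\<beta>\<in>multi_idx UNIV (Suc m). (P \<beta>)\<^sup>2)" by (simp add: sum_distrib_left)
    also have "\<dots> \<le> (real m + 1) * (C * (?K * (real m + 1) powr p))"
    proof (intro mult_mono order_trans[OF P[of "Suc m"]] mult_left_mono C)
      show "(real (Suc m) + 1) powr p \<le> ?K * (real m + 1) powr p"
        by (intro powr_comparable) auto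
    qed (use C in \<open>auto intro: sum_nonneg\<close>)
    also have "\<dots> = ?R" by (simp add: powr_add mult_ac)
    finally show ?thesis .
  qed
  ultimately have "(\<Sum>\<alpha>\<in>multi_idx UNIV m. real (\<alpha> i) * (P (\<alpha>(i := \<alpha> i - 1)))\<^sup>2
      + (real (\<alpha> i) + 1) * (P (\<alpha>(i := Suc (\<alpha> i))))\<^sup>2) \<le> ?R + ?R"
    unfolding sum.distrib by (rule add_mono)
  moreover have "(\<Sum>\<alpha>\<in>multi_idx UNIV m. (ladder b i P \<alpha>)\<^sup>2)
      \<le> (\<Sum>\<alpha>\<in>multi_idx UNIV m. real (\<alpha> i) * (P (\<alpha>(i := \<alpha> i - 1)))\<^sup>2
      + (real (\<alpha> i) + 1) * (P (\<alpha>(i := Suc (\<alpha> i))))\<^sup>2)"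
    by (intro sum_mono le)
  ultimately have "(\<Sum>\<alpha>\<in>multi_idx UNIV m. (ladder b i P \<alpha>)\<^sup>2) \<le> ?R + ?R"
    by (rule order_trans[rotated])
  then show ?thesis by (simp only: mult_2[symmetric] mult.assoc)
qed

section \<open>Completeness and the structure of the eigenbasis\<close>

text \<open>Lebesgue measure on vectors is the image of the product measure over
  \<open>Basis\<close>, and the axis vectors identify \<open>Basis\<close> with the index type; the
  rest is Fubini for products.\<close>

lemma
  fixes f :: "'d::finite \<Rightarrow> real \<Rightarrow> real"
  assumes f: "\<And>i. integrable lborel (f i)"
  shows integrable_prod_vec: "integrable lborel (\<lambda>x::real^'d. \<Prod>i\<in>UNIV. f i (x $ i))"
    and integral_prod_vec:
      "(LINT x|lborel. (\<Prod>i\<in>UNIV. f i ((x::real^'d) $ i))) = (\<Prod>i\<in>UNIV. LBINT t. f i t)"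
proof -
  interpret product_sigma_finite "\<lambda>b::real^'d. lborel :: real measure" ..
  have [measurable]: "f i \<in> borel_measurable borel" for i
    using borel_measurable_integrable[OF f] by simp
  have B: "(Basis :: (real^'d) set) = (\<lambda>i. axis i 1) ` UNIV" by (auto simp: Basis_vec_def)
  have inj: "inj (\<lambda>i::'d. axis i (1::real))" by (auto simp: inj_def axis_eq_axis)
  have nth: "(\<Sum>b\<in>Basis. y b *\<^sub>R b) $ i = y (axis i 1)" for y and i :: 'd
    unfolding B by (subst sum.reindex[OF inj])
      (simp add: axis_def if_distrib[of "\<lambda>c. _ * c"] cong: if_cong)
  have pr: "(\<Prod>i\<in>UNIV. f i ((\<Sum>b\<in>Basis. y b *\<^sub>R b) $ i)) = (\<Prod>b\<in>Basis. f (axis_index b) (y b))" for y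
    unfolding nth unfolding B by (subst prod.reindex[OF inj]) (simp add: axis_index_axis)
  have int: "integrable (Pi\<^sub>M Basis (\<lambda>b::real^'d. lborel)) (\<lambda>y. \<Prod>b\<in>Basis. f (axis_index b) (y b))"
    by (intro product_integrable_prod f) auto
  show "integrable lborel (\<lambda>x::real^'d. \<Prod>i\<in>UNIV. f i (x $ i))"
  proof (subst lborel_eq, subst integrable_distr_eq)
    show "integrable (Pi\<^sub>M Basis (\<lambda>b::real^'d. lborel)) (\<lambda>y. \<Prod>i\<in>UNIV. f i ((\<Sum>b\<in>Basis. y b *\<^sub>R b) $ i))"
      unfolding pr by (rule int)
  qed measurable
  have "(LINT x|lborel. (\<Prod>i\<in>UNIV. f i ((x::real^'d) $ i)))
      = (LINT y|Pi\<^sub>M Basis (\<lambda>b::real^'d. lborel). (\<Prod>b\<in>Basis. f (axis_index b) (y b)))"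
  proof (subst lborel_eq, subst integral_distr)
    show "(LINT y|Pi\<^sub>M Basis (\<lambda>b::real^'d. lborel). (\<Prod>i\<in>UNIV. f i ((\<Sum>b\<in>Basis. y b *\<^sub>R b) $ i)))
      = (LINT y|Pi\<^sub>M Basis (\<lambda>b::real^'d. lborel). (\<Prod>b\<in>Basis. f (axis_index b) (y b)))"
      unfolding pr ..
  qed measurable
  also have "\<dots> = (\<Prod>b\<in>(Basis :: (real^'d) set). LBINT t. f (axis_index b) t)"
    by (intro product_integral_prod f) auto
  also have "\<dots> = (\<Prod>i\<in>UNIV. LBINT t. f i t)"
    unfolding B by (subst prod.reindex[OF inj]) (simp add: axis_index_axis)
  finally show "(LINT x|lborel. (\<Prod>i\<in>UNIV. f i ((x::real^'d) $ i))) = (\<Prod>i\<in>UNIV. LBINT t. f i t)" .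
qed

lemma
  fixes \<alpha> \<beta> :: "'d::finite \<Rightarrow> nat"
  shows integrable_hermite_nd_mult: "integrable lborel (\<lambda>x. hermite_nd \<alpha> x * hermite_nd \<beta> x)"
    and hermite_nd_orthonormal:
      "(LINT x|lborel. hermite_nd \<alpha> x * hermite_nd \<beta> x) = (if \<alpha> = \<beta> then 1 else 0)"
proof -
  have e: "(\<lambda>x. hermite_nd \<alpha> x * hermite_nd \<beta> x)
      = (\<lambda>x. \<Prod>i\<in>UNIV. hermite_fun (\<alpha> i) (x $ i) * hermite_fun (\<beta> i) (x $ i))"
    by (simp add: hermite_nd_def prod.distrib)
  show "integrable lborel (\<lambda>x. hermite_nd \<alpha> x * hermite_nd \<beta> x)"
    unfolding e by (intro integrable_prod_vec integrable_hermite_fun_mult)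
  have "(LINT x|lborel. hermite_nd \<alpha> x * hermite_nd \<beta> x)
      = (\<Prod>i\<in>UNIV. LBINT t. hermite_fun (\<alpha> i) t * hermite_fun (\<beta> i) t)"
    unfolding e by (intro integral_prod_vec integrable_hermite_fun_mult)
  also have "\<dots> = (if \<alpha> = \<beta> then 1 else 0)"
    by (auto simp: hermite_fun_orthonormal fun_eq_iff prod_zero_iff)
  finally show "(LINT x|lborel. hermite_nd \<alpha> x * hermite_nd \<beta> x) = (if \<alpha> = \<beta> then 1 else 0)" .
qed

lemma integrable_exp_minus_norm_sq:
  assumes "0 < a"
  shows "integrable lborel (\<lambda>x::real^'d::finite. exp (- (a * (norm x)\<^sup>2)))"
proof -
  have "(\<lambda>x::real^'d. exp (- (a * (norm x)\<^sup>2))) = (\<lambda>x. \<Prod>i\<in>UNIV. exp (- (a * (x $ i)\<^sup>2)))"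
    by (simp add: norm_vec_sq sum_distrib_left sum_negf flip: exp_sum)
  then show ?thesis
    using assms by (simp only:) (intro integrable_prod_vec integrable_exp_minus_sq)
qed

lemma integrable_mult_of_squares:
  fixes f g :: "'a \<Rightarrow> 'b::{real_normed_field, banach, second_countable_topology}"
  assumes [measurable]: "f \<in> borel_measurable M" "g \<in> borel_measurable M"
    and "integrable M (\<lambda>x. (norm (f x))\<^sup>2)" "integrable M (\<lambda>x. (norm (g x))\<^sup>2)"
  shows "integrable M (\<lambda>x. f x * g x)"
proof (rule Bochner_Integration.integrable_bound)
  show "integrable M (\<lambda>x. (norm (f x))\<^sup>2 + (norm (g x))\<^sup>2)" using assms by simp
  show "AE x in M. norm (f x * g x) \<le> norm ((norm (f x))\<^sup>2 + (norm (g x))\<^sup>2)"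
  proof (rule AE_I2)
    fix x
    have "0 \<le> (norm (f x) - norm (g x))\<^sup>2" by simp
    then have "2 * (norm (f x) * norm (g x)) \<le> (norm (f x))\<^sup>2 + (norm (g x))\<^sup>2"
      by (simp add: power2_diff)
    moreover have "0 \<le> norm (f x) * norm (g x)" by simp
    ultimately show "norm (f x * g x) \<le> norm ((norm (f x))\<^sup>2 + (norm (g x))\<^sup>2)"
      unfolding norm_mult real_norm_def by linarith
  qed
qed measurable

lemma square_integrable_mult:
  "square_integrable f \<Longrightarrow> square_integrable g \<Longrightarrow> integrable lborel (\<lambda>x. f x * g x)"
  unfolding square_integrable_def by (intro integrable_mult_of_squares) auto

lemma hermite_span_square_integrable:
  fixes f :: "real^'d::finite \<Rightarrow> complex"
  assumes "f \<in> hermite_span"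
  shows "square_integrable f"
proof -
  have m: "f \<in> borel_measurable borel"
    using hermite_span_continuous[OF assms] by (rule borel_measurable_continuous_onI)
  obtain C where C: "C \<ge> 0" "\<And>x. cmod (f x) \<le> C * exp (- (norm x)\<^sup>2 / 4)"
    using hermite_span_gaussian_bound[OF assms] by blast
  have "integrable lborel (\<lambda>x. (cmod (f x))\<^sup>2)"
  proof (rule Bochner_Integration.integrable_bound)
    show "integrable lborel (\<lambda>x::real^'d. C\<^sup>2 * exp (- (1 / 2 * (norm x)\<^sup>2)))"
      by (intro integrable_mult_right integrable_exp_minus_norm_sq) auto
    show "AE x in lborel. norm ((cmod (f x))\<^sup>2) \<le> norm (C\<^sup>2 * exp (- (1 / 2 * (norm x)\<^sup>2)))"
    proof (rule AE_I2)
      fix x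
      have "(cmod (f x))\<^sup>2 \<le> (C * exp (- (norm x)\<^sup>2 / 4))\<^sup>2" using C by (intro power_mono) auto
      also have "\<dots> = C\<^sup>2 * exp (- (1 / 2 * (norm x)\<^sup>2))"
        by (simp add: power_mult_distrib flip: exp_double)
      finally show "norm ((cmod (f x))\<^sup>2) \<le> norm (C\<^sup>2 * exp (- (1 / 2 * (norm x)\<^sup>2)))" by simp
    qed
  qed (use m in measurable)
  then show ?thesis using m by (simp add: square_integrable_def)
qed

text \<open>The signed law of \<open>T\<close> under \<open>g\<close> is split into its positive and
  negative parts. Frequency 0 shows that both have the same mass \<open>c\<close>; after
  normalisation they are probability laws with the same characteristic function, which Levy's
  uniqueness theorem identifies. The case \<open>c = 0\<close> is separate because it cannot be
  normalised.\<close>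

lemma real_measure_eq_of_fourier:
  fixes g :: "'a \<Rightarrow> real" and T :: "'a \<Rightarrow> real"
  assumes [measurable]: "T \<in> borel_measurable M" and g: "integrable M g"
    and zero: "\<And>\<xi>. (CLINT y|M. complex_of_real (g y) * iexp (\<xi> * T y)) = 0"
    and B[measurable]: "B \<in> sets borel"
  shows "(LINT y|M. g y * indicator B (T y)) = 0"
proof -
  have [measurable]: "g \<in> borel_measurable M" using g by simp
  define p where "p = (\<lambda>y. max 0 (g y))"
  define q where "q = (\<lambda>y. max 0 (- g y))"
  have [measurable]: "p \<in> borel_measurable M" "q \<in> borel_measurable M" by (auto simp: p_def q_def)
  have p: "integrable M p" and q: "integrable M q" unfolding p_def q_def using g by auto
  have pos: "0 \<le> p y" "0 \<le> q y" and diff: "g y = p y - q y" for y by (auto simp: p_def q_def)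
  define c where "c = (LINT y|M. p y)"
  have "complex_of_real (LINT y|M. g y) = 0" using zero[of 0] by simp
  then have "(LINT y|M. g y) = 0" by simp
  then have cq: "(LINT y|M. q y) = c" using p q by (simp add: diff[abs_def] c_def)
  have ind: "integrable M (\<lambda>y. h y * indicator B (T y))" if "integrable M h" for h :: "'a \<Rightarrow> real"
    by (rule Bochner_Integration.integrable_bound[OF that])
      (use that in \<open>auto simp: indicator_def borel_measurable_integrable\<close>)
  show ?thesis
  proof (cases "c = 0")
    case True
    have "(LINT y|M. p y) = 0" "(LINT y|M. q y) = 0" using True cq by (simp_all add: c_def)
    then have "AE y in M. p y = 0" "AE y in M. q y = 0"
      using pos p q by (simp_all add: integral_nonneg_eq_0_iff_AE)
    then have "AE y in M. g y * indicator B (T y) = 0" by eventually_elim (simp add: diff)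
    then show ?thesis by (rule integral_eq_zero_AE)
  next
    case False
    have c0: "0 < c" using False pos by (simp add: c_def less_le integral_nonneg)
    define D where "D = (\<lambda>h. distr (density M (\<lambda>y. ennreal (h y / c))) borel T)"
    have rd: "real_distribution (D h)"
      if h: "integrable M h" "\<And>y. 0 \<le> h y" "(LINT y|M. h y) = c" for h
    proof -
      have [measurable]: "h \<in> borel_measurable M" using h by simp
      have "prob_space (density M (\<lambda>y. ennreal (h y / c)))"
      proof (rule prob_spaceI)
        have "emeasure (density M (\<lambda>y. ennreal (h y / c))) (space M) = (\<integral>\<^sup>+ y. ennreal (h y / c) \<partial>M)"
          by (simp add: emeasure_density)
        also have "\<dots> = ennreal (LINT y|M. h y / c)"
          using h c0 by (intro nn_integral_eq_integral) auto
        finally show "emeasure (density M (\<lambda>y. ennreal (h y / c))) (space (density M (\<lambda>y. ennreal (h y / c)))) = 1"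
          using h c0 by simp
      qed
      then show ?thesis unfolding D_def by (rule prob_space.real_distribution_distr) simp
    qed
    have int: "integral\<^sup>L (D h) \<theta> = (LINT y|M. (h y / c) *\<^sub>R \<theta> (T y))"
      if "h \<in> borel_measurable M" "\<And>y. 0 \<le> h y" and [measurable]: "\<theta> \<in> borel_measurable borel"
      for h and \<theta> :: "real \<Rightarrow> 'b::{banach, second_countable_topology}"
    proof -
      have [measurable]: "h \<in> borel_measurable M" by fact
      show ?thesis unfolding D_def using that c0
        by (subst integral_distr, simp, simp, subst integral_density) auto
    qed
    have ie: "integrable M (\<lambda>y. complex_of_real (h y) * iexp (\<xi> * T y))"
      if "integrable M h" for h \<xi>
      by (rule Bochner_Integration.integrable_bound[OF that])
        (use that in \<open>auto simp: norm_mult borel_measurable_integrable\<close>)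
    have "char (D p) = char (D q)"
    proof (rule ext)
      fix \<xi>
      have "(CLINT y|M. complex_of_real (g y) * iexp (\<xi> * T y))
          = (CLINT y|M. complex_of_real (p y) * iexp (\<xi> * T y)) - (CLINT y|M. complex_of_real (q y) * iexp (\<xi> * T y))"
        using ie[OF p] ie[OF q] by (simp add: diff left_diff_distrib)
      then have "(CLINT y|M. complex_of_real (p y) * iexp (\<xi> * T y)) = (CLINT y|M. complex_of_real (q y) * iexp (\<xi> * T y))"
        using zero by simp
      moreover have "char (D h) \<xi> = (CLINT y|M. complex_of_real (h y) * iexp (\<xi> * T y)) / c"
        if "h \<in> borel_measurable M" "\<And>y. 0 \<le> h y" for h
        unfolding char_def using that by (subst int) (auto simp: scaleR_conv_of_real simp flip: integral_divide_zero)
      ultimately show "char (D p) \<xi> = char (D q) \<xi>" using pos by simp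
    qed
    then have "D p = D q" by (intro Levy_uniqueness rd p q pos cq) (simp_all add: c_def)
    then have "(LINT t|D p. indicator B t) = (LINT t|D q. (indicator B t :: real))" by simp
    moreover have "(LINT t|D h. (indicator B t :: real)) = (LINT y|M. h y / c * indicator B (T y))"
      if "h \<in> borel_measurable M" "\<And>y. 0 \<le> h y" for h
      by (subst int[OF that]) simp_all
    ultimately have "(LINT y|M. p y / c * indicator B (T y)) = (LINT y|M. q y / c * indicator B (T y))"
      using pos by (metis \<open>p \<in> borel_measurable M\<close> \<open>q \<in> borel_measurable M\<close>)
    then have "(LINT y|M. p y * indicator B (T y)) = (LINT y|M. q y * indicator B (T y))"
      using c0 by simp
    then show ?thesis using ind[OF p] ind[OF q] by (simp add: diff left_diff_distrib)
  qed
qed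

lemma exp_tilt_bound: "exp (- t\<^sup>2 / 2) * exp \<bar>\<xi> * t\<bar> \<le> exp (\<xi>\<^sup>2) * exp (- t\<^sup>2 / 4)" for t \<xi> :: real
proof -
  have "0 \<le> (\<bar>t\<bar> / 2 - \<bar>\<xi>\<bar>)\<^sup>2" by simp
  then have "\<bar>\<xi> * t\<bar> \<le> t\<^sup>2 / 4 + \<xi>\<^sup>2"
    by (simp add: power2_diff abs_mult power_divide mult.commute)
  then show ?thesis by (simp flip: exp_add) 
qed

lemma hermite_complete_coordinate:
  fixes G :: "real^'d::finite \<Rightarrow> real"
  assumes [measurable]: "G \<in> borel_measurable borel"
    and int: "integrable lborel (\<lambda>y. G y * exp (- (y $ j)\<^sup>2 / 4))"
    and zero: "\<And>n. (LINT y|lborel. G y * hermite_fun n (y $ j)) = 0"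
    and B[measurable]: "B \<in> sets borel"
  shows "(LINT y|lborel. G y * (exp (- (y $ j)\<^sup>2 / 2) * indicator B (y $ j))) = 0"
proof -
  have dom: "integrable lborel (\<lambda>y. G y * \<theta> (y $ j))"
    if [measurable]: "\<theta> \<in> borel_measurable borel" and "\<And>t. \<bar>\<theta> t\<bar> \<le> C * exp (- t\<^sup>2 / 4)" for \<theta> C
  proof (rule Bochner_Integration.integrable_bound)
    show "integrable lborel (\<lambda>y. C * (G y * exp (- (y $ j)\<^sup>2 / 4)))" using int by simp
    have "\<bar>G y\<bar> * \<bar>\<theta> (y $ j)\<bar> \<le> \<bar>C * (G y * exp (- (y $ j)\<^sup>2 / 4))\<bar>" for y
    proof -
      have "\<bar>G y\<bar> * \<bar>\<theta> (y $ j)\<bar> \<le> \<bar>G y\<bar> * (C * exp (- (y $ j)\<^sup>2 / 4))"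
        using that by (intro mult_left_mono) auto
      also have "\<dots> \<le> \<bar>\<bar>G y\<bar> * (C * exp (- (y $ j)\<^sup>2 / 4))\<bar>" by (rule abs_ge_self)
      finally show ?thesis by (simp add: abs_mult mult_ac)
    qed
    then show "AE y in lborel. norm (G y * \<theta> (y $ j)) \<le> norm (C * (G y * exp (- (y $ j)\<^sup>2 / 4)))"
      by (simp add: abs_mult)
  qed measurable
  have pint: "integrable lborel (\<lambda>y. G y * ((y $ j) ^ k * hermite_fun n (y $ j)))" for k n
  proof -
    obtain C where "\<And>x. \<bar>x\<bar> ^ k * \<bar>hermite_fun n x\<bar> \<le> C * exp (- x\<^sup>2 / 4)"
      using hermite_fun_decay[of k n] by blast
    then show ?thesis by (intro dom[where \<theta> = "\<lambda>t. t ^ k * hermite_fun n t"]) (auto simp: abs_mult power_abs)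
  qed
  have mom: "(LINT y|lborel. G y * ((y $ j) ^ k * hermite_fun n (y $ j))) = 0" for k n
  proof (induction k arbitrary: n)
    case 0 then show ?case using zero by simp
  next
    case (Suc k)
    have "(LINT y|lborel. G y * ((y $ j) ^ Suc k * hermite_fun n (y $ j)))
      = (LINT y|lborel. (sqrt (real n + 1) / sqrt 2) * (G y * ((y $ j) ^ k * hermite_fun (Suc n) (y $ j)))
          + (sqrt (real n) / sqrt 2) * (G y * ((y $ j) ^ k * hermite_fun (n - 1) (y $ j))))"
    proof (rule Bochner_Integration.integral_cong[OF refl])
      fix y :: "real^'d"
      have "y $ j * hermite_fun n (y $ j) = (sqrt (real n + 1) / sqrt 2) * hermite_fun (Suc n) (y $ j)
          + (sqrt (real n) / sqrt 2) * hermite_fun (n - 1) (y $ j)"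
        using hermite_fun_rec[of "y $ j" n] by (simp add: field_simps)
      moreover have "G y * ((y $ j) ^ Suc k * hermite_fun n (y $ j))
          = G y * (y $ j) ^ k * (y $ j * hermite_fun n (y $ j))" by simp
      ultimately show "G y * ((y $ j) ^ Suc k * hermite_fun n (y $ j))
        = (sqrt (real n + 1) / sqrt 2) * (G y * ((y $ j) ^ k * hermite_fun (Suc n) (y $ j)))
          + (sqrt (real n) / sqrt 2) * (G y * ((y $ j) ^ k * hermite_fun (n - 1) (y $ j)))"
        by (simp only:) (simp add: algebra_simps)
    qed
    also have "\<dots> = 0" using pint Suc by simp
    finally show ?case .
  qed
  define g where "g = (\<lambda>y. G y * exp (- (y $ j)\<^sup>2 / 2))"
  have [measurable]: "g \<in> borel_measurable borel" by (simp add: g_def)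
  have h0: "exp (- t\<^sup>2 / 2) = pi powr (1 / 4) * hermite_fun 0 t" for t
    by (simp add: hermite_fun.simps flip: powr_add mult.assoc)
  have gint: "integrable lborel (\<lambda>y. g y * (y $ j) ^ k)" for k
    using integrable_mult_right[OF pint[of k 0], of "pi powr (1 / 4)"]
    by (simp only: g_def h0 mult_ac)
  have gmom: "(LINT y|lborel. g y * (y $ j) ^ k) = 0" for k
  proof -
    have "(LINT y|lborel. g y * (y $ j) ^ k) = (LINT y|lborel. pi powr (1 / 4) * (G y * ((y $ j) ^ k * hermite_fun 0 (y $ j))))"
      by (simp only: g_def h0 mult_ac)
    then show ?thesis using mom by simp
  qed
  have "(LINT y|lborel. g y * indicator B (y $ j)) = 0"
  proof (rule real_measure_eq_of_fourier)
    show "integrable lborel g" using gint[of 0] by simp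
    fix \<xi> :: real
    define s where "s = (\<lambda>N y. \<Sum>k<N. complex_of_real (g y) * ((\<i> * of_real (\<xi> * y $ j)) ^ k /\<^sub>R fact k))"
    have term_eq: "complex_of_real (g y) * ((\<i> * of_real (\<xi> * y $ j)) ^ k /\<^sub>R fact k)
        = (\<i> * of_real \<xi>) ^ k / fact k * complex_of_real (g y * (y $ j) ^ k)" for y :: "real^'d" and k
      by (simp add: scaleR_conv_of_real power_mult_distrib field_simps)
    have s0: "(CLINT y|lborel. s N y) = 0" for N
    proof -
      have "(CLINT y|lborel. s N y) = (\<Sum>k<N. (CLINT y|lborel. (\<i> * of_real \<xi>) ^ k / fact k * complex_of_real (g y * (y $ j) ^ k)))"
        unfolding s_def term_eq by (rule Bochner_Integration.integral_sum) (intro integrable_mult_right integrable_of_real gint)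
      also have "\<dots> = 0"
      proof (intro sum.neutral ballI)
        fix k
        have "(CLINT y|lborel. complex_of_real (g y * (y $ j) ^ k)) = 0"
          unfolding integral_complex_of_real gmom by simp
        then show "(CLINT y|lborel. (\<i> * of_real \<xi>) ^ k / fact k * complex_of_real (g y * (y $ j) ^ k)) = 0"
          by simp
      qed
      finally show ?thesis .
    qed
    have lim: "(\<lambda>N. CLINT y|lborel. s N y) \<longlonglongrightarrow> (CLINT y|lborel. complex_of_real (g y) * iexp (\<xi> * y $ j))"
    proof (rule integral_dominated_convergence)
      show "(\<lambda>y. complex_of_real (g y) * iexp (\<xi> * y $ j)) \<in> borel_measurable lborel" by measurable
      show "s N \<in> borel_measurable lborel" for N unfolding s_def by measurable
      have "\<bar>exp (- t\<^sup>2 / 2) * exp \<bar>\<xi> * t\<bar>\<bar> \<le> exp (\<xi>\<^sup>2) * exp (- t\<^sup>2 / 4)" for t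
        using exp_tilt_bound[of t \<xi>] by simp
      then have "integrable lborel (\<lambda>y. G y * (exp (- (y $ j)\<^sup>2 / 2) * exp \<bar>\<xi> * (y $ j)\<bar>))"
        by (intro dom[where \<theta> = "\<lambda>t. exp (- t\<^sup>2 / 2) * exp \<bar>\<xi> * t\<bar>"]) auto
      then have "integrable lborel (\<lambda>y. norm (G y * (exp (- (y $ j)\<^sup>2 / 2) * exp \<bar>\<xi> * (y $ j)\<bar>)))"
        by (rule integrable_norm)
      then show "integrable lborel (\<lambda>y. \<bar>g y\<bar> * exp \<bar>\<xi> * (y $ j)\<bar>)"
        by (simp add: g_def abs_mult mult.assoc)
      show "AE y in lborel. (\<lambda>N. s N y) \<longlonglongrightarrow> complex_of_real (g y) * iexp (\<xi> * y $ j)"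
      proof (rule AE_I2)
        fix y :: "real^'d"
        have "(\<lambda>k. (\<i> * of_real (\<xi> * y $ j)) ^ k /\<^sub>R fact k) sums iexp (\<xi> * y $ j)"
          by (rule exp_converges)
        from sums_mult[OF this, of "complex_of_real (g y)"]
        show "(\<lambda>N. s N y) \<longlonglongrightarrow> complex_of_real (g y) * iexp (\<xi> * y $ j)"
          by (simp add: sums_def s_def)
      qed
      show "AE y in lborel. norm (s N y) \<le> \<bar>g y\<bar> * exp \<bar>\<xi> * (y $ j)\<bar>" for N
      proof (rule AE_I2)
        fix y :: "real^'d"
        let ?z = "\<bar>\<xi> * y $ j\<bar>"
        have "norm (s N y) \<le> (\<Sum>k<N. \<bar>g y\<bar> * (?z ^ k /\<^sub>R fact k))"
          unfolding s_def
          by (rule order_trans[OF norm_sum]) (intro sum_mono, simp add: norm_mult norm_power power_abs abs_mult)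
        also have "\<dots> = \<bar>g y\<bar> * (\<Sum>k<N. ?z ^ k /\<^sub>R fact k)" by (simp add: sum_distrib_left)
        also have "(\<Sum>k<N. ?z ^ k /\<^sub>R fact k) \<le> exp ?z"
          unfolding exp_def by (intro sum_le_suminf summable_exp_generic) auto
        finally show "norm (s N y) \<le> \<bar>g y\<bar> * exp \<bar>\<xi> * (y $ j)\<bar>" by (simp add: mult_left_mono)
      qed
    qed
    show "(CLINT y|lborel. complex_of_real (g y) * iexp (\<xi> * y $ j)) = 0"
      using lim unfolding s0 by (simp add: LIMSEQ_const_iff)
  qed auto
  then show ?thesis by (simp add: g_def mult.assoc)
qed

text \<open>Open boxes are stable under intersection, generate the Borel sets and exhaust the space,
  so the measures with densities \<open>p\<close> and \<open>q\<close> coincide.\<close>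

lemma AE_zero_if_box_integrals_zero:
  fixes g :: "'a::euclidean_space \<Rightarrow> real"
  assumes g: "integrable lborel g"
    and zero: "\<And>a b. (LINT y|lborel. g y * indicator (box a b) y) = 0"
  shows "AE y in lborel. g y = 0"
proof -
  have [measurable]: "g \<in> borel_measurable borel" using borel_measurable_integrable[OF g] by simp
  define p where "p = (\<lambda>y. max 0 (g y))"
  define q where "q = (\<lambda>y. max 0 (- g y))"
  have [measurable]: "p \<in> borel_measurable borel" "q \<in> borel_measurable borel"
    by (auto simp: p_def q_def)
  have p: "integrable lborel p" and q: "integrable lborel q" unfolding p_def q_def using g by auto
  have pos: "0 \<le> p y" "0 \<le> q y" and diff: "g y = p y - q y" for y by (auto simp: p_def q_def)
  have ind: "integrable lborel (\<lambda>y. h y * indicator (box a b) y)"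
    if "integrable lborel h" for h :: "'a \<Rightarrow> real" and a b
    by (rule Bochner_Integration.integrable_bound[OF that])
      (use that in \<open>auto simp: indicator_def borel_measurable_integrable\<close>)
  have eq: "emeasure (density lborel (\<lambda>y. ennreal (p y))) (box a b)
      = emeasure (density lborel (\<lambda>y. ennreal (q y))) (box a b)"
    and fin: "emeasure (density lborel (\<lambda>y. ennreal (p y))) (box a b) \<noteq> \<infinity>" for a b
  proof -
    have em: "emeasure (density lborel (\<lambda>y. ennreal (h y))) (box a b)
        = ennreal (LINT y|lborel. h y * indicator (box a b) y)"
      if h: "integrable lborel h" "\<And>y. 0 \<le> h y" for h
    proof -
      have [measurable]: "h \<in> borel_measurable borel" using borel_measurable_integrable[OF h(1)] by simp
      have "emeasure (density lborel (\<lambda>y. ennreal (h y))) (box a b)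
         = (\<integral>\<^sup>+ y. ennreal (h y * indicator (box a b) y) \<partial>lborel)"
        using h(2) by (subst emeasure_density) (auto intro!: nn_integral_cong simp: indicator_def)
      also have "\<dots> = ennreal (LINT y|lborel. h y * indicator (box a b) y)"
        by (rule nn_integral_eq_integral) (use h in \<open>auto intro: ind\<close>)
      finally show ?thesis .
    qed
    have "(LINT y|lborel. p y * indicator (box a b) y) = (LINT y|lborel. q y * indicator (box a b) y)"
      using zero[of a b] ind[OF p] ind[OF q] by (simp add: diff left_diff_distrib)
    then show "emeasure (density lborel (\<lambda>y. ennreal (p y))) (box a b)
      = emeasure (density lborel (\<lambda>y. ennreal (q y))) (box a b)"
      using em[OF p pos(1)] em[OF q pos(2)] by simp
    show "emeasure (density lborel (\<lambda>y. ennreal (p y))) (box a b) \<noteq> \<infinity>"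
      using em[OF p pos(1)] by simp
  qed
  have "density lborel (\<lambda>y. ennreal (p y)) = density lborel (\<lambda>y. ennreal (q y))"
  proof (rule measure_eqI_generator_eq)
    let ?E = "range (\<lambda>(a, b). box a b::'a set)"
    show "Int_stable ?E" by (auto simp: Int_stable_def box_Int_box)
    show "?E \<subseteq> Pow UNIV" "sets (density lborel (\<lambda>y. ennreal (p y))) = sigma_sets UNIV ?E"
      "sets (density lborel (\<lambda>y. ennreal (q y))) = sigma_sets UNIV ?E"
      by (simp_all add: borel_eq_box)
    let ?A = "\<lambda>n::nat. box (- (real n *\<^sub>R One)) (real n *\<^sub>R One) :: 'a set"
    show "range ?A \<subseteq> ?E" "(\<Union>i. ?A i) = UNIV" unfolding UN_box_eq_UNIV by auto
    show "emeasure (density lborel (\<lambda>y. ennreal (p y))) (?A i) \<noteq> \<infinity>" for i by (rule fin)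
    show "emeasure (density lborel (\<lambda>y. ennreal (p y))) S = emeasure (density lborel (\<lambda>y. ennreal (q y))) S"
      if "S \<in> ?E" for S using that eq by auto
  qed
  moreover have "(\<integral>\<^sup>+ y. ennreal (p y) \<partial>lborel) \<noteq> \<infinity>"
    using nn_integral_eq_integral[OF p] pos by simp
  ultimately have "AE y in lborel. ennreal (p y) = ennreal (q y)"
    by (subst (asm) finite_density_unique) auto
  then show ?thesis
    by eventually_elim (use pos in \<open>simp add: diff\<close>)
qed

text \<open>\<open>J\<close> is the set of coordinates in which the Hermite function has been
  exchanged for a Gaussian times an indicator. \<open>\<alpha>\<close> stays arbitrary because each
  exchange needs all Hermite indices in the new coordinate. At \<open>J = UNIV\<close> the integrals
  of \<open>f\<close> times a Gaussian over all boxes vanish.\<close>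

lemma hermite_nd_complete:
  fixes f :: "real^'d::finite \<Rightarrow> real"
  assumes [measurable]: "f \<in> borel_measurable borel" and f2: "integrable lborel (\<lambda>x. (f x)\<^sup>2)"
    and zero: "\<And>\<alpha>. (LINT y|lborel. f y * hermite_nd \<alpha> y) = 0"
  shows "AE y in lborel. f y = 0"
proof -
  define \<theta> where "\<theta> = (\<lambda>J (\<alpha> :: 'd \<Rightarrow> nat) (B :: 'd \<Rightarrow> real set) i t.
     if i \<in> J then exp (- t\<^sup>2 / 2) * indicator (B i) t else hermite_fun (\<alpha> i) t)"
  have meas[measurable]: "\<theta> J \<alpha> B i \<in> borel_measurable borel" if "\<And>i. B i \<in> sets borel" for J \<alpha> B i
    using that unfolding \<theta>_def by measurable
  have bound: "\<exists>C\<ge>0. \<forall>i t. \<bar>\<theta> J \<alpha> B i t\<bar> \<le> C * exp (- t\<^sup>2 / 4)" for J \<alpha> B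
  proof -
    have "\<forall>i. \<exists>C\<ge>0. \<forall>x. \<bar>hermite_fun (\<alpha> i) x\<bar> \<le> C * exp (- x\<^sup>2 / 4)"
      using hermite_fun_gaussian_bound by blast
    then obtain C where C: "\<And>i. C i \<ge> 0" "\<And>i x. \<bar>hermite_fun (\<alpha> i) x\<bar> \<le> C i * exp (- x\<^sup>2 / 4)"
      by metis
    have "\<bar>\<theta> J \<alpha> B i t\<bar> \<le> (1 + sum C UNIV) * exp (- t\<^sup>2 / 4)" for i t
    proof -
      have s: "0 \<le> sum C UNIV" "C i \<le> sum C UNIV" using C by (auto intro: sum_nonneg member_le_sum)
      have e: "exp (- t\<^sup>2 / 2) \<le> exp (- t\<^sup>2 / 4)" by simp
      show ?thesis
      proof (cases "i \<in> J")
        case True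
        have "\<bar>\<theta> J \<alpha> B i t\<bar> \<le> 1 * exp (- t\<^sup>2 / 4)" using True e by (simp add: \<theta>_def indicator_def)
        also have "\<dots> \<le> (1 + sum C UNIV) * exp (- t\<^sup>2 / 4)" using s by (intro mult_right_mono) auto
        finally show ?thesis .
      next
        case False
        have "\<bar>\<theta> J \<alpha> B i t\<bar> \<le> C i * exp (- t\<^sup>2 / 4)" using False C(2)[of i t] by (simp add: \<theta>_def)
        also have "\<dots> \<le> (1 + sum C UNIV) * exp (- t\<^sup>2 / 4)" using s by (intro mult_right_mono) auto
        finally show ?thesis .
      qed
    qed
    moreover have "0 \<le> 1 + sum C UNIV" using C(1) by (intro add_nonneg_nonneg sum_nonneg) auto
    ultimately show ?thesis by blast
  qed
  have ident: "integrable lborel (\<lambda>y. f y * H y)"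
    if [measurable]: "H \<in> borel_measurable borel" and H: "\<And>y. \<bar>H y\<bar> \<le> C * exp (- (norm y)\<^sup>2 / 4)" for H C
  proof (rule integrable_mult_of_squares)
    show "integrable lborel (\<lambda>x. (norm (f x))\<^sup>2)" using f2 by simp
    show "integrable lborel (\<lambda>x. (norm (H x))\<^sup>2)"
    proof (rule Bochner_Integration.integrable_bound)
      show "integrable lborel (\<lambda>x::real^'d. C\<^sup>2 * exp (- (1 / 2 * (norm x)\<^sup>2)))"
        by (intro integrable_mult_right integrable_exp_minus_norm_sq) auto
      show "AE x in lborel. norm ((norm (H x))\<^sup>2) \<le> norm (C\<^sup>2 * exp (- (1 / 2 * (norm x)\<^sup>2)))"
      proof (rule AE_I2)
        fix x
        have "\<bar>H x\<bar>\<^sup>2 \<le> (C * exp (- (norm x)\<^sup>2 / 4))\<^sup>2" using H by (intro power_mono) auto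
        also have "\<dots> = C\<^sup>2 * exp (- (1 / 2 * (norm x)\<^sup>2))"
          by (simp add: power_mult_distrib flip: exp_double)
        finally show "norm ((norm (H x))\<^sup>2) \<le> norm (C\<^sup>2 * exp (- (1 / 2 * (norm x)\<^sup>2)))" by simp
      qed
    qed measurable
  qed measurable
  have main: "(LINT y|lborel. f y * (\<Prod>i\<in>UNIV. \<theta> J \<alpha> B i (y $ i))) = 0"
    if "\<And>i. B i \<in> sets borel" for J \<alpha> B
  proof -
    have "finite J" by simp
    then show ?thesis
    proof (induction J arbitrary: \<alpha> rule: finite_induct)
      case empty
      then show ?case using zero[of \<alpha>] by (simp add: \<theta>_def hermite_nd_def)
    next
      case (insert j J)
      note B[measurable] = that
      define G where "G = (\<lambda>y. f y * (\<Prod>i\<in>UNIV - {j}. \<theta> J \<alpha> B i (y $ i)))"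
      have [measurable]: "G \<in> borel_measurable borel" unfolding G_def by measurable
      obtain C where C: "C \<ge> 0" "\<And>i t. \<bar>\<theta> J \<alpha> B i t\<bar> \<le> C * exp (- t\<^sup>2 / 4)" using bound by blast
      have "integrable lborel (\<lambda>y. f y * ((\<Prod>i\<in>UNIV - {j}. \<theta> J \<alpha> B i (y $ i)) * exp (- (y $ j)\<^sup>2 / 4)))"
      proof (rule ident)
        fix y :: "real^'d"
        have "\<bar>\<Prod>i\<in>UNIV - {j}. \<theta> J \<alpha> B i (y $ i)\<bar> \<le> (\<Prod>i\<in>UNIV - {j}. C * exp (- (y $ i)\<^sup>2 / 4))"
          unfolding abs_prod by (intro prod_mono conjI C abs_ge_zero)
        also have "\<dots> = C ^ card (UNIV - {j}) * exp (\<Sum>i\<in>UNIV - {j}. - (y $ i)\<^sup>2 / 4)"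
          by (simp add: prod.distrib exp_sum)
        finally have "\<bar>(\<Prod>i\<in>UNIV - {j}. \<theta> J \<alpha> B i (y $ i)) * exp (- (y $ j)\<^sup>2 / 4)\<bar>
           \<le> C ^ card (UNIV - {j}) * exp (\<Sum>i\<in>UNIV - {j}. - (y $ i)\<^sup>2 / 4) * exp (- (y $ j)\<^sup>2 / 4)"
          by (simp only: abs_mult abs_exp_cancel) (rule mult_right_mono, auto)
        also have "\<dots> = C ^ card (UNIV - {j}) * exp (- (norm y)\<^sup>2 / 4)"
        proof -
          have "(\<Sum>i\<in>UNIV - {j}. - (y $ i)\<^sup>2 / 4) + - (y $ j)\<^sup>2 / 4 = (\<Sum>i\<in>UNIV. - (y $ i)\<^sup>2 / 4)"
            by (subst sum.remove[of UNIV j]) auto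
          also have "\<dots> = - (norm y)\<^sup>2 / 4" by (simp add: norm_vec_sq sum_negf sum_divide_distrib)
          finally show ?thesis by (simp only: mult.assoc exp_add[symmetric])
        qed
        finally show "\<bar>(\<Prod>i\<in>UNIV - {j}. \<theta> J \<alpha> B i (y $ i)) * exp (- (y $ j)\<^sup>2 / 4)\<bar>
           \<le> C ^ card (UNIV - {j}) * exp (- (norm y)\<^sup>2 / 4)" .
      qed measurable
      then have Gint: "integrable lborel (\<lambda>y. G y * exp (- (y $ j)\<^sup>2 / 4))"
        by (simp add: G_def mult.assoc)
      have Gz: "(LINT y|lborel. G y * hermite_fun n (y $ j)) = 0" for n
      proof -
        have eq: "(\<Prod>i\<in>UNIV. \<theta> J (\<alpha>(j := n)) B i (y $ i))
          = hermite_fun n (y $ j) * (\<Prod>i\<in>UNIV - {j}. \<theta> J \<alpha> B i (y $ i))" for y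
        proof -
          have "(\<Prod>i\<in>UNIV - {j}. \<theta> J (\<alpha>(j := n)) B i (y $ i)) = (\<Prod>i\<in>UNIV - {j}. \<theta> J \<alpha> B i (y $ i))"
            by (intro prod.cong) (auto simp: \<theta>_def)
          moreover have "\<theta> J (\<alpha>(j := n)) B j (y $ j) = hermite_fun n (y $ j)"
            using insert(2) by (simp add: \<theta>_def)
          ultimately show ?thesis by (subst prod.remove[of UNIV j]) simp_all
        qed
        show ?thesis using insert(3)[of "\<alpha>(j := n)"] unfolding eq G_def by (simp only: mult_ac)
      qed
      have "(LINT y|lborel. G y * (exp (- (y $ j)\<^sup>2 / 2) * indicator (B j) (y $ j))) = 0"
        using Gint Gz B by (intro hermite_complete_coordinate) auto
      moreover have "(\<Prod>i\<in>UNIV. \<theta> (insert j J) \<alpha> B i (y $ i))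
          = (exp (- (y $ j)\<^sup>2 / 2) * indicator (B j) (y $ j)) * (\<Prod>i\<in>UNIV - {j}. \<theta> J \<alpha> B i (y $ i))" for y
      proof -
        have "(\<Prod>i\<in>UNIV - {j}. \<theta> (insert j J) \<alpha> B i (y $ i)) = (\<Prod>i\<in>UNIV - {j}. \<theta> J \<alpha> B i (y $ i))"
          by (intro prod.cong) (auto simp: \<theta>_def)
        moreover have "\<theta> (insert j J) \<alpha> B j (y $ j) = exp (- (y $ j)\<^sup>2 / 2) * indicator (B j) (y $ j)"
          by (simp add: \<theta>_def)
        ultimately show ?thesis by (subst prod.remove[of UNIV j]) simp_all
      qed
      ultimately show ?case by (simp add: G_def mult_ac)
    qed
  qed
  have "AE y in lborel. f y * exp (- (norm y)\<^sup>2 / 2) = 0"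
  proof (rule AE_zero_if_box_integrals_zero)
    show "integrable lborel (\<lambda>y. f y * exp (- (norm y)\<^sup>2 / 2))"
      by (rule ident[where C = 1]) auto
    fix a b :: "real^'d"
    have "(\<Prod>i\<in>UNIV. \<theta> UNIV \<alpha> (\<lambda>i. {a $ i <..< b $ i}) i (y $ i))
        = exp (- (norm y)\<^sup>2 / 2) * indicator (box a b) y" for y \<alpha>
    proof -
      have "(\<Prod>i\<in>UNIV. \<theta> UNIV \<alpha> (\<lambda>i. {a $ i <..< b $ i}) i (y $ i))
        = exp (\<Sum>i\<in>UNIV. - (y $ i)\<^sup>2 / 2) * (\<Prod>i\<in>UNIV. indicator {a $ i <..< b $ i} (y $ i))"
        by (simp add: \<theta>_def prod.distrib exp_sum)
      also have "(\<Prod>i\<in>UNIV. indicator {a $ i <..< b $ i} (y $ i)) = (indicator (box a b) y :: real)"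
        by (auto simp: indicator_def mem_box_cart prod_zero_iff)
      also have "(\<Sum>i\<in>UNIV. - (y $ i)\<^sup>2 / 2) = - (norm y)\<^sup>2 / 2"
        by (simp add: norm_vec_sq sum_negf sum_divide_distrib)
      finally show ?thesis .
    qed
    then show "(LINT y|lborel. f y * exp (- (norm y)\<^sup>2 / 2) * indicator (box a b) y) = 0"
      using main[of "\<lambda>i. {a $ i <..< b $ i}" UNIV "\<lambda>_. 0"] by (simp add: mult.assoc)
  qed
  then show ?thesis by simp
qed

lemma hermite_nd_complete_complex:
  fixes f :: "real^'d::finite \<Rightarrow> complex"
  assumes f: "square_integrable f"
    and zero: "\<And>\<alpha>. (CLINT y|lborel. f y * of_real (hermite_nd \<alpha> y)) = 0"
  shows "AE y in lborel. f y = 0"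
proof -
  have [measurable]: "f \<in> borel_measurable borel" and f2: "integrable lborel (\<lambda>x. (cmod (f x))\<^sup>2)"
    using f by (auto simp: square_integrable_def)
  have int: "integrable lborel (\<lambda>y. f y * of_real (hermite_nd \<alpha> y))" for \<alpha>
    by (rule square_integrable_mult[OF f hermite_span_square_integrable[OF hermite_span.hermite]])
  have "AE y in lborel. Re (f y) = 0"
  proof (rule hermite_nd_complete)
    show "integrable lborel (\<lambda>x. (Re (f x))\<^sup>2)"
      by (rule Bochner_Integration.integrable_bound[OF f2]) (auto simp: cmod_def)
    show "(LINT y|lborel. Re (f y) * hermite_nd \<alpha> y) = 0" for \<alpha>
      using integral_Re[OF int[of \<alpha>]] zero[of \<alpha>] by simp
  qed simp
  moreover have "AE y in lborel. Im (f y) = 0"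
  proof (rule hermite_nd_complete)
    show "integrable lborel (\<lambda>x. (Im (f x))\<^sup>2)"
      by (rule Bochner_Integration.integrable_bound[OF f2]) (auto simp: cmod_def)
    show "(LINT y|lborel. Im (f y) * hermite_nd \<alpha> y) = 0" for \<alpha>
      using integral_Im[OF int[of \<alpha>]] zero[of \<alpha>] by simp
  qed simp
  ultimately show ?thesis by eventually_elim (simp add: complex_eq_iff)
qed

section \<open>Eigenfunctions as finite Hermite combinations\<close>

lemma square_integrable_add:
  fixes f g :: "real^'d::finite \<Rightarrow> complex"
  assumes "square_integrable f" "square_integrable g"
  shows "square_integrable (\<lambda>x. f x + g x)"
proof -
  have [measurable]: "f \<in> borel_measurable borel" "g \<in> borel_measurable borel"
    and i: "integrable lborel (\<lambda>x. (cmod (f x))\<^sup>2)" "integrable lborel (\<lambda>x. (cmod (g x))\<^sup>2)"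
    using assms by (auto simp: square_integrable_def)
  have "integrable lborel (\<lambda>x. (cmod (f x + g x))\<^sup>2)"
  proof (rule Bochner_Integration.integrable_bound)
    show "integrable lborel (\<lambda>x. 2 * (cmod (f x))\<^sup>2 + 2 * (cmod (g x))\<^sup>2)" using i by simp
    show "AE x in lborel. norm ((cmod (f x + g x))\<^sup>2) \<le> norm (2 * (cmod (f x))\<^sup>2 + 2 * (cmod (g x))\<^sup>2)"
    proof (rule AE_I2)
      fix x
      have "(cmod (f x + g x))\<^sup>2 \<le> (cmod (f x) + cmod (g x))\<^sup>2"
        by (intro power_mono norm_triangle_ineq) auto
      also have "\<dots> \<le> 2 * (cmod (f x))\<^sup>2 + 2 * (cmod (g x))\<^sup>2"
        using zero_le_power2[of "cmod (f x) - cmod (g x)"] by (simp add: power2_eq_square algebra_simps)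
      finally show "norm ((cmod (f x + g x))\<^sup>2) \<le> norm (2 * (cmod (f x))\<^sup>2 + 2 * (cmod (g x))\<^sup>2)" by simp
    qed
  qed measurable
  then show ?thesis by (simp add: square_integrable_def)
qed

text \<open>Testing the weak equation with a Hermite function of eigenvalue \<open>k\<close> gives
  \<open>(k - l) * c \<alpha> = 0\<close>, so only indices with \<open>k = l\<close> survive and
  completeness does the rest. \<open>A\<close> may be any finite set containing these indices;
  taking it empty later shows that no other values of \<open>l\<close> occur.\<close>

lemma oscillator_eigenfunction_expansion:
  fixes f :: "real^'d::finite \<Rightarrow> complex"
  assumes ev: "harmonic_oscillator f (\<lambda>x. of_real l * f x)"
    and A: "finite A" "\<And>\<alpha>. 2 * real (sum \<alpha> UNIV) + real CARD('d) = l \<Longrightarrow> \<alpha> \<in> A"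
  defines "c \<equiv> \<lambda>\<alpha>. CLINT y|lborel. f y * of_real (hermite_nd \<alpha> y)"
  shows "AE x in lborel. f x = (\<Sum>\<alpha>\<in>A. c \<alpha> * of_real (hermite_nd \<alpha> x))"
proof -
  let ?H = "\<lambda>\<alpha> x. complex_of_real (hermite_nd \<alpha> x)"
  have f: "square_integrable f" using ev by (simp add: harmonic_oscillator_def)
  have H: "?H \<alpha> \<in> hermite_span" for \<alpha> :: "'d \<Rightarrow> nat" by (rule hermite_span.hermite)
  have c0: "c \<alpha> = 0" if "\<alpha> \<notin> A" for \<alpha>
  proof -
    let ?k = "2 * real (sum \<alpha> UNIV) + real CARD('d)"
    have "(CLINT x|lborel. f x * (- laplacian (?H \<alpha>) x + of_real ((norm x)\<^sup>2) * ?H \<alpha> x))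
        = (CLINT x|lborel. of_real l * f x * ?H \<alpha> x)"
      using ev hermite_span_schwartz[OF H] unfolding harmonic_oscillator_def by blast
    then have "(CLINT x|lborel. of_real ?k * (f x * ?H \<alpha> x)) = (CLINT x|lborel. of_real l * (f x * ?H \<alpha> x))"
      unfolding harmonic_oscillator_hermite_nd by (simp only: mult.assoc mult.left_commute)
    then have "of_real ?k * c \<alpha> = of_real l * c \<alpha>" by (simp only: c_def integral_mult_right_zero)
    moreover have "?k \<noteq> l" using A(2)[of \<alpha>] that by blast
    then have "complex_of_real ?k \<noteq> of_real l" unfolding of_real_eq_iff .
    ultimately show ?thesis by (metis mult_cancel_right)
  qed
  define S where "S = (\<lambda>x. \<Sum>\<alpha>\<in>A. c \<alpha> * ?H \<alpha> x)"
  have S: "(\<lambda>x. - 1 * S x) \<in> hermite_span"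
    unfolding S_def by (intro hermite_span.scale hermite_span_sum H)
  have "AE x in lborel. f x + - 1 * S x = 0"
  proof (rule hermite_nd_complete_complex)
    show "square_integrable (\<lambda>x. f x + - 1 * S x)"
      by (rule square_integrable_add[OF f hermite_span_square_integrable[OF S]])
    fix \<beta> :: "'d \<Rightarrow> nat"
    have HH: "integrable lborel (\<lambda>y. ?H \<alpha> y * ?H \<beta> y)" for \<alpha>
      using H by (intro square_integrable_mult hermite_span_square_integrable)
    have fH: "integrable lborel (\<lambda>y. f y * ?H \<beta> y)"
      by (rule square_integrable_mult[OF f hermite_span_square_integrable[OF H]])
    have on: "(CLINT y|lborel. ?H \<alpha> y * ?H \<beta> y) = (if \<alpha> = \<beta> then 1 else 0)" for \<alpha>
      using arg_cong[OF hermite_nd_orthonormal[of \<alpha> \<beta>], of complex_of_real]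
      by (simp only: integral_complex_of_real[symmetric] of_real_mult) auto
    have "(CLINT y|lborel. S y * ?H \<beta> y) = (CLINT y|lborel. \<Sum>\<alpha>\<in>A. c \<alpha> * (?H \<alpha> y * ?H \<beta> y))"
      by (simp add: S_def sum_distrib_right mult.assoc)
    also have "\<dots> = (\<Sum>\<alpha>\<in>A. c \<alpha> * (CLINT y|lborel. ?H \<alpha> y * ?H \<beta> y))"
      using HH by (subst Bochner_Integration.integral_sum) auto
    also have "\<dots> = c \<beta>" using A(1) c0 by (auto simp: on if_distrib cong: if_cong)
    finally have "(CLINT y|lborel. S y * ?H \<beta> y) = c \<beta>" .
    moreover have "integrable lborel (\<lambda>y. S y * ?H \<beta> y)"
      using HH by (simp add: S_def sum_distrib_right mult.assoc)
    ultimately show "(CLINT y|lborel. (f y + - 1 * S y) * ?H \<beta> y) = 0"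
      using fH by (simp add: left_diff_distrib c_def)
  qed
  then show ?thesis by (simp add: S_def)
qed

text \<open>\<open>z\<close> is the orthogonal projection of \<open>v\<close> onto the span of the
  conjugated rows of \<open>U\<close>, and the inequality is the expansion of
  \<open>|v - z|^2 >= 0\<close>.\<close>

lemma bessel_finite:
  fixes U :: "'n \<Rightarrow> 'a \<Rightarrow> complex" and v :: "'a \<Rightarrow> complex"
  assumes "finite A" "finite N"
    and on: "\<And>m n. m \<in> N \<Longrightarrow> n \<in> N \<Longrightarrow> (\<Sum>\<alpha>\<in>A. U m \<alpha> * cnj (U n \<alpha>)) = (if m = n then 1 else 0)"
  shows "(\<Sum>n\<in>N. (cmod (\<Sum>\<alpha>\<in>A. U n \<alpha> * v \<alpha>))\<^sup>2) \<le> (\<Sum>\<alpha>\<in>A. (cmod (v \<alpha>))\<^sup>2)"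
proof -
  define s where "s = (\<lambda>n. \<Sum>\<alpha>\<in>A. U n \<alpha> * v \<alpha>)"
  define z where "z = (\<lambda>\<alpha>. \<Sum>n\<in>N. s n * cnj (U n \<alpha>))"
  define S where "S = (\<Sum>n\<in>N. s n * cnj (s n))"
  have vz: "(\<Sum>\<alpha>\<in>A. v \<alpha> * cnj (z \<alpha>)) = S"
  proof -
    have "(\<Sum>\<alpha>\<in>A. v \<alpha> * cnj (z \<alpha>)) = (\<Sum>\<alpha>\<in>A. \<Sum>n\<in>N. cnj (s n) * (U n \<alpha> * v \<alpha>))"
      by (simp add: z_def sum_distrib_left mult_ac)
    also have "\<dots> = (\<Sum>n\<in>N. \<Sum>\<alpha>\<in>A. cnj (s n) * (U n \<alpha> * v \<alpha>))" by (rule sum.swap)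
    also have "\<dots> = S" by (simp add: S_def s_def flip: sum_distrib_left) (simp add: mult.commute)
    finally show ?thesis .
  qed
  have zz: "(\<Sum>\<alpha>\<in>A. z \<alpha> * cnj (z \<alpha>)) = S"
  proof -
    have "(\<Sum>\<alpha>\<in>A. z \<alpha> * cnj (z \<alpha>)) = (\<Sum>\<alpha>\<in>A. \<Sum>n\<in>N. \<Sum>m\<in>N. cnj (s n) * s m * (U n \<alpha> * cnj (U m \<alpha>)))"
      by (simp add: z_def sum_distrib_left sum_distrib_right mult_ac)
    also have "\<dots> = (\<Sum>n\<in>N. \<Sum>\<alpha>\<in>A. \<Sum>m\<in>N. cnj (s n) * s m * (U n \<alpha> * cnj (U m \<alpha>)))"
      by (rule sum.swap)
    also have "\<dots> = (\<Sum>n\<in>N. \<Sum>m\<in>N. \<Sum>\<alpha>\<in>A. cnj (s n) * s m * (U n \<alpha> * cnj (U m \<alpha>)))"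
      by (intro sum.cong refl sum.swap)
    also have "\<dots> = (\<Sum>n\<in>N. \<Sum>m\<in>N. cnj (s n) * s m * (if n = m then 1 else 0))"
      using on by (intro sum.cong refl) (simp flip: sum_distrib_left)
    also have "\<dots> = S" using assms(2) by (simp add: S_def mult.commute if_distrib cong: if_cong)
    finally show ?thesis .
  qed
  have S: "S = of_real (\<Sum>n\<in>N. (cmod (s n))\<^sup>2)"
    unfolding S_def of_real_sum complex_norm_square ..
  have "0 \<le> (\<Sum>\<alpha>\<in>A. (cmod (v \<alpha> - z \<alpha>))\<^sup>2)" by (intro sum_nonneg) auto
  also have "\<dots> = Re (\<Sum>\<alpha>\<in>A. (v \<alpha> - z \<alpha>) * cnj (v \<alpha> - z \<alpha>))"
    by (simp add: complex_norm_square[symmetric] del: complex_cnj_diff)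
  also have "(\<Sum>\<alpha>\<in>A. (v \<alpha> - z \<alpha>) * cnj (v \<alpha> - z \<alpha>))
      = (\<Sum>\<alpha>\<in>A. v \<alpha> * cnj (v \<alpha>)) - (\<Sum>\<alpha>\<in>A. v \<alpha> * cnj (z \<alpha>))
        - cnj (\<Sum>\<alpha>\<in>A. v \<alpha> * cnj (z \<alpha>)) + (\<Sum>\<alpha>\<in>A. z \<alpha> * cnj (z \<alpha>))"
    by (simp add: algebra_simps sum.distrib sum_subtractf)
  also have "Re \<dots> = (\<Sum>\<alpha>\<in>A. (cmod (v \<alpha>))\<^sup>2) - (\<Sum>n\<in>N. (cmod (s n))\<^sup>2)"
    unfolding vz zz S by (simp add: complex_norm_square[symmetric])
  finally show ?thesis by (simp add: s_def)
qed

text \<open>A sum over an infinite set is 0, so this is meaningful only together with the finiteness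
  of the levels, which \<open>eigenbasis_structure\<close> supplies.\<close>

definition spectral_bound :: "(nat \<Rightarrow> nat) \<Rightarrow> (nat \<Rightarrow> 'b \<Rightarrow> complex) \<Rightarrow> real \<Rightarrow> bool" where
  "spectral_bound lev D p \<longleftrightarrow>
     (\<exists>C>0. \<forall>m x. (\<Sum>n | lev n = m. (cmod (D n x))\<^sup>2) \<le> C * (real m + 1) powr p)"

lemma card_multi_idx_le: "card (multi_idx (UNIV :: 'd::finite set) m) \<le> (m + 1) ^ CARD('d)"
proof -
  have "multi_idx (UNIV :: 'd set) m \<subseteq> PiE UNIV (\<lambda>_. {..m})"
    by (auto simp: multi_idx_def PiE_def intro: member_le_sum)
  then have "card (multi_idx (UNIV :: 'd set) m) \<le> card (PiE (UNIV :: 'd set) (\<lambda>_. {..m}))"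
    by (intro card_mono finite_PiE) auto
  then show ?thesis by (simp add: card_PiE)
qed

text \<open>The basis enters only through the matrix \<open>U\<close> of its Hermite coefficients,
  whose rows are orthonormal within a level. Derivatives and multiplication by coordinates act on
  the Hermite functions and leave \<open>U\<close> alone, so Bessel's inequality transfers each
  ladder bound to \<open>g\<close>. Two orders are needed because the supremum of the gradient is
  controlled through its own derivative and its decay in \<open>x\<close>.\<close>

lemma eigenbasis_structure:
  fixes \<phi> :: "nat \<Rightarrow> real^'d::finite \<Rightarrow> complex"
  assumes "oscillator_eigenbasis \<Lambda> \<phi>"
  obtains lev g where
    "\<And>n. \<Lambda> n = 2 * real (lev n) + real CARD('d)"
    "\<And>m. finite {n. lev n = m}" "\<And>m. card {n. lev n = m} \<le> (m + 1) ^ CARD('d)"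
    "\<And>n. g n \<in> hermite_span" "\<And>n. AE x in lborel. \<phi> n x = g n x"
    "spectral_bound lev g (gamma_exp CARD('d))"
    "\<And>i. spectral_bound lev (\<lambda>n x. of_real (x $ i) * g n x) (gamma_exp CARD('d) + 1)"
    "\<And>i. spectral_bound lev (\<lambda>n. partial_deriv i (g n)) (gamma_exp CARD('d) + 1)"
    "\<And>i j. spectral_bound lev (\<lambda>n x. of_real (x $ j) * partial_deriv i (g n) x) (gamma_exp CARD('d) + 2)"
    "\<And>i j. spectral_bound lev (\<lambda>n. partial_deriv j (partial_deriv i (g n))) (gamma_exp CARD('d) + 2)"
proof -
  let ?d = "CARD('d)"
  let ?H = "\<lambda>\<alpha> x. complex_of_real (hermite_nd \<alpha> x)"
  have onb: "orthonormal_basis_L2 \<phi>" and ev: "\<And>n. harmonic_oscillator (\<phi> n) (\<lambda>x. of_real (\<Lambda> n) * \<phi> n x)"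
    using assms by (auto simp: oscillator_eigenbasis_def)
  have sq: "square_integrable (\<phi> n)" for n using onb by (simp add: orthonormal_basis_L2_def)
  have on: "(CLINT x|lborel. \<phi> m x * cnj (\<phi> n x)) = (if m = n then 1 else 0)" for m n
    using onb by (simp add: orthonormal_basis_L2_def)
  \<comment> \<open>A value off the spectrum would make the index set of the expansion empty and
    \<open>\<phi> n\<close> zero almost everywhere, against its norm 1.\<close>
  have "\<exists>m. \<Lambda> n = 2 * real m + real ?d" for n
  proof (rule ccontr)
    assume *: "\<nexists>m. \<Lambda> n = 2 * real m + real ?d"
    have "AE x in lborel. \<phi> n x = (\<Sum>\<alpha>\<in>{}. (CLINT y|lborel. \<phi> n y * ?H \<alpha> y) * ?H \<alpha> x)"
      by (rule oscillator_eigenfunction_expansion[OF ev]) (use * in \<open>auto dest: sym simp del: of_nat_sum\<close>)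
    then have "AE x in lborel. \<phi> n x * cnj (\<phi> n x) = 0" by eventually_elim simp
    then have "(CLINT x|lborel. \<phi> n x * cnj (\<phi> n x)) = 0" by (rule integral_eq_zero_AE)
    then show False using on[of n n] by simp
  qed
  then obtain lev where lev: "\<And>n. \<Lambda> n = 2 * real (lev n) + real ?d" by metis
  define U where "U = (\<lambda>n \<alpha>. CLINT y|lborel. \<phi> n y * ?H \<alpha> y)"
  define g where "g = (\<lambda>n x. \<Sum>\<alpha>\<in>multi_idx UNIV (lev n). U n \<alpha> * ?H \<alpha> x)"
  have g: "g n \<in> hermite_span" for n
    unfolding g_def by (intro hermite_span_sum hermite_span.scale hermite_span.hermite)
  have ae: "AE x in lborel. \<phi> n x = g n x" for n
    unfolding g_def U_def
    by (rule oscillator_eigenfunction_expansion[OF ev finite_multi_idx])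
      (auto simp: lev multi_idx_def simp del: of_nat_sum)
  have HH: "integrable lborel (\<lambda>y. ?H \<alpha> y * ?H \<beta> y)" for \<alpha> \<beta> :: "'d \<Rightarrow> nat"
    by (rule square_integrable_mult; rule hermite_span_square_integrable; rule hermite_span.hermite)
  have Hon: "(CLINT y|lborel. ?H \<alpha> y * ?H \<beta> y) = (if \<alpha> = \<beta> then 1 else 0)" for \<alpha> \<beta> :: "'d \<Rightarrow> nat"
    using arg_cong[OF hermite_nd_orthonormal[of \<alpha> \<beta>], of complex_of_real]
    by (simp only: integral_complex_of_real[symmetric] of_real_mult) auto
  have Uon: "(\<Sum>\<alpha>\<in>multi_idx UNIV k. U m \<alpha> * cnj (U n \<alpha>)) = (if m = n then 1 else 0)"
    if "lev m = k" "lev n = k" for m n k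
  proof -
    let ?A = "multi_idx (UNIV :: 'd set) k"
    have "(CLINT x|lborel. \<phi> m x * cnj (\<phi> n x)) = (CLINT x|lborel. g m x * cnj (g n x))"
    proof (rule integral_cong_AE)
      show "AE x in lborel. \<phi> m x * cnj (\<phi> n x) = g m x * cnj (g n x)"
        using ae[of m] ae[of n] by eventually_elim simp
      have [measurable]: "\<phi> i \<in> borel_measurable borel" "g i \<in> borel_measurable borel" for i
        using sq[of i] hermite_span_square_integrable[OF g[of i]] by (simp_all add: square_integrable_def)
      have [measurable]: "cnj \<in> borel_measurable borel"
        by (intro borel_measurable_continuous_onI continuous_intros)
      show "(\<lambda>x. \<phi> m x * cnj (\<phi> n x)) \<in> borel_measurable lborel"
        "(\<lambda>x. g m x * cnj (g n x)) \<in> borel_measurable lborel" by measurable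
    qed
    also have "(\<lambda>x. g m x * cnj (g n x)) = (\<lambda>x. \<Sum>\<alpha>\<in>?A. \<Sum>\<beta>\<in>?A. (U m \<alpha> * cnj (U n \<beta>)) * (?H \<alpha> x * ?H \<beta> x))"
      using that by (simp add: g_def sum_product mult_ac)
    also have "(CLINT x|lborel. \<Sum>\<alpha>\<in>?A. \<Sum>\<beta>\<in>?A. (U m \<alpha> * cnj (U n \<beta>)) * (?H \<alpha> x * ?H \<beta> x))
       = (\<Sum>\<alpha>\<in>?A. \<Sum>\<beta>\<in>?A. (U m \<alpha> * cnj (U n \<beta>)) * (CLINT x|lborel. ?H \<alpha> x * ?H \<beta> x))"
      using HH by (simp add: Bochner_Integration.integral_sum)
    also have "\<dots> = (\<Sum>\<alpha>\<in>?A. U m \<alpha> * cnj (U n \<alpha>))"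
      by (simp add: Hon if_distrib cong: if_cong)
    finally show ?thesis using on[of m n] by simp
  qed
  have bessel: "(\<Sum>n\<in>N. (cmod (\<Sum>\<alpha>\<in>multi_idx UNIV k. U n \<alpha> * v \<alpha>))\<^sup>2) \<le> (\<Sum>\<alpha>\<in>multi_idx UNIV k. (cmod (v \<alpha>))\<^sup>2)"
    if "finite N" "N \<subseteq> {n. lev n = k}" for N k v
    using that by (intro bessel_finite Uon) auto
  \<comment> \<open>Bessel's inequality with unit vectors bounds the squared norm of every column of
    \<open>U\<close> by 1; summing over columns bounds the number of rows by the number of
    multi-indices.\<close>
  have fin: "finite {n. lev n = k} \<and> card {n. lev n = k} \<le> card (multi_idx (UNIV :: 'd set) k)" for k
  proof (rule finite_if_finite_subsets_card_bdd)
    fix N assume N: "N \<subseteq> {n. lev n = k}" "finite N"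
    let ?A = "multi_idx (UNIV :: 'd set) k"
    have "complex_of_real (real (card N)) = (\<Sum>n\<in>N. \<Sum>\<alpha>\<in>?A. U n \<alpha> * cnj (U n \<alpha>))"
      using N Uon by (simp add: subset_eq)
    also have "\<dots> = complex_of_real (\<Sum>n\<in>N. \<Sum>\<alpha>\<in>?A. (cmod (U n \<alpha>))\<^sup>2)"
      unfolding of_real_sum complex_norm_square ..
    finally have "real (card N) = (\<Sum>n\<in>N. \<Sum>\<alpha>\<in>?A. (cmod (U n \<alpha>))\<^sup>2)" unfolding of_real_eq_iff .
    also have "\<dots> = (\<Sum>\<beta>\<in>?A. \<Sum>n\<in>N. (cmod (U n \<beta>))\<^sup>2)" by (rule sum.swap)
    also have "\<dots> \<le> (\<Sum>\<beta>\<in>?A. 1)"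
    proof (intro sum_mono)
      fix \<beta> assume \<beta>: "\<beta> \<in> ?A"
      have "(\<Sum>n\<in>N. (cmod (\<Sum>\<alpha>\<in>?A. U n \<alpha> * (if \<alpha> = \<beta> then 1 else 0)))\<^sup>2) \<le> (\<Sum>\<alpha>\<in>?A. (cmod (if \<alpha> = \<beta> then 1 else 0))\<^sup>2)"
        using N by (intro bessel)
      then show "(\<Sum>n\<in>N. (cmod (U n \<beta>))\<^sup>2) \<le> 1"
        using \<beta> by (simp add: if_distrib[of cmod] if_distrib[of "\<lambda>x. x\<^sup>2"] if_distrib[of "\<lambda>x. _ * x"] cong: if_cong)
    qed
    finally show "card N \<le> card ?A" by simp
  qed
  have card: "card {n. lev n = k} \<le> (k + 1) ^ ?d" for k
    using fin[of k] card_multi_idx_le[where 'd = 'd, of k] by simp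
  have transfer: "spectral_bound lev D p"
    if D: "\<And>n x. D n x = (\<Sum>\<alpha>\<in>multi_idx UNIV (lev n). U n \<alpha> * of_real (P x \<alpha>))"
      and P: "0 < C" "\<And>m x. (\<Sum>\<alpha>\<in>multi_idx UNIV m. (P x \<alpha>)\<^sup>2) \<le> C * (real m + 1) powr p"
    for D and P :: "real^'d \<Rightarrow> ('d \<Rightarrow> nat) \<Rightarrow> real" and C p
    unfolding spectral_bound_def
  proof (intro exI[of _ C] conjI allI P(1))
    fix m x
    have "(\<Sum>n | lev n = m. (cmod (D n x))\<^sup>2)
       = (\<Sum>n | lev n = m. (cmod (\<Sum>\<alpha>\<in>multi_idx UNIV m. U n \<alpha> * of_real (P x \<alpha>)))\<^sup>2)"
      by (intro sum.cong) (auto simp: D)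
    also have "\<dots> \<le> (\<Sum>\<alpha>\<in>multi_idx UNIV m. (cmod (complex_of_real (P x \<alpha>)))\<^sup>2)"
      using fin by (intro bessel) auto
    also have "\<dots> \<le> C * (real m + 1) powr p" using P(2)[of x m] by simp
    finally show "(\<Sum>n | lev n = m. (cmod (D n x))\<^sup>2) \<le> C * (real m + 1) powr p" .
  qed
  let ?g = "gamma_exp ?d"
  define P0 where "P0 = (\<lambda>x \<alpha>. hermite_nd \<alpha> (x :: real^'d))"
  obtain C0 where C0: "C0 > 0" "\<And>m x. (\<Sum>\<alpha>\<in>multi_idx UNIV m. (P0 x \<alpha>)\<^sup>2) \<le> C0 * (real m + 1) powr ?g"
  proof -
    obtain C where C: "C > 0" "\<And>m x. (\<Sum>\<alpha>\<in>multi_idx UNIV m. \<Prod>i\<in>(UNIV :: 'd set). (hermite_fun (\<alpha> i) (x i))\<^sup>2)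
      \<le> C * (real m + 1) powr ?g"
      using spectral_function_bound[of "UNIV :: 'd set"] by auto
    have "(\<Sum>\<alpha>\<in>multi_idx UNIV m. (P0 x \<alpha>)\<^sup>2) \<le> C * (real m + 1) powr ?g" for m x
      using C(2)[of "\<lambda>i. x $ i" m] by (simp add: P0_def hermite_nd_def prod_power_distrib)
    then show ?thesis using that C(1) by blast
  qed
  define C1 where "C1 = 2 * 2 powr \<bar>?g\<bar> * C0"
  have C1: "C1 > 0" "\<And>m x b i. (\<Sum>\<alpha>\<in>multi_idx UNIV m. (ladder b i (P0 x) \<alpha>)\<^sup>2) \<le> C1 * (real m + 1) powr (?g + 1)"
    unfolding C1_def using C0(1) ladder_sum_bound[OF less_imp_le[OF C0(1)] C0(2)] by simp_all
  define C2 where "C2 = 2 * 2 powr \<bar>?g + 1\<bar> * C1"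
  have C2: "C2 > 0" "\<And>m x b i b' j. (\<Sum>\<alpha>\<in>multi_idx UNIV m. (ladder b i (ladder b' j (P0 x)) \<alpha>)\<^sup>2) \<le> C2 * (real m + 1) powr (?g + 2)"
  proof -
    show "C2 > 0" using C1 by (simp add: C2_def)
    fix m x b i b' j
    have "(\<Sum>\<alpha>\<in>multi_idx UNIV m. (ladder b i (ladder b' j (P0 x)) \<alpha>)\<^sup>2) \<le> C2 * (real m + 1) powr (?g + 1 + 1)"
      unfolding C2_def by (rule ladder_sum_bound[OF less_imp_le[OF C1(1)] C1(2)])
    then show "(\<Sum>\<alpha>\<in>multi_idx UNIV m. (ladder b i (ladder b' j (P0 x)) \<alpha>)\<^sup>2) \<le> C2 * (real m + 1) powr (?g + 2)"
      by (simp add: add.assoc)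
  qed
  have sum_deriv: "((\<lambda>x. \<Sum>\<alpha>\<in>A. U n \<alpha> * complex_of_real (P x \<alpha>)) has_derivative
      (\<lambda>v. \<Sum>i\<in>UNIV. v $ i *\<^sub>R (\<Sum>\<alpha>\<in>A. U n \<alpha> * complex_of_real (Q i \<alpha>)))) (at x)"
    if "\<And>\<alpha>. ((\<lambda>x. P x \<alpha>) has_derivative (\<lambda>v. \<Sum>i\<in>UNIV. v $ i *\<^sub>R Q i \<alpha>)) (at x)"
    for P :: "real^'d \<Rightarrow> ('d \<Rightarrow> nat) \<Rightarrow> real" and Q n A x
  proof -
    have "((\<lambda>x. \<Sum>\<alpha>\<in>A. U n \<alpha> * complex_of_real (P x \<alpha>)) has_derivative
      (\<lambda>v. \<Sum>\<alpha>\<in>A. U n \<alpha> * complex_of_real (\<Sum>i\<in>UNIV. v $ i *\<^sub>R Q i \<alpha>))) (at x)"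
      by (intro has_derivative_sum has_derivative_mult_right bounded_linear.has_derivative[OF bounded_linear_of_real] that)
    moreover have "(\<Sum>\<alpha>\<in>A. U n \<alpha> * complex_of_real (\<Sum>i\<in>UNIV. v $ i *\<^sub>R Q i \<alpha>))
       = (\<Sum>i\<in>UNIV. v $ i *\<^sub>R (\<Sum>\<alpha>\<in>A. U n \<alpha> * complex_of_real (Q i \<alpha>)))" for v :: "real^'d"
      by (simp add: sum_distrib_left scaleR_sum_right scaleR_conv_of_real mult_ac) (rule sum.swap)
    ultimately show ?thesis by simp
  qed
  have P0d: "((\<lambda>x. P0 x \<alpha>) has_derivative (\<lambda>v. \<Sum>i\<in>UNIV. v $ i *\<^sub>R ladder False i (P0 x) \<alpha>)) (at x)" for x \<alpha>
    using hermite_nd_has_derivative[of \<alpha> x] by (simp add: P0_def[abs_def])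
  have P1d: "((\<lambda>x. ladder False i (P0 x) \<alpha>) has_derivative
      (\<lambda>v. \<Sum>j\<in>UNIV. v $ j *\<^sub>R ladder False i (ladder False j (P0 x)) \<alpha>)) (at x)" for x \<alpha> i
    using ladder_has_derivative[of "\<lambda>\<beta> x. P0 x \<beta>" "\<lambda>j. ladder False j (P0 x)" x False i \<alpha>, OF P0d] by simp
  have g_eq: "g n = (\<lambda>x. \<Sum>\<alpha>\<in>multi_idx UNIV (lev n). U n \<alpha> * of_real (P0 x \<alpha>))" for n
    by (simp add: g_def P0_def)
  have dg: "partial_deriv i (g n) = (\<lambda>x. \<Sum>\<alpha>\<in>multi_idx UNIV (lev n). U n \<alpha> * of_real (ladder False i (P0 x) \<alpha>))" for i n
    unfolding g_eq by (rule ext) (rule partial_deriv_eq[OF sum_deriv[OF P0d]])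
  \<comment> \<open>The order of the ladders is reversed: the later derivative \<open>j\<close>
    falls on the innermost function \<open>P0\<close>, inside the ladder that expresses
    \<open>i\<close>.\<close>
  have ddg: "partial_deriv j (partial_deriv i (g n))
     = (\<lambda>x. \<Sum>\<alpha>\<in>multi_idx UNIV (lev n). U n \<alpha> * of_real (ladder False i (ladder False j (P0 x)) \<alpha>))" for i j n
    unfolding dg by (rule ext) (rule partial_deriv_eq[OF sum_deriv[OF P1d]])
  have xP0: "x $ i * P0 x \<alpha> = ladder True i (P0 x) \<alpha>" for x i \<alpha>
    using ladder_True_hermite_nd[of i x \<alpha>] by (simp add: P0_def)
  have xg: "of_real (x $ i) * g n x = (\<Sum>\<alpha>\<in>multi_idx UNIV (lev n). U n \<alpha> * of_real (ladder True i (P0 x) \<alpha>))" for x i n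
    by (simp add: g_eq sum_distrib_left xP0[symmetric] mult_ac)
  have xdg: "of_real (x $ j) * partial_deriv i (g n) x
     = (\<Sum>\<alpha>\<in>multi_idx UNIV (lev n). U n \<alpha> * of_real (ladder False i (ladder True j (P0 x)) \<alpha>))" for x i j n
  proof -
    have "ladder False i (ladder True j (P0 x)) \<alpha> = x $ j * ladder False i (P0 x) \<alpha>" for \<alpha>
    proof -
      have "ladder True j (P0 x) = (\<lambda>\<beta>. x $ j * P0 x \<beta>)" by (rule ext) (simp add: xP0)
      then show ?thesis by (simp add: ladder_linear[OF bounded_linear_mult_right])
    qed
    then show ?thesis by (simp add: dg sum_distrib_left mult_ac)
  qed
  show ?thesis
  proof (rule that)
    show "\<And>n. \<Lambda> n = 2 * real (lev n) + real ?d" by (rule lev)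
    show "\<And>m. finite {n. lev n = m}" using fin by blast
    show "\<And>m. card {n. lev n = m} \<le> (m + 1) ^ ?d" by (rule card)
    show "\<And>n. g n \<in> hermite_span" by (rule g)
    show "\<And>n. AE x in lborel. \<phi> n x = g n x" by (rule ae)
    show "spectral_bound lev g ?g" by (rule transfer[OF _ C0]) (simp add: g_eq)
    show "\<And>i. spectral_bound lev (\<lambda>n x. of_real (x $ i) * g n x) (?g + 1)" by (rule transfer[OF xg C1])
    show "\<And>i. spectral_bound lev (\<lambda>n. partial_deriv i (g n)) (?g + 1)"
      by (rule transfer[OF _ C1]) (simp add: dg)
    show "\<And>i j. spectral_bound lev (\<lambda>n x. of_real (x $ j) * partial_deriv i (g n) x) (?g + 2)"
      by (rule transfer[OF xdg C2])
    show "\<And>i j. spectral_bound lev (\<lambda>n. partial_deriv j (partial_deriv i (g n))) (?g + 2)"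
      by (rule transfer[OF _ C2]) (simp add: ddg)
  qed
qed

section \<open>Suprema of sub-Gaussian sums\<close>

lemma lipschitz_of_partials:
  fixes S :: "real^'d::finite \<Rightarrow> complex"
  assumes S: "\<And>x. (S has_derivative (\<lambda>v. \<Sum>i\<in>UNIV. v $ i *\<^sub>R D i x)) (at x)"
    and D: "\<And>i x. cmod (D i x) \<le> L"
  shows "cmod (S x - S y) \<le> real CARD('d) * L * norm (x - y)"
proof (rule differentiable_bound[of UNIV])
  show "(S has_derivative (\<lambda>v. \<Sum>i\<in>UNIV. v $ i *\<^sub>R D i x)) (at x within UNIV)" for x
    using S[of x] by simp
  show "onorm (\<lambda>v. \<Sum>i\<in>UNIV. v $ i *\<^sub>R D i x) \<le> real CARD('d) * L" for x
  proof (rule onorm_le)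
    fix v :: "real^'d"
    have "norm (\<Sum>i\<in>UNIV. v $ i *\<^sub>R D i x) \<le> (\<Sum>i\<in>(UNIV::'d set). norm v * L)"
    proof (rule order_trans[OF norm_sum], intro sum_mono)
      fix i
      have "norm (v $ i *\<^sub>R D i x) = \<bar>v $ i\<bar> * cmod (D i x)" by simp
      also have "\<dots> \<le> norm v * L" by (intro mult_mono component_le_norm_cart D) auto
      finally show "norm (v $ i *\<^sub>R D i x) \<le> norm v * L" .
    qed
    then show "norm (\<Sum>i\<in>UNIV. v $ i *\<^sub>R D i x) \<le> real CARD('d) * L * norm v" by (simp add: mult_ac)
  qed
qed auto

locale subgaussian_family = prob_space +
  fixes X :: "nat \<Rightarrow> 'a \<Rightarrow> real" and \<sigma> :: real
  assumes indep: "indep_vars (\<lambda>_. borel) X UNIV"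
    and sigma_pos: "0 < \<sigma>"
    and mgf_integrable: "\<And>n r. integrable M (\<lambda>\<omega>. exp (r * X n \<omega>))"
    and mgf_le: "\<And>n r. expectation (\<lambda>\<omega>. exp (r * X n \<omega>)) \<le> exp (1 / 2 * \<sigma>\<^sup>2 * r\<^sup>2)"
begin

lemma X_measurable [measurable]: "X n \<in> borel_measurable M"
  using indep by (simp add: indep_vars_def)

lemma mgf_sum:
  assumes "finite F"
  shows "integrable M (\<lambda>\<omega>. exp (r * (\<Sum>n\<in>F. b n * X n \<omega>)))"
    and "expectation (\<lambda>\<omega>. exp (r * (\<Sum>n\<in>F. b n * X n \<omega>))) \<le> exp (1 / 2 * \<sigma>\<^sup>2 * r\<^sup>2 * (\<Sum>n\<in>F. (b n)\<^sup>2))"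
proof -
  have e: "(\<lambda>\<omega>. exp (r * (\<Sum>n\<in>F. b n * X n \<omega>))) = (\<lambda>\<omega>. \<Prod>n\<in>F. exp ((r * b n) * X n \<omega>))"
    using assms by (simp add: sum_distrib_left exp_sum mult.assoc)
  have ind: "indep_vars (\<lambda>_. borel) (\<lambda>n \<omega>. exp ((r * b n) * X n \<omega>)) F"
    by (rule indep_vars_compose2[OF indep_vars_subset[OF indep]]) auto
  show "integrable M (\<lambda>\<omega>. exp (r * (\<Sum>n\<in>F. b n * X n \<omega>)))"
    unfolding e using assms ind mgf_integrable by (rule indep_vars_integrable)
  have "expectation (\<lambda>\<omega>. \<Prod>n\<in>F. exp ((r * b n) * X n \<omega>)) = (\<Prod>n\<in>F. expectation (\<lambda>\<omega>. exp ((r * b n) * X n \<omega>)))"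
    using assms ind mgf_integrable by (rule indep_vars_lebesgue_integral)
  also have "\<dots> \<le> (\<Prod>n\<in>F. exp (1 / 2 * \<sigma>\<^sup>2 * (r * b n)\<^sup>2))"
    by (intro prod_mono conjI mgf_le) (auto intro: integral_nonneg)
  also have "\<dots> = exp (1 / 2 * \<sigma>\<^sup>2 * r\<^sup>2 * (\<Sum>n\<in>F. (b n)\<^sup>2))"
    using assms by (simp add: exp_sum[symmetric] sum_distrib_left power_mult_distrib mult_ac)
  finally show "expectation (\<lambda>\<omega>. exp (r * (\<Sum>n\<in>F. b n * X n \<omega>))) \<le> exp (1 / 2 * \<sigma>\<^sup>2 * r\<^sup>2 * (\<Sum>n\<in>F. (b n)\<^sup>2))"
    unfolding e .
qed

text \<open>Markov's inequality for the exponential moment, with \<open>r\<close> the minimiser of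
  \<open>\<sigma>^2 r^2 V / 2 - r t sqrt V\<close>. An upper bound \<open>V\<close> replaces the sum
  of squares itself, so one threshold serves all grid points.\<close>

lemma tail_one_sided:
  assumes F: "finite F" and V: "(\<Sum>n\<in>F. (b n)\<^sup>2) \<le> V" "0 < V" and t: "0 < t"
  shows "prob {\<omega>\<in>space M. t * sqrt V \<le> (\<Sum>n\<in>F. b n * X n \<omega>)} \<le> exp (- t\<^sup>2 / (2 * \<sigma>\<^sup>2))"
proof -
  define r where "r = t / (\<sigma>\<^sup>2 * sqrt V)"
  have r: "0 < r" using t V sigma_pos by (simp add: r_def)
  let ?S = "\<lambda>\<omega>. \<Sum>n\<in>F. b n * X n \<omega>"
  have "{\<omega>\<in>space M. t * sqrt V \<le> ?S \<omega>} = {\<omega>\<in>space M. exp (r * (t * sqrt V)) \<le> exp (r * ?S \<omega>)}"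
    using r by simp
  then have "prob {\<omega>\<in>space M. t * sqrt V \<le> ?S \<omega>} \<le> expectation (\<lambda>\<omega>. exp (r * ?S \<omega>)) / exp (r * (t * sqrt V))"
    using integral_Markov_inequality_measure[OF mgf_sum(1)[OF F], where A = "{}" and c = "exp (r * (t * sqrt V))" and r1 = r and b1 = b] by simp
  also have "\<dots> \<le> exp (1 / 2 * \<sigma>\<^sup>2 * r\<^sup>2 * V) / exp (r * (t * sqrt V))"
  proof (intro divide_right_mono order_trans[OF mgf_sum(2)[OF F]])
    show "exp (1 / 2 * \<sigma>\<^sup>2 * r\<^sup>2 * (\<Sum>n\<in>F. (b n)\<^sup>2)) \<le> exp (1 / 2 * \<sigma>\<^sup>2 * r\<^sup>2 * V)"
      using V by (simp add: mult_left_mono)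
  qed auto
  also have "\<dots> = exp (1 / 2 * \<sigma>\<^sup>2 * r\<^sup>2 * V - r * (t * sqrt V))" by (simp add: exp_diff)
  also have "1 / 2 * \<sigma>\<^sup>2 * r\<^sup>2 * V - r * (t * sqrt V) = - t\<^sup>2 / (2 * \<sigma>\<^sup>2)"
  proof -
    have "sqrt V * sqrt V = V" using V by simp
    then have "\<sigma>\<^sup>2 * r\<^sup>2 * V = t\<^sup>2 / \<sigma>\<^sup>2" "r * (t * sqrt V) = t\<^sup>2 / \<sigma>\<^sup>2"
      using V sigma_pos by (simp_all add: r_def power_divide power_mult_distrib field_simps power2_eq_square)
    then show ?thesis by simp
  qed
  finally show ?thesis .
qed

lemma tail_two_sided:
  assumes F: "finite F" and V: "(\<Sum>n\<in>F. (b n)\<^sup>2) \<le> V" "0 < V" and t: "0 < t"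
  shows "prob {\<omega>\<in>space M. t * sqrt V < \<bar>\<Sum>n\<in>F. b n * X n \<omega>\<bar>} \<le> 2 * exp (- t\<^sup>2 / (2 * \<sigma>\<^sup>2))"
proof -
  let ?A = "\<lambda>b. {\<omega>\<in>space M. t * sqrt V \<le> (\<Sum>n\<in>F. b n * X n \<omega>)}"
  have "prob {\<omega>\<in>space M. t * sqrt V < \<bar>\<Sum>n\<in>F. b n * X n \<omega>\<bar>} \<le> prob (?A b \<union> ?A (\<lambda>n. - b n))"
    by (intro finite_measure_mono) (auto simp: sum_negf abs_less_iff abs_if split: if_splits)
  also have "\<dots> \<le> prob (?A b) + prob (?A (\<lambda>n. - b n))"
    by (intro measure_Un_le) measurable
  also have "\<dots> \<le> exp (- t\<^sup>2 / (2 * \<sigma>\<^sup>2)) + exp (- t\<^sup>2 / (2 * \<sigma>\<^sup>2))"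
    using assms by (intro add_mono tail_one_sided) auto
  finally show ?thesis by simp
qed

text \<open>The supremum over \<open>\<real>\<^sup>d\<close> is reduced to a grid of \<open>2\<^bsup>O(J)\<^esup>\<close> points, whence the loss \<open>sqrt J\<close>. A
  polynomial loss \<open>2\<^bsup>a J\<^esup>\<close> is harmless in the bounds for the derivatives (mesh of the grid) and for
  the decay in \<open>x\<close> (size of the grid).\<close>

lemma sup_bound:
  fixes a p :: nat
  shows "\<exists>B>0. \<forall>J\<ge>1. \<forall>F (f :: nat \<Rightarrow> real^'d::finite \<Rightarrow> complex) f' V.
     finite F \<and> card F \<le> 2 ^ (a * J) \<and> 0 \<le> V
     \<and> (\<forall>n\<in>F. \<forall>x. (f n has_derivative (\<lambda>v. \<Sum>i\<in>UNIV. v $ i *\<^sub>R f' i n x)) (at x))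
     \<and> (\<forall>x. (\<Sum>n\<in>F. (cmod (f n x))\<^sup>2) \<le> V)
     \<and> (\<forall>i x. (\<Sum>n\<in>F. (cmod (f' i n x))\<^sup>2) \<le> V * 2 ^ (a * J))
     \<and> (\<forall>x. (norm x)\<^sup>2 * (\<Sum>n\<in>F. (cmod (f n x))\<^sup>2) \<le> V * 2 ^ (a * J))
     \<longrightarrow> (\<exists>Bad\<in>events. prob Bad \<le> 1 / 2 ^ (p * J)
          \<and> (\<forall>\<omega>\<in>space M - Bad. \<forall>x. cmod (\<Sum>n\<in>F. of_real (X n \<omega>) * f n x) \<le> B * sqrt (V * real J)))"
proof -
  let ?d = "CARD('d)"
  \<comment> \<open>The tail exponent must outweigh the at most \<open>2^(a J)\<close> variables,
    the at most \<open>2^((2 a J + 2) d)\<close> grid points and the constants, and still leave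
    \<open>2^(- p J)\<close>.\<close>
  define q where "q = a + p + (2 * a + 2) * ?d + 3"
  define B1 where "B1 = \<sigma> * sqrt (2 * real q * ln 2)"
  have B1: "0 < B1" proof -
    have "0 < q" unfolding q_def by simp
    then have "0 < real q" unfolding of_nat_0_less_iff .
    then show ?thesis unfolding B1_def using sigma_pos by simp
  qed
  define B where "B = (3 + (real ?d)\<^sup>2) * B1"
  have B: "0 < B" unfolding B_def using B1 by (intro mult_pos_pos add_pos_nonneg) auto
  show ?thesis
  proof (intro exI[of _ B] conjI allI impI B, elim conjE)
    fix J :: nat and F and f :: "nat \<Rightarrow> real^'d \<Rightarrow> complex" and f' and V :: real
    assume J: "1 \<le> J" and F: "finite F" and cF: "card F \<le> 2 ^ (a * J)" and V0: "0 \<le> V"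
      and fd: "\<forall>n\<in>F. \<forall>x. (f n has_derivative (\<lambda>v. \<Sum>i\<in>UNIV. v $ i *\<^sub>R f' i n x)) (at x)"
      and fV: "\<forall>x. (\<Sum>n\<in>F. (cmod (f n x))\<^sup>2) \<le> V"
      and dV: "\<forall>i x. (\<Sum>n\<in>F. (cmod (f' i n x))\<^sup>2) \<le> V * 2 ^ (a * J)"
      and xV: "\<forall>x. (norm x)\<^sup>2 * (\<Sum>n\<in>F. (cmod (f n x))\<^sup>2) \<le> V * 2 ^ (a * J)"
    define S where "S = (\<lambda>\<omega> x. \<Sum>n\<in>F. complex_of_real (X n \<omega>) * f n x)"
    show "\<exists>Bad\<in>events. prob Bad \<le> 1 / 2 ^ (p * J)
          \<and> (\<forall>\<omega>\<in>space M - Bad. \<forall>x. cmod (\<Sum>n\<in>F. of_real (X n \<omega>) * f n x) \<le> B * sqrt (V * real J))"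
    proof (cases "V = 0")
      case True
      have "f n x = 0" if "n \<in> F" for n x
      proof -
        have "(\<Sum>n\<in>F. (cmod (f n x))\<^sup>2) = 0"
          using fV True by (intro antisym sum_nonneg) auto
        then show ?thesis using F that by (simp add: sum_nonneg_eq_0_iff)
      qed
      then have "cmod (\<Sum>n\<in>F. of_real (X n \<omega>) * f n x) \<le> B * sqrt (V * real J)" for \<omega> x
        using True by simp
      then show ?thesis by (intro bexI[of _ "{}"]) auto
    next
      case False
      then have V: "0 < V" using V0 by simp
      \<comment> \<open>This level makes the tail \<open>exp (- t^2 / (2 \<sigma>^2))\<close> equal
        to \<open>2^(- q J)\<close>, which is where \<open>B1\<close> comes from.\<close>
      define t where "t = B1 * sqrt (real J)"
      have t: "0 < t" using B1 J by (simp add: t_def)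
      have tail: "exp (- t\<^sup>2 / (2 * \<sigma>\<^sup>2)) = 1 / 2 ^ (q * J)"
      proof -
        have "t\<^sup>2 = \<sigma>\<^sup>2 * (2 * real q * ln 2) * real J"
          by (simp add: t_def B1_def power_mult_distrib)
        then have "- t\<^sup>2 / (2 * \<sigma>\<^sup>2) = - (real (q * J) * ln 2)"
          using sigma_pos by simp
        also have "exp \<dots> = 1 / 2 ^ (q * J)"
          by (simp only: exp_minus exp_of_nat_mult) (simp add: inverse_eq_divide)
        finally show ?thesis .
      qed
      \<comment> \<open>\<open>R\<close> is both the radius to be covered by the grid and the
        inverse of its mesh, hence integer coordinates up to \<open>R^2\<close>.\<close>
      define R :: nat where "R = 2 ^ (a * J)"
      have R: "1 \<le> R" by (simp add: R_def)
      define K where "K = PiE (UNIV :: 'd set) (\<lambda>_. {- int (R\<^sup>2) .. int (R\<^sup>2)})"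
      define pt where "pt = (\<lambda>k :: 'd \<Rightarrow> int. (\<chi> i. real_of_int (k i) / real R) :: real^'d)"
      have K: "finite K" "card K \<le> 2 ^ ((2 * a * J + 2) * ?d)"
      proof -
        show "finite K" unfolding K_def by (intro finite_PiE) auto
        have "nat (int N - - int N + 1) = 2 * N + 1" for N by linarith
        then have "card {- int N..int N} = 2 * N + 1" for N by (simp only: card_atLeastAtMost_int)
        then have "card K = (2 * R\<^sup>2 + 1) ^ ?d"
          unfolding K_def by (subst card_PiE) (simp_all only: finite prod_constant)
        also have "\<dots> \<le> (2 ^ (2 * a * J + 2)) ^ ?d"
        proof (intro power_mono)
          have "R\<^sup>2 = 2 ^ (2 * a * J)" unfolding R_def power_mult[symmetric] by (simp add: mult_ac)
          moreover have "(1::nat) \<le> 2 ^ (2 * a * J)" by simp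
          ultimately show "2 * R\<^sup>2 + 1 \<le> 2 ^ (2 * a * J + 2)" by (simp add: power_add)
        qed auto
        finally show "card K \<le> 2 ^ ((2 * a * J + 2) * ?d)" by (simp only: power_mult[symmetric])
      qed
      \<comment> \<open>\<open>E1\<close> controls every single variable by \<open>t\<close>. With
        Cauchy-Schwarz this yields the crude bound \<open>cs\<close>, which loses a factor
        \<open>sqrt R\<close> and is used only away from the grid points.\<close>
      define E1 where "E1 = (\<lambda>n. {\<omega>\<in>space M. t * sqrt 1 < \<bar>\<Sum>m\<in>{n}. 1 * X m \<omega>\<bar>})"
      define E2 where "E2 = (\<lambda>k. {\<omega>\<in>space M. t * sqrt V < \<bar>\<Sum>n\<in>F. Re (f n (pt k)) * X n \<omega>\<bar>})"
      define E3 where "E3 = (\<lambda>k. {\<omega>\<in>space M. t * sqrt V < \<bar>\<Sum>n\<in>F. Im (f n (pt k)) * X n \<omega>\<bar>})"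
      have E_meas[measurable]: "E1 n \<in> events" "E2 k \<in> events" "E3 k \<in> events" for n k
        unfolding E1_def E2_def E3_def by measurable
      have E1: "prob (E1 n) \<le> 2 * (1 / 2 ^ (q * J))" for n
        unfolding E1_def tail[symmetric] using t by (intro tail_two_sided) auto
      have E2: "prob (E2 k) \<le> 2 * (1 / 2 ^ (q * J))" for k
        unfolding E2_def tail[symmetric]
      proof (intro tail_two_sided F V t)
        have "(\<Sum>n\<in>F. (Re (f n (pt k)))\<^sup>2) \<le> (\<Sum>n\<in>F. (cmod (f n (pt k)))\<^sup>2)"
          by (intro sum_mono) (simp add: cmod_def)
        then show "(\<Sum>n\<in>F. (Re (f n (pt k)))\<^sup>2) \<le> V" using fV[rule_format, of "pt k"] by (rule order_trans)
      qed
      have E3: "prob (E3 k) \<le> 2 * (1 / 2 ^ (q * J))" for k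
        unfolding E3_def tail[symmetric]
      proof (intro tail_two_sided F V t)
        have "(\<Sum>n\<in>F. (Im (f n (pt k)))\<^sup>2) \<le> (\<Sum>n\<in>F. (cmod (f n (pt k)))\<^sup>2)"
          by (intro sum_mono) (simp add: cmod_def)
        then show "(\<Sum>n\<in>F. (Im (f n (pt k)))\<^sup>2) \<le> V" using fV[rule_format, of "pt k"] by (rule order_trans)
      qed
      define Bad where "Bad = (\<Union>n\<in>F. E1 n) \<union> ((\<Union>k\<in>K. E2 k) \<union> (\<Union>k\<in>K. E3 k))"
      have Bad_meas: "Bad \<in> events" unfolding Bad_def using F K by (intro sets.Un sets.finite_UN) auto
      have Bad_prob: "prob Bad \<le> 1 / 2 ^ (p * J)"
      proof -
        let ?N = "2 ^ (q * J) :: real"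
        have "prob Bad \<le> prob (\<Union>n\<in>F. E1 n) + prob ((\<Union>k\<in>K. E2 k) \<union> (\<Union>k\<in>K. E3 k))"
          unfolding Bad_def using F K by (intro measure_Un_le sets.Un sets.finite_UN) auto
        also have "\<dots> \<le> prob (\<Union>n\<in>F. E1 n) + (prob (\<Union>k\<in>K. E2 k) + prob (\<Union>k\<in>K. E3 k))"
          using F K by (intro add_left_mono measure_Un_le sets.finite_UN) auto
        also have "\<dots> \<le> (\<Sum>n\<in>F. prob (E1 n)) + ((\<Sum>k\<in>K. prob (E2 k)) + (\<Sum>k\<in>K. prob (E3 k)))"
          using F K by (intro add_mono measure_UNION_le) auto
        also have "\<dots> \<le> (\<Sum>n\<in>F. 2 * (1 / ?N)) + ((\<Sum>k\<in>K. 2 * (1 / ?N)) + (\<Sum>k\<in>K. 2 * (1 / ?N)))"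
          by (intro add_mono sum_mono E1 E2 E3)
        also have "\<dots> = (2 * real (card F) + 4 * real (card K)) / ?N"
          by (simp add: add_divide_distrib)
        also have "\<dots> \<le> (2 ^ (q * J - p * J)) / ?N"
        proof (intro divide_right_mono)
          define e where "e = q * J - p * J"
          have e: "e = (a + (2 * a + 2) * ?d + 3) * J" by (simp add: e_def q_def algebra_simps flip: diff_mult_distrib)
          have e1: "a * J + 2 \<le> e" unfolding e using J by (simp add: algebra_simps)
          have "(2 * ?d + 3) * 1 \<le> (2 * ?d + 3) * J" using J by (rule mult_le_mono2)
          then have e2: "(2 * a * J + 2) * ?d + 3 \<le> e" unfolding e by (simp add: algebra_simps)
          have "2 * real (card F) \<le> 2 * 2 ^ (a * J)"
          proof -
            have "real (card F) \<le> real (2 ^ (a * J))" using cF by (simp only: of_nat_le_iff)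
            then show ?thesis by simp
          qed
          also have "\<dots> = 2 ^ (a * J + 2) / 2" by (simp add: power_add)
          also have "\<dots> \<le> 2 ^ e / 2" using e1 by (intro divide_right_mono power_increasing) auto
          finally have 1: "2 * real (card F) \<le> 2 ^ e / 2" .
          have "4 * real (card K) \<le> 4 * 2 ^ ((2 * a * J + 2) * ?d)"
          proof -
            have "real (card K) \<le> real (2 ^ ((2 * a * J + 2) * ?d))" using K by (simp only: of_nat_le_iff)
            then show ?thesis by simp
          qed
          also have "\<dots> = 2 ^ ((2 * a * J + 2) * ?d + 3) / 2" by (simp add: power_add)
          also have "\<dots> \<le> 2 ^ e / 2" using e2 by (intro divide_right_mono power_increasing) auto
          finally have 2: "4 * real (card K) \<le> 2 ^ e / 2" .
          show "2 * real (card F) + 4 * real (card K) \<le> 2 ^ (q * J - p * J)"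
            using 1 2 by (simp add: e_def)
        qed auto
        also have "\<dots> = 1 / 2 ^ (p * J)"
        proof -
          have "p * J \<le> q * J" by (simp add: q_def)
          then have "?N = 2 ^ (q * J - p * J) * 2 ^ (p * J)" by (simp flip: power_add)
          then show ?thesis by simp
        qed
        finally show ?thesis .
      qed
      have good: "cmod (S \<omega> x) \<le> B * sqrt (V * real J)" if \<omega>: "\<omega> \<in> space M - Bad" for \<omega> x
      proof -
        have Xt: "\<bar>X n \<omega>\<bar> \<le> t" if "n \<in> F" for n
          using \<omega> that by (auto simp: Bad_def E1_def)
        have cs: "cmod (\<Sum>n\<in>F. complex_of_real (X n \<omega>) * h n) \<le> t * sqrt (real R * W)"
          if W: "(\<Sum>n\<in>F. (cmod (h n))\<^sup>2) \<le> W" for h W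
        proof -
          have "cmod (\<Sum>n\<in>F. complex_of_real (X n \<omega>) * h n) \<le> (\<Sum>n\<in>F. t * cmod (h n))"
            by (rule order_trans[OF norm_sum]) (auto intro!: sum_mono mult_right_mono Xt simp: norm_mult)
          also have "\<dots> = t * (\<Sum>n\<in>F. cmod (h n))" by (simp add: sum_distrib_left)
          also have "(\<Sum>n\<in>F. cmod (h n)) \<le> sqrt (real R * W)"
          proof (rule real_le_rsqrt)
            have "(\<Sum>n\<in>F. cmod (h n))\<^sup>2 \<le> (\<Sum>n\<in>F. (cmod (h n))\<^sup>2) * real (card F)"
              by (rule sum_squared_le_sum_of_squares)
            also have "\<dots> \<le> W * real R"
              using W cF by (intro mult_mono order_trans[OF sum_nonneg W])
                (auto simp: R_def intro: order_trans[OF sum_nonneg W])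
            finally show "(\<Sum>n\<in>F. cmod (h n))\<^sup>2 \<le> real R * W" by (simp add: mult.commute)
          qed
          finally show ?thesis using t by (simp add: mult_left_mono)
        qed
        have R': "2 ^ (a * J) = real R" by (simp add: R_def)
        have SB: "t * sqrt V * (3 + (real ?d)\<^sup>2) = B * sqrt (V * real J)"
          by (simp add: t_def B_def real_sqrt_mult)
        show ?thesis
        proof (cases "norm x \<le> real R")
          \<comment> \<open>Outside the ball the decay hypothesis allows \<open>W = V / R\<close> in
            \<open>cs\<close>, which exactly compensates the factor \<open>R\<close> there.\<close>
          case False
          then have x: "real R < norm x" "0 < norm x" using R by (auto intro: le_less_trans)
          have "(\<Sum>n\<in>F. (cmod (f n x))\<^sup>2) \<le> V * real R / (norm x)\<^sup>2"
            using xV x unfolding R' by (simp add: le_divide_eq mult.commute)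
          also have "\<dots> \<le> V * real R / (real R)\<^sup>2"
            using x R V by (intro divide_left_mono power_mono mult_pos_pos) auto
          also have "\<dots> = V / real R" using R by (simp add: power2_eq_square)
          finally have "cmod (S \<omega> x) \<le> t * sqrt (real R * (V / real R))" unfolding S_def by (rule cs)
          also have "\<dots> = t * sqrt V * 1" using R by simp
          also have "\<dots> \<le> t * sqrt V * (3 + (real ?d)\<^sup>2)" using t V by (intro mult_left_mono) auto
          finally show ?thesis unfolding SB .
        next
          case True
          define k where "k = (\<lambda>i. \<lfloor>x $ i * real R\<rfloor>)"
          have xi: "\<bar>x $ i\<bar> \<le> real R" for i using component_le_norm_cart[of x i] True by simp
          have kK: "k \<in> K"
          proof -
            have "\<bar>x $ i * real R\<bar> \<le> real R * real R" for i
              using xi[of i] by (simp add: abs_mult mult_right_mono)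
            then have "- int (R\<^sup>2) \<le> k i \<and> k i \<le> int (R\<^sup>2)" for i
              unfolding k_def using abs_le_D1[of "x $ i * real R" "real R * real R"]
                abs_le_D2[of "x $ i * real R" "real R * real R"]
              by (auto simp: le_floor_iff floor_le_iff power2_eq_square intro: le_less_trans)
            then show ?thesis by (auto simp: K_def PiE_def)
          qed
          have dist: "norm (x - pt k) \<le> real ?d / real R"
          proof -
            have "norm (x - pt k) \<le> (\<Sum>i\<in>UNIV. \<bar>(x - pt k) $ i\<bar>)" by (rule norm_le_l1_cart)
            also have "\<dots> \<le> (\<Sum>i\<in>(UNIV::'d set). 1 / real R)"
            proof (intro sum_mono)
              fix i
              have "\<bar>x $ i * real R - real_of_int (k i)\<bar> \<le> 1" unfolding k_def by linarith
              then have "\<bar>x $ i * real R - real_of_int (k i)\<bar> / real R \<le> 1 / real R"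
                by (intro divide_right_mono) auto
              moreover have "(x - pt k) $ i = (x $ i * real R - real_of_int (k i)) / real R"
                using R by (simp add: pt_def field_simps)
              ultimately show "\<bar>(x - pt k) $ i\<bar> \<le> 1 / real R" by simp
            qed
            finally show ?thesis by simp
          qed
          have grid: "cmod (S \<omega> (pt k)) \<le> 2 * t * sqrt V"
          proof -
            have "\<bar>\<Sum>n\<in>F. Re (f n (pt k)) * X n \<omega>\<bar> \<le> t * sqrt V" "\<bar>\<Sum>n\<in>F. Im (f n (pt k)) * X n \<omega>\<bar> \<le> t * sqrt V"
              using \<omega> kK by (auto simp: Bad_def E2_def E3_def)
            then have "\<bar>Re (S \<omega> (pt k))\<bar> \<le> t * sqrt V" "\<bar>Im (S \<omega> (pt k))\<bar> \<le> t * sqrt V"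
              by (simp_all add: S_def mult.commute)
            then show ?thesis using cmod_le[of "S \<omega> (pt k)"] by linarith
          qed
          \<comment> \<open>The crude gradient bound \<open>t * (R * sqrt V)\<close> meets the
            distance \<open>d / R\<close> to the grid, so \<open>R\<close> cancels; one factor
            \<open>d\<close> comes from the mesh and one from the gradient.\<close>
          have "cmod (S \<omega> x - S \<omega> (pt k)) \<le> real ?d * (t * (real R * sqrt V)) * norm (x - pt k)"
          proof (rule lipschitz_of_partials)
            fix y
            have "((\<lambda>x. S \<omega> x) has_derivative (\<lambda>v. \<Sum>n\<in>F. complex_of_real (X n \<omega>) * (\<Sum>i\<in>UNIV. v $ i *\<^sub>R f' i n y))) (at y)"
              unfolding S_def using fd by (intro has_derivative_sum has_derivative_mult_right) auto
            moreover have "(\<Sum>n\<in>F. complex_of_real (X n \<omega>) * (\<Sum>i\<in>UNIV. v $ i *\<^sub>R f' i n y))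
               = (\<Sum>i\<in>UNIV. v $ i *\<^sub>R (\<Sum>n\<in>F. complex_of_real (X n \<omega>) * f' i n y))" for v :: "real^'d"
              by (simp add: sum_distrib_left scaleR_sum_right scaleR_conv_of_real mult_ac) (rule sum.swap)
            ultimately show "(S \<omega> has_derivative (\<lambda>v. \<Sum>i\<in>UNIV. v $ i *\<^sub>R (\<Sum>n\<in>F. complex_of_real (X n \<omega>) * f' i n y))) (at y)"
              by simp
            show "cmod (\<Sum>n\<in>F. complex_of_real (X n \<omega>) * f' i n y) \<le> t * (real R * sqrt V)" for i
            proof -
              have "cmod (\<Sum>n\<in>F. complex_of_real (X n \<omega>) * f' i n y) \<le> t * sqrt (real R * (V * real R))"
                using dV unfolding R' by (intro cs) auto
              also have "sqrt (real R * (V * real R)) = real R * sqrt V"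
              proof -
                have "real R * (V * real R) = (real R)\<^sup>2 * V" by (simp add: power2_eq_square)
                then show ?thesis by (simp add: real_sqrt_mult)
              qed
              finally show ?thesis .
            qed
          qed
          also have "\<dots> \<le> real ?d * (t * (real R * sqrt V)) * (real ?d / real R)"
            using dist t V by (intro mult_left_mono) auto
          also have "\<dots> = t * sqrt V * (real ?d)\<^sup>2" using R by (simp add: power2_eq_square)
          finally have "cmod (S \<omega> x) \<le> 2 * t * sqrt V + t * sqrt V * (real ?d)\<^sup>2"
            using grid norm_triangle_sub[of "S \<omega> x" "S \<omega> (pt k)"] by linarith
          also have "\<dots> \<le> t * sqrt V * (3 + (real ?d)\<^sup>2)" using t V by (simp add: algebra_simps)
          finally show ?thesis unfolding SB .
        qed
      qed
      show ?thesis using Bad_meas Bad_prob good unfolding S_def by blast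
    qed
  qed
qed

end

section \<open>Random sums over dyadic ranges of blocks\<close>

lemma sum_UN_le:
  fixes f :: "'a \<Rightarrow> real"
  assumes "finite I" "\<And>i. i \<in> I \<Longrightarrow> finite (S i)" "\<And>x. 0 \<le> f x"
  shows "sum f (\<Union>i\<in>I. S i) \<le> (\<Sum>i\<in>I. sum f (S i))"
  using assms
proof (induction I rule: finite_induct)
  case (insert i I)
  have "sum f (S i \<union> (\<Union>i\<in>I. S i)) \<le> sum f (S i) + sum f (\<Union>i\<in>I. S i)"
    using insert by (subst sum_Un) (auto intro: sum_nonneg)
  also have "sum f (\<Union>i\<in>I. S i) \<le> (\<Sum>i\<in>I. sum f (S i))"
    using insert by blast
  finally show ?case using insert by simp
qed simp

lemma uniform_constant:
  fixes Q :: "'s::finite \<Rightarrow> real \<Rightarrow> bool"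
  assumes ex: "\<And>s. \<exists>C>0. Q s C" and mono: "\<And>s C C'. Q s C \<Longrightarrow> C \<le> C' \<Longrightarrow> Q s C'"
  shows "\<exists>C>0. \<forall>s. Q s C"
proof -
  obtain C where C: "\<And>s. C s > 0" "\<And>s. Q s (C s)" using ex by metis
  have "C s \<le> 1 + sum C UNIV" for s
    using member_le_sum[of s UNIV C] C(1) by (simp add: less_imp_le add_increasing)
  moreover have "0 < 1 + sum C UNIV" using C(1) by (intro add_pos_nonneg sum_nonneg) (auto intro: less_imp_le)
  ultimately show ?thesis using mono[OF C(2)] by blast
qed

text \<open>\<open>b k\<close> stands for the block maxima. The shift by
  \<open>CARD('d) div 2\<close> appears because \<open>2 k <= 2 m + d < 2 k + 2\<close> means
  \<open>k = m + d div 2\<close>.\<close>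

locale hermite_series =
  fixes lev :: "nat \<Rightarrow> nat" and g :: "nat \<Rightarrow> real^'d::finite \<Rightarrow> complex"
    and c :: "nat \<Rightarrow> complex" and b :: "nat \<Rightarrow> real" and \<mu> \<nu> A :: real
  assumes lev_mono: "mono lev"
    and lev_finite: "\<And>m. finite {n. lev n = m}"
    and lev_card: "\<And>m. card {n. lev n = m} \<le> (m + 1) ^ CARD('d)"
    and g_span: "\<And>n. g n \<in> hermite_span"
    and g_bound: "spectral_bound lev g (gamma_exp CARD('d))"
    and xg_bound: "\<And>i. spectral_bound lev (\<lambda>n x. of_real (x $ i) * g n x) (gamma_exp CARD('d) + 1)"
    and dg_bound: "\<And>i. spectral_bound lev (\<lambda>n. partial_deriv i (g n)) (gamma_exp CARD('d) + 1)"
    and xdg_bound: "\<And>i j. spectral_bound lev (\<lambda>n x. of_real (x $ j) * partial_deriv i (g n) x) (gamma_exp CARD('d) + 2)"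
    and ddg_bound: "\<And>i j. spectral_bound lev (\<lambda>n. partial_deriv j (partial_deriv i (g n))) (gamma_exp CARD('d) + 2)"
    and c_le: "\<And>n. (cmod (c n))\<^sup>2 \<le> b (lev n + CARD('d) div 2)"
    and b_nonneg: "\<And>k. 0 \<le> b k"
    and A_pos: "0 < A"
    and b_sum: "\<And>j. 1 \<le> j \<Longrightarrow> (\<Sum>k=2^j..2^(j+1). b k)
        \<le> A * 2 powr ((- gamma_exp CARD('d) - \<mu>) * real j) * real j powr (2 * \<nu>)"
begin

definition blk :: "nat \<Rightarrow> nat" where "blk n = lev n + CARD('d) div 2"

definition dyad :: "nat \<Rightarrow> nat \<Rightarrow> nat set" where
  "dyad J J' = {n. 2 ^ J \<le> blk n \<and> blk n < 2 ^ J'}"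

text \<open>\<open>vsum e J J'\<close> is, up to a constant, the variance of the dyadic blocks \<open>J \<le> j < J'\<close> of the
  series (\<open>e = 0\<close>) and of its first and second derivatives (\<open>e = 1, 2\<close>).\<close>

definition vsum :: "real \<Rightarrow> nat \<Rightarrow> nat \<Rightarrow> real" where
  "vsum e J J' = (\<Sum>j=J..<J'. 2 powr ((e - \<mu>) * real j) * real j powr (2 * \<nu>))"

lemma vsum_nonneg: "0 \<le> vsum e J J'"
  unfolding vsum_def by (intro sum_nonneg) auto

text \<open>One derivative multiplies the variance by at most the top frequency, a loss of the
  polynomial kind that \<open>sup_bound\<close> tolerates.\<close>

lemma vsum_Suc_le: "vsum (e + 1) J J' \<le> 2 ^ J' * vsum e J J'"
  unfolding vsum_def sum_distrib_left
proof (rule sum_mono)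
  fix j assume j: "j \<in> {J..<J'}"
  have "2 powr ((e + 1 - \<mu>) * real j) = 2 powr (real j) * 2 powr ((e - \<mu>) * real j)"
    by (simp flip: powr_add) (simp add: algebra_simps)
  also have "\<dots> \<le> 2 ^ J' * 2 powr ((e - \<mu>) * real j)"
    using j by (intro mult_right_mono) (auto simp: powr_realpow)
  finally show "2 powr ((e + 1 - \<mu>) * real j) * real j powr (2 * \<nu>)
      \<le> 2 ^ J' * (2 powr ((e - \<mu>) * real j) * real j powr (2 * \<nu>))"
    by (simp add: mult.assoc[symmetric] mult_right_mono)
qed

lemma blk_finite: "finite {n. blk n < K}" and blk_card: "card {n. blk n < K} \<le> K * K ^ CARD('d)"
proof -
  have sub: "{n. blk n < K} \<subseteq> (\<Union>m<K. {n. lev n = m})" by (auto simp: blk_def)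
  show "finite {n. blk n < K}" by (rule finite_subset[OF sub]) (auto intro: lev_finite)
  have "card {n. blk n < K} \<le> card (\<Union>m<K. {n. lev n = m})"
    by (intro card_mono sub) (auto intro: lev_finite)
  also have "\<dots> \<le> (\<Sum>m<K. card {n. lev n = m})" by (rule card_UN_le) simp
  also have "\<dots> \<le> (\<Sum>m<K. K ^ CARD('d))"
    by (intro sum_mono order_trans[OF lev_card] power_mono) auto
  finally show "card {n. blk n < K} \<le> K * K ^ CARD('d)" by simp
qed

lemma dyad_finite: "finite (dyad J J')"
  by (rule finite_subset[OF _ blk_finite[of "2 ^ J'"]]) (auto simp: dyad_def)

lemma blk_mono: "m \<le> n \<Longrightarrow> blk m \<le> blk n"
  using lev_mono by (simp add: blk_def mono_def)

text \<open>\<open>blk\<close> is monotone in \<open>n\<close>, so the indices below a block form an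
  initial segment. Hence only 2^O(J') truncations \<open>n < N\<close> can differ on a dyadic
  range.\<close>

lemma blk_le_imp_less_card: "blk n < K \<Longrightarrow> n < card {n. blk n < K}"
proof -
  assume "blk n < K"
  then have "{..n} \<subseteq> {n. blk n < K}" using blk_mono by (auto intro: le_less_trans)
  then have "card {..n} \<le> card {n. blk n < K}" by (intro card_mono blk_finite)
  then show ?thesis by simp
qed

lemma dyadic_cover:
  assumes "2 ^ J \<le> k" "k < (2::nat) ^ J'"
  obtains j where "J \<le> j" "j < J'" "2 ^ j \<le> k" "k < 2 ^ (j + 1)"
proof -
  have k: "0 < k" using assms(1) by (rule less_le_trans[rotated]) simp
  define j where "j = floor_log k"
  have j: "2 ^ j \<le> k" "k < 2 ^ (j + 1)"
    using k floor_log_exp2_le[of k] floor_log_exp2_gt[of k] by (simp_all add: j_def)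
  have "(2::nat) ^ J < 2 ^ (j + 1)" using assms(1) j(2) by (rule le_less_trans)
  then have "J < j + 1" by (rule power_less_imp_less_exp[rotated]) simp
  moreover have "(2::nat) ^ j < 2 ^ J'" using j(1) assms(2) by (rule le_less_trans)
  then have "j < J'" by (rule power_less_imp_less_exp[rotated]) simp
  ultimately show ?thesis using j by (intro that[of j]) auto
qed

text \<open>For \<open>k >= 1\<close> the numbers \<open>m + 1\<close> and
  \<open>k = m + d div 2\<close> are comparable with ratio \<open>L\<close>; blocks below
  \<open>d div 2\<close> are empty.\<close>

lemma block_bound:
  fixes D :: "nat \<Rightarrow> 'b \<Rightarrow> complex"
  assumes "spectral_bound lev D p"
  shows "\<exists>C>0. \<forall>k\<ge>1. \<forall>x. (\<Sum>n | blk n = k. (cmod (c n * D n x))\<^sup>2) \<le> C * real k powr p * b k"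
proof -
  let ?d = "CARD('d)"
  obtain C where C: "C > 0" "\<And>m x. (\<Sum>n | lev n = m. (cmod (D n x))\<^sup>2) \<le> C * (real m + 1) powr p"
    using assms unfolding spectral_bound_def by blast
  define L where "L = real (?d + 2)"
  have "(\<Sum>n | blk n = k. (cmod (c n * D n x))\<^sup>2) \<le> (C * L powr \<bar>p\<bar>) * real k powr p * b k"
    if k: "1 \<le> k" for k x
  proof (cases "?d div 2 \<le> k")
    case False
    then have "{n. blk n = k} = {}" by (auto simp: blk_def)
    then show ?thesis using C b_nonneg[of k] by (simp only:) simp
  next
    case True
    define m where "m = k - ?d div 2"
    have km: "k = m + ?d div 2" using True by (simp add: m_def)
    have e: "{n. blk n = k} = {n. lev n = m}" by (auto simp: blk_def km)
    have "(\<Sum>n | blk n = k. (cmod (c n * D n x))\<^sup>2) \<le> (\<Sum>n | lev n = m. b k * (cmod (D n x))\<^sup>2)"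
      unfolding e using c_le
      by (intro sum_mono) (auto simp: norm_mult power_mult_distrib km intro!: mult_right_mono)
    also have "\<dots> = b k * (\<Sum>n | lev n = m. (cmod (D n x))\<^sup>2)" by (simp add: sum_distrib_left)
    also have "\<dots> \<le> b k * (C * (L powr \<bar>p\<bar> * real k powr p))"
    proof -
      have "(real m + 1) powr p \<le> L powr \<bar>p\<bar> * real k powr p"
      proof (rule powr_comparable)
        have "real m + 1 \<le> 2 * real k" using k km by simp
        also have "\<dots> \<le> L * real k" by (intro mult_right_mono) (auto simp: L_def)
        finally show "real m + 1 \<le> L * real k" .
        have "real k \<le> real m + real ?d" using km by simp
        also have "\<dots> \<le> real m * L + L" by (intro add_mono) (auto simp: L_def algebra_simps)
        finally show "real k \<le> L * (real m + 1)" by (simp add: algebra_simps)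
      qed (use k in auto)
      then have "C * (real m + 1) powr p \<le> C * (L powr \<bar>p\<bar> * real k powr p)"
        using C by (intro mult_left_mono) auto
      then show ?thesis by (rule mult_left_mono[OF order_trans[OF C(2)] b_nonneg])
    qed
    finally show ?thesis by (simp add: mult_ac)
  qed
  moreover have "0 < C * L powr \<bar>p\<bar>" using C by (simp add: L_def)
  ultimately show ?thesis by blast
qed

text \<open>The ranges from \<open>2^j\<close> to \<open>2^(j+1)\<close> share endpoints, as in the
  hypothesis on the coefficients, so the union is only bounded by the sum of sums. The spectral
  exponent cancels: \<open>(\<gamma> + e) + (- \<gamma> - \<mu>) = e - \<mu>\<close>.\<close>

lemma range_bound:
  fixes D :: "nat \<Rightarrow> 'b \<Rightarrow> complex"
  assumes "spectral_bound lev D (gamma_exp CARD('d) + e)"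
  shows "\<exists>C>0. \<forall>J\<ge>1. \<forall>J' F x. F \<subseteq> dyad J J' \<longrightarrow> (\<Sum>n\<in>F. (cmod (c n * D n x))\<^sup>2) \<le> C * vsum e J J'"
proof -
  let ?p = "gamma_exp CARD('d) + e"
  obtain C where C: "C > 0" "\<And>k x. 1 \<le> k \<Longrightarrow> (\<Sum>n | blk n = k. (cmod (c n * D n x))\<^sup>2) \<le> C * real k powr ?p * b k"
    using block_bound[OF assms] by blast
  define C' where "C' = C * 2 powr \<bar>?p\<bar> * A"
  have "(\<Sum>n\<in>F. (cmod (c n * D n x))\<^sup>2) \<le> C' * vsum e J J'" if J: "1 \<le> J" and F: "F \<subseteq> dyad J J'" for J J' F x
  proof -
    let ?T = "\<lambda>n. (cmod (c n * D n x))\<^sup>2"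
    have blkfin: "finite {n. blk n = k}" for k
      by (rule finite_subset[OF _ blk_finite[of "Suc k"]]) auto
    have "sum ?T F \<le> sum ?T (\<Union>j\<in>{J..<J'}. \<Union>k\<in>{2^j..2^(j+1)}. {n. blk n = k})"
    proof (intro sum_mono2)
      show "finite (\<Union>j\<in>{J..<J'}. \<Union>k\<in>{2^j..2^(j+1)}. {n. blk n = k})" using blkfin by blast
      show "F \<subseteq> (\<Union>j\<in>{J..<J'}. \<Union>k\<in>{2^j..2^(j+1)}. {n. blk n = k})"
      proof
        fix n assume "n \<in> F"
        then have "2 ^ J \<le> blk n" "blk n < 2 ^ J'" using F by (auto simp: dyad_def)
        then obtain j where "J \<le> j" "j < J'" "2 ^ j \<le> blk n" "blk n < 2 ^ (j + 1)" by (rule dyadic_cover)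
        then show "n \<in> (\<Union>j\<in>{J..<J'}. \<Union>k\<in>{2^j..2^(j+1)}. {n. blk n = k})"
          by (auto intro!: bexI[of _ j])
      qed
    qed auto
    also have "\<dots> \<le> (\<Sum>j=J..<J'. sum ?T (\<Union>k\<in>{2^j..2^(j+1)}. {n. blk n = k}))"
      using blkfin by (intro sum_UN_le) auto
    also have "\<dots> \<le> (\<Sum>j=J..<J'. \<Sum>k=2^j..2^(j+1). sum ?T {n. blk n = k})"
      using blkfin by (intro sum_mono sum_UN_le) auto
    also have "\<dots> \<le> (\<Sum>j=J..<J'. C' * (2 powr ((e - \<mu>) * real j) * real j powr (2 * \<nu>)))"
    proof (intro sum_mono)
      fix j assume j: "j \<in> {J..<J'}"
      have j1: "1 \<le> j" using j J by simp
      have "(\<Sum>k=2^j..2^(j+1). sum ?T {n. blk n = k})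
          \<le> (\<Sum>k=2^j..2^(j+1). C * (2 powr \<bar>?p\<bar> * 2 powr (real j * ?p)) * b k)"
      proof (intro sum_mono)
        fix k :: nat assume k: "k \<in> {2^j..2^(j+1)}"
        have k1: "1 \<le> k" using k by (auto intro: order_trans[of _ "2 ^ j"])
        have kr: "2 ^ j \<le> real k" "real k \<le> 2 * 2 ^ j"
        proof -
          have "real (2 ^ j) \<le> real k" "real k \<le> real (2 ^ (j + 1))" using k by (simp_all only: of_nat_le_iff atLeastAtMost_iff)
          then show "2 ^ j \<le> real k" "real k \<le> 2 * 2 ^ j" by simp_all
        qed
        then have kr3: "2 ^ j \<le> 2 * real k" by linarith
        have "sum ?T {n. blk n = k} \<le> C * real k powr ?p * b k" by (rule C(2)[OF k1])
        also have "\<dots> \<le> C * (2 powr \<bar>?p\<bar> * (2 ^ j) powr ?p) * b k"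
          using kr kr3 k1 C b_nonneg by (intro mult_right_mono mult_left_mono powr_comparable) auto
        also have "(2 ^ j) powr ?p = 2 powr (real j * ?p)"
          by (simp add: powr_powr flip: powr_realpow)
        finally show "sum ?T {n. blk n = k} \<le> C * (2 powr \<bar>?p\<bar> * 2 powr (real j * ?p)) * b k" .
      qed
      also have "\<dots> = C * (2 powr \<bar>?p\<bar> * 2 powr (real j * ?p)) * (\<Sum>k=2^j..2^(j+1). b k)"
        by (simp add: sum_distrib_left)
      also have "\<dots> \<le> C * (2 powr \<bar>?p\<bar> * 2 powr (real j * ?p))
          * (A * 2 powr ((- gamma_exp CARD('d) - \<mu>) * real j) * real j powr (2 * \<nu>))"
        using C by (intro mult_left_mono b_sum j1) auto
      also have "\<dots> = C' * ((2 powr (real j * ?p) * 2 powr ((- gamma_exp CARD('d) - \<mu>) * real j)) * real j powr (2 * \<nu>))"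
        by (simp add: C'_def mult_ac)
      also have "2 powr (real j * ?p) * 2 powr ((- gamma_exp CARD('d) - \<mu>) * real j) = 2 powr ((e - \<mu>) * real j)"
        by (simp flip: powr_add) (simp add: algebra_simps)
      finally show "(\<Sum>k=2^j..2^(j+1). sum ?T {n. blk n = k}) \<le> C' * (2 powr ((e - \<mu>) * real j) * real j powr (2 * \<nu>))" .
    qed
    also have "\<dots> = C' * vsum e J J'" by (simp add: vsum_def sum_distrib_left)
    finally show ?thesis .
  qed
  moreover have "0 < C'" using C A_pos by (simp add: C'_def)
  ultimately show ?thesis by blast
qed

text \<open>The finite index type \<open>'d option\<close> lets the values and all components of the
  gradient pass through one union bound.\<close>

definition deriv_opt :: "'d option \<Rightarrow> nat \<Rightarrow> real^'d \<Rightarrow> complex" where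
  "deriv_opt s n = (case s of None \<Rightarrow> g n | Some i \<Rightarrow> partial_deriv i (g n))"

definition deriv_order :: "'d option \<Rightarrow> real" where
  "deriv_order s = (case s of None \<Rightarrow> 0 | Some i \<Rightarrow> 1)"

lemma deriv_opt_simps [simp]:
  "deriv_opt None n = g n" "deriv_opt (Some i) n = partial_deriv i (g n)"
  "deriv_order None = 0" "deriv_order (Some i) = 1"
  by (simp_all add: deriv_opt_def deriv_order_def)

lemma deriv_opt_span: "deriv_opt s n \<in> hermite_span"
  by (cases s) (auto intro: g_span hermite_span_deriv(2))

lemma deriv_opt_bounds:
  "spectral_bound lev (deriv_opt s) (gamma_exp CARD('d) + deriv_order s)"
  "spectral_bound lev (\<lambda>n. partial_deriv i (deriv_opt s n)) (gamma_exp CARD('d) + (deriv_order s + 1))"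
  "spectral_bound lev (\<lambda>n x. of_real (x $ i) * deriv_opt s n x) (gamma_exp CARD('d) + (deriv_order s + 1))"
proof -
  show "spectral_bound lev (deriv_opt s) (gamma_exp CARD('d) + deriv_order s)"
    using g_bound dg_bound by (cases s) (simp_all add: deriv_opt_def[abs_def])
  show "spectral_bound lev (\<lambda>n. partial_deriv i (deriv_opt s n)) (gamma_exp CARD('d) + (deriv_order s + 1))"
    using dg_bound ddg_bound by (cases s) simp_all
  show "spectral_bound lev (\<lambda>n x. of_real (x $ i) * deriv_opt s n x) (gamma_exp CARD('d) + (deriv_order s + 1))"
    using xg_bound xdg_bound by (cases s) simp_all
qed

lemma uniform_range_bounds:
  "\<exists>C>0. \<forall>s i. \<forall>J\<ge>1. \<forall>J' F x. F \<subseteq> dyad J J' \<longrightarrow>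
     (\<Sum>n\<in>F. (cmod (c n * deriv_opt s n x))\<^sup>2) \<le> C * vsum (deriv_order s) J J'
   \<and> (\<Sum>n\<in>F. (cmod (c n * partial_deriv i (deriv_opt s n) x))\<^sup>2) \<le> C * vsum (deriv_order s + 1) J J'
   \<and> (\<Sum>n\<in>F. (cmod (c n * (of_real (x $ i) * deriv_opt s n x)))\<^sup>2) \<le> C * vsum (deriv_order s + 1) J J'"
proof -
  define bnd where "bnd = (\<lambda>(D :: nat \<Rightarrow> real^'d \<Rightarrow> complex) e C. \<forall>J\<ge>1. \<forall>J' F x. F \<subseteq> dyad J J' \<longrightarrow>
     (\<Sum>n\<in>F. (cmod (c n * D n x))\<^sup>2) \<le> C * vsum e J J')"
  have ex: "\<exists>C>0. bnd D e C" if "spectral_bound lev D (gamma_exp CARD('d) + e)" for D e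
    using range_bound[OF that] by (simp add: bnd_def)
  have mono: "bnd D e C'" if "bnd D e C" "C \<le> C'" for D e C C'
    using that unfolding bnd_def by (meson mult_right_mono order_trans vsum_nonneg)
  define Q where "Q = (\<lambda>(s, i) C. bnd (deriv_opt s) (deriv_order s) C
     \<and> bnd (\<lambda>n. partial_deriv i (deriv_opt s n)) (deriv_order s + 1) C
     \<and> bnd (\<lambda>n x. of_real (x $ i) * deriv_opt s n x) (deriv_order s + 1) C)"
  have "\<exists>C>0. \<forall>si. Q si C"
  proof (rule uniform_constant)
    fix si :: "'d option \<times> 'd"
    obtain s i where si: "si = (s, i)" by (cases si)
    obtain C1 C2 C3 where C: "C1 > 0" "bnd (deriv_opt s) (deriv_order s) C1"
      "C2 > 0" "bnd (\<lambda>n. partial_deriv i (deriv_opt s n)) (deriv_order s + 1) C2"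
      "C3 > 0" "bnd (\<lambda>n x. of_real (x $ i) * deriv_opt s n x) (deriv_order s + 1) C3"
      using ex[OF deriv_opt_bounds(1)] ex[OF deriv_opt_bounds(2)] ex[OF deriv_opt_bounds(3)] by blast
    have le: "C1 \<le> C1 + C2 + C3" "C2 \<le> C1 + C2 + C3" "C3 \<le> C1 + C2 + C3" using C(1,3,5) by auto
    have "Q si (C1 + C2 + C3)"
      unfolding si Q_def using mono[OF C(2) le(1)] mono[OF C(4) le(2)] mono[OF C(6) le(3)] by simp
    moreover have "0 < C1 + C2 + C3" using C by simp
    ultimately show "\<exists>C>0. Q si C" by blast
  next
    show "Q si C'" if "Q si C" "C \<le> C'" for si C C'
      using that mono by (cases si) (auto simp: Q_def)
  qed
  then obtain C where "C > 0" and C: "\<And>s i. Q (s, i) C" by blast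
  have D: "(\<Sum>n\<in>F. (cmod (c n * D n x))\<^sup>2) \<le> C * vsum e J J'"
    if "bnd D e C" "1 \<le> J" "F \<subseteq> dyad J J'" for D e C J J' F x
    using that unfolding bnd_def by simp
  have C': "bnd (deriv_opt s) (deriv_order s) C" "bnd (\<lambda>n. partial_deriv i (deriv_opt s n)) (deriv_order s + 1) C"
    "bnd (\<lambda>n x. of_real (x $ i) * deriv_opt s n x) (deriv_order s + 1) C" for s i
    using C[of s i] unfolding Q_def prod.case by simp_all
  show ?thesis
    by (intro exI[of _ C] conjI allI impI \<open>C > 0\<close>) (rule D[OF C'(1)] D[OF C'(2)] D[OF C'(3)]; assumption)+
qed

text \<open>The whole probabilistic content for a single outcome; everything afterwards is
  deterministic. \<open>B\<close> will not depend on the outcome, while \<open>J0\<close> will. Only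
  the upper end \<open>J'\<close> has to be large, and the truncation \<open>N\<close> serves the
  convergence of partial sums.\<close>

definition tame :: "real \<Rightarrow> (nat \<Rightarrow> complex) \<Rightarrow> bool" where
  "tame B a \<longleftrightarrow> (\<exists>J0. \<forall>J'\<ge>J0. \<forall>J N s x. 1 \<le> J \<and> J < J' \<longrightarrow>
     cmod (\<Sum>n\<in>dyad J J' \<inter> {..<N}. a n * deriv_opt s n x)
       \<le> B * sqrt (vsum (deriv_order s) J J' * real J'))"

end

locale random_hermite_series = subgaussian_family M X \<sigma> + hermite_series lev g c b \<mu> \<nu> A
  for M :: "'w measure" and X \<sigma> lev and g :: "nat \<Rightarrow> real^'d::finite \<Rightarrow> complex" and c b \<mu> \<nu> A
begin

lemma AE_tame: "\<exists>B>0. AE \<omega> in M. tame B (\<lambda>n. c n * of_real (X n \<omega>))"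
proof -
  let ?d = "CARD('d)"
  \<comment> \<open>Fewer than \<open>K\<close> blocks contain at most \<open>K^(d + 1)\<close>
    indices, whence \<open>a\<close>. The union over \<open>J\<close>, \<open>N\<close> and
    \<open>s\<close> has at most a multiple of \<open>2^J' * 2^(a J')\<close> members, so
    \<open>p = a + 3\<close> leaves the summable \<open>4^(- J')\<close>.\<close>
  define a where "a = ?d + 1"
  define p where "p = a + 3"
  obtain C where C: "C > 0" and CF0: "\<forall>s i. \<forall>J\<ge>1. \<forall>J' F x. F \<subseteq> dyad J J' \<longrightarrow>
       (\<Sum>n\<in>F. (cmod (c n * deriv_opt s n x))\<^sup>2) \<le> C * vsum (deriv_order s) J J'
     \<and> (\<Sum>n\<in>F. (cmod (c n * partial_deriv i (deriv_opt s n) x))\<^sup>2) \<le> C * vsum (deriv_order s + 1) J J'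
     \<and> (\<Sum>n\<in>F. (cmod (c n * (of_real (x $ i) * deriv_opt s n x)))\<^sup>2) \<le> C * vsum (deriv_order s + 1) J J'"
    using uniform_range_bounds by (elim exE conjE)
  note CF = CF0[rule_format]
  obtain B where B: "B > 0" and sup0: "\<forall>J\<ge>1. \<forall>F (f :: nat \<Rightarrow> real^'d \<Rightarrow> complex) f' V.
     finite F \<and> card F \<le> 2 ^ (a * J) \<and> 0 \<le> V
     \<and> (\<forall>n\<in>F. \<forall>x. (f n has_derivative (\<lambda>v. \<Sum>i\<in>UNIV. v $ i *\<^sub>R f' i n x)) (at x))
     \<and> (\<forall>x. (\<Sum>n\<in>F. (cmod (f n x))\<^sup>2) \<le> V)
     \<and> (\<forall>i x. (\<Sum>n\<in>F. (cmod (f' i n x))\<^sup>2) \<le> V * 2 ^ (a * J))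
     \<and> (\<forall>x. (norm x)\<^sup>2 * (\<Sum>n\<in>F. (cmod (f n x))\<^sup>2) \<le> V * 2 ^ (a * J))
     \<longrightarrow> (\<exists>Bad\<in>events. prob Bad \<le> 1 / 2 ^ (p * J)
          \<and> (\<forall>\<omega>\<in>space M - Bad. \<forall>x. cmod (\<Sum>n\<in>F. of_real (X n \<omega>) * f n x) \<le> B * sqrt (V * real J)))"
    using sup_bound[of a p, where 'd = 'd] by (elim exE conjE)
  have J'pow: "2 ^ J \<le> (2::real) ^ (a * J)" for J by (intro power_increasing) (auto simp: a_def)
  have dJ: "real ?d * 2 ^ J \<le> 2 ^ (a * J)" if "1 \<le> J" for J
  proof -
    have "real ?d \<le> 2 ^ ?d" using of_nat_less_two_power[of ?d, where 'a = real] by simp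
    also have "\<dots> \<le> 2 ^ (?d * J)" using that by (intro power_increasing) auto
    finally have "real ?d * 2 ^ J \<le> 2 ^ (?d * J) * 2 ^ J" by (intro mult_right_mono) auto
    then show ?thesis by (simp add: a_def power_add)
  qed
  have bad: "\<exists>Bad\<in>events. prob Bad \<le> 1 / 2 ^ (p * J')
      \<and> (\<forall>\<omega>\<in>space M - Bad. \<forall>x. cmod (\<Sum>n\<in>dyad J J' \<inter> {..<N}. (c n * of_real (X n \<omega>)) * deriv_opt s n x)
          \<le> B * sqrt (C * vsum (deriv_order s) J J' * real J'))"
    if J: "1 \<le> J" "J < J'" for J J' N s
  proof -
    let ?F = "dyad J J' \<inter> {..<N}"
    let ?V = "C * vsum (deriv_order s) J J'"
    have J'1: "1 \<le> J'" using J by simp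
    have F: "?F \<subseteq> dyad J J'" by auto
    have vs: "C * vsum (deriv_order s + 1) J J' \<le> ?V * 2 ^ J'"
      using mult_left_mono[OF vsum_Suc_le, of C "deriv_order s" J J'] C by (simp add: mult_ac)
    have V0: "0 \<le> ?V" using C vsum_nonneg by simp
    have "\<exists>Bad\<in>events. prob Bad \<le> 1 / 2 ^ (p * J')
          \<and> (\<forall>\<omega>\<in>space M - Bad. \<forall>x. cmod (\<Sum>n\<in>?F. of_real (X n \<omega>) * (c n * deriv_opt s n x)) \<le> B * sqrt (?V * real J'))"
    proof (rule sup0[THEN spec, THEN mp, OF J'1, THEN spec[of _ ?F],
          THEN spec[of _ "\<lambda>n x. c n * deriv_opt s n x"],
          THEN spec[of _ "\<lambda>i n x. c n * partial_deriv i (deriv_opt s n) x"],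
          THEN spec[of _ ?V], THEN mp], intro conjI)
      show "finite ?F" using dyad_finite by simp
      have "card ?F \<le> card {n. blk n < 2 ^ J'}" by (intro card_mono blk_finite) (auto simp: dyad_def)
      also have "\<dots> \<le> 2 ^ J' * (2 ^ J') ^ ?d" by (rule blk_card)
      also have "\<dots> = 2 ^ (a * J')" by (simp add: a_def power_add mult.commute flip: power_mult)
      finally show "card ?F \<le> 2 ^ (a * J')" .
      show "0 \<le> ?V" by (rule V0)
      show "\<forall>n\<in>?F. \<forall>x. ((\<lambda>x. c n * deriv_opt s n x) has_derivative
          (\<lambda>v. \<Sum>i\<in>UNIV. v $ i *\<^sub>R (c n * partial_deriv i (deriv_opt s n) x))) (at x)"
      proof (intro ballI allI)
        fix n x
        have "((\<lambda>x. c n * deriv_opt s n x) has_derivative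
          (\<lambda>v. c n * (\<Sum>i\<in>UNIV. v $ i *\<^sub>R partial_deriv i (deriv_opt s n) x))) (at x)"
          by (intro has_derivative_mult_right hermite_span_deriv(1) deriv_opt_span)
        then show "((\<lambda>x. c n * deriv_opt s n x) has_derivative
          (\<lambda>v. \<Sum>i\<in>UNIV. v $ i *\<^sub>R (c n * partial_deriv i (deriv_opt s n) x))) (at x)"
          by (simp add: sum_distrib_left)
      qed
      show "\<forall>x. (\<Sum>n\<in>?F. (cmod (c n * deriv_opt s n x))\<^sup>2) \<le> ?V" using CF[OF J(1) F] by blast
      show "\<forall>i x. (\<Sum>n\<in>?F. (cmod (c n * partial_deriv i (deriv_opt s n) x))\<^sup>2) \<le> ?V * 2 ^ (a * J')"
      proof (intro allI)
        fix i x
        have "(\<Sum>n\<in>?F. (cmod (c n * partial_deriv i (deriv_opt s n) x))\<^sup>2) \<le> C * vsum (deriv_order s + 1) J J'"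
          using CF[OF J(1) F] by blast
        also note vs
        also have "?V * 2 ^ J' \<le> ?V * 2 ^ (a * J')" by (intro mult_left_mono J'pow V0)
        finally show "(\<Sum>n\<in>?F. (cmod (c n * partial_deriv i (deriv_opt s n) x))\<^sup>2) \<le> ?V * 2 ^ (a * J')" .
      qed
      show "\<forall>x. (norm x)\<^sup>2 * (\<Sum>n\<in>?F. (cmod (c n * deriv_opt s n x))\<^sup>2) \<le> ?V * 2 ^ (a * J')"
      proof
        fix x :: "real^'d"
        have "(norm x)\<^sup>2 * (\<Sum>n\<in>?F. (cmod (c n * deriv_opt s n x))\<^sup>2)
            = (\<Sum>i\<in>UNIV. \<Sum>n\<in>?F. (cmod (c n * (of_real (x $ i) * deriv_opt s n x)))\<^sup>2)"
          by (simp add: norm_vec_sq sum_distrib_right sum_distrib_left norm_mult power_mult_distrib mult_ac)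
            (rule sum.swap)
        also have "\<dots> \<le> (\<Sum>i\<in>(UNIV::'d set). C * vsum (deriv_order s + 1) J J')"
          using CF[OF J(1) F] by (intro sum_mono) blast
        also have "\<dots> = real ?d * (C * vsum (deriv_order s + 1) J J')" by simp
        also have "\<dots> \<le> real ?d * (?V * 2 ^ J')" by (intro mult_left_mono vs) auto
        also have "\<dots> = ?V * (real ?d * 2 ^ J')" by simp
        also have "\<dots> \<le> ?V * 2 ^ (a * J')" by (intro mult_left_mono dJ J'1 V0)
        finally show "(norm x)\<^sup>2 * (\<Sum>n\<in>?F. (cmod (c n * deriv_opt s n x))\<^sup>2) \<le> ?V * 2 ^ (a * J')" .
      qed
    qed
    then show ?thesis by (simp add: mult_ac)
  qed
  define Bad where "Bad = (\<lambda>J J' N s. SOME E. E \<in> events \<and> prob E \<le> 1 / 2 ^ (p * J')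
      \<and> (\<forall>\<omega>\<in>space M - E. \<forall>x. cmod (\<Sum>n\<in>dyad J J' \<inter> {..<N}. (c n * of_real (X n \<omega>)) * deriv_opt s n x)
          \<le> B * sqrt (C * vsum (deriv_order s) J J' * real J')))"
  have Bad_all: "Bad J J' N s \<in> events \<and> prob (Bad J J' N s) \<le> 1 / 2 ^ (p * J')
      \<and> (\<forall>\<omega>\<in>space M - Bad J J' N s. \<forall>x. cmod (\<Sum>n\<in>dyad J J' \<inter> {..<N}. (c n * of_real (X n \<omega>)) * deriv_opt s n x)
          \<le> B * sqrt (C * vsum (deriv_order s) J J' * real J'))"
    if "1 \<le> J" "J < J'" for J J' N s
    unfolding Bad_def by (rule someI_ex) (rule bad[OF that, unfolded Bex_def])
  have Bad: "Bad J J' N s \<in> events" "prob (Bad J J' N s) \<le> 1 / 2 ^ (p * J')"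
    if "1 \<le> J" "J < J'" for J J' N s
    using Bad_all[OF that] by blast+
  define Nmax where "Nmax = (\<lambda>J'. 2 ^ (a * J') :: nat)"
  define I where "I = (\<lambda>J'. {1..<J'} \<times> {..Nmax J'} \<times> (UNIV :: 'd option set))"
  define E where "E = (\<lambda>J'. \<Union>(J, N, s)\<in>I J'. Bad J J' N s)"
  have I_fin: "finite (I J')" for J' by (simp add: I_def)
  have E_meas: "E J' \<in> events" for J'
    unfolding E_def using I_fin by (intro sets.finite_UN) (auto simp: I_def intro: Bad)
  have E_prob: "prob (E J') \<le> 2 * (real ?d + 1) * (1 / 4) ^ J'" for J'
  proof -
    have "prob (E J') \<le> (\<Sum>i\<in>I J'. prob (case i of (J, N, s) \<Rightarrow> Bad J J' N s))"
      unfolding E_def using I_fin by (intro measure_UNION_le) (auto simp: I_def intro: Bad)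
    also have "\<dots> \<le> (\<Sum>i\<in>I J'. 1 / 2 ^ (p * J'))"
      by (intro sum_mono) (auto simp: I_def intro!: Bad)
    also have "\<dots> = real (card (I J')) / 2 ^ (p * J')" by simp
    also have "\<dots> \<le> (2 ^ J' * (2 * 2 ^ (a * J')) * (real ?d + 1)) / 2 ^ (p * J')"
    proof (intro divide_right_mono)
      have "real (card (I J')) = real (J' - 1) * (real (Nmax J') + 1) * (real ?d + 1)"
      proof -
        have "card (I J') = (J' - 1) * (Nmax J' + 1) * (?d + 1)"
          by (simp add: I_def card_cartesian_product card_UNIV_option distrib_left distrib_right)
        then show ?thesis by (simp only: of_nat_mult of_nat_add of_nat_1)
      qed
      also have "\<dots> \<le> 2 ^ J' * (2 * 2 ^ (a * J')) * (real ?d + 1)"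
      proof (intro mult_mono)
        have "real (J' - 1) \<le> real J'" by simp
        also have "\<dots> \<le> 2 ^ J'" using of_nat_less_two_power[of J', where 'a = real] by simp
        finally show "real (J' - 1) \<le> 2 ^ J'" .
        have "(1::real) \<le> 2 ^ (a * J')" by simp
        then show "real (Nmax J') + 1 \<le> 2 * 2 ^ (a * J')" by (simp add: Nmax_def)
      qed auto
      finally show "real (card (I J')) \<le> 2 ^ J' * (2 * 2 ^ (a * J')) * (real ?d + 1)" .
    qed auto
    also have "\<dots> = 2 * (real ?d + 1) * (1 / 4) ^ J'"
    proof -
      have "(2::real) ^ (p * J') = 2 ^ J' * 2 ^ (a * J') * 4 ^ J'"
      proof -
        have "p * J' = J' + a * J' + 2 * J'" by (simp add: p_def algebra_simps)
        then show ?thesis by (simp only: power_add power_mult[of 2 2]) simp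
      qed
      then show ?thesis by (simp add: power_divide)
    qed
    finally show ?thesis .
  qed
  have "AE \<omega> in M. eventually (\<lambda>J'. \<omega> \<in> space M - E J') sequentially"
  proof (rule borel_cantelli_AE1[OF E_meas])
    show "emeasure M (E n) < \<infinity>" for n by (simp add: emeasure_eq_measure)
    show "summable (\<lambda>J'. prob (E J'))"
    proof (rule summable_comparison_test')
      show "summable (\<lambda>J'. 2 * (real ?d + 1) * (1 / 4) ^ J')"
        by (intro summable_mult summable_geometric) simp
      show "norm (prob (E n)) \<le> 2 * (real ?d + 1) * (1 / 4) ^ n" if "0 \<le> n" for n using E_prob by simp
    qed
  qed
  then have "AE \<omega> in M. tame (B * sqrt C) (\<lambda>n. c n * of_real (X n \<omega>))"
  proof eventually_elim
    case (elim \<omega>)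
    then obtain J0 where J0: "\<And>J'. J0 \<le> J' \<Longrightarrow> \<omega> \<in> space M - E J'"
      by (auto simp: eventually_sequentially)
    have "cmod (\<Sum>n\<in>dyad J J' \<inter> {..<N}. (c n * of_real (X n \<omega>)) * deriv_opt s n x)
       \<le> B * sqrt C * sqrt (vsum (deriv_order s) J J' * real J')"
      if J: "J0 \<le> J'" "1 \<le> J" "J < J'" for J J' N s x
    proof -
      \<comment> \<open>Beyond \<open>Nmax J'\<close> a truncation no longer changes the set, so the
        finitely many values in \<open>I J'\<close> represent all \<open>N\<close>.\<close>
      define N' where "N' = min N (Nmax J')"
      have "dyad J J' \<inter> {..<N} = dyad J J' \<inter> {..<N'}"
      proof -
        have "n < Nmax J'" if "n \<in> dyad J J'" for n
        proof -
          have "n < card {n. blk n < 2 ^ J'}" using that by (intro blk_le_imp_less_card) (auto simp: dyad_def)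
          also have "\<dots> \<le> 2 ^ J' * (2 ^ J') ^ ?d" by (rule blk_card)
          also have "\<dots> = Nmax J'" by (simp add: Nmax_def a_def power_add mult.commute flip: power_mult)
          finally show ?thesis .
        qed
        then show ?thesis by (auto simp: N'_def)
      qed
      moreover have "\<omega> \<in> space M - Bad J J' N' s"
        using J0[OF J(1)] J by (auto simp: E_def I_def N'_def)
      ultimately have "cmod (\<Sum>n\<in>dyad J J' \<inter> {..<N}. (c n * of_real (X n \<omega>)) * deriv_opt s n x)
          \<le> B * sqrt (C * vsum (deriv_order s) J J' * real J')"
        using Bad_all[OF J(2,3), of N' s] by simp
      then show ?thesis by (simp add: real_sqrt_mult mult.assoc)
    qed
    then show ?case unfolding tame_def by blast
  qed
  moreover have "0 < B * sqrt C" using B C by simp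
  ultimately show ?thesis by blast
qed

end

section \<open>Convergence of the series\<close>

lemma telescope_limit:
  fixes Q :: "nat \<Rightarrow> 'a::banach"
  assumes A: "summable A" and Q: "\<And>i. i0 \<le> i \<Longrightarrow> norm (Q (Suc i) - Q i) \<le> A i"
  shows "Q \<longlonglongrightarrow> lim Q" and "\<And>i. i0 \<le> i \<Longrightarrow> norm (lim Q - Q i) \<le> (\<Sum>k. A (i + k))"
proof -
  have step: "\<exists>L. Q \<longlonglongrightarrow> L \<and> norm (L - Q i) \<le> (\<Sum>k. A (i + k))" if i: "i0 \<le> i" for i
  proof -
    have sA: "summable (\<lambda>k. A (i + k))" using summable_ignore_initial_segment[OF A, of i] by (simp add: add.commute)
    have b: "norm (Q (Suc (i + k)) - Q (i + k)) \<le> A (i + k)" for k using Q i by simp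
    have sn: "summable (\<lambda>k. norm (Q (Suc (i + k)) - Q (i + k)))"
      by (rule summable_comparison_test'[OF sA, of 0]) (simp add: b)
    define D where "D = (\<Sum>k. Q (Suc (i + k)) - Q (i + k))"
    have "(\<lambda>k. Q (Suc (i + k)) - Q (i + k)) sums D"
      unfolding D_def by (rule summable_sums[OF summable_norm_cancel[OF sn]])
    moreover have "(\<Sum>k<n. Q (Suc (i + k)) - Q (i + k)) = Q (i + n) - Q i" for n
      by (induction n) auto
    ultimately have "(\<lambda>n. Q (i + n) - Q i) \<longlonglongrightarrow> D" by (simp add: sums_def)
    then have "(\<lambda>n. Q (i + n) - Q i + Q i) \<longlonglongrightarrow> D + Q i" by (intro tendsto_intros)
    then have "(\<lambda>n. Q (n + i)) \<longlonglongrightarrow> D + Q i" by (simp add: add.commute)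
    then have "Q \<longlonglongrightarrow> D + Q i" by (rule LIMSEQ_offset)
    moreover have "norm D \<le> (\<Sum>k. norm (Q (Suc (i + k)) - Q (i + k)))"
      unfolding D_def by (rule summable_norm[OF sn])
    moreover have "\<dots> \<le> (\<Sum>k. A (i + k))" by (rule suminf_le[OF b sn sA])
    ultimately show ?thesis by (intro exI[of _ "D + Q i"]) auto
  qed
  from step[of i0] obtain L where "Q \<longlonglongrightarrow> L" by blast
  then show "Q \<longlonglongrightarrow> lim Q" by (simp add: limI)
  show "norm (lim Q - Q i) \<le> (\<Sum>k. A (i + k))" if "i0 \<le> i" for i
    using step[OF that] limI by blast
qed

text \<open>The product of the functions \<open>1 / (1 + t^2)\<close> of the coordinates is a
  majorant whose integrability is one-dimensional; its inverse is at most
  \<open>(1 + |x|^2)^d\<close>, which the seminorms of orders 0 and \<open>2 d\<close>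
  control.\<close>

lemma schwartz_integrable:
  fixes \<psi> :: "real^'d::finite \<Rightarrow> complex"
  assumes "schwartz \<psi>"
  shows "integrable lborel \<psi>"
proof -
  let ?d = "CARD('d)"
  have diff: "\<psi> differentiable (at x)" for x
    using assms unfolding schwartz_def by (metis iterated_partial_deriv.simps(1))
  have "\<exists>C. \<forall>x. norm x ^ k * cmod (\<psi> x) \<le> C" for k
  proof -
    have "bounded (range (\<lambda>x. norm x ^ k *\<^sub>R iterated_partial_deriv [] \<psi> x))"
      using assms unfolding schwartz_def by blast
    then show ?thesis by (auto simp: bounded_iff)
  qed
  then obtain C where C: "\<And>k x. norm x ^ k * cmod (\<psi> x) \<le> C k" by metis
  have "continuous_on UNIV \<psi>"
    by (intro continuous_at_imp_continuous_on ballI differentiable_imp_continuous_within diff)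
  then have [measurable]: "\<psi> \<in> borel_measurable borel" by (rule borel_measurable_continuous_onI)
  have "set_integrable lborel (einterval (-\<infinity>) \<infinity>) (\<lambda>x. inverse (1 + x\<^sup>2))"
    by (rule integrable_inverse_1_plus_square)
  then have "integrable lborel (\<lambda>t::real. inverse (1 + t\<^sup>2))" by (simp add: set_integrable_def)
  then have int: "integrable lborel (\<lambda>x::real^'d. \<Prod>i\<in>UNIV. inverse (1 + (x $ i)\<^sup>2))"
    by (intro integrable_prod_vec)
  have bound: "cmod (\<psi> x) \<le> (2 ^ ?d * (C 0 + C (2 * ?d))) * (\<Prod>i\<in>UNIV. inverse (1 + (x $ i)\<^sup>2))" for x
  proof -
    let ?P = "\<Prod>i\<in>UNIV. 1 + (x $ i)\<^sup>2"
    have P: "0 < ?P" by (intro prod_pos) (auto intro: add_pos_nonneg)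
    have "?P \<le> (\<Prod>i\<in>(UNIV :: 'd set). 1 + (norm x)\<^sup>2)"
      by (intro prod_mono) (auto simp: norm_vec_sq intro!: member_le_sum[of _ UNIV "\<lambda>i. (x $ i)\<^sup>2"])
    also have "\<dots> = (1 + (norm x)\<^sup>2) ^ ?d" by simp
    also have "\<dots> \<le> (2 * max 1 ((norm x)\<^sup>2)) ^ ?d" by (intro power_mono) auto
    also have "\<dots> \<le> 2 ^ ?d * (1 + norm x ^ (2 * ?d))"
      by (simp add: power_mult_distrib max_def flip: power_mult)
    finally have "?P * cmod (\<psi> x) \<le> 2 ^ ?d * (1 + norm x ^ (2 * ?d)) * cmod (\<psi> x)"
      by (intro mult_right_mono) auto
    also have "\<dots> = 2 ^ ?d * (norm x ^ 0 * cmod (\<psi> x) + norm x ^ (2 * ?d) * cmod (\<psi> x))"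
      by (simp add: algebra_simps)
    also have "\<dots> \<le> 2 ^ ?d * (C 0 + C (2 * ?d))" by (intro mult_left_mono add_mono C) auto
    finally have "cmod (\<psi> x) \<le> (2 ^ ?d * (C 0 + C (2 * ?d))) / ?P"
      using P by (simp add: le_divide_eq mult.commute)
    moreover have "inverse ?P = (\<Prod>i\<in>UNIV. inverse (1 + (x $ i)\<^sup>2))"
      using prod_inversef[of "\<lambda>i. 1 + (x $ i)\<^sup>2" UNIV] by (simp add: comp_def)
    ultimately show ?thesis by (simp add: divide_inverse)
  qed
  show ?thesis
  proof (rule Bochner_Integration.integrable_bound)
    show "integrable lborel (\<lambda>x::real^'d. (2 ^ ?d * (C 0 + C (2 * ?d))) * (\<Prod>i\<in>UNIV. inverse (1 + (x $ i)\<^sup>2)))"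
      by (intro integrable_mult_right int)
    show "AE x in lborel. norm (\<psi> x) \<le> norm ((2 ^ ?d * (C 0 + C (2 * ?d))) * (\<Prod>i\<in>UNIV. inverse (1 + (x $ i)\<^sup>2)))"
      unfolding real_norm_def by (intro AE_I2 order_trans[OF bound abs_ge_self])
  qed measurable
qed

context hermite_series
begin

definition head :: "(nat \<Rightarrow> complex) \<Rightarrow> nat \<Rightarrow> real^'d \<Rightarrow> complex" where
  "head a J x = (\<Sum>n | blk n < 2 ^ J. a n * g n x)"

definition dhead :: "(nat \<Rightarrow> complex) \<Rightarrow> 'd \<Rightarrow> nat \<Rightarrow> real^'d \<Rightarrow> complex" where
  "dhead a i J x = (\<Sum>n | blk n < 2 ^ J. a n * partial_deriv i (g n) x)"

text \<open>Contribution of one rung of a ladder \<open>l\<close> of dyadic exponents.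
  \<open>l = Suc\<close> takes the dyadic blocks one at a time, \<open>l i = 2^i\<close> takes
  super-blocks; both go through the same convergence argument. \<open>e = 0\<close> stands for
  values and \<open>e = 1\<close> for gradients.\<close>

definition osc :: "real \<Rightarrow> real \<Rightarrow> (nat \<Rightarrow> nat) \<Rightarrow> nat \<Rightarrow> real" where
  "osc e B l i = B * sqrt (vsum e (l i) (l (Suc i)) * real (l (Suc i)))"

lemma head_split:
  assumes "J \<le> J'"
  shows "(\<Sum>n | blk n < 2 ^ J'. f n) = (\<Sum>n | blk n < 2 ^ J. f n) + (\<Sum>n\<in>dyad J J'. f n)"
proof -
  have p: "(2::nat) ^ J \<le> 2 ^ J'" using assms by (intro power_increasing) auto
  have "{n. blk n < 2 ^ J'} = {n. blk n < 2 ^ J} \<union> dyad J J'"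
    by (auto simp: dyad_def intro: less_le_trans[OF _ p])
  moreover have "{n. blk n < 2 ^ J} \<inter> dyad J J' = {}" by (auto simp: dyad_def)
  ultimately show ?thesis by (simp add: sum.union_disjoint blk_finite dyad_finite)
qed

lemma dyad_lessThan: "\<exists>N. dyad J J' \<inter> {..<N} = dyad J J'"
  using finite_nat_set_iff_bounded[of "dyad J J'"] dyad_finite by blast

lemma head_has_derivative:
  "(head a J has_derivative (\<lambda>v. \<Sum>i\<in>UNIV. v $ i *\<^sub>R dhead a i J x)) (at x)"
proof -
  have "((\<lambda>x. \<Sum>n | blk n < 2 ^ J. a n * g n x) has_derivative
     (\<lambda>v. \<Sum>n | blk n < 2 ^ J. a n * (\<Sum>i\<in>UNIV. v $ i *\<^sub>R partial_deriv i (g n) x))) (at x)"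
    by (intro has_derivative_sum has_derivative_mult_right hermite_span_deriv(1) g_span)
  moreover have "(\<Sum>n | blk n < 2 ^ J. a n * (\<Sum>i\<in>UNIV. v $ i *\<^sub>R partial_deriv i (g n) x))
     = (\<Sum>i\<in>UNIV. v $ i *\<^sub>R dhead a i J x)" for v :: "real^'d"
    by (simp add: dhead_def sum_distrib_left scaleR_sum_right) (rule sum.swap)
  ultimately show ?thesis by (simp add: head_def[abs_def])
qed

lemma tame_ladder:
  assumes "tame B a" and l: "strict_mono l" "1 \<le> l 0"
  obtains i0 where
    "\<And>i N x. i0 \<le> i \<Longrightarrow> cmod (\<Sum>n\<in>dyad (l i) (l (Suc i)) \<inter> {..<N}. a n * g n x) \<le> osc 0 B l i"
    "\<And>i x. i0 \<le> i \<Longrightarrow> cmod (head a (l (Suc i)) x - head a (l i) x) \<le> osc 0 B l i"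
    "\<And>i j x. i0 \<le> i \<Longrightarrow> cmod (dhead a j (l (Suc i)) x - dhead a j (l i) x) \<le> osc 1 B l i"
proof -
  obtain J0 where J0_all: "\<forall>J'\<ge>J0. \<forall>J N s x. 1 \<le> J \<and> J < J' \<longrightarrow>
     cmod (\<Sum>n\<in>dyad J J' \<inter> {..<N}. a n * deriv_opt s n x) \<le> B * sqrt (vsum (deriv_order s) J J' * real J')"
    using assms(1) unfolding tame_def by (elim exE)
  note J0 = J0_all[rule_format, OF _ conjI]
  have lm: "l i < l (Suc i)" "1 \<le> l i" "i \<le> l i" for i
  proof -
    show "l i < l (Suc i)" using l(1) by (simp add: strict_mono_def)
    show "1 \<le> l i" using l by (metis le0 order_trans strict_mono_less_eq)
    show "i \<le> l i" by (rule strict_mono_imp_increasing[OF l(1)])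
  qed
  have key: "cmod (\<Sum>n\<in>dyad (l i) (l (Suc i)) \<inter> {..<N}. a n * deriv_opt s n x) \<le> osc (deriv_order s) B l i"
    if "J0 \<le> i" for i N s x
    unfolding osc_def using lm(1,2)[of i] lm(3)[of "Suc i"] that by (intro J0) auto
  have full: "cmod (\<Sum>n\<in>dyad (l i) (l (Suc i)). a n * deriv_opt s n x) \<le> osc (deriv_order s) B l i"
    if "J0 \<le> i" for i s x
    using dyad_lessThan[of "l i" "l (Suc i)"] key[OF that] by metis
  show ?thesis
  proof (rule that[of J0])
    fix i N x assume i: "J0 \<le> i"
    show "cmod (\<Sum>n\<in>dyad (l i) (l (Suc i)) \<inter> {..<N}. a n * g n x) \<le> osc 0 B l i"
      using key[OF i, where N = N and s = None and x = x] by simp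
    show "cmod (head a (l (Suc i)) x - head a (l i) x) \<le> osc 0 B l i"
      using full[OF i, where s = None and x = x] head_split[OF less_imp_le[OF lm(1)[of i]], of "\<lambda>n. a n * g n x"]
      by (simp add: head_def)
    show "cmod (dhead a j (l (Suc i)) x - dhead a j (l i) x) \<le> osc 1 B l i" for j
      using full[OF i, where s = "Some j" and x = x] head_split[OF less_imp_le[OF lm(1)[of i]], of "\<lambda>n. a n * partial_deriv j (g n) x"]
      by (simp add: dhead_def)
  qed
qed

text \<open>Take the first \<open>i'\<close> whose next head contains all \<open>n < N\<close>. By
  minimality and monotonicity of \<open>blk\<close>, the head at \<open>i'\<close> is still inside
  \<open>{..<N}\<close>; for the starting index this is the hypothesis on \<open>N\<close>. The
  partial sum is then a head plus a truncated rung, which \<open>tame\<close> controls.\<close>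

lemma lessThan_between_heads:
  assumes l: "strict_mono l" and N: "card {n. blk n < 2 ^ l i} \<le> N"
  obtains i' where "i \<le> i'" "{n. blk n < 2 ^ l i'} \<subseteq> {..<N}" "{..<N} \<subseteq> {n. blk n < 2 ^ l (Suc i')}"
proof -
  let ?P = "\<lambda>k. {..<N} \<subseteq> {n. blk n < 2 ^ l (Suc (i + k))}"
  have "\<exists>k. ?P k"
  proof
    show "?P (blk N)"
    proof
      fix n assume "n \<in> {..<N}"
      then have "blk n \<le> blk N" by (intro blk_mono) auto
      also have "blk N < 2 ^ blk N" by (rule less_exp)
      also have "\<dots> \<le> 2 ^ l (Suc (i + blk N))"
        using strict_mono_imp_increasing[OF l, of "Suc (i + blk N)"] by (intro power_increasing) auto
      finally show "n \<in> {n. blk n < 2 ^ l (Suc (i + blk N))}" by simp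
    qed
  qed
  then obtain k where k: "?P k" "\<And>k'. k' < k \<Longrightarrow> \<not> ?P k'" by (rule exists_least_iff[THEN iffD1, THEN exE]) blast
  have "{n. blk n < 2 ^ l (i + k)} \<subseteq> {..<N}"
  proof (cases k)
    case 0
    have "n < N" if "blk n < 2 ^ l i" for n
      using blk_le_imp_less_card[OF that] N by linarith
    then show ?thesis using 0 by auto
  next
    case (Suc k')
    then have "\<not> ?P k'" using k(2)[of k'] by simp
    then obtain m where "m < N" "\<not> blk m < 2 ^ l (Suc (i + k'))" by blast
    then have m: "m < N" "2 ^ l (i + k) \<le> blk m" using Suc by simp_all
    have "n < N" if "blk n < 2 ^ l (i + k)" for n
    proof (rule ccontr)
      assume "\<not> n < N"
      then have "blk m \<le> blk n" using m by (intro blk_mono) auto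
      then show False using that m by simp
    qed
    then show ?thesis by auto
  qed
  then show ?thesis using that[of "i + k"] k(1) by simp
qed

text \<open>\<open>L\<close> accounts for the gradient of the head at \<open>i0\<close>, about which
  \<open>tame\<close> says nothing; it is finite because that head lies in
  \<open>hermite_span\<close>. Like \<open>i0\<close> it depends on the outcome, so the later
  estimates must allow any \<open>L\<close>.\<close>

lemma ladder_limit:
  assumes tame: "tame B a" and l: "strict_mono l" "1 \<le> l 0" and A: "summable (osc 0 B l)" and B: "0 < B"
  obtains u i0 L where
    "\<And>i x. i0 \<le> i \<Longrightarrow> cmod (u x - head a (l i) x) \<le> (\<Sum>k. osc 0 B l (i + k))"
    "\<And>x. (\<lambda>N. \<Sum>n<N. a n * g n x) \<longlonglongrightarrow> u x"
    "\<exists>N0 C. \<forall>N\<ge>N0. \<forall>x. cmod ((\<Sum>n<N. a n * g n x) - u x) \<le> C"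
    "\<And>i x y. i0 \<le> i \<Longrightarrow> cmod (head a (l i) x - head a (l i) y)
        \<le> (L + real CARD('d) * (\<Sum>k<i. osc 1 B l k)) * norm (x - y)"
    "\<And>i j x. i0 \<le> i \<Longrightarrow> cmod (dhead a j (l (Suc i)) x - dhead a j (l i) x) \<le> osc 1 B l i"
    "0 \<le> L"
proof -
  obtain i0 where
    part: "\<And>i N x. i0 \<le> i \<Longrightarrow> cmod (\<Sum>n\<in>dyad (l i) (l (Suc i)) \<inter> {..<N}. a n * g n x) \<le> osc 0 B l i"
    and hd: "\<And>i x. i0 \<le> i \<Longrightarrow> cmod (head a (l (Suc i)) x - head a (l i) x) \<le> osc 0 B l i"
    and dhd: "\<And>i j x. i0 \<le> i \<Longrightarrow> cmod (dhead a j (l (Suc i)) x - dhead a j (l i) x) \<le> osc 1 B l i"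
    by (rule tame_ladder[OF tame l]) blast
  have osc0: "0 \<le> osc e B l i" for e i using B vsum_nonneg by (simp add: osc_def)
  define u where "u = (\<lambda>x. lim (\<lambda>i. head a (l i) x))"
  define tail where "tail = (\<lambda>i. \<Sum>k. osc 0 B l (i + k))"
  have sA: "summable (\<lambda>k. osc 0 B l (i + k))" for i
    using summable_ignore_initial_segment[OF A, of i] by (simp add: add.commute)
  have u: "cmod (u x - head a (l i) x) \<le> tail i" if "i0 \<le> i" for i x
    unfolding u_def tail_def
    by (rule telescope_limit(2)[where Q = "\<lambda>i. head a (l i) x", OF A hd that])
  have tail_tendsto: "tail \<longlonglongrightarrow> 0"
    using suminf_exist_split2[OF A] by (simp add: tail_def[abs_def] add.commute)
  have osc_tail: "osc 0 B l i \<le> tail i" for i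
    using sum_le_suminf[OF sA, of "{0}" i] osc0 by (simp add: tail_def)
  have tail_mono: "tail i' \<le> tail i" if "i \<le> i'" for i i'
  proof -
    from that have "\<exists>m. i' = i + m" by (rule le_Suc_ex)
    then obtain m where m: "i' = i + m" ..
    have "tail i = (\<Sum>k. osc 0 B l (i + (k + m))) + (\<Sum>k<m. osc 0 B l (i + k))"
      unfolding tail_def by (rule suminf_split_initial_segment[OF sA])
    moreover have "(\<Sum>k<m. osc 0 B l (i + k)) \<ge> 0" by (intro sum_nonneg osc0)
    moreover have "tail i' = (\<Sum>k. osc 0 B l (i + (k + m)))"
      unfolding tail_def m by (simp only: add.assoc add.commute[of m])
    ultimately show ?thesis by linarith
  qed
  \<comment> \<open>The partial sum differs from a head by a truncated rung; that rung and the
    distance from the head to \<open>u\<close> are each at most the tail at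
    \<open>i'\<close>.\<close>
  have close: "cmod ((\<Sum>n<N. a n * g n x) - u x) \<le> 2 * tail i"
    if i: "i0 \<le> i" and N: "card {n. blk n < 2 ^ l i} \<le> N" for i N x
  proof -
    obtain i' where i': "i \<le> i'" "{n. blk n < 2 ^ l i'} \<subseteq> {..<N}" "{..<N} \<subseteq> {n. blk n < 2 ^ l (Suc i')}"
      by (rule lessThan_between_heads[OF l(1) N])
    have "{..<N} = {n. blk n < 2 ^ l i'} \<union> (dyad (l i') (l (Suc i')) \<inter> {..<N})"
      using i' by (auto simp: dyad_def)
    then have "(\<Sum>n<N. a n * g n x)
        = (\<Sum>n\<in>{n. blk n < 2 ^ l i'} \<union> (dyad (l i') (l (Suc i')) \<inter> {..<N}). a n * g n x)" by simp
    also have "\<dots> = head a (l i') x + (\<Sum>n\<in>dyad (l i') (l (Suc i')) \<inter> {..<N}. a n * g n x)"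
      unfolding head_def
      by (rule sum.union_disjoint) (use dyad_finite in \<open>auto simp: blk_finite dyad_def\<close>)
    finally have "(\<Sum>n<N. a n * g n x) - u x
        = (\<Sum>n\<in>dyad (l i') (l (Suc i')) \<inter> {..<N}. a n * g n x) - (u x - head a (l i') x)" by simp
    then have "cmod ((\<Sum>n<N. a n * g n x) - u x)
        \<le> cmod (\<Sum>n\<in>dyad (l i') (l (Suc i')) \<inter> {..<N}. a n * g n x) + cmod (u x - head a (l i') x)"
      using norm_triangle_ineq4 by metis
    also have "\<dots> \<le> tail i' + tail i'"
      using i i'(1) by (intro add_mono u order_trans[OF part osc_tail]) auto
    also have "\<dots> \<le> 2 * tail i" using tail_mono[OF i'(1)] by simp
    finally show ?thesis .
  qed
  have lim: "(\<lambda>N. \<Sum>n<N. a n * g n x) \<longlonglongrightarrow> u x" for x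
  proof (rule LIMSEQ_I)
    fix r :: real assume "0 < r"
    then have "\<forall>\<^sub>F i in sequentially. tail i < r / 2"
      using order_tendstoD(2)[OF tail_tendsto, of "r / 2"] by simp
    then obtain i1 where i1: "\<And>i. i1 \<le> i \<Longrightarrow> tail i < r / 2" by (auto simp: eventually_sequentially)
    define i where "i = max i0 i1"
    have "cmod ((\<Sum>n<N. a n * g n x) - u x) < r" if "card {n. blk n < 2 ^ l i} \<le> N" for N
    proof -
      have "i0 \<le> i" "i1 \<le> i" by (simp_all add: i_def)
      from close[OF this(1) that, of x] i1[OF this(2)] show ?thesis by linarith
    qed
    then show "\<exists>no. \<forall>N\<ge>no. norm ((\<Sum>n<N. a n * g n x) - u x) < r" by blast
  qed
  have "\<exists>L0. \<forall>j x. cmod (dhead a j (l i0) x) \<le> L0 \<and> 0 \<le> L0"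
  proof -
    have "\<exists>C\<ge>0. \<forall>x. cmod (dhead a j (l i0) x) \<le> C" for j
    proof -
      have "dhead a j (l i0) \<in> hermite_span"
        unfolding dhead_def[abs_def] by (intro hermite_span_sum hermite_span.scale hermite_span_deriv(2) g_span)
      from hermite_span_power_bound[OF this, of 0] show ?thesis by simp
    qed
    then obtain C where C: "\<And>j. 0 \<le> C j" "\<And>j x. cmod (dhead a j (l i0) x) \<le> C j" by metis
    have "cmod (dhead a j (l i0) x) \<le> sum C UNIV \<and> 0 \<le> sum C UNIV" for j x
      using order_trans[OF C(2) member_le_sum[of j UNIV C]] C(1) by (auto intro: sum_nonneg)
    then show ?thesis by blast
  qed
  then obtain L0 where L0: "\<And>j x. cmod (dhead a j (l i0) x) \<le> L0" "0 \<le> L0" by blast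
  have dbound: "cmod (dhead a j (l i) x) \<le> L0 + (\<Sum>k<i. osc 1 B l k)" if "i0 \<le> i" for i j x
    using that
  proof (induction i rule: dec_induct)
    case base
    have "0 \<le> (\<Sum>k<i0. osc 1 B l k)" by (intro sum_nonneg osc0)
    then show ?case using L0(1)[of j x] by linarith
  next
    case (step i)
    then show ?case
      using dhd[OF step(1), of j x] norm_triangle_sub[of "dhead a j (l (Suc i)) x" "dhead a j (l i) x"] by simp
  qed
  have lip: "cmod (head a (l i) x - head a (l i) y)
        \<le> (real CARD('d) * L0 + real CARD('d) * (\<Sum>k<i. osc 1 B l k)) * norm (x - y)" if "i0 \<le> i" for i x y
    using lipschitz_of_partials[where S = "head a (l i)" and D = "\<lambda>j. dhead a j (l i)" and x = x and y = y,
        OF head_has_derivative dbound[OF that]] by (simp add: distrib_left)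
  show ?thesis
  proof (rule that[of i0 u "real CARD('d) * L0"])
    show "cmod (u x - head a (l i) x) \<le> (\<Sum>k. osc 0 B l (i + k))" if "i0 \<le> i" for i x
      using u[OF that] by (simp add: tail_def)
    show "\<And>x. (\<lambda>N. \<Sum>n<N. a n * g n x) \<longlonglongrightarrow> u x" by (rule lim)
    show "\<exists>N0 C. \<forall>N\<ge>N0. \<forall>x. cmod ((\<Sum>n<N. a n * g n x) - u x) \<le> C"
      using close[of i0] by blast
    show "0 \<le> real CARD('d) * L0" using L0 by simp
  qed (use lip dhd in auto)
qed

text \<open>The limit is bounded, because a finite Hermite combination is and \<open>u\<close> stays
  within a constant of it. Test functions are integrable, so dominated convergence gives the
  distributional sum; under the integral \<open>\<phi> n\<close> may be replaced by
  \<open>g n\<close>.\<close>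

lemma limit_sums_in_tempered:
  assumes lim: "\<And>x. (\<lambda>N. \<Sum>n<N. a n * g n x) \<longlonglongrightarrow> u x"
    and bnd: "\<exists>N0 C. \<forall>N\<ge>N0. \<forall>x. cmod ((\<Sum>n<N. a n * g n x) - u x) \<le> C"
    and \<phi>: "\<And>n. AE x in lborel. \<phi> n x = g n x" "\<And>n. \<phi> n \<in> borel_measurable lborel"
  shows "sums_in_tempered a \<phi> u"
  unfolding sums_in_tempered_def
proof (intro allI impI)
  fix \<psi> :: "real^'d \<Rightarrow> complex" assume \<psi>: "schwartz \<psi>"
  have psi: "integrable lborel \<psi>" by (rule schwartz_integrable[OF \<psi>])
  have [measurable]: "\<psi> \<in> borel_measurable lborel" using psi by simp
  define S where "S = (\<lambda>N x. \<Sum>n<N. a n * g n x)"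
  have S: "S N \<in> hermite_span" for N
    unfolding S_def by (intro hermite_span_sum hermite_span.scale g_span)
  have g_meas: "f \<in> borel_measurable borel" if "f \<in> hermite_span" for f :: "real^'d \<Rightarrow> complex"
    by (rule borel_measurable_continuous_onI[OF hermite_span_continuous[OF that]])
  have [measurable]: "S N \<in> borel_measurable borel" for N by (rule g_meas[OF S])
  have [measurable]: "u \<in> borel_measurable borel"
  proof (rule borel_measurable_LIMSEQ_metric[of S])
    show "(\<lambda>N. S N x) \<longlonglongrightarrow> u x" for x using lim[of x] by (simp add: S_def)
  qed measurable
  obtain N0 C where C: "\<And>N x. N0 \<le> N \<Longrightarrow> cmod (S N x - u x) \<le> C" using bnd unfolding S_def by blast
  have bounded_int: "integrable lborel (\<lambda>x. f x * \<psi> x)"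
    if "\<And>x. cmod (f x) \<le> K" "f \<in> borel_measurable borel" for f :: "real^'d \<Rightarrow> complex" and K
  proof (rule Bochner_Integration.integrable_bound)
    show "integrable lborel (\<lambda>x. K *\<^sub>R \<psi> x)" using psi by simp
    show "(\<lambda>x. f x * \<psi> x) \<in> borel_measurable lborel" using that(2) by measurable
    have "0 \<le> K" using that(1)[of 0] norm_ge_zero order_trans by blast
    then show "AE x in lborel. norm (f x * \<psi> x) \<le> norm (K *\<^sub>R \<psi> x)"
      using that(1) by (auto simp: norm_mult intro!: mult_right_mono)
  qed
  have hb: "\<exists>K. \<forall>x. cmod (f x) \<le> K" if "f \<in> hermite_span" for f :: "real^'d \<Rightarrow> complex"
    using hermite_span_power_bound[OF that, of 0] by auto
  obtain K where K: "\<And>x. cmod (S N0 x) \<le> K" using hb[OF S] by blast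
  have uK: "cmod (u x) \<le> K + C" for x
    using C[of N0 x] K[of x] norm_triangle_sub[of "u x" "S N0 x"] by (simp add: norm_minus_commute)
  show "integrable lborel (\<lambda>x. u x * \<psi> x) \<and>
      (\<lambda>n. a n * (CLINT x|lborel. \<phi> n x * \<psi> x)) sums (CLINT x|lborel. u x * \<psi> x)"
  proof
    show "integrable lborel (\<lambda>x. u x * \<psi> x)" by (rule bounded_int[OF uK]) simp
    have phig: "(CLINT x|lborel. \<phi> n x * \<psi> x) = (CLINT x|lborel. g n x * \<psi> x)" for n
    proof (rule integral_cong_AE)
      show "AE x in lborel. \<phi> n x * \<psi> x = g n x * \<psi> x" using \<phi>(1)[of n] by eventually_elim simp
      have [measurable]: "\<phi> n \<in> borel_measurable lborel" "g n \<in> borel_measurable borel"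
        using \<phi>(2) g_meas[OF g_span] by auto
      show "(\<lambda>x. \<phi> n x * \<psi> x) \<in> borel_measurable lborel" "(\<lambda>x. g n x * \<psi> x) \<in> borel_measurable lborel"
        by measurable
    qed
    have gint: "integrable lborel (\<lambda>x. g n x * \<psi> x)" for n
      using hb[OF g_span[of n]] bounded_int g_meas[OF g_span] by blast
    have part: "(\<Sum>n<N. a n * (CLINT x|lborel. \<phi> n x * \<psi> x)) = (CLINT x|lborel. S N x * \<psi> x)" for N
    proof -
      have "(CLINT x|lborel. S N x * \<psi> x) = (CLINT x|lborel. \<Sum>n<N. a n * (g n x * \<psi> x))"
        by (simp add: S_def sum_distrib_right mult.assoc)
      also have "\<dots> = (\<Sum>n<N. a n * (CLINT x|lborel. g n x * \<psi> x))"
        using gint by (subst Bochner_Integration.integral_sum) auto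
      finally show ?thesis by (simp add: phig)
    qed
    have "(\<lambda>N. CLINT x|lborel. S (N + N0) x * \<psi> x) \<longlonglongrightarrow> (CLINT x|lborel. u x * \<psi> x)"
    proof (rule integral_dominated_convergence)
      show "integrable lborel (\<lambda>x. (K + 2 * C) * norm (\<psi> x))" using psi by simp
      show "AE x in lborel. (\<lambda>N. S (N + N0) x * \<psi> x) \<longlonglongrightarrow> u x * \<psi> x"
      proof (rule AE_I2)
        fix x
        have "(\<lambda>N. S (N + N0) x) \<longlonglongrightarrow> u x" using lim[of x] unfolding S_def by (rule LIMSEQ_ignore_initial_segment)
        then show "(\<lambda>N. S (N + N0) x * \<psi> x) \<longlonglongrightarrow> u x * \<psi> x" by (intro tendsto_intros)
      qed
      show "AE x in lborel. norm (S (N + N0) x * \<psi> x) \<le> (K + 2 * C) * norm (\<psi> x)" for N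
      proof (rule AE_I2)
        fix x
        have "cmod (S (N + N0) x) \<le> K + 2 * C"
          using C[of "N + N0" x] uK[of x] norm_triangle_sub[of "S (N + N0) x" "u x"] by simp
        then show "norm (S (N + N0) x * \<psi> x) \<le> (K + 2 * C) * norm (\<psi> x)"
          by (simp add: norm_mult mult_right_mono)
      qed
    qed measurable
    then have "(\<lambda>N. CLINT x|lborel. S N x * \<psi> x) \<longlonglongrightarrow> (CLINT x|lborel. u x * \<psi> x)"
      by (rule LIMSEQ_offset)
    then show "(\<lambda>n. a n * (CLINT x|lborel. \<phi> n x * \<psi> x)) sums (CLINT x|lborel. u x * \<psi> x)"
      by (simp add: sums_def part)
  qed
qed

text \<open>Summable increments make the gradients of the heads converge uniformly in
  \<open>x\<close>; of the heads themselves only pointwise convergence is then required.\<close>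

lemma limit_differentiable:
  assumes u: "\<And>x. (\<lambda>i. head a (l i) x) \<longlonglongrightarrow> u x"
    and d: "\<And>i j x. i0 \<le> i \<Longrightarrow> cmod (dhead a j (l (Suc i)) x - dhead a j (l i) x) \<le> T i"
    and T: "summable T"
  shows "u differentiable (at x)"
proof -
  define D where "D = (\<lambda>j x. lim (\<lambda>i. dhead a j (l i) x))"
  define tail where "tail = (\<lambda>i. \<Sum>k. T (i + k))"
  have D: "cmod (D j x - dhead a j (l i) x) \<le> tail i" if "i0 \<le> i" for i j x
    unfolding D_def tail_def
    by (rule telescope_limit(2)[where Q = "\<lambda>i. dhead a j (l i) x", OF T d that])
  have tail_tendsto: "tail \<longlonglongrightarrow> 0"
    using suminf_exist_split2[OF T] by (simp add: tail_def[abs_def] add.commute)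
  have "\<exists>g. \<forall>x\<in>UNIV. (\<lambda>n. head a (l n) x) \<longlonglongrightarrow> g x \<and>
      (g has_derivative (\<lambda>v. \<Sum>j\<in>UNIV. v $ j *\<^sub>R D j x)) (at x within UNIV)"
  proof (rule has_derivative_sequence)
    show "convex (UNIV :: (real^'d) set)" by simp
    show "(head a (l n) has_derivative (\<lambda>v. \<Sum>j\<in>UNIV. v $ j *\<^sub>R dhead a j (l n) x)) (at x within UNIV)" for n x
      using head_has_derivative[of a "l n" x] by simp
    show "(0 :: real^'d) \<in> UNIV" "(\<lambda>n. head a (l n) 0) \<longlonglongrightarrow> u 0" using u by auto
    fix e :: real assume e: "0 < e"
    define r where "r = e / real CARD('d)"
    have "\<forall>\<^sub>F n in sequentially. tail n < r"
      using order_tendstoD(2)[OF tail_tendsto, of r] e by (simp add: r_def)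
    then show "\<forall>\<^sub>F n in sequentially. \<forall>x\<in>UNIV. \<forall>h. norm ((\<Sum>j\<in>UNIV. h $ j *\<^sub>R dhead a j (l n) x)
        - (\<Sum>j\<in>UNIV. h $ j *\<^sub>R D j x)) \<le> e * norm h"
      using eventually_ge_at_top[of i0]
    proof eventually_elim
      case (elim n)
      show ?case
      proof (intro ballI allI)
        fix x h :: "real^'d"
        have "norm ((\<Sum>j\<in>UNIV. h $ j *\<^sub>R dhead a j (l n) x) - (\<Sum>j\<in>UNIV. h $ j *\<^sub>R D j x))
            = norm (\<Sum>j\<in>UNIV. h $ j *\<^sub>R (dhead a j (l n) x - D j x))"
          by (simp add: scaleR_diff_right sum_subtractf)
        also have "\<dots> \<le> (\<Sum>j\<in>(UNIV::'d set). norm h * r)"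
        proof (rule order_trans[OF norm_sum], intro sum_mono)
          fix j
          have "norm (h $ j *\<^sub>R (dhead a j (l n) x - D j x)) = \<bar>h $ j\<bar> * cmod (D j x - dhead a j (l n) x)"
            by (simp add: norm_minus_commute)
          also have "\<dots> \<le> norm h * r"
            using order_trans[OF D[OF elim(2), of j x] less_imp_le[OF elim(1)]]
            by (intro mult_mono component_le_norm_cart) auto
          finally show "norm (h $ j *\<^sub>R (dhead a j (l n) x - D j x)) \<le> norm h * r" .
        qed
        also have "\<dots> = e * norm h" by (simp add: r_def)
        finally show "norm ((\<Sum>j\<in>UNIV. h $ j *\<^sub>R dhead a j (l n) x) - (\<Sum>j\<in>UNIV. h $ j *\<^sub>R D j x)) \<le> e * norm h" .
      qed
    qed
  qed
  then obtain v where v: "\<And>x. (\<lambda>n. head a (l n) x) \<longlonglongrightarrow> v x"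
    "\<And>x. (v has_derivative (\<lambda>h. \<Sum>j\<in>UNIV. h $ j *\<^sub>R D j x)) (at x)" by auto
  have "u = v" using LIMSEQ_unique[OF u v(1)] by blast
  then show ?thesis using v(2) by (auto simp: differentiable_def)
qed

end

section \<open>The modulus of continuity\<close>

text \<open>Substitution \<open>h = 2^(- y)\<close> with real \<open>y\<close>: then
  \<open>|ln h| = y * ln 2\<close>, and the factor \<open>ln 2 powr \<theta>\<close> goes into the
  constant.\<close>

lemma ennreal_bigo_dyadic:
  assumes K: "0 < K" and m: "\<And>y. Y \<le> y \<Longrightarrow> m (2 powr (- y)) \<le> ennreal (K * (2 powr (- \<mu> * y) * y powr \<theta>))"
  shows "ennreal_bigo_at_0 m (\<lambda>h. h powr \<mu> * \<bar>ln h\<bar> powr \<theta>)"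
  unfolding ennreal_bigo_at_0_def
proof (intro exI[of _ "K / ln 2 powr \<theta>"] conjI)
  show "0 < K / ln 2 powr \<theta>" using K by simp
  define Y' where "Y' = max Y 1"
  have "m h \<le> ennreal (K / ln 2 powr \<theta> * \<bar>h powr \<mu> * \<bar>ln h\<bar> powr \<theta>\<bar>)" if h: "0 < h" "h < 2 powr (- Y')" for h
  proof -
    define y where "y = - log 2 h"
    have hy: "h = 2 powr (- y)" using h by (simp add: y_def)
    have "log 2 h < - Y'" using h by (simp add: log_less_iff)
    then have y: "Y \<le> y" "1 \<le> y" by (auto simp: y_def Y'_def)
    have ln: "\<bar>ln h\<bar> = y * ln 2" using y by (simp add: hy ln_powr abs_mult)
    have "h powr \<mu> = 2 powr (- \<mu> * y)" by (simp add: hy powr_powr mult.commute)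
    then have "K / ln 2 powr \<theta> * \<bar>h powr \<mu> * \<bar>ln h\<bar> powr \<theta>\<bar> = K * (2 powr (- \<mu> * y) * y powr \<theta>)"
      unfolding ln using y by (simp add: powr_mult)
    then show ?thesis using m[OF y(1)] by (simp add: hy)
  qed
  then show "\<forall>\<^sub>F h in at_right 0. m h \<le> ennreal (K / ln 2 powr \<theta> * \<bar>h powr \<mu> * \<bar>ln h\<bar> powr \<theta>\<bar>)"
    by (intro eventually_at_rightI[of 0 "2 powr (- Y')"]) auto
qed

section \<open>Elementary growth and summation estimates\<close>

lemma power_of_two_below:
  fixes y :: real
  assumes "1 \<le> y"
  obtains i where "2 ^ i \<le> y" "y < 2 * 2 ^ i"
proof -
  define n where "n = nat \<lfloor>y\<rfloor>"
  have n: "real n \<le> y" "y < real n + 1" "0 < n" using assms unfolding n_def by linarith+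
  define i where "i = floor_log n"
  have i: "2 ^ i \<le> n" "n < 2 ^ (i + 1)"
    using n floor_log_exp2_le[of n] floor_log_exp2_gt[of n] by (simp_all add: i_def)
  then have "real (2 ^ i) \<le> real n" "real (n + 1) \<le> real (2 ^ (i + 1))" by (simp_all only: of_nat_le_iff)
  then have "2 ^ i \<le> real n" "real n + 1 \<le> 2 * 2 ^ i" by simp_all
  then show ?thesis using n by (intro that[of i]) linarith+
qed

lemma summable_powr_weight:
  assumes "0 < p"
  shows "summable (\<lambda>n. 2 powr (- p * real n) * (1 + real n) powr r)"
proof (rule summable_comparison_test_bigo)
  show "summable (\<lambda>n. norm (inverse (real n ^ 2)))" using inverse_power_summable[of 2, where 'a = real] by simp
  show "(\<lambda>n. 2 powr (- p * real n) * (1 + real n) powr r) \<in> O(\<lambda>n. inverse (real n ^ 2))"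
    using assms by real_asymp
qed

lemma powr_times_exp_bounded:
  "\<exists>C>0. \<forall>n. real n powr s \<le> C * 2 powr (real n / 4)"
proof -
  have "(\<lambda>n. real n powr s * 2 powr (- real n / 4)) \<longlonglongrightarrow> 0" by real_asymp
  then have "Bseq (\<lambda>n. real n powr s * 2 powr (- real n / 4))"
    by (intro convergent_imp_Bseq convergentI)
  then obtain C where C: "0 < C" "\<And>n. norm (real n powr s * 2 powr (- real n / 4)) \<le> C"
    by (auto simp: Bseq_def)
  have "real n powr s \<le> C * 2 powr (real n / 4)" for n
  proof -
    have "real n powr s * 2 powr (- real n / 4) \<le> C" using C(2)[of n] by simp
    then have "real n powr s * 2 powr (- real n / 4) * 2 powr (real n / 4) \<le> C * 2 powr (real n / 4)"
      by (intro mult_right_mono) auto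
    then show ?thesis by (simp add: mult.assoc flip: powr_add)
  qed
  then show ?thesis using C by blast
qed

lemma eventually_powr_le:
  assumes "0 < q" shows "\<exists>Y. \<forall>y\<ge>Y. 2 powr (- q * y) \<le> y powr (s::real)"
proof -
  have "eventually (\<lambda>y. 2 powr (- q * y) \<le> y powr s) at_top" using assms by real_asymp
  then show ?thesis by (simp add: eventually_at_top_linorder)
qed

context hermite_series
begin

lemma modulus_le:
  fixes u v :: "real^'d \<Rightarrow> complex"
  assumes close: "\<And>x. cmod (u x - v x) \<le> t" and lip: "\<And>x y. cmod (v x - v y) \<le> S * norm (x - y)"
    and "0 \<le> S"
  shows "modulus_of_continuity u h \<le> ennreal (S * h + 2 * t)"
  unfolding modulus_of_continuity_def
proof (rule SUP_least, clarify)
  fix x y :: "real^'d" assume h: "norm (x - y) \<le> h"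
  have "cmod (u x - u y) \<le> cmod (u x - v x) + (cmod (v x - v y) + cmod (u y - v y))"
    using norm_triangle_ineq[of "u x - v x" "(v x - v y) + (v y - u y)"]
      norm_triangle_ineq[of "v x - v y" "v y - u y"] norm_minus_commute[of "u y" "v y"] by simp
  also have "\<dots> \<le> t + (S * h + t)"
    using assms h by (intro add_mono order_trans[OF lip] mult_left_mono) auto
  finally show "ennreal (cmod (u x - u y)) \<le> ennreal (S * h + 2 * t)" by (intro ennreal_leI) simp
qed

lemma osc_nonneg: "0 \<le> B \<Longrightarrow> 0 \<le> osc e B l i"
  by (simp add: osc_def vsum_nonneg)

text \<open>A super-block holds \<open>2^i\<close> exponents \<open>j\<close>, each with weight
  comparable to \<open>2^(2 \<nu> i)\<close>, and the union bound contributes another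
  \<open>2^(i+1)\<close>; the root of the product is of order \<open>2^(i (1 + \<nu>))\<close>.
  \<open>W\<close> collects the exponential factor, which depends on
  \<open>e - \<mu>\<close>.\<close>

lemma osc_super:
  assumes B: "0 \<le> B" and W: "0 \<le> W"
    and le: "\<And>j. 2 ^ i \<le> j \<Longrightarrow> j < 2 * 2 ^ i \<Longrightarrow> 2 powr ((e - \<mu>) * real j) \<le> W\<^sup>2"
  shows "osc e B (\<lambda>i. 2 ^ i) i \<le> (B * sqrt (2 powr (\<bar>2 * \<nu>\<bar> + 1))) * (W * 2 powr (real i * (1 + \<nu>)))"
proof -
  let ?a = "2 ^ i :: nat"
  let ?c = "2 powr (\<bar>2 * \<nu>\<bar> + 1)"
  let ?z = "2 powr (real i * (1 + \<nu>))"
  have "vsum e (2 ^ i) (2 ^ Suc i) \<le> (\<Sum>j=?a..<2 * ?a. W\<^sup>2 * (2 powr \<bar>2 * \<nu>\<bar> * real ?a powr (2 * \<nu>)))"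
    unfolding vsum_def power_Suc
  proof (intro sum_mono mult_mono)
    fix j assume j: "j \<in> {?a..<2 * ?a}"
    then show "2 powr ((e - \<mu>) * real j) \<le> W\<^sup>2" by (intro le) auto
    have a0: "0 < ?a" by simp
    have j': "?a \<le> j" "j < 2 * ?a" using j by auto
    have "real ?a \<le> real j" "real j \<le> 2 * real ?a" "0 < real ?a"
      using j' a0 by linarith+
    note f = this
    show "real j powr (2 * \<nu>) \<le> 2 powr \<bar>2 * \<nu>\<bar> * real ?a powr (2 * \<nu>)"
      by (rule powr_comparable) (use f in linarith)+
  qed auto
  also have "\<dots> = real ?a * (W\<^sup>2 * (2 powr \<bar>2 * \<nu>\<bar> * real ?a powr (2 * \<nu>)))" by simp
  finally have v: "vsum e (2 ^ i) (2 ^ Suc i) \<le> real ?a * (W\<^sup>2 * (2 powr \<bar>2 * \<nu>\<bar> * real ?a powr (2 * \<nu>)))" .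
  have "vsum e (2 ^ i) (2 ^ Suc i) * real (2 ^ Suc i)
      \<le> real ?a * (W\<^sup>2 * (2 powr \<bar>2 * \<nu>\<bar> * real ?a powr (2 * \<nu>))) * real (2 ^ Suc i)"
    by (intro mult_right_mono v) auto
  also have "\<dots> = (sqrt ?c * (W * ?z))\<^sup>2"
  proof -
    have ap: "real ?a = 2 powr real i" by (simp add: powr_realpow)
    have "?z\<^sup>2 = 2 powr (real i + real i + real i * (2 * \<nu>))"
      by (simp add: power2_eq_square algebra_simps flip: powr_add)
    also have "\<dots> = real ?a * real ?a * real ?a powr (2 * \<nu>)"
      unfolding ap by (simp only: powr_add powr_powr)
    finally have z2: "?z\<^sup>2 = real ?a * real ?a * real ?a powr (2 * \<nu>)" .
    have "?c = 2 powr \<bar>2 * \<nu>\<bar> * 2" by (simp add: powr_add)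
    then show ?thesis by (simp add: power_mult_distrib z2)
  qed
  finally have "sqrt (vsum e (2 ^ i) (2 ^ Suc i) * real (2 ^ Suc i)) \<le> sqrt ?c * (W * ?z)"
    using W by (intro real_le_lsqrt) auto
  then have "B * sqrt (vsum e (2 ^ i) (2 ^ Suc i) * real (2 ^ Suc i)) \<le> B * (sqrt ?c * (W * ?z))"
    by (intro mult_left_mono B)
  then show ?thesis by (simp only: osc_def mult.assoc)
qed

text \<open>Rung \<open>i\<close> of the ladder \<open>Suc\<close> is the single block
  \<open>i + 1\<close>; the ladder starts at 1 because \<open>tame\<close> requires
  \<open>1 <= J\<close>.\<close>

lemma osc_single:
  assumes B: "0 \<le> B"
  shows "osc e B Suc i \<le> (B * sqrt 2) * (2 powr ((e - \<mu>) / 2 * (real i + 1)) * (real i + 1) powr (1 / 2 + \<nu>))"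
proof -
  let ?j = "real i + 1"
  let ?z = "2 powr ((e - \<mu>) / 2 * ?j) * ?j powr (1 / 2 + \<nu>)"
  have "vsum e (Suc i) (Suc (Suc i)) * real (Suc (Suc i)) = 2 powr ((e - \<mu>) * ?j) * ?j powr (2 * \<nu>) * (?j + 1)"
    by (simp add: vsum_def add.commute)
  also have "\<dots> \<le> 2 powr ((e - \<mu>) * ?j) * ?j powr (2 * \<nu>) * (2 * ?j)"
    by (intro mult_left_mono) auto
  also have "\<dots> = (sqrt 2 * ?z)\<^sup>2"
  proof -
    have "(2 powr ((e - \<mu>) / 2 * ?j))\<^sup>2 = 2 powr ((e - \<mu>) * ?j)"
      by (simp add: power2_eq_square flip: powr_add)
    moreover have "(?j powr (1 / 2 + \<nu>))\<^sup>2 = ?j powr (2 * \<nu>) * ?j"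
    proof -
      have "(?j powr (1 / 2 + \<nu>))\<^sup>2 = ?j powr (2 * \<nu> + 1)"
        by (simp add: power2_eq_square algebra_simps flip: powr_add)
      then show ?thesis by (simp add: powr_add)
    qed
    ultimately show ?thesis by (simp add: power_mult_distrib)
  qed
  finally have "sqrt (vsum e (Suc i) (Suc (Suc i)) * real (Suc (Suc i))) \<le> sqrt 2 * ?z"
    by (intro real_le_lsqrt) auto
  then have "B * sqrt (vsum e (Suc i) (Suc (Suc i)) * real (Suc (Suc i))) \<le> B * (sqrt 2 * ?z)"
    by (intro mult_left_mono B)
  then show ?thesis by (simp only: osc_def mult.assoc)
qed

lemma strict_mono_pow2: "strict_mono (\<lambda>i. 2 ^ i :: nat)"
  by (intro strict_monoI power_strict_increasing) auto

lemma summable_geo_powr: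
  assumes "s < 0"
  shows "summable (\<lambda>k. 2 powr (real k * s))"
proof -
  have "(\<lambda>k. 2 powr (real k * s)) = (\<lambda>k. (2 powr s) ^ k)"
    by (simp add: powr_powr mult.commute flip: powr_realpow)
  moreover have "2 powr s < 2 powr 0" using assms by (intro powr_less_mono) auto
  ultimately show ?thesis by (simp add: summable_geometric)
qed

text \<open>In \<open>rate\<close> the constant \<open>K\<close> may depend on \<open>L\<close> but
  not on \<open>i0\<close>, which only decides how small \<open>h = 2^(- y)\<close> must be. The cut
  \<open>i\<close> is free, so each regime of \<open>\<mu>\<close> can balance the gradient sum
  against the tail in its own way.\<close>

lemma modulus_from_ladder:
  assumes tame: "tame B a" and B: "0 < B" and l: "strict_mono l" "1 \<le> l 0" and A: "summable (osc 0 B l)"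
    and \<phi>: "\<And>n. AE x in lborel. \<phi> n x = g n x" "\<And>n. \<phi> n \<in> borel_measurable lborel"
    and rate: "\<And>L. 0 \<le> L \<Longrightarrow> \<exists>K>0. \<forall>i0. \<exists>Y. \<forall>y\<ge>Y. \<exists>i\<ge>i0.
       (L + real CARD('d) * (\<Sum>k<i. osc 1 B l k)) * 2 powr (- y) + 2 * (\<Sum>k. osc 0 B l (i + k))
         \<le> K * (2 powr (- \<mu> * y) * y powr \<theta>)"
  shows "\<exists>u. sums_in_tempered a \<phi> u \<and> ennreal_bigo_at_0 (modulus_of_continuity u) (\<lambda>h. h powr \<mu> * \<bar>ln h\<bar> powr \<theta>)"
proof -
  obtain u i0 L where
    close: "\<And>i x. i0 \<le> i \<Longrightarrow> cmod (u x - head a (l i) x) \<le> (\<Sum>k. osc 0 B l (i + k))"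
    and lim: "\<And>x. (\<lambda>N. \<Sum>n<N. a n * g n x) \<longlonglongrightarrow> u x"
    and bnd: "\<exists>N0 C. \<forall>N\<ge>N0. \<forall>x. cmod ((\<Sum>n<N. a n * g n x) - u x) \<le> C"
    and lip: "\<And>i x y. i0 \<le> i \<Longrightarrow> cmod (head a (l i) x - head a (l i) y)
        \<le> (L + real CARD('d) * (\<Sum>k<i. osc 1 B l k)) * norm (x - y)"
    and L: "0 \<le> L"
    by (rule ladder_limit[OF tame l A B]) blast
  have s: "sums_in_tempered a \<phi> u" by (rule limit_sums_in_tempered[OF lim bnd \<phi>])
  obtain K where K: "0 < K" and KY: "\<forall>i0. \<exists>Y. \<forall>y\<ge>Y. \<exists>i\<ge>i0.
       (L + real CARD('d) * (\<Sum>k<i. osc 1 B l k)) * 2 powr (- y) + 2 * (\<Sum>k. osc 0 B l (i + k))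
         \<le> K * (2 powr (- \<mu> * y) * y powr \<theta>)" using rate[OF L] by (elim exE conjE)
  obtain Y where Y: "\<forall>y\<ge>Y. \<exists>i\<ge>i0.
       (L + real CARD('d) * (\<Sum>k<i. osc 1 B l k)) * 2 powr (- y) + 2 * (\<Sum>k. osc 0 B l (i + k))
         \<le> K * (2 powr (- \<mu> * y) * y powr \<theta>)" using KY[THEN spec, of i0] by (elim exE)
  have "modulus_of_continuity u (2 powr (- y)) \<le> ennreal (K * (2 powr (- \<mu> * y) * y powr \<theta>))" if y: "Y \<le> y" for y
  proof -
    obtain i where i: "i0 \<le> i" "(L + real CARD('d) * (\<Sum>k<i. osc 1 B l k)) * 2 powr (- y) + 2 * (\<Sum>k. osc 0 B l (i + k))
         \<le> K * (2 powr (- \<mu> * y) * y powr \<theta>)" using Y[THEN spec, THEN mp, OF y] by (elim exE conjE)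
    have "0 \<le> (\<Sum>k<i. osc 1 B l k)" using B by (intro sum_nonneg osc_nonneg) simp
    then have "0 \<le> L + real CARD('d) * (\<Sum>k<i. osc 1 B l k)" using L by simp
    from modulus_le[OF close[OF i(1)] lip[OF i(1)] this]
    have "modulus_of_continuity u (2 powr (- y)) \<le> ennreal ((L + real CARD('d) * (\<Sum>k<i. osc 1 B l k)) * 2 powr (- y)
        + 2 * (\<Sum>k. osc 0 B l (i + k)))" .
    also have "\<dots> \<le> ennreal (K * (2 powr (- \<mu> * y) * y powr \<theta>))" by (intro ennreal_leI i)
    finally show ?thesis .
  qed
  then show ?thesis using s ennreal_bigo_dyadic[OF K] by blast
qed

text \<open>Cut at \<open>2^i <= y < 2 * 2^i\<close>. The tail is dominated by a geometric series in
  \<open>2^(1 + \<nu>)\<close>, convergent by \<open>\<nu> < - 1\<close> and of order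
  \<open>y^(1 + \<nu>)\<close>. The gradient of the lower super-blocks is at most of order
  \<open>2^(2^i / 2) <= 2^(y / 2)\<close>, so after multiplication by \<open>h\<close> it is
  exponentially small in \<open>y\<close>.\<close>

lemma rate_zero:
  assumes B: "0 < B" and \<mu>: "\<mu> = 0" and \<nu>: "\<nu> < - 1" and L: "0 \<le> L"
  shows "summable (osc 0 B (\<lambda>i. 2 ^ i))"
    and "\<exists>K>0. \<forall>i0. \<exists>Y. \<forall>y\<ge>Y. \<exists>i\<ge>i0.
       (L + real CARD('d) * (\<Sum>k<i. osc 1 B (\<lambda>i. 2 ^ i) k)) * 2 powr (- y) + 2 * (\<Sum>k. osc 0 B (\<lambda>i. 2 ^ i) (i + k))
         \<le> K * (2 powr (- \<mu> * y) * y powr (1 + \<nu>))"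
proof -
  let ?l = "\<lambda>i. 2 ^ i :: nat"
  let ?d = "real CARD('d)"
  define C where "C = B * sqrt (2 powr (\<bar>2 * \<nu>\<bar> + 1))"
  have C: "0 < C" using B by (simp add: C_def)
  define z where "z = (\<lambda>k. 2 powr (real k * (1 + \<nu>)))"
  have zs: "summable z" unfolding z_def using \<nu> by (intro summable_geo_powr) simp
  have z0: "0 \<le> z k" for k by (simp add: z_def)
  define G where "G = suminf z"
  have G: "(\<Sum>k<i. z k) \<le> G" for i unfolding G_def by (intro sum_le_suminf zs) (auto simp: z0)
  have G0: "0 \<le> G" unfolding G_def by (intro suminf_nonneg zs z0)
  have o0: "osc 0 B ?l i \<le> C * z i" for i
    using osc_super[of B 1 i 0] B \<mu> by (simp add: C_def z_def)
  \<comment> \<open>All exponents on the rung are below \<open>2 * 2^i\<close>, whence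
    \<open>W = 2^(2^i)\<close> after the square root.\<close>
  have o1: "osc 1 B ?l i \<le> C * (2 powr (2 ^ i) * z i)" for i
    unfolding C_def z_def
  proof (rule osc_super)
    fix j :: nat assume "j < 2 * 2 ^ i"
    then have "real j \<le> real (2 * 2 ^ i)" by (simp only: of_nat_le_iff less_imp_le)
    then have "2 powr ((1 - \<mu>) * real j) \<le> 2 powr (2 ^ i + 2 ^ i)" using \<mu> by (intro powr_mono) auto
    also have "\<dots> = (2 powr (2 ^ i))\<^sup>2" by (simp only: powr_add power2_eq_square)
    finally show "2 powr ((1 - \<mu>) * real j) \<le> (2 powr (2 ^ i))\<^sup>2" .
  qed (use B in auto)
  have on: "0 \<le> osc e B ?l i" for e i using B by (intro osc_nonneg) simp
  show s0: "summable (osc 0 B ?l)"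
    by (rule summable_comparison_test'[OF summable_mult[OF zs, of C], of 0]) (use o0 on in auto)
  have tail: "(\<Sum>k. osc 0 B ?l (i + k)) \<le> C * G * z i" for i
  proof -
    have zz: "z (i + k) = z i * z k" for k by (simp add: z_def algebra_simps flip: powr_add)
    have "(\<Sum>k. osc 0 B ?l (i + k)) \<le> (\<Sum>k. C * z i * z k)"
    proof (rule suminf_le)
      show "osc 0 B ?l (i + k) \<le> C * z i * z k" for k using o0[of "i + k"] by (simp add: zz mult.assoc)
      show "summable (\<lambda>k. osc 0 B ?l (i + k))"
        using summable_ignore_initial_segment[OF s0, of i] by (simp add: add.commute)
      show "summable (\<lambda>k. C * z i * z k)" by (intro summable_mult zs)
    qed
    also have "\<dots> = C * G * z i" using suminf_mult[OF zs, of "C * z i"] by (simp add: G_def mult_ac)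
    finally show ?thesis .
  qed
  have head: "(\<Sum>k<i. osc 1 B ?l k) \<le> C * G * 2 powr (2 ^ i / 2)" for i
  proof -
    have "(\<Sum>k<i. osc 1 B ?l k) \<le> (\<Sum>k<i. C * 2 powr (2 ^ i / 2) * z k)"
    proof (intro sum_mono)
      fix k assume k: "k \<in> {..<i}"
      have "(2::real) * 2 ^ k \<le> 2 ^ i" using k power_increasing[of "Suc k" i "2::real"] by simp
      then have "2 powr (2 ^ k) \<le> 2 powr (2 ^ i / 2 :: real)" by (intro powr_mono) auto
      then have "C * (2 powr (2 ^ k) * z k) \<le> C * (2 powr (2 ^ i / 2) * z k)"
        using C z0 by (intro mult_left_mono mult_right_mono) auto
      then show "osc 1 B ?l k \<le> C * 2 powr (2 ^ i / 2) * z k" using o1[of k] by simp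
    qed
    also have "\<dots> = C * 2 powr (2 ^ i / 2) * (\<Sum>k<i. z k)" by (simp add: sum_distrib_left)
    also have "\<dots> \<le> C * 2 powr (2 ^ i / 2) * G" using C G by (intro mult_left_mono) auto
    finally show ?thesis by (simp add: mult_ac)
  qed
  obtain Y1 where Y1: "\<And>y. Y1 \<le> y \<Longrightarrow> 2 powr (- (1 / 2) * y) \<le> y powr (1 + \<nu>)"
    using eventually_powr_le[of "1 / 2" "1 + \<nu>"] by auto
  define K where "K = 1 + L + ?d * (C * G) + 2 * (C * G * 2 powr \<bar>1 + \<nu>\<bar>)"
  have K: "0 < K" unfolding K_def using L C G0 by (intro add_pos_nonneg mult_nonneg_nonneg) auto
  show "\<exists>K>0. \<forall>i0. \<exists>Y. \<forall>y\<ge>Y. \<exists>i\<ge>i0.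
       (L + ?d * (\<Sum>k<i. osc 1 B ?l k)) * 2 powr (- y) + 2 * (\<Sum>k. osc 0 B ?l (i + k))
         \<le> K * (2 powr (- \<mu> * y) * y powr (1 + \<nu>))"
  proof (rule exI[of _ K], intro conjI K allI)
    fix i0 :: nat
    show "\<exists>Y. \<forall>y\<ge>Y. \<exists>i\<ge>i0.
       (L + ?d * (\<Sum>k<i. osc 1 B ?l k)) * 2 powr (- y) + 2 * (\<Sum>k. osc 0 B ?l (i + k))
         \<le> K * (2 powr (- \<mu> * y) * y powr (1 + \<nu>))"
    proof (intro exI[of _ "max Y1 (2 ^ Suc i0)"] allI impI)
      fix y :: real assume y: "max Y1 (2 ^ Suc i0) \<le> y"
      have "(1::real) \<le> 2 ^ Suc i0" by (rule one_le_power) simp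
      then have y1: "1 \<le> y" using y by simp
      obtain i where i: "2 ^ i \<le> y" "y < 2 * 2 ^ i" by (rule power_of_two_below[OF y1])
      have "2 * 2 ^ i0 \<le> y" using y by simp
      then have "(2::real) ^ i0 < 2 ^ i" using i(2) by linarith
      then have "i0 < i" by (rule power_less_imp_less_exp[rotated]) simp
      then have ii: "i0 \<le> i" by simp
      let ?w = "y powr (1 + \<nu>)"
      have w: "0 \<le> ?w" by simp
      have zi: "z i \<le> 2 powr \<bar>1 + \<nu>\<bar> * ?w"
      proof -
        have "z i = (2 ^ i) powr (1 + \<nu>)" by (simp add: z_def powr_powr flip: powr_realpow)
        also have "\<dots> \<le> 2 powr \<bar>1 + \<nu>\<bar> * ?w" using i y1 by (intro powr_comparable) auto
        finally show ?thesis .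
      qed
      have h1: "2 powr (- y) \<le> ?w"
      proof -
        have "2 powr (- y) \<le> 2 powr (- (1 / 2) * y)" using y1 by (intro powr_mono) auto
        also have "\<dots> \<le> ?w" using y by (intro Y1) simp
        finally show ?thesis .
      qed
      have h2: "(\<Sum>k<i. osc 1 B ?l k) * 2 powr (- y) \<le> C * G * ?w"
      proof -
        have "(\<Sum>k<i. osc 1 B ?l k) * 2 powr (- y) \<le> C * G * 2 powr (2 ^ i / 2) * 2 powr (- y)"
          by (intro mult_right_mono head) auto
        also have "\<dots> = C * G * 2 powr (2 ^ i / 2 - y)" by (simp add: powr_add[symmetric] mult.assoc)
        also have "\<dots> \<le> C * G * 2 powr (- (1 / 2) * y)"
          using i C G0 by (intro mult_left_mono powr_mono) auto
        also have "\<dots> \<le> C * G * ?w" using y C G0 by (intro mult_left_mono Y1) auto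
        finally show ?thesis .
      qed
      have "(L + ?d * (\<Sum>k<i. osc 1 B ?l k)) * 2 powr (- y) + 2 * (\<Sum>k. osc 0 B ?l (i + k))
          = L * 2 powr (- y) + ?d * ((\<Sum>k<i. osc 1 B ?l k) * 2 powr (- y)) + 2 * (\<Sum>k. osc 0 B ?l (i + k))"
        by (simp add: algebra_simps)
      also have "\<dots> \<le> L * ?w + ?d * (C * G * ?w) + 2 * (C * G * (2 powr \<bar>1 + \<nu>\<bar> * ?w))"
        using L C G0 by (intro add_mono mult_left_mono h1 h2 order_trans[OF tail] zi) auto
      also have "\<dots> \<le> K * ?w" using w by (simp add: K_def algebra_simps)
      finally show "\<exists>i\<ge>i0. (L + ?d * (\<Sum>k<i. osc 1 B ?l k)) * 2 powr (- y) + 2 * (\<Sum>k. osc 0 B ?l (i + k))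
         \<le> K * (2 powr (- \<mu> * y) * y powr (1 + \<nu>))"
        using ii y1 \<mu> by auto
    qed
  qed
qed

text \<open>For \<open>\<mu> = 1\<close> it is the gradient that carries no exponential factor
  (\<open>W = 1\<close>), while the values decay like \<open>2^(- 2^k / 2)\<close> up to a power of
  \<open>2^k\<close>; half of that exponent pays for the power.\<close>

lemma osc_one_bounds:
  assumes B: "0 < B" and \<mu>: "\<mu> = 1"
  shows "\<exists>C>0. (\<forall>k. osc 1 B (\<lambda>i. 2 ^ i) k \<le> C * 2 powr (real k * (1 + \<nu>)))
    \<and> (\<forall>k. osc 0 B (\<lambda>i. 2 ^ i) k \<le> C * 2 powr (- (2 ^ k) / 4))"
proof -
  define C1 where "C1 = B * sqrt (2 powr (\<bar>2 * \<nu>\<bar> + 1))"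
  have C1: "0 < C1" using B by (simp add: C1_def)
  obtain C2 where C2: "0 < C2" "\<And>n. real n powr (1 + \<nu>) \<le> C2 * 2 powr (real n / 4)"
    using powr_times_exp_bounded by blast
  have o1: "osc 1 B (\<lambda>i. 2 ^ i) k \<le> C1 * 2 powr (real k * (1 + \<nu>))" for k
    using osc_super[of B 1 k 1] B \<mu> by (simp add: C1_def)
  have o0: "osc 0 B (\<lambda>i. 2 ^ i) k \<le> C1 * C2 * 2 powr (- (2 ^ k) / 4)" for k
  proof -
    let ?W = "2 powr (- (2 ^ k) / 2) :: real"
    have "osc 0 B (\<lambda>i. 2 ^ i) k \<le> C1 * (?W * 2 powr (real k * (1 + \<nu>)))"
      unfolding C1_def
    proof (rule osc_super)
      fix j :: nat assume "2 ^ k \<le> j"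
      then have "real (2 ^ k) \<le> real j" by (simp only: of_nat_le_iff)
      then have "2 powr ((0 - \<mu>) * real j) \<le> 2 powr (- (2 ^ k) / 2 + - (2 ^ k) / 2)"
        using \<mu> by (intro powr_mono) auto
      also have "\<dots> = ?W\<^sup>2" by (simp only: powr_add power2_eq_square)
      finally show "2 powr ((0 - \<mu>) * real j) \<le> ?W\<^sup>2" .
    qed (use B in auto)
    also have "2 powr (real k * (1 + \<nu>)) = real (2 ^ k) powr (1 + \<nu>)"
      by (simp add: powr_powr flip: powr_realpow)
    also have "C1 * (?W * real (2 ^ k) powr (1 + \<nu>)) \<le> C1 * (?W * (C2 * 2 powr (real (2 ^ k) / 4)))"
      using C1 by (intro mult_left_mono C2) auto
    also have "\<dots> = C1 * C2 * (?W * 2 powr (2 ^ k / 4))" by simp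
    also have "?W * 2 powr (2 ^ k / 4) = 2 powr (- (2 ^ k) / 4)"
      by (simp flip: powr_add)
    finally show ?thesis .
  qed
  define C where "C = C1 + C1 * C2"
  have le: "C1 \<le> C" "C1 * C2 \<le> C" using C1 C2(1) by (auto simp: C_def)
  have "0 < C" using C1 le by linarith
  moreover have "osc 1 B (\<lambda>i. 2 ^ i) k \<le> C * 2 powr (real k * (1 + \<nu>))" for k
    by (rule order_trans[OF o1 mult_right_mono[OF le(1)]]) simp
  moreover have "osc 0 B (\<lambda>i. 2 ^ i) k \<le> C * 2 powr (- (2 ^ k) / 4)" for k
    by (rule order_trans[OF o0 mult_right_mono[OF le(2)]]) simp
  ultimately show ?thesis by blast
qed

text \<open>\<open>2^i + k <= 2^(i + k)\<close> compares the doubly exponential tail with its first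
  term times a geometric series.\<close>

lemma summable_double_exp:
  "summable (\<lambda>k. 2 powr (- (2 ^ (i + k)) / 4 :: real))"
  "\<exists>G\<ge>0. \<forall>i. (\<Sum>k. 2 powr (- (2 ^ (i + k)) / 4 :: real)) \<le> G * 2 powr (- (2 ^ i) / 4)"
proof -
  define w where "w = (\<lambda>k. 2 powr (real k * (- 1 / 4)))"
  have w: "summable w" unfolding w_def by (intro summable_geo_powr) simp
  have le: "2 powr (- (2 ^ (i + k)) / 4 :: real) \<le> 2 powr (- (2 ^ i) / 4) * w k" for i k
  proof -
    have "(2::nat) ^ i + k \<le> 2 ^ (i + k)"
    proof (induction k)
      case (Suc k)
      have "(1::nat) \<le> 2 ^ (i + k)" by simp
      then have "2 ^ i + k + 1 \<le> 2 * 2 ^ (i + k)" using Suc by linarith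
      then show ?case by simp
    qed simp
    then have "real (2 ^ i + k) \<le> real (2 ^ (i + k))" by (simp only: of_nat_le_iff)
    then have "2 powr (- (2 ^ (i + k)) / 4 :: real) \<le> 2 powr (- (2 ^ i) / 4 + real k * (- 1 / 4))"
      by (intro powr_mono) auto
    then show ?thesis by (simp only: powr_add w_def)
  qed
  show s: "summable (\<lambda>k. 2 powr (- (2 ^ (i + k)) / 4 :: real))" for i
    by (rule summable_comparison_test'[OF summable_mult[OF w, of "2 powr (- (2 ^ i) / 4)"], of 0]) (use le in auto)
  have "(\<Sum>k. 2 powr (- (2 ^ (i + k)) / 4 :: real)) \<le> suminf w * 2 powr (- (2 ^ i) / 4)" for i
    using suminf_le[OF le s summable_mult[OF w], of i] suminf_mult[OF w, of "2 powr (- (2 ^ i) / 4)"]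
    by (simp add: mult.commute)
  moreover have "0 \<le> suminf w" by (intro suminf_nonneg w) (simp add: w_def)
  ultimately show "\<exists>G\<ge>0. \<forall>i. (\<Sum>k. 2 powr (- (2 ^ (i + k)) / 4 :: real)) \<le> G * 2 powr (- (2 ^ i) / 4)" by blast
qed

text \<open>Now the gradient dominates: its rungs grow at most like \<open>2^(k \<theta>)\<close>
  and sum to order \<open>(2^i)^\<theta>\<close>, comparable to \<open>y^\<theta>\<close>.
  Positivity of \<open>\<theta>\<close> makes the majorant geometric; with exponent 0 its equal
  terms would add up to a multiple of their number \<open>i\<close>. For \<open>\<nu> < - 1\<close>
  the gradient rungs are summable, which is the input for differentiability.\<close>

lemma rate_one:
  assumes B: "0 < B" and \<mu>: "\<mu> = 1"
  shows "summable (osc 0 B (\<lambda>i. 2 ^ i))"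
    and "0 \<le> L \<Longrightarrow> 0 < \<theta> \<Longrightarrow> 1 + \<nu> \<le> \<theta> \<Longrightarrow> \<exists>K>0. \<forall>i0. \<exists>Y. \<forall>y\<ge>Y. \<exists>i\<ge>i0.
       (L + real CARD('d) * (\<Sum>k<i. osc 1 B (\<lambda>i. 2 ^ i) k)) * 2 powr (- y) + 2 * (\<Sum>k. osc 0 B (\<lambda>i. 2 ^ i) (i + k))
         \<le> K * (2 powr (- \<mu> * y) * y powr \<theta>)"
    and "\<nu> < - 1 \<Longrightarrow> summable (osc 1 B (\<lambda>i. 2 ^ i))"
proof -
  let ?l = "\<lambda>i. 2 ^ i :: nat"
  let ?d = "real CARD('d)"
  obtain C where C: "0 < C" "\<And>k. osc 1 B ?l k \<le> C * 2 powr (real k * (1 + \<nu>))"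
    "\<And>k. osc 0 B ?l k \<le> C * 2 powr (- (2 ^ k) / 4)" using osc_one_bounds[OF B \<mu>] by blast
  have on: "0 \<le> osc e B ?l i" for e i using B by (intro osc_nonneg) simp
  show s0: "summable (osc 0 B ?l)"
    by (rule summable_comparison_test'[OF summable_mult[OF summable_double_exp(1)[of 0], of C], of 0])
      (use C(3) on in auto)
  show "summable (osc 1 B ?l)" if "\<nu> < - 1"
    by (rule summable_comparison_test'[OF summable_mult[OF summable_geo_powr[of "1 + \<nu>"], of C], of 0])
      (use C(2) on that in auto)
  obtain G where G: "0 \<le> G" "\<And>i. (\<Sum>k. 2 powr (- (2 ^ (i + k)) / 4 :: real)) \<le> G * 2 powr (- (2 ^ i) / 4)"
    using summable_double_exp(2) by blast
  have tail: "(\<Sum>k. osc 0 B ?l (i + k)) \<le> C * (G * 2 powr (- (2 ^ i) / 4))" for i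
  proof -
    have "(\<Sum>k. osc 0 B ?l (i + k)) \<le> (\<Sum>k. C * 2 powr (- (2 ^ (i + k)) / 4))"
    proof (rule suminf_le)
      show "summable (\<lambda>k. osc 0 B ?l (i + k))"
        using summable_ignore_initial_segment[OF s0, of i] by (simp add: add.commute)
    qed (intro C(3) summable_mult summable_double_exp(1))+
    also have "\<dots> = C * (\<Sum>k. 2 powr (- (2 ^ (i + k)) / 4))" by (rule suminf_mult[OF summable_double_exp(1)])
    also have "\<dots> \<le> C * (G * 2 powr (- (2 ^ i) / 4))" using C G by (intro mult_left_mono) auto
    finally show ?thesis .
  qed
  assume L: "0 \<le> L" and \<theta>: "0 < \<theta>" "1 + \<nu> \<le> \<theta>"
  define a where "a = 2 powr \<theta>"
  have a1: "1 < a" using powr_less_mono[of 0 \<theta> 2] \<theta> by (simp add: a_def)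
  have ap: "2 powr (real k * \<theta>) = a ^ k" for k
    by (simp add: a_def powr_power mult.commute)
  have head: "(\<Sum>k<i. osc 1 B ?l k) \<le> C / (a - 1) * (2 ^ i) powr \<theta>" for i
  proof -
    have "(\<Sum>k<i. osc 1 B ?l k) \<le> (\<Sum>k<i. C * a ^ k)"
    proof (intro sum_mono order_trans[OF C(2)] mult_left_mono)
      fix k
      have "2 powr (real k * (1 + \<nu>)) \<le> 2 powr (real k * \<theta>)" using \<theta> by (intro powr_mono mult_left_mono) auto
      then show "2 powr (real k * (1 + \<nu>)) \<le> a ^ k" unfolding ap .
    qed (use C in auto)
    also have "\<dots> = C * ((a ^ i - 1) / (a - 1))" using a1 by (simp add: sum_distrib_left[symmetric] geometric_sum)
    also have "\<dots> \<le> C * (a ^ i / (a - 1))" using C a1 by (intro mult_left_mono divide_right_mono) auto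
    also have "a ^ i = (2 ^ i) powr \<theta>" by (simp add: ap[symmetric] powr_powr flip: powr_realpow)
    finally show ?thesis by simp
  qed
  define K where "K = 1 + L + ?d * (C / (a - 1) * 8 powr \<theta>) + 2 * (C * G)"
  have K: "0 < K" unfolding K_def using L C G a1 by (intro add_pos_nonneg mult_nonneg_nonneg) auto
  show "\<exists>K>0. \<forall>i0. \<exists>Y. \<forall>y\<ge>Y. \<exists>i\<ge>i0.
       (L + ?d * (\<Sum>k<i. osc 1 B ?l k)) * 2 powr (- y) + 2 * (\<Sum>k. osc 0 B ?l (i + k))
         \<le> K * (2 powr (- \<mu> * y) * y powr \<theta>)"
  proof (rule exI[of _ K], intro conjI K allI)
    fix i0 :: nat
    show "\<exists>Y. \<forall>y\<ge>Y. \<exists>i\<ge>i0.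
       (L + ?d * (\<Sum>k<i. osc 1 B ?l k)) * 2 powr (- y) + 2 * (\<Sum>k. osc 0 B ?l (i + k))
         \<le> K * (2 powr (- \<mu> * y) * y powr \<theta>)"
    proof (intro exI[of _ "2 ^ i0 :: real"] allI impI)
      fix y :: real assume y: "2 ^ i0 \<le> y"
      have "(1::real) \<le> 2 ^ i0" by (rule one_le_power) simp
      then have y1: "1 \<le> y" using y by (rule order_trans)
      \<comment> \<open>The factor 8 ensures \<open>2^i > 4 y\<close>, so that the tail
        \<open>2^(- 2^i / 4)\<close> is below \<open>h = 2^(- y)\<close>.\<close>
      then have "1 \<le> 8 * y" by simp
      then obtain i where i: "2 ^ i \<le> 8 * y" "8 * y < 2 * 2 ^ i" by (rule power_of_two_below)
      have "(2::real) ^ i0 < 2 ^ i" using i(2) y y1 by linarith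
      then have "i0 < i" by (rule power_less_imp_less_exp[rotated]) simp
      then have ii: "i0 \<le> i" by simp
      let ?w = "y powr \<theta>"
      let ?h = "2 powr (- y)"
      have w: "1 \<le> ?w" using y1 \<theta> by (simp add: ge_one_powr_ge_zero)
      have hd: "(\<Sum>k<i. osc 1 B ?l k) \<le> C / (a - 1) * 8 powr \<theta> * ?w"
      proof -
        have "(2 ^ i) powr \<theta> \<le> (8 * y) powr \<theta>" using i \<theta> by (intro powr_mono2) auto
        also have "\<dots> = 8 powr \<theta> * ?w" using y1 by (simp add: powr_mult)
        finally have "C / (a - 1) * (2 ^ i) powr \<theta> \<le> C / (a - 1) * (8 powr \<theta> * ?w)"
          using C a1 by (intro mult_left_mono) auto
        then show ?thesis using head[of i] by simp
      qed
      have tl: "(\<Sum>k. osc 0 B ?l (i + k)) \<le> C * G * ?h"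
      proof -
        have "2 powr (- (2 ^ i) / 4) \<le> ?h" using i by (intro powr_mono) auto
        then have "C * (G * 2 powr (- (2 ^ i) / 4)) \<le> C * (G * ?h)" using C G by (intro mult_left_mono) auto
        then show ?thesis using tail[of i] by simp
      qed
      have "(L + ?d * (\<Sum>k<i. osc 1 B ?l k)) * ?h + 2 * (\<Sum>k. osc 0 B ?l (i + k))
          \<le> (L * ?w + ?d * (C / (a - 1) * 8 powr \<theta> * ?w)) * ?h + 2 * (C * G * ?h * ?w)"
      proof (intro add_mono mult_right_mono mult_left_mono hd order_trans[OF tl])
        show "L \<le> L * ?w" using L w mult_left_mono[of 1 ?w L] by simp
        have "0 \<le> C * G * ?h" using C G by simp
        then show "C * G * ?h \<le> C * G * ?h * ?w" using w mult_left_mono[of 1 ?w "C * G * ?h"] by simp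
      qed auto
      also have "\<dots> = (L + ?d * (C / (a - 1) * 8 powr \<theta>) + 2 * (C * G)) * (?h * ?w)" by (simp add: algebra_simps)
      also have "\<dots> \<le> K * (?h * ?w)" unfolding K_def by (intro mult_right_mono) auto
      finally show "\<exists>i\<ge>i0. (L + ?d * (\<Sum>k<i. osc 1 B ?l k)) * 2 powr (- y) + 2 * (\<Sum>k. osc 0 B ?l (i + k))
         \<le> K * (2 powr (- \<mu> * y) * y powr \<theta>)"
        using ii \<mu> by auto
    qed
  qed
qed

text \<open>Block \<open>j\<close> has size \<open>2^(- \<mu> j / 2)\<close> and gradient
  \<open>2^((1 - \<mu>) j / 2)\<close>, up to the power \<open>j^(1/2 + \<nu>)\<close>. Both
  exponents are nonzero, so the sums above and below the cut are governed by the terms nearest to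
  it; the varying power is compared with its value at the cut at the price of the weight
  \<open>(1 + n)^|s|\<close> in \<open>w\<close>.\<close>

lemma rate_between:
  assumes B: "0 < B" and \<mu>: "0 < \<mu>" "\<mu> < 1"
  shows "summable (osc 0 B Suc)"
    and "0 \<le> L \<Longrightarrow> \<exists>K>0. \<forall>i0. \<exists>Y. \<forall>y\<ge>Y. \<exists>i\<ge>i0.
       (L + real CARD('d) * (\<Sum>k<i. osc 1 B Suc k)) * 2 powr (- y) + 2 * (\<Sum>k. osc 0 B Suc (i + k))
         \<le> K * (2 powr (- \<mu> * y) * y powr (1 / 2 + \<nu>))"
proof -
  let ?d = "real CARD('d)"
  define s where "s = 1 / 2 + \<nu>"
  define C where "C = B * sqrt 2"
  have C: "0 < C" using B by (simp add: C_def)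
  define q where "q = \<mu> / 2"
  define p where "p = (1 - \<mu>) / 2"
  have qp: "0 < q" "0 < p" using \<mu> by (simp_all add: q_def p_def)
  define w where "w = (\<lambda>p n. 2 powr (- p * real n) * (1 + real n) powr \<bar>s\<bar>)"
  have ws: "summable (w p)" if "0 < p" for p unfolding w_def using that by (rule summable_powr_weight)
  have w0: "0 \<le> w p n" for p n by (simp add: w_def)
  have G0: "0 \<le> suminf (w p)" if "0 < p" for p by (intro suminf_nonneg ws that w0)
  have o0: "osc 0 B Suc i \<le> C * (2 powr (- q * (real i + 1)) * (real i + 1) powr s)" for i
    using osc_single[of B 0 i] B by (simp add: C_def q_def s_def)
  have o1: "osc 1 B Suc i \<le> C * (2 powr (p * (real i + 1)) * (real i + 1) powr s)" for i
    using osc_single[of B 1 i] B by (simp add: C_def p_def s_def)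
  have on: "0 \<le> osc e B Suc i" for e i using B by (intro osc_nonneg) simp
  have o0': "osc 0 B Suc (i + k) \<le> C * (2 powr (- q * (real i + 1)) * (real i + 1) powr s) * w q k" for i k
  proof -
    have "(real (i + k) + 1) powr s \<le> (1 + real k) powr \<bar>s\<bar> * (real i + 1) powr s"
      by (rule powr_comparable) (auto simp: algebra_simps)
    then have "C * (2 powr (- q * (real (i + k) + 1)) * (real (i + k) + 1) powr s)
       \<le> C * (2 powr (- q * (real (i + k) + 1)) * ((1 + real k) powr \<bar>s\<bar> * (real i + 1) powr s))"
      using C by (intro mult_left_mono) auto
    with o0[of "i + k"] have "osc 0 B Suc (i + k)
       \<le> C * (2 powr (- q * (real (i + k) + 1)) * ((1 + real k) powr \<bar>s\<bar> * (real i + 1) powr s))"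
      by (rule order_trans)
    also have "2 powr (- q * (real (i + k) + 1)) = 2 powr (- q * (real i + 1)) * 2 powr (- q * real k)"
      by (simp add: algebra_simps flip: powr_add)
    finally have "osc 0 B Suc (i + k)
       \<le> C * (2 powr (- q * (real i + 1)) * 2 powr (- q * real k) * ((1 + real k) powr \<bar>s\<bar> * (real i + 1) powr s))" .
    then show ?thesis by (simp only: w_def mult_ac)
  qed
  show s0: "summable (osc 0 B Suc)"
    by (rule summable_comparison_test'[OF summable_mult[OF ws[OF qp(1)]], of 0 _ "C * (2 powr (- q * (real 0 + 1)) * (real 0 + 1) powr s)"])
      (use o0'[of 0] on in auto)
  have tail: "(\<Sum>k. osc 0 B Suc (i + k)) \<le> C * (2 powr (- q * (real i + 1)) * (real i + 1) powr s) * suminf (w q)" for i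
  proof -
    have "(\<Sum>k. osc 0 B Suc (i + k)) \<le> (\<Sum>k. C * (2 powr (- q * (real i + 1)) * (real i + 1) powr s) * w q k)"
    proof (rule suminf_le)
      show "summable (\<lambda>k. osc 0 B Suc (i + k))"
        using summable_ignore_initial_segment[OF s0, of i] by (simp add: add.commute)
    qed (intro o0' summable_mult ws qp)+
    also have "\<dots> = C * (2 powr (- q * (real i + 1)) * (real i + 1) powr s) * suminf (w q)"
      by (rule suminf_mult[OF ws[OF qp(1)]])
    finally show ?thesis .
  qed
  \<comment> \<open>Summing backwards makes the distance to the cut the summation index, so that
    growth in \<open>k\<close> becomes decay in \<open>m\<close>.\<close>
  have head: "(\<Sum>k<i. osc 1 B Suc k) \<le> C * (2 powr (p * (real i + 1)) * (real i + 1) powr s) * suminf (w p)" for i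
  proof -
    let ?c = "C * (2 powr (p * (real i + 1)) * (real i + 1) powr s)"
    have "(\<Sum>k<i. osc 1 B Suc k) = (\<Sum>m<i. osc 1 B Suc (i - Suc m))"
      by (rule sum.nat_diff_reindex[symmetric])
    also have "\<dots> \<le> (\<Sum>m<i. ?c * w p (Suc m))"
    proof (intro sum_mono)
      fix m assume "m \<in> {..<i}"
      then have m: "real (i - Suc m) + 1 = real i - real m" "real m + 1 \<le> real i" by auto
      have "(real i - real m) powr s \<le> (1 + real (Suc m)) powr \<bar>s\<bar> * (real i + 1) powr s"
      proof (rule powr_comparable)
        show "real i - real m \<le> (1 + real (Suc m)) * (real i + 1)"
          using m(2) by (simp add: algebra_simps add_increasing)
        have "0 \<le> (1 + real m) * (real i - real m - 1)" using m(2) by (intro mult_nonneg_nonneg) auto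
        then show "real i + 1 \<le> (1 + real (Suc m)) * (real i - real m)" by (simp add: algebra_simps)
      qed (use m in auto)
      then have "C * (2 powr (p * (real i - real m)) * (real i - real m) powr s)
         \<le> C * (2 powr (p * (real i - real m)) * ((1 + real (Suc m)) powr \<bar>s\<bar> * (real i + 1) powr s))"
        using C by (intro mult_left_mono) auto
      with o1[of "i - Suc m"] have "osc 1 B Suc (i - Suc m)
         \<le> C * (2 powr (p * (real i - real m)) * ((1 + real (Suc m)) powr \<bar>s\<bar> * (real i + 1) powr s))"
        unfolding m(1) by (rule order_trans)
      also have "2 powr (p * (real i - real m)) = 2 powr (p * (real i + 1)) * 2 powr (- p * real (Suc m))"
        by (simp add: algebra_simps flip: powr_add)
      finally show "osc 1 B Suc (i - Suc m) \<le> ?c * w p (Suc m)" by (simp only: w_def mult_ac)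
    qed
    also have "\<dots> = ?c * (\<Sum>m<i. w p (Suc m))" by (simp add: sum_distrib_left)
    also have "\<dots> \<le> ?c * suminf (w p)"
    proof (intro mult_left_mono)
      have "(\<Sum>m<i. w p (Suc m)) \<le> (\<Sum>m<Suc i. w p m)"
        using w0[of p 0] by (simp only: sum.lessThan_Suc_shift)
      also have "\<dots> \<le> suminf (w p)" by (intro sum_le_suminf ws qp) (auto simp: w0)
      finally show "(\<Sum>m<i. w p (Suc m)) \<le> suminf (w p)" .
    qed (use C in auto)
    finally show ?thesis .
  qed
  assume L: "0 \<le> L"
  obtain Y1 where Y1: "\<And>y. Y1 \<le> y \<Longrightarrow> 2 powr (- (1 - \<mu>) * y) \<le> y powr s"
    using eventually_powr_le[of "1 - \<mu>" s] \<mu> by auto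
  define Kp where "Kp = C * 3 powr \<bar>s\<bar> * 2 * suminf (w p)"
  define Kq where "Kq = C * 3 powr \<bar>s\<bar> * suminf (w q)"
  have Kpq: "0 \<le> Kp" "0 \<le> Kq" using C G0 qp by (simp_all add: Kp_def Kq_def)
  define K where "K = 1 + L + ?d * Kp + 2 * Kq"
  have K: "0 < K" unfolding K_def using L Kpq by (intro add_pos_nonneg mult_nonneg_nonneg) auto
  show "\<exists>K>0. \<forall>i0. \<exists>Y. \<forall>y\<ge>Y. \<exists>i\<ge>i0.
       (L + ?d * (\<Sum>k<i. osc 1 B Suc k)) * 2 powr (- y) + 2 * (\<Sum>k. osc 0 B Suc (i + k))
         \<le> K * (2 powr (- \<mu> * y) * y powr (1 / 2 + \<nu>))"
    unfolding s_def[symmetric]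
  proof (rule exI[of _ K], intro conjI K allI)
    fix i0 :: nat
    show "\<exists>Y. \<forall>y\<ge>Y. \<exists>i\<ge>i0.
       (L + ?d * (\<Sum>k<i. osc 1 B Suc k)) * 2 powr (- y) + 2 * (\<Sum>k. osc 0 B Suc (i + k))
         \<le> K * (2 powr (- \<mu> * y) * y powr s)"
    proof (intro exI[of _ "max Y1 (real i0 + 1)"] allI impI)
      fix y :: real assume y: "max Y1 (real i0 + 1) \<le> y"
      then have y1: "1 \<le> y" by simp
      \<comment> \<open>Eigenvalue \<open>2^j\<close> has wavelength \<open>2^(- j / 2)\<close>,
        which matches \<open>h = 2^(- y)\<close> at \<open>j = 2 y\<close>; \<open>i\<close> is one
        less because rung \<open>i\<close> is block \<open>i + 1\<close>.\<close>
      define i where "i = nat \<lceil>2 * y\<rceil> - 1"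
      define j where "j = real i + 1"
      have j: "2 * y \<le> j" "j < 2 * y + 1" unfolding i_def j_def using y1 by linarith+
      have ii: "i0 \<le> i" using j y unfolding j_def by linarith
      have js: "j powr s \<le> 3 powr \<bar>s\<bar> * y powr s"
        using j y1 by (intro powr_comparable) auto
      let ?r = "2 powr (- \<mu> * y) * y powr s"
      have tl: "(\<Sum>k. osc 0 B Suc (i + k)) \<le> Kq * ?r"
      proof -
        have "2 powr (- q * j) \<le> 2 powr (- \<mu> * y)"
        proof (intro powr_mono)
          have "\<mu> * (2 * y) \<le> \<mu> * j" using j(1) \<mu> by (intro mult_left_mono) auto
          then show "- q * j \<le> - \<mu> * y" by (simp add: q_def)
        qed simp
        then have "C * (2 powr (- q * j) * j powr s) * suminf (w q) \<le> C * (2 powr (- \<mu> * y) * (3 powr \<bar>s\<bar> * y powr s)) * suminf (w q)"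
          using C G0 qp js by (intro mult_right_mono mult_left_mono mult_mono) auto
        then show ?thesis using tail[of i] by (simp add: Kq_def j_def mult_ac)
      qed
      have hd: "(\<Sum>k<i. osc 1 B Suc k) * 2 powr (- y) \<le> Kp * ?r"
      proof -
        have "2 powr (p * j) \<le> 2 powr (y * (1 - \<mu>) + 1)"
        proof (intro powr_mono)
          have "(1 - \<mu>) * j \<le> (1 - \<mu>) * (2 * y + 1)" using j(2) \<mu> by (intro mult_left_mono) auto
          also have "\<dots> = 2 * (y * (1 - \<mu>)) + (1 - \<mu>)" by (simp add: algebra_simps)
          finally show "p * j \<le> y * (1 - \<mu>) + 1" using \<mu> by (simp add: p_def)
        qed simp
        then have "C * (2 powr (p * j) * j powr s) * suminf (w p)
            \<le> C * (2 powr (y * (1 - \<mu>) + 1) * (3 powr \<bar>s\<bar> * y powr s)) * suminf (w p)"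
          using C G0 qp js by (intro mult_right_mono mult_left_mono mult_mono) auto
        then have "(\<Sum>k<i. osc 1 B Suc k) * 2 powr (- y)
           \<le> C * (2 powr (y * (1 - \<mu>) + 1) * (3 powr \<bar>s\<bar> * y powr s)) * suminf (w p) * 2 powr (- y)"
          using head[of i] by (intro mult_right_mono) (auto simp: j_def)
        also have "\<dots> = C * ((2 powr (y * (1 - \<mu>) + 1) * 2 powr (- y)) * (3 powr \<bar>s\<bar> * y powr s)) * suminf (w p)"
          by (simp add: mult_ac)
        also have "2 powr (y * (1 - \<mu>) + 1) * 2 powr (- y) = 2 * 2 powr (- \<mu> * y)"
        proof -
          have "y * (1 - \<mu>) + 1 + - y = 1 + - \<mu> * y" by (simp add: algebra_simps)
          then have "2 powr (y * (1 - \<mu>) + 1) * 2 powr (- y) = 2 powr (1 + - \<mu> * y)"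
            by (simp only: powr_add[symmetric])
          also have "\<dots> = 2 powr 1 * 2 powr (- \<mu> * y)" by (rule powr_add)
          finally show ?thesis by simp
        qed
        finally show ?thesis by (simp add: Kp_def mult_ac)
      qed
      have lh: "2 powr (- y) \<le> ?r"
      proof -
        have "2 powr (- y) = 2 powr (- \<mu> * y) * 2 powr (- (1 - \<mu>) * y)"
          by (simp add: algebra_simps flip: powr_add)
        also have "\<dots> \<le> ?r" using y by (intro mult_left_mono Y1) auto
        finally show ?thesis .
      qed
      have "(L + ?d * (\<Sum>k<i. osc 1 B Suc k)) * 2 powr (- y) + 2 * (\<Sum>k. osc 0 B Suc (i + k))
          = L * 2 powr (- y) + ?d * ((\<Sum>k<i. osc 1 B Suc k) * 2 powr (- y)) + 2 * (\<Sum>k. osc 0 B Suc (i + k))"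
        by (simp add: algebra_simps)
      also have "\<dots> \<le> L * ?r + ?d * (Kp * ?r) + 2 * (Kq * ?r)"
        using L by (intro add_mono mult_left_mono lh hd tl) auto
      also have "\<dots> = (L + ?d * Kp + 2 * Kq) * ?r" by (simp add: algebra_simps)
      also have "\<dots> \<le> K * ?r" unfolding K_def by (intro mult_right_mono) auto
      finally show "\<exists>i\<ge>i0. (L + ?d * (\<Sum>k<i. osc 1 B Suc k)) * 2 powr (- y) + 2 * (\<Sum>k. osc 0 B Suc (i + k))
         \<le> K * (2 powr (- \<mu> * y) * y powr s)" using ii by blast
    qed
  qed
qed

text \<open>Super-blocks serve the two endpoint values of \<open>\<mu>\<close>, single blocks the
  values between. At \<open>\<mu> = 1\<close> both branches of \<open>theta_exp\<close> meet the two
  requirements of \<open>rate_one\<close>, positivity and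
  \<open>1 + \<nu> <= \<theta>\<close>.\<close>

lemma tame_modulus:
  assumes tame: "tame B a" and B: "0 < B"
    and \<phi>: "\<And>n. AE x in lborel. \<phi> n x = g n x" "\<And>n. \<phi> n \<in> borel_measurable lborel"
    and par: "(0 < \<mu> \<and> \<mu> \<le> 1) \<or> (\<nu> < - 1 \<and> \<mu> = 0)" "\<not> (\<mu> = 1 \<and> \<nu> < - 1)"
  shows "\<exists>u. sums_in_tempered a \<phi> u \<and>
     ennreal_bigo_at_0 (modulus_of_continuity u) (\<lambda>h. h powr \<mu> * \<bar>ln h\<bar> powr theta_exp \<mu> \<nu>)"
proof -
  consider "\<mu> = 0" "\<nu> < - 1" | "0 < \<mu>" "\<mu> < 1" | "\<mu> = 1" "- 1 \<le> \<nu>" using par by linarith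
  then show ?thesis
  proof cases
    case 1
    have "theta_exp \<mu> \<nu> = 1 + \<nu>" using 1 by (simp add: theta_exp_def)
    then show ?thesis
      using modulus_from_ladder[OF tame B strict_mono_pow2 _ rate_zero(1)[OF B 1 order_refl] \<phi> rate_zero(2)[OF B 1]] by simp
  next
    case 2
    have "theta_exp \<mu> \<nu> = 1 / 2 + \<nu>" using 2 by (simp add: theta_exp_def)
    moreover have "strict_mono Suc" by (simp add: strict_mono_Suc_iff)
    ultimately show ?thesis
      using modulus_from_ladder[OF tame B _ _ rate_between(1)[OF B 2] \<phi> rate_between(2)[OF B 2]] by simp
  next
    case 3
    have "0 < theta_exp \<mu> \<nu>" "1 + \<nu> \<le> theta_exp \<mu> \<nu>" using 3 by (auto simp: theta_exp_def)
    from modulus_from_ladder[OF tame B strict_mono_pow2 _ rate_one(1)[OF B 3(1)] \<phi> rate_one(2)[OF B 3(1) _ this]]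
    show ?thesis by simp
  qed
qed

text \<open>\<open>\<nu> < - 1\<close> makes the gradient rungs of the super-block ladder summable,
  so the heads converge together with their gradients, uniformly in \<open>x\<close>.\<close>

lemma tame_differentiable:
  assumes tame: "tame B a" and B: "0 < B"
    and \<phi>: "\<And>n. AE x in lborel. \<phi> n x = g n x" "\<And>n. \<phi> n \<in> borel_measurable lborel"
    and par: "\<mu> = 1" "\<nu> < - 1"
  shows "\<exists>u. sums_in_tempered a \<phi> u \<and> (\<forall>x. u differentiable (at x))"
proof -
  let ?l = "\<lambda>i. 2 ^ i :: nat"
  have s0: "summable (osc 0 B ?l)" and s1: "summable (osc 1 B ?l)"
    using rate_one(1,3)[OF B par(1)] par(2) by auto
  have l0: "1 \<le> ?l 0" by simp
  obtain u i0 L where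
    close: "\<And>i x. i0 \<le> i \<Longrightarrow> cmod (u x - head a (?l i) x) \<le> (\<Sum>k. osc 0 B ?l (i + k))"
    and lim: "\<And>x. (\<lambda>N. \<Sum>n<N. a n * g n x) \<longlonglongrightarrow> u x"
    and bnd: "\<exists>N0 C. \<forall>N\<ge>N0. \<forall>x. cmod ((\<Sum>n<N. a n * g n x) - u x) \<le> C"
    and dhd: "\<And>i j x. i0 \<le> i \<Longrightarrow> cmod (dhead a j (?l (Suc i)) x - dhead a j (?l i) x) \<le> osc 1 B ?l i"
    by (rule ladder_limit[OF tame strict_mono_pow2 l0 s0 B]) blast
  have "(\<lambda>i. head a (?l i) x) \<longlonglongrightarrow> u x" for x
  proof -
    have "(\<lambda>i. \<Sum>k. osc 0 B ?l (i + k)) \<longlonglongrightarrow> 0"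
      using suminf_exist_split2[OF s0] by (simp add: add.commute)
    moreover have "\<forall>\<^sub>F i in sequentially. norm (u x - head a (?l i) x) \<le> (\<Sum>k. osc 0 B ?l (i + k))"
      using eventually_ge_at_top[of i0] by eventually_elim (rule close)
    ultimately have "(\<lambda>i. u x - head a (?l i) x) \<longlonglongrightarrow> 0"
      by (rule Lim_null_comparison[rotated])
    then have "(\<lambda>i. u x - (u x - head a (?l i) x)) \<longlonglongrightarrow> u x - 0" by (intro tendsto_intros)
    then show ?thesis by simp
  qed
  then have "u differentiable (at x)" for x
    by (rule limit_differentiable[OF _ dhd s1])
  then show ?thesis using limit_sums_in_tempered[OF lim bnd \<phi>] by blast
qed

end

text \<open>The moment bound is assumed for one variable; it depends on the law alone and so passes
  to all of them with the same \<open>\<sigma>\<close>.\<close>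

lemma subgaussian_family_of_iid:
  assumes M: "prob_space M" and X: "iid M X" "subgaussian M (X k)"
  obtains \<sigma> where "subgaussian_family M X \<sigma>"
proof -
  interpret prob_space M by (rule M)
  have ind: "indep_vars (\<lambda>_. borel) X UNIV" and dist: "\<And>m n. distr M borel (X m) = distr M borel (X n)"
    using X(1) by (auto simp: iid_def)
  have [measurable]: "X n \<in> borel_measurable M" for n using ind by (auto simp: indep_vars_def)
  obtain \<sigma> where \<sigma>: "0 < \<sigma>" "\<And>r. integrable M (\<lambda>\<omega>. exp (r * X k \<omega>))"
    "\<And>r. (LINT \<omega>|M. exp (r * X k \<omega>)) \<le> exp (1 / 2 * \<sigma>\<^sup>2 * r\<^sup>2)"
    using X(2) by (auto simp: subgaussian_def)
  have int: "integrable M (\<lambda>\<omega>. exp (r * X n \<omega>)) \<longleftrightarrow> integrable (distr M borel (X n)) (\<lambda>t. exp (r * t))"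
    and expect: "(LINT \<omega>|M. exp (r * X n \<omega>)) = (LINT t|distr M borel (X n). exp (r * t))" for n r
    by (auto intro!: integrable_distr_eq[symmetric] integral_distr[symmetric])
  have "subgaussian_family M X \<sigma>"
  proof
    fix n :: nat and r :: real
    show "integrable M (\<lambda>\<omega>. exp (r * X n \<omega>))" using \<sigma>(2)[of r] unfolding int by (simp only: dist[of n k])
    show "(LINT \<omega>|M. exp (r * X n \<omega>)) \<le> exp (1 / 2 * \<sigma>\<^sup>2 * r\<^sup>2)"
      using \<sigma>(3)[of r] unfolding expect by (simp only: dist[of n k])
  qed (use ind \<sigma>(1) in auto)
  then show ?thesis by (rule that)
qed

text \<open>Eigenvalues are integers of the parity of \<open>d\<close> and blocks are half-open
  intervals of length 2, so each block lies within a single level. Its finiteness makes the maximum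
  genuine.\<close>

lemma block_max_bounds:
  fixes lev :: "nat \<Rightarrow> nat"
  assumes lev: "\<And>n. \<Lambda> n = 2 * real (lev n) + real d" and fin: "\<And>m. finite {n. lev n = m}"
  shows "(cmod (c n))\<^sup>2 \<le> block_max \<Lambda> c (lev n + d div 2)" and "0 \<le> block_max \<Lambda> c k"
proof -
  have mem: "n \<in> eigen_block \<Lambda> k \<longleftrightarrow> k = lev n + d div 2" for n k
  proof -
    have "2 * real k \<le> \<Lambda> n \<longleftrightarrow> real (2 * k) \<le> real (2 * lev n + d)" by (simp add: lev)
    moreover have "\<Lambda> n < 2 * (real k + 1) \<longleftrightarrow> real (2 * lev n + d) < real (2 * k + 2)" by (simp add: lev add.commute)
    ultimately show ?thesis unfolding eigen_block_def mem_Collect_eq of_nat_le_iff of_nat_less_iff by presburger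
  qed
  have fb: "finite (eigen_block \<Lambda> k)" for k
  proof (rule finite_subset)
    show "eigen_block \<Lambda> k \<subseteq> {n. lev n = k - d div 2}" using mem by auto
  qed (rule fin)
  show "(cmod (c n))\<^sup>2 \<le> block_max \<Lambda> c (lev n + d div 2)"
  proof -
    have n: "n \<in> eigen_block \<Lambda> (lev n + d div 2)" by (simp add: mem)
    then have "(cmod (c n))\<^sup>2 \<le> Max ((\<lambda>n. (cmod (c n))\<^sup>2) ` eigen_block \<Lambda> (lev n + d div 2))"
      by (intro Max_ge finite_imageI fb imageI)
    then show ?thesis using n by (auto simp: block_max_def)
  qed
  show "0 \<le> block_max \<Lambda> c k"
    using fb[of k] by (auto simp: block_max_def Max_ge_iff)
qed

theorem theorem2p7:
  fixes \<mu> \<nu> :: real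
    and \<Lambda> :: "nat \<Rightarrow> real"
    and \<phi> :: "nat \<Rightarrow> real ^ 'd::finite \<Rightarrow> complex"
    and c :: "nat \<Rightarrow> complex"
    and M :: "'w measure"
    and X :: "nat \<Rightarrow> 'w \<Rightarrow> real"
  assumes "oscillator_eigenbasis \<Lambda> \<phi>"
    and "(0 < \<mu> \<and> \<mu> \<le> 1) \<or> (\<nu> < - 1 \<and> \<mu> = 0)"
    and "\<exists>C>0. \<forall>j\<ge>1::nat.
           (\<Sum>k = 2 ^ j..2 ^ (j + 1). block_max \<Lambda> c k)
             \<le> C * 2 powr ((- gamma_exp CARD('d) - \<mu>) * real j) * real j powr (2 * \<nu>)"
    and "prob_space M"
    and "iid M X"
    and "\<And>n. \<not> (\<exists>a. AE \<omega> in M. X n \<omega> = a)"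
    and "subgaussian M (X 1)"
  shows "(\<not> (\<mu> = 1 \<and> \<nu> < - 1) \<longrightarrow>
            (AE \<omega> in M. \<exists>u. sums_in_tempered (\<lambda>n. c n * of_real (X n \<omega>)) \<phi> u \<and>
               ennreal_bigo_at_0 (modulus_of_continuity u)
                 (\<lambda>h. h powr \<mu> * \<bar>ln h\<bar> powr theta_exp \<mu> \<nu>))) \<and>
         (\<mu> = 1 \<and> \<nu> < - 1 \<longrightarrow>
            (AE \<omega> in M. \<exists>u. sums_in_tempered (\<lambda>n. c n * of_real (X n \<omega>)) \<phi> u \<and>
               (\<forall>x. u differentiable (at x))))"
proof -
  obtain lev g where lev: "\<And>n. \<Lambda> n = 2 * real (lev n) + real CARD('d)"
    and fin: "\<And>m. finite {n. lev n = m}" and card: "\<And>m. card {n. lev n = m} \<le> (m + 1) ^ CARD('d)"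
    and span: "\<And>n. g n \<in> hermite_span" and \<phi>g: "\<And>n. AE x in lborel. \<phi> n x = g n x"
    and bounds: "spectral_bound lev g (gamma_exp CARD('d))"
      "\<And>i. spectral_bound lev (\<lambda>n x. of_real (x $ i) * g n x) (gamma_exp CARD('d) + 1)"
      "\<And>i. spectral_bound lev (\<lambda>n. partial_deriv i (g n)) (gamma_exp CARD('d) + 1)"
      "\<And>i j. spectral_bound lev (\<lambda>n x. of_real (x $ j) * partial_deriv i (g n) x) (gamma_exp CARD('d) + 2)"
      "\<And>i j. spectral_bound lev (\<lambda>n. partial_deriv j (partial_deriv i (g n))) (gamma_exp CARD('d) + 2)"
    by (rule eigenbasis_structure[OF assms(1)]) (rule that)
  have \<phi>m: "\<phi> n \<in> borel_measurable lborel" for n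
    using assms(1) by (simp add: oscillator_eigenbasis_def orthonormal_basis_L2_def square_integrable_def)
  have "mono \<Lambda>" using assms(1) by (simp add: oscillator_eigenbasis_def)
  have lev_mono: "mono lev"
  proof (rule monoI)
    fix m n :: nat assume "m \<le> n"
    then have "\<Lambda> m \<le> \<Lambda> n" by (rule monoD[OF \<open>mono \<Lambda>\<close>])
    then show "lev m \<le> lev n" by (simp add: lev)
  qed
  obtain C where C: "0 < C" "\<And>j. 1 \<le> j \<Longrightarrow> (\<Sum>k = 2 ^ j..2 ^ (j + 1). block_max \<Lambda> c k)
             \<le> C * 2 powr ((- gamma_exp CARD('d) - \<mu>) * real j) * real j powr (2 * \<nu>)"
    using assms(3) by (elim exE conjE) simp
  obtain \<sigma> where \<sigma>: "subgaussian_family M X \<sigma>"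
    by (rule subgaussian_family_of_iid[OF assms(4,5,7)])
  have "hermite_series lev g c (block_max \<Lambda> c) \<mu> \<nu> C"
    by (rule hermite_series.intro[OF lev_mono fin card span bounds block_max_bounds[OF lev fin] C])
  then interpret random_hermite_series M X \<sigma> lev g c "block_max \<Lambda> c" \<mu> \<nu> C
    by (rule random_hermite_series.intro[OF \<sigma>])
  \<comment> \<open>\<open>B\<close> is deterministic, so one almost sure event carries both
    conclusions.\<close>
  obtain B where B: "0 < B" and ae: "AE \<omega> in M. tame B (\<lambda>n. c n * of_real (X n \<omega>))"
    using AE_tame by (elim exE conjE)
  show ?thesis
  proof (intro conjI impI)
    assume *: "\<not> (\<mu> = 1 \<and> \<nu> < - 1)"
    show "AE \<omega> in M. \<exists>u. sums_in_tempered (\<lambda>n. c n * of_real (X n \<omega>)) \<phi> u \<and>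
               ennreal_bigo_at_0 (modulus_of_continuity u) (\<lambda>h. h powr \<mu> * \<bar>ln h\<bar> powr theta_exp \<mu> \<nu>)"
      using ae by eventually_elim (rule tame_modulus[OF _ B \<phi>g \<phi>m assms(2) *])
  next
    assume *: "\<mu> = 1 \<and> \<nu> < - 1"
    show "AE \<omega> in M. \<exists>u. sums_in_tempered (\<lambda>n. c n * of_real (X n \<omega>)) \<phi> u \<and> (\<forall>x. u differentiable (at x))"
      using ae by eventually_elim (rule tame_differentiable[OF _ B \<phi>g \<phi>m conjunct1[OF *] conjunct2[OF *]])
  qed
qed

end
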